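(* Let $\mathfrak C=(n,\Lambda,L,P)$ be a Lagrangian stabilizer code, $R=\mathbb Z_n[\Lambda]$, $D=\mathrm{rk}(\Lambda)$, such that each charge module $Q^i(\mathfrak C)=\mathrm{Ext}^{i+1}_R(\overline{P/L},R)$, $i\ge 0$, is zero or has Krull dimension $0$. Let $\Gamma\subset\Lambda$ be a subgroup of finite index, free with basis $\gamma_1,\dots,\gamma_D$, such that $x^\gamma-1$ annihilates $Q^i(\mathfrak C)$ for all $\gamma\in\Gamma$ and all $i\ge 0$. Put $t_j=1-x^{\gamma_j}$ and $\mathbf t=(t_1,\dots,t_D)$. Then, for $0\le i\le D-2$, there is an isomorphism of $R$-modules $$Q^i(\mathfrak C)\cong\check{\mathrm H}^{i+1}(\mathbf t,P/L),$$ where $\check{\mathrm H}^\bullet(\mathbf t,-)$ is Čech cohomology with respect to $\mathbf t$.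
   Context: Let $n$ be a positive integer, $\mathbb Z_n=\mathbb Z/n\mathbb Z$, $\Lambda$ a finitely generated abelian group of free rank $D$, $R=\mathbb Z_n[\Lambda]$, $x^\lambda\in R$ the element corresponding to $\lambda\in\Lambda$. The antipode of $R$ is $\overline{\sum_\lambda r_\lambda x^\lambda}=\sum_\lambda r_\lambda x^{-\lambda}$; for an $R$-module $M$, $\overline M$ is the same abelian group with $R$-action twisted by the antipode. A stabilizer code $(n,\Lambda,L,P)$ consists of: $P=P_0[\Lambda]=P_0\otimes_{\mathbb Z_n}R$, where $P_0$ is a finitely generated $\mathbb Z_n$-module with an alternating ($\omega_0(a,a)=0$), nondegenerate ($\omega_0(\cdot,a)=0\Rightarrow a=0$) bilinear form $\omega_0:P_0\times P_0\to\mathbb Z_n$, equipped with the form $\omega:P\times P\to R$, $\omega(a x^\lambda,b x^\mu)=\omega_0(a,b)x^{\mu-\lambda}$ (extended $\mathbb Z_n$-bilinearly); and an $R$-submodule $L\subset P$ with $\omega|_{L\times L}=0$. With $L^\omega=\{p\in P:\omega(l,p)=0\ \forall l\in L\}$, the code is Lagrangian if $L^\omega=L$. The dimension of an $R$-module $M$ is the Krull dimension of $R/\mathrm{Ann}(M)$. Čech complex: for a module $M$, $\check{\mathrm C}^0(\mathbf t,M)=M$ and $\check{\mathrm C}^p(\mathbf t,M)=\bigoplus_{1\le i_1<\dots<i_p\le D}M_{t_{i_1}\cdots t_{i_p}}$ (localizations), with differential $(\delta\varphi)_{i_0\dots i_p}=\sum_{j=0}^p(-1)^j\varphi_{i_0\dots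 i_{j-1}i_{j+1}\dots i_p}$ (localization maps implicit); $\check{\mathrm H}^p(\mathbf t,M)$ is its cohomology in degree $p$. *)

theory Defs
  imports "HOL-Algebra.Algebra" "HOL-Library.Extended_Real"
begin

section \<open>Modules over a commutative ring\<close>

text \<open>
  Modules are the records of HOL-Algebra.  Such a record also carries the multiplicative fields of
  a ring, which play no role in the notion of a module; they are left \<open>undefined\<close> below.
\<close>

definition self_module :: "('r, 'c) ring_scheme \<Rightarrow> ('r, 'r) module" where
  "self_module R = \<lparr>carrier = carrier R, monoid.mult = monoid.mult R, monoid.one = monoid.one R,
     ring.zero = ring.zero R, ring.add = ring.add R, smult = monoid.mult R\<rparr>"

definition mod_homs ::
  "('r, 'c) ring_scheme \<Rightarrow> ('r, 'm, 'd) module_scheme \<Rightarrow> ('r, 'k, 'e) module_scheme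
    \<Rightarrow> ('m \<Rightarrow> 'k) set" where
  "mod_homs R M N = {f \<in> carrier M \<rightarrow> carrier N.
     (\<forall>x\<in>carrier M. \<forall>y\<in>carrier M. f (x \<oplus>\<^bsub>M\<^esub> y) = f x \<oplus>\<^bsub>N\<^esub> f y) \<and>
     (\<forall>r\<in>carrier R. \<forall>x\<in>carrier M. f (r \<odot>\<^bsub>M\<^esub> x) = r \<odot>\<^bsub>N\<^esub> f x)}"

definition mod_isomorphic ::
  "('r, 'c) ring_scheme \<Rightarrow> ('r, 'm, 'd) module_scheme \<Rightarrow> ('r, 'k, 'e) module_scheme \<Rightarrow> bool" where
  "mod_isomorphic R M N \<longleftrightarrow> (\<exists>f\<in>mod_homs R M N. bij_betw f (carrier M) (carrier N))"

definition hom_module ::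
  "('r, 'c) ring_scheme \<Rightarrow> ('r, 'm, 'd) module_scheme \<Rightarrow> ('r, 'k, 'e) module_scheme
    \<Rightarrow> ('r, 'm \<Rightarrow> 'k) module" where
  "hom_module R M N = \<lparr>carrier = mod_homs R M N \<inter> extensional (carrier M),
     monoid.mult = undefined, monoid.one = undefined,
     ring.zero = (\<lambda>x\<in>carrier M. \<zero>\<^bsub>N\<^esub>),
     ring.add = (\<lambda>f g. \<lambda>x\<in>carrier M. f x \<oplus>\<^bsub>N\<^esub> g x),
     smult = (\<lambda>r f. \<lambda>x\<in>carrier M. r \<odot>\<^bsub>N\<^esub> f x)\<rparr>"

definition quot_module ::
  "('r, 'm, 'd) module_scheme \<Rightarrow> 'm set \<Rightarrow> ('r, 'm set) module" where
  "quot_module M H = \<lparr>carrier = a_rcosets\<^bsub>M\<^esub> H, monoid.mult = undefined, monoid.one = undefined,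
     ring.zero = H, ring.add = set_add M,
     smult = (\<lambda>r U. \<Union>x\<in>U. H +>\<^bsub>M\<^esub> (r \<odot>\<^bsub>M\<^esub> x))\<rparr>"

definition fin_gen_module :: "('r, 'c) ring_scheme \<Rightarrow> ('r, 'm, 'd) module_scheme \<Rightarrow> bool" where
  "fin_gen_module R M \<longleftrightarrow> (\<exists>S. finite S \<and> S \<subseteq> carrier M \<and>
     (\<forall>x\<in>carrier M. \<exists>c\<in>S \<rightarrow> carrier R. x = (\<Oplus>\<^bsub>M\<^esub>s\<in>S. c s \<odot>\<^bsub>M\<^esub> s)))"

definition annihilator :: "('r, 'c) ring_scheme \<Rightarrow> ('r, 'm, 'd) module_scheme \<Rightarrow> 'r set" where
  "annihilator R M = {r \<in> carrier R. \<forall>x\<in>carrier M. r \<odot>\<^bsub>M\<^esub> x = \<zero>\<^bsub>M\<^esub>}"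

text \<open>The supremum is taken in the extended reals, so the zero ring has dimension \<open>- \<infinity>\<close>.\<close>

definition krull_dim :: "('r, 'c) ring_scheme \<Rightarrow> ereal" where
  "krull_dim R = Sup {ereal (real m) | m.
     \<exists>\<pp>. (\<forall>i\<le>m. primeideal (\<pp> i) R) \<and> (\<forall>i<m. \<pp> i \<subset> \<pp> (Suc i))}"

definition module_dim :: "('r, 'c) ring_scheme \<Rightarrow> ('r, 'm, 'd) module_scheme \<Rightarrow> ereal" where
  "module_dim R M = krull_dim (R Quot annihilator R M)"


section \<open>Cohomology of cochain complexes\<close>

text \<open>A cochain complex is given by modules \<open>C p\<close> and differentials \<open>d p\<close> from \<open>C p\<close> to
  \<open>C (p + 1)\<close>, for \<open>p \<ge> 0\<close>.\<close>

definition cocycles ::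
  "(nat \<Rightarrow> ('r, 'm) module) \<Rightarrow> (nat \<Rightarrow> 'm \<Rightarrow> 'm) \<Rightarrow> nat \<Rightarrow> 'm set" where
  "cocycles C d p = {x \<in> carrier (C p). d p x = \<zero>\<^bsub>C (Suc p)\<^esub>}"

definition coboundaries ::
  "(nat \<Rightarrow> ('r, 'm) module) \<Rightarrow> (nat \<Rightarrow> 'm \<Rightarrow> 'm) \<Rightarrow> nat \<Rightarrow> 'm set" where
  "coboundaries C d p = (case p of 0 \<Rightarrow> {\<zero>\<^bsub>C 0\<^esub>} | Suc q \<Rightarrow> d q ` carrier (C q))"

definition cohomology ::
  "(nat \<Rightarrow> ('r, 'm) module) \<Rightarrow> (nat \<Rightarrow> 'm \<Rightarrow> 'm) \<Rightarrow> nat \<Rightarrow> ('r, 'm set) module" where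
  "cohomology C d p = quot_module ((C p)\<lparr>carrier := cocycles C d p\<rparr>) (coboundaries C d p)"


section \<open>Ext\<close>

text \<open>
  Finitely supported functions from \<open>A\<close> to \<open>B\<close>, extended by the given zero element outside \<open>A\<close>.
\<close>

definition fin_supp :: "'a set \<Rightarrow> 'b set \<Rightarrow> 'b \<Rightarrow> ('a \<Rightarrow> 'b) set" where
  "fin_supp A B z =
     {f. (\<forall>a\<in>A. f a \<in> B) \<and> (\<forall>a. a \<notin> A \<longrightarrow> f a = z) \<and> finite {a. f a \<noteq> z}}"

definition free_module :: "('r, 'c) ring_scheme \<Rightarrow> 'b set \<Rightarrow> ('r, 'b \<Rightarrow> 'r) module" where
  "free_module R B = \<lparr>carrier = fin_supp B (carrier R) \<zero>\<^bsub>R\<^esub>,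
     monoid.mult = undefined, monoid.one = undefined, ring.zero = (\<lambda>b. \<zero>\<^bsub>R\<^esub>),
     ring.add = (\<lambda>f g b. f b \<oplus>\<^bsub>R\<^esub> g b),
     smult = (\<lambda>r f b. if b \<in> B then r \<otimes>\<^bsub>R\<^esub> f b else \<zero>\<^bsub>R\<^esub>)\<rparr>"

definition lin_ext ::
  "('r, 'c) ring_scheme \<Rightarrow> ('r, 'm, 'd) module_scheme \<Rightarrow> ('b \<Rightarrow> 'm) \<Rightarrow> ('b \<Rightarrow> 'r) \<Rightarrow> 'm" where
  "lin_ext R N e f = (\<Oplus>\<^bsub>N\<^esub>b\<in>{b. f b \<noteq> \<zero>\<^bsub>R\<^esub>}. f b \<odot>\<^bsub>N\<^esub> e b)"

text \<open>
  Every module \<open>M\<close> has the following free resolution \<open>\<dots> \<rightarrow> F\<^sub>1 \<rightarrow> F\<^sub>0 \<rightarrow> M\<close>, which involves no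
  choices.  \<open>F\<^sub>0\<close> has one basis vector \<open>Gen m\<close> for each \<open>m\<close> in \<open>M\<close>, mapped to \<open>m\<close>.  The basis of
  \<open>F\<^bsub>k+1\<^esub>\<close> consists of all formal expressions \<open>Rel [(r\<^sub>1, b\<^sub>1), \<dots>, (r\<^sub>s, b\<^sub>s)]\<close> with basis vectors
  \<open>b\<^sub>i\<close> of \<open>F\<^sub>k\<close> such that \<open>r\<^sub>1 b\<^sub>1 + \<dots> + r\<^sub>s b\<^sub>s\<close> is in the kernel of the map out of \<open>F\<^sub>k\<close>; this
  basis vector is mapped to the element \<open>r\<^sub>1 b\<^sub>1 + \<dots> + r\<^sub>s b\<^sub>s\<close> of \<open>F\<^sub>k\<close>.  Labelling the
  basis by expressions keeps all \<open>F\<^sub>k\<close> in one type.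
\<close>

datatype ('r, 'm) res_gen = Gen 'm | Rel "('r \<times> ('r, 'm) res_gen) list"

fun gen_value :: "('r, 'm) res_gen \<Rightarrow> 'm" where
  "gen_value (Gen m) = m"
| "gen_value (Rel l) = undefined"

definition formal_sum :: "('r, 'c) ring_scheme \<Rightarrow> ('r \<times> 'b) list \<Rightarrow> 'b \<Rightarrow> 'r" where
  "formal_sum R l =
     foldr (\<lambda>(r, b) f x. if x = b then r \<oplus>\<^bsub>R\<^esub> f x else f x) l (\<lambda>x. \<zero>\<^bsub>R\<^esub>)"

fun rel_value :: "('r, 'c) ring_scheme \<Rightarrow> ('r, 'm) res_gen \<Rightarrow> ('r, 'm) res_gen \<Rightarrow> 'r" where
  "rel_value R (Rel l) = formal_sum R l"
| "rel_value R (Gen m) = undefined"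

fun res_basis ::
  "('r, 'c) ring_scheme \<Rightarrow> ('r, 'm, 'd) module_scheme \<Rightarrow> nat \<Rightarrow> ('r, 'm) res_gen set" where
  "res_basis R M 0 = Gen ` carrier M"
| "res_basis R M (Suc 0) = {Rel l | l. set l \<subseteq> carrier R \<times> res_basis R M 0 \<and>
     lin_ext R M gen_value (formal_sum R l) = \<zero>\<^bsub>M\<^esub>}"
| "res_basis R M (Suc (Suc k)) = {Rel l | l. set l \<subseteq> carrier R \<times> res_basis R M (Suc k) \<and>
     lin_ext R (free_module R (res_basis R M k)) (rel_value R) (formal_sum R l) = (\<lambda>b. \<zero>\<^bsub>R\<^esub>)}"

definition res_module ::
  "('r, 'c) ring_scheme \<Rightarrow> ('r, 'm, 'd) module_scheme \<Rightarrow> nat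
    \<Rightarrow> ('r, ('r, 'm) res_gen \<Rightarrow> 'r) module" where
  "res_module R M k = free_module R (res_basis R M k)"

definition res_aug ::
  "('r, 'c) ring_scheme \<Rightarrow> ('r, 'm, 'd) module_scheme \<Rightarrow> (('r, 'm) res_gen \<Rightarrow> 'r) \<Rightarrow> 'm" where
  "res_aug R M = lin_ext R M gen_value"

text \<open>The map from \<open>F\<^bsub>k+1\<^esub>\<close> to \<open>F\<^sub>k\<close>.\<close>

definition res_diff ::
  "('r, 'c) ring_scheme \<Rightarrow> ('r, 'm, 'd) module_scheme \<Rightarrow> nat
    \<Rightarrow> (('r, 'm) res_gen \<Rightarrow> 'r) \<Rightarrow> ('r, 'm) res_gen \<Rightarrow> 'r" where
  "res_diff R M k = lin_ext R (res_module R M k) (rel_value R)"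

definition Ext ::
  "('r, 'c) ring_scheme \<Rightarrow> nat \<Rightarrow> ('r, 'm, 'd) module_scheme \<Rightarrow> ('r, 'k, 'e) module_scheme
    \<Rightarrow> ('r, ((('r, 'm) res_gen \<Rightarrow> 'r) \<Rightarrow> 'k) set) module" where
  "Ext R i M N = cohomology
     (\<lambda>k. hom_module R (res_module R M k) N)
     (\<lambda>k \<phi>. \<lambda>x\<in>carrier (res_module R M (Suc k)). \<phi> (res_diff R M k x)) i"


text \<open>The remaining facts of this section show that \<open>\<dots> \<rightarrow> F\<^sub>1 \<rightarrow> F\<^sub>0 \<rightarrow> M \<rightarrow> 0\<close> is exact.\<close>

lemma free_module_sel [simp]:
  "carrier (free_module R B) = fin_supp B (carrier R) \<zero>\<^bsub>R\<^esub>"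
  "\<zero>\<^bsub>free_module R B\<^esub> = (\<lambda>b. \<zero>\<^bsub>R\<^esub>)"
  "f \<oplus>\<^bsub>free_module R B\<^esub> g = (\<lambda>b. f b \<oplus>\<^bsub>R\<^esub> g b)"
  "r \<odot>\<^bsub>free_module R B\<^esub> f = (\<lambda>b. if b \<in> B then r \<otimes>\<^bsub>R\<^esub> f b else \<zero>\<^bsub>R\<^esub>)"
  by (simp_all add: free_module_def)

lemma fin_supp_in: "f \<in> fin_supp B C z \<Longrightarrow> b \<in> B \<Longrightarrow> f b \<in> C"
  and fin_supp_out: "f \<in> fin_supp B C z \<Longrightarrow> b \<notin> B \<Longrightarrow> f b = z"
  and fin_supp_finite: "f \<in> fin_supp B C z \<Longrightarrow> finite {b. f b \<noteq> z}"
  and fin_supp_sub: "f \<in> fin_supp B C z \<Longrightarrow> {b. f b \<noteq> z} \<subseteq> B"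
  by (auto simp: fin_supp_def)

lemma fin_suppI:
  "(\<And>a. a \<in> B \<Longrightarrow> f a \<in> C) \<Longrightarrow> (\<And>a. a \<notin> B \<Longrightarrow> f a = z) \<Longrightarrow> finite S \<Longrightarrow>
   (\<And>a. a \<in> B \<Longrightarrow> f a \<noteq> z \<Longrightarrow> a \<in> S) \<Longrightarrow> f \<in> fin_supp B C z"
  unfolding fin_supp_def by (auto intro: finite_subset[of _ S])

lemma (in cring) free_module_module: "Module.module R (free_module R B)"
proof -
  have inC: "f b \<in> carrier R" if "f \<in> fin_supp B (carrier R) \<zero>" for f b
    using that by (cases "b \<in> B") (auto simp: fin_supp_def)
  have add: "(\<lambda>b. f b \<oplus> g b) \<in> fin_supp B (carrier R) \<zero>"
    if "f \<in> fin_supp B (carrier R) \<zero>" "g \<in> fin_supp B (carrier R) \<zero>" for f g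
    by (rule fin_suppI[where S = "{b. f b \<noteq> \<zero>} \<union> {b. g b \<noteq> \<zero>}"])
      (use that inC fin_supp_out[OF that(1)] fin_supp_out[OF that(2)] in \<open>auto dest: fin_supp_finite\<close>)
  have sm: "(\<lambda>b. if b \<in> B then r \<otimes> f b else \<zero>) \<in> fin_supp B (carrier R) \<zero>"
    if "r \<in> carrier R" "f \<in> fin_supp B (carrier R) \<zero>" for r f
    by (rule fin_suppI[where S = "{b. f b \<noteq> \<zero>}"])
      (use that inC in \<open>auto dest: fin_supp_finite\<close>)
  have neg: "(\<lambda>b. \<ominus> f b) \<in> fin_supp B (carrier R) \<zero>"
    if "f \<in> fin_supp B (carrier R) \<zero>" for f
    by (rule fin_suppI[where S = "{b. f b \<noteq> \<zero>}"])
      (use that inC fin_supp_out[OF that] in \<open>auto dest: fin_supp_finite\<close>)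
  have zero: "(\<lambda>b. \<zero>) \<in> fin_supp B (carrier R) \<zero>" by (simp add: fin_supp_def)
  have ab: "abelian_group (free_module R B)"
  proof (rule abelian_groupI)
    fix f assume f: "f \<in> carrier (free_module R B)"
    show "\<exists>g\<in>carrier (free_module R B). g \<oplus>\<^bsub>free_module R B\<^esub> f = \<zero>\<^bsub>free_module R B\<^esub>"
      by (rule bexI[of _ "\<lambda>b. \<ominus> f b"]) (use f neg inC in \<open>auto simp: l_neg\<close>)
  qed (use add zero inC in \<open>auto simp: fun_eq_iff a_ac\<close>)
  show ?thesis
    by (rule moduleI[OF cring_axioms ab])
      (use sm add inC in \<open>auto simp: fun_eq_iff l_distr r_distr m_assoc dest: fin_supp_out\<close>)
qed

lemma (in module) lin_ext_hom:
  assumes e: "e \<in> B \<rightarrow> carrier M"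
  shows "lin_ext R M e \<in> mod_homs R (free_module R B) M"
proof -
  have sup: "lin_ext R M e f = (\<Oplus>\<^bsub>M\<^esub>b\<in>A. f b \<odot>\<^bsub>M\<^esub> e b)"
    if "f \<in> fin_supp B (carrier R) \<zero>" "finite A" "{b. f b \<noteq> \<zero>} \<subseteq> A" "A \<subseteq> B" for f A
    unfolding lin_ext_def
    by (rule M.add.finprod_mono_neutral_cong_left) (use that e in \<open>auto simp: fin_supp_def Pi_iff subset_iff intro!: smult_l_null smult_closed\<close>)
  have clos: "lin_ext R M e f \<in> carrier M" if "f \<in> fin_supp B (carrier R) \<zero>" for f
    unfolding lin_ext_def using that e fin_supp_sub[OF that]
    by (intro M.finsum_closed) (auto simp: fin_supp_def intro!: smult_closed)
  interpret F: module R "free_module R B" by (rule R.free_module_module)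
  { fix f g assume fg: "f \<in> fin_supp B (carrier R) \<zero>" "g \<in> fin_supp B (carrier R) \<zero>"
    let ?A = "{b. f b \<noteq> \<zero>} \<union> {b. g b \<noteq> \<zero>}"
    have A: "finite ?A" "?A \<subseteq> B" using fg by (auto simp: fin_supp_def)
    have fgc: "(\<lambda>b. f b \<oplus>\<^bsub>R\<^esub> g b) \<in> fin_supp B (carrier R) \<zero>"
      using F.a_closed[of f g] fg by simp
    have "lin_ext R M e (\<lambda>b. f b \<oplus>\<^bsub>R\<^esub> g b) = (\<Oplus>\<^bsub>M\<^esub>b\<in>?A. (f b \<oplus>\<^bsub>R\<^esub> g b) \<odot>\<^bsub>M\<^esub> e b)"
      by (rule sup[OF fgc A(1) _ A(2)]) auto
    also have "\<dots> = (\<Oplus>\<^bsub>M\<^esub>b\<in>?A. f b \<odot>\<^bsub>M\<^esub> e b \<oplus>\<^bsub>M\<^esub> g b \<odot>\<^bsub>M\<^esub> e b)"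
      by (rule M.finsum_cong') (use A e fg in \<open>auto simp: fin_supp_def intro!: smult_l_distr M.a_closed smult_closed\<close>)
    also have "\<dots> = (\<Oplus>\<^bsub>M\<^esub>b\<in>?A. f b \<odot>\<^bsub>M\<^esub> e b) \<oplus>\<^bsub>M\<^esub> (\<Oplus>\<^bsub>M\<^esub>b\<in>?A. g b \<odot>\<^bsub>M\<^esub> e b)"
      by (rule M.finsum_addf) (use A e fg in \<open>auto simp: fin_supp_def intro!: smult_closed\<close>)
    also have "\<dots> = lin_ext R M e f \<oplus>\<^bsub>M\<^esub> lin_ext R M e g"
      using sup[OF fg(1) A(1) _ A(2)] sup[OF fg(2) A(1) _ A(2)] by auto
    finally have "lin_ext R M e (\<lambda>b. f b \<oplus>\<^bsub>R\<^esub> g b) = lin_ext R M e f \<oplus>\<^bsub>M\<^esub> lin_ext R M e g" .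
  } note 1 = this
  have fs: "(\<Oplus>\<^bsub>M\<^esub>b\<in>A. r \<odot>\<^bsub>M\<^esub> h b) = r \<odot>\<^bsub>M\<^esub> (\<Oplus>\<^bsub>M\<^esub>b\<in>A. h b)"
    if "finite A" "r \<in> carrier R" "h \<in> A \<rightarrow> carrier M" for A r h
    using that(1,3) by (induction A rule: finite_induct) (use that(2) in \<open>auto simp: smult_r_null smult_r_distr Pi_def\<close>)
  { fix r f assume rf: "r \<in> carrier R" "f \<in> fin_supp B (carrier R) \<zero>"
    let ?A = "{b. f b \<noteq> \<zero>}"
    have A: "finite ?A" "?A \<subseteq> B" using rf by (auto simp: fin_supp_def)
    have rfc: "(\<lambda>b. if b \<in> B then r \<otimes>\<^bsub>R\<^esub> f b else \<zero>) \<in> fin_supp B (carrier R) \<zero>"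
      using F.smult_closed[of r f] rf by simp
    have "lin_ext R M e (\<lambda>b. if b \<in> B then r \<otimes>\<^bsub>R\<^esub> f b else \<zero>) =
       (\<Oplus>\<^bsub>M\<^esub>b\<in>?A. (if b \<in> B then r \<otimes>\<^bsub>R\<^esub> f b else \<zero>) \<odot>\<^bsub>M\<^esub> e b)"
      by (rule sup[OF rfc A(1) _ A(2)]) (use rf in auto)
    also have "\<dots> = (\<Oplus>\<^bsub>M\<^esub>b\<in>?A. r \<odot>\<^bsub>M\<^esub> (f b \<odot>\<^bsub>M\<^esub> e b))"
      by (rule M.finsum_cong') (use A e rf in \<open>auto simp: fin_supp_def intro!: smult_assoc1 smult_closed\<close>)
    also have "\<dots> = r \<odot>\<^bsub>M\<^esub> lin_ext R M e f" unfolding lin_ext_def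
      by (rule fs) (use A e rf in \<open>auto simp: fin_supp_def intro!: smult_closed\<close>)
    finally have "lin_ext R M e (\<lambda>b. if b \<in> B then r \<otimes>\<^bsub>R\<^esub> f b else \<zero>) = r \<odot>\<^bsub>M\<^esub> lin_ext R M e f" .
  } note 2 = this
  show ?thesis unfolding mod_homs_def using clos 1 2 by auto
qed

lemma (in module) lin_ext_unit:
  assumes "e b \<in> carrier M"
  shows "lin_ext R M e (\<lambda>x. if x = b then \<one>\<^bsub>R\<^esub> else \<zero>\<^bsub>R\<^esub>) = e b"
proof (cases "\<one>\<^bsub>R\<^esub> = \<zero>\<^bsub>R\<^esub>")
  case True
  have "e b = \<zero>\<^bsub>M\<^esub>" using assms True by (metis smult_l_null smult_one)
  thus ?thesis using True by (simp add: lin_ext_def)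
next
  case False
  hence "{x. (if x = b then \<one>\<^bsub>R\<^esub> else \<zero>\<^bsub>R\<^esub>) \<noteq> \<zero>\<^bsub>R\<^esub>} = {b}" by auto
  thus ?thesis using assms by (simp add: lin_ext_def)
qed

lemma (in cring) unit_fin_supp:
  "b \<in> B \<Longrightarrow> (\<lambda>x. if x = b then \<one> else \<zero>) \<in> fin_supp B (carrier R) \<zero>"
  by (auto simp: fin_supp_def intro: finite_subset[of _ "{b}"])

lemma (in cring) formal_sum_closed:
  "set l \<subseteq> carrier R \<times> B \<Longrightarrow> formal_sum R l \<in> fin_supp B (carrier R) \<zero>"
proof (induction l)
  case Nil thus ?case by (simp add: formal_sum_def fin_supp_def)
next
  case (Cons p l)
  obtain r b where p: "p = (r, b)" by force
  have IH: "formal_sum R l \<in> fin_supp B (carrier R) \<zero>" using Cons by auto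
  have eq: "formal_sum R (p # l) = (\<lambda>x. if x = b then r \<oplus> formal_sum R l x else formal_sum R l x)"
    by (simp add: formal_sum_def p fun_eq_iff)
  have "{x. formal_sum R (p # l) x \<noteq> \<zero>} \<subseteq> insert b {x. formal_sum R l x \<noteq> \<zero>}" by (auto simp: eq)
  hence "finite {x. formal_sum R (p # l) x \<noteq> \<zero>}" using IH finite_subset by (fastforce simp: fin_supp_def)
  thus ?case using IH Cons.prems p unfolding fin_supp_def mem_Collect_eq eq by auto
qed

lemma (in cring) formal_sum_onto:
  assumes "f \<in> fin_supp B (carrier R) \<zero>"
  shows "\<exists>l. set l \<subseteq> carrier R \<times> B \<and> formal_sum R l = f"
proof -
  have *: "distinct bs \<Longrightarrow> set bs \<subseteq> B \<Longrightarrow>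
     formal_sum R (map (\<lambda>b. (f b, b)) bs) = (\<lambda>x. if x \<in> set bs then f x else \<zero>)" for bs
    by (induction bs) (use assms in \<open>auto simp: formal_sum_def fun_eq_iff fin_supp_def\<close>)
  obtain bs where bs: "distinct bs" "set bs = {b. f b \<noteq> \<zero>}"
    using finite_distinct_list[OF fin_supp_finite[OF assms]] by auto
  have "set bs \<subseteq> B" using bs fin_supp_sub[OF assms] by simp
  thus ?thesis using *[OF bs(1)] bs assms
    by (intro exI[of _ "map (\<lambda>b. (f b, b)) bs"]) (auto simp: fin_supp_def fun_eq_iff)
qed

lemma mod_homs_lin_ext_zero:
  assumes "Module.module R F" "Module.module R N" "h \<in> mod_homs R F N"
    and "e \<in> B \<rightarrow> carrier F" "\<And>b. b \<in> B \<Longrightarrow> h (e b) = \<zero>\<^bsub>N\<^esub>"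
    and "f \<in> fin_supp B (carrier R) \<zero>\<^bsub>R\<^esub>"
  shows "h (lin_ext R F e f) = \<zero>\<^bsub>N\<^esub>"
proof -
  interpret F: module R F by fact
  interpret N: module R N by fact
  have h0: "h \<zero>\<^bsub>F\<^esub> = \<zero>\<^bsub>N\<^esub>"
  proof -
    have "h (\<zero>\<^bsub>R\<^esub> \<odot>\<^bsub>F\<^esub> \<zero>\<^bsub>F\<^esub>) = \<zero>\<^bsub>R\<^esub> \<odot>\<^bsub>N\<^esub> h \<zero>\<^bsub>F\<^esub>" "h \<zero>\<^bsub>F\<^esub> \<in> carrier N"
      using assms(3) F.zero_closed F.R.zero_closed unfolding mod_homs_def by blast+
    thus ?thesis by (simp add: F.smult_l_null N.smult_l_null)
  qed
  have "finite A \<Longrightarrow> A \<subseteq> B \<Longrightarrow> h (\<Oplus>\<^bsub>F\<^esub>b\<in>A. f b \<odot>\<^bsub>F\<^esub> e b) = \<zero>\<^bsub>N\<^esub>" for A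
  proof (induction A rule: finite_induct)
    case empty thus ?case by (simp add: h0)
  next
    case (insert b A)
    have c: "f x \<odot>\<^bsub>F\<^esub> e x \<in> carrier F" "e x \<in> carrier F" "f x \<in> carrier R" if "x \<in> B" for x
      using that assms(4,6) fin_supp_in by (fastforce intro!: F.smult_closed)+
    have c': "(\<Oplus>\<^bsub>F\<^esub>b\<in>A. f b \<odot>\<^bsub>F\<^esub> e b) \<in> carrier F"
      using insert c by (intro F.finsum_closed) auto
    have "(\<Oplus>\<^bsub>F\<^esub>b\<in>insert b A. f b \<odot>\<^bsub>F\<^esub> e b) = f b \<odot>\<^bsub>F\<^esub> e b \<oplus>\<^bsub>F\<^esub> (\<Oplus>\<^bsub>F\<^esub>b\<in>A. f b \<odot>\<^bsub>F\<^esub> e b)"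
      using insert c by (intro F.finsum_insert) auto
    hence "h (\<Oplus>\<^bsub>F\<^esub>b\<in>insert b A. f b \<odot>\<^bsub>F\<^esub> e b) = f b \<odot>\<^bsub>N\<^esub> h (e b) \<oplus>\<^bsub>N\<^esub> h (\<Oplus>\<^bsub>F\<^esub>b\<in>A. f b \<odot>\<^bsub>F\<^esub> e b)"
      using assms(3) c c' insert.prems unfolding mod_homs_def by auto
    thus ?case using insert assms(5) c by (simp add: N.smult_r_null)
  qed
  from this[of "{b. f b \<noteq> \<zero>\<^bsub>R\<^esub>}"] show ?thesis
    using assms(6) by (auto simp: lin_ext_def fin_supp_def)
qed

lemma res_exact_aux:
  assumes "Module.module R N" and h: "h \<in> mod_homs R (free_module R B) N"
    and B': "B' = {Rel l | l. set l \<subseteq> carrier R \<times> B \<and> h (formal_sum R l) = \<zero>\<^bsub>N\<^esub>}"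
  shows "lin_ext R (free_module R B) (rel_value R) ` carrier (free_module R B') =
      {f \<in> carrier (free_module R B). h f = \<zero>\<^bsub>N\<^esub>}"
    and "lin_ext R (free_module R B) (rel_value R) \<in> mod_homs R (free_module R B') (free_module R B)"
proof -
  interpret N: module R N by fact
  interpret F: module R "free_module R B" by (rule N.R.free_module_module)
  have e: "rel_value R \<in> B' \<rightarrow> carrier (free_module R B)"
  proof
    fix b assume "b \<in> B'"
    then obtain l where "b = Rel l" "set l \<subseteq> carrier R \<times> B" unfolding B' by auto
    thus "rel_value R b \<in> carrier (free_module R B)" using N.R.formal_sum_closed[of l B] by simp
  qed
  have e0: "h (rel_value R b) = \<zero>\<^bsub>N\<^esub>" if "b \<in> B'" for b
    using that unfolding B' by auto
  show hom: "lin_ext R (free_module R B) (rel_value R) \<in> mod_homs R (free_module R B') (free_module R B)"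
    by (rule F.lin_ext_hom[OF e])
  show "lin_ext R (free_module R B) (rel_value R) ` carrier (free_module R B') =
      {f \<in> carrier (free_module R B). h f = \<zero>\<^bsub>N\<^esub>}" (is "?l = ?r")
  proof
    show "?l \<subseteq> ?r"
    proof (rule image_subsetI)
      fix f assume f: "f \<in> carrier (free_module R B')"
      hence "lin_ext R (free_module R B) (rel_value R) f \<in> carrier (free_module R B)"
        using hom unfolding mod_homs_def by blast
      moreover have "h (lin_ext R (free_module R B) (rel_value R) f) = \<zero>\<^bsub>N\<^esub>"
        by (rule mod_homs_lin_ext_zero[OF F.module_axioms N.module_axioms h e]) (use e0 f in auto)
      ultimately show "lin_ext R (free_module R B) (rel_value R) f \<in> ?r" by simp
    qed
    show "?r \<subseteq> ?l"
    proof
      fix f assume f: "f \<in> ?r"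
      then obtain l where l: "set l \<subseteq> carrier R \<times> B" "formal_sum R l = f"
        using N.R.formal_sum_onto[of f B] by auto
      hence "Rel l \<in> B'" using f by (auto simp: B')
      moreover have "lin_ext R (free_module R B) (rel_value R)
          (\<lambda>x. if x = Rel l then \<one>\<^bsub>R\<^esub> else \<zero>\<^bsub>R\<^esub>) = f"
        using F.lin_ext_unit[of "rel_value R" "Rel l"] f l by simp
      ultimately show "f \<in> ?l" using N.R.unit_fin_supp[of "Rel l" B']
        by (metis free_module_sel(1) imageI)
    qed
  qed
qed

context module begin

lemma res_aug_hom: "res_aug R M \<in> mod_homs R (res_module R M 0) M"
  unfolding res_aug_def res_module_def by (rule lin_ext_hom) auto

lemma res_aug_surj: "res_aug R M ` carrier (res_module R M 0) = carrier M"
proof -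
  have "m \<in> res_aug R M ` carrier (res_module R M 0)" if "m \<in> carrier M" for m
  proof (rule image_eqI)
    let ?g = "Gen m :: ('a, 'c) res_gen"
    show "m = res_aug R M (\<lambda>x. if x = ?g then \<one>\<^bsub>R\<^esub> else \<zero>\<^bsub>R\<^esub>)"
      using lin_ext_unit[of gen_value ?g] that by (simp add: res_aug_def)
    show "(\<lambda>x. if x = ?g then \<one>\<^bsub>R\<^esub> else \<zero>\<^bsub>R\<^esub>) \<in> carrier (res_module R M 0)"
      using R.unit_fin_supp[of ?g "Gen ` carrier M"] that by (simp add: res_module_def)
  qed
  thus ?thesis using res_aug_hom by (fastforce simp: mod_homs_def)
qed

lemma res_exact_0:
  "res_diff R M 0 ` carrier (res_module R M (Suc 0)) =
     {f \<in> carrier (res_module R M 0). res_aug R M f = \<zero>\<^bsub>M\<^esub>}"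
  "res_diff R M 0 \<in> mod_homs R (res_module R M (Suc 0)) (res_module R M 0)"
  using res_exact_aux[OF module_axioms res_aug_hom[unfolded res_module_def]]
  by (simp_all add: res_diff_def res_module_def res_aug_def)

lemma res_exact_Suc:
  "res_diff R M (Suc k) ` carrier (res_module R M (Suc (Suc k))) =
     {f \<in> carrier (res_module R M (Suc k)). res_diff R M k f = \<zero>\<^bsub>res_module R M k\<^esub>}"
  "res_diff R M (Suc k) \<in> mod_homs R (res_module R M (Suc (Suc k))) (res_module R M (Suc k))"
proof -
  have *: "res_diff R M k \<in> mod_homs R (res_module R M (Suc k)) (res_module R M k) \<Longrightarrow>
   res_diff R M (Suc k) ` carrier (res_module R M (Suc (Suc k))) =
     {f \<in> carrier (res_module R M (Suc k)). res_diff R M k f = \<zero>\<^bsub>res_module R M k\<^esub>} \<and>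
   res_diff R M (Suc k) \<in> mod_homs R (res_module R M (Suc (Suc k))) (res_module R M (Suc k))" for k
    using res_exact_aux[OF R.free_module_module, of "res_diff R M k" "res_basis R M (Suc k)" "res_basis R M k" "res_basis R M (Suc (Suc k))"]
    by (simp add: res_diff_def res_module_def)
  have "res_diff R M k \<in> mod_homs R (res_module R M (Suc k)) (res_module R M k)"
    by (induction k) (use res_exact_0 * in auto)
  thus "res_diff R M (Suc k) ` carrier (res_module R M (Suc (Suc k))) =
     {f \<in> carrier (res_module R M (Suc k)). res_diff R M k f = \<zero>\<^bsub>res_module R M k\<^esub>}"
  "res_diff R M (Suc k) \<in> mod_homs R (res_module R M (Suc (Suc k))) (res_module R M (Suc k))"
    using * by auto
qed

end


section \<open>Localization at one element and Cech cohomology\<close>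

text \<open>\<open>frac R M s m k\<close> is the fraction \<open>m / s\<^sup>k\<close>, the class of all \<open>(m', k')\<close> for which
  \<open>s\<^sup>j (s\<^bsup>k'\<^esup> m - s\<^sup>k m') = 0\<close> for some \<open>j\<close>.\<close>

definition frac ::
  "('r, 'c) ring_scheme \<Rightarrow> ('r, 'm, 'd) module_scheme \<Rightarrow> 'r \<Rightarrow> 'm \<Rightarrow> nat \<Rightarrow> ('m \<times> nat) set" where
  "frac R M s m k = {(m', k'). m' \<in> carrier M \<and>
     (\<exists>j::nat. (s [^]\<^bsub>R\<^esub> (j + k')) \<odot>\<^bsub>M\<^esub> m = (s [^]\<^bsub>R\<^esub> (j + k)) \<odot>\<^bsub>M\<^esub> m')}"

definition loc_module ::
  "('r, 'c) ring_scheme \<Rightarrow> ('r, 'm, 'd) module_scheme \<Rightarrow> 'r \<Rightarrow> ('r, ('m \<times> nat) set) module" where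
  "loc_module R M s = \<lparr>carrier = {frac R M s m k | m k. m \<in> carrier M},
     monoid.mult = undefined, monoid.one = undefined,
     ring.zero = frac R M s \<zero>\<^bsub>M\<^esub> 0,
     ring.add = (\<lambda>U V. \<Union>(m, k)\<in>U. \<Union>(m', k')\<in>V. frac R M s
       ((s [^]\<^bsub>R\<^esub> k') \<odot>\<^bsub>M\<^esub> m \<oplus>\<^bsub>M\<^esub> (s [^]\<^bsub>R\<^esub> k) \<odot>\<^bsub>M\<^esub> m') (k + k')),
     smult = (\<lambda>r U. \<Union>(m, k)\<in>U. frac R M s (r \<odot>\<^bsub>M\<^esub> m) k)\<rparr>"

text \<open>The canonical map from the localization at \<open>s\<close> to the localization at \<open>s u\<close>, which sends
  \<open>m / s\<^sup>k\<close> to \<open>u\<^sup>k m / (s u)\<^sup>k\<close>.\<close>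

definition loc_map ::
  "('r, 'c) ring_scheme \<Rightarrow> ('r, 'm, 'd) module_scheme \<Rightarrow> 'r \<Rightarrow> 'r
    \<Rightarrow> ('m \<times> nat) set \<Rightarrow> ('m \<times> nat) set" where
  "loc_map R M s u U = (\<Union>(m, k)\<in>U. frac R M (s \<otimes>\<^bsub>R\<^esub> u) ((u [^]\<^bsub>R\<^esub> k) \<odot>\<^bsub>M\<^esub> m) k)"

definition cech_loc ::
  "('r, 'c) ring_scheme \<Rightarrow> (nat \<Rightarrow> 'r) \<Rightarrow> ('r, 'm, 'd) module_scheme \<Rightarrow> nat set
    \<Rightarrow> ('r, ('m \<times> nat) set) module" where
  "cech_loc R t M I = loc_module R M (\<Otimes>\<^bsub>R\<^esub>i\<in>I. t i)"

definition cech_indices :: "nat \<Rightarrow> nat \<Rightarrow> nat set set" where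
  "cech_indices D p = {I. I \<subseteq> {1..D} \<and> card I = p}"

text \<open>
  A strictly increasing tuple of indices is represented by the set of its entries.  In degree \<open>0\<close>
  the only summand is the localization of \<open>M\<close> at the empty product \<open>1\<close>, which is \<open>M\<close> by way of
  \<open>m / 1\<^sup>k \<mapsto> m\<close>.
\<close>

definition cech_module ::
  "('r, 'c) ring_scheme \<Rightarrow> nat \<Rightarrow> (nat \<Rightarrow> 'r) \<Rightarrow> ('r, 'm, 'd) module_scheme \<Rightarrow> nat
    \<Rightarrow> ('r, nat set \<Rightarrow> ('m \<times> nat) set) module" where
  "cech_module R D t M p = \<lparr>
     carrier = (\<Pi>\<^sub>E I\<in>cech_indices D p. carrier (cech_loc R t M I)),
     monoid.mult = undefined, monoid.one = undefined,
     ring.zero = (\<lambda>I\<in>cech_indices D p. \<zero>\<^bsub>cech_loc R t M I\<^esub>),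
     ring.add = (\<lambda>\<phi> \<psi>. \<lambda>I\<in>cech_indices D p. \<phi> I \<oplus>\<^bsub>cech_loc R t M I\<^esub> \<psi> I),
     smult = (\<lambda>r \<phi>. \<lambda>I\<in>cech_indices D p. r \<odot>\<^bsub>cech_loc R t M I\<^esub> \<phi> I)\<rparr>"

text \<open>The entry \<open>i\<close> of the increasing tuple \<open>I = (i\<^sub>0, \<dots>, i\<^sub>p)\<close> is \<open>i\<^sub>j\<close> for
  \<open>j = card {i' \<in> I. i' < i}\<close>.\<close>

definition cech_diff ::
  "('r, 'c) ring_scheme \<Rightarrow> nat \<Rightarrow> (nat \<Rightarrow> 'r) \<Rightarrow> ('r, 'm, 'd) module_scheme \<Rightarrow> nat
    \<Rightarrow> (nat set \<Rightarrow> ('m \<times> nat) set) \<Rightarrow> nat set \<Rightarrow> ('m \<times> nat) set" where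
  "cech_diff R D t M p \<phi> = (\<lambda>I\<in>cech_indices D (Suc p).
     \<Oplus>\<^bsub>cech_loc R t M I\<^esub>i\<in>I.
       ((\<ominus>\<^bsub>R\<^esub> \<one>\<^bsub>R\<^esub>) [^]\<^bsub>R\<^esub> card {i' \<in> I. i' < i}) \<odot>\<^bsub>cech_loc R t M I\<^esub>
         loc_map R M (\<Otimes>\<^bsub>R\<^esub>i'\<in>I - {i}. t i') (t i) (\<phi> (I - {i})))"

definition cech_cohomology ::
  "('r, 'c) ring_scheme \<Rightarrow> nat \<Rightarrow> (nat \<Rightarrow> 'r) \<Rightarrow> ('r, 'm, 'd) module_scheme \<Rightarrow> nat
    \<Rightarrow> ('r, (nat set \<Rightarrow> ('m \<times> nat) set) set) module" where
  "cech_cohomology R D t M p = cohomology (cech_module R D t M) (cech_diff R D t M) p"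


section \<open>Finitely generated abelian groups\<close>

text \<open>As everywhere in HOL-Algebra, abelian groups are written multiplicatively.\<close>

definition fin_gen_group :: "('l, 'c) monoid_scheme \<Rightarrow> bool" where
  "fin_gen_group G \<longleftrightarrow> (\<exists>S. finite S \<and> S \<subseteq> carrier G \<and> generate G S = carrier G)"

definition int_independent :: "('l, 'c) monoid_scheme \<Rightarrow> 'l set \<Rightarrow> bool" where
  "int_independent G B \<longleftrightarrow> finite B \<and> B \<subseteq> carrier G \<and>
     (\<forall>c :: 'l \<Rightarrow> int. (\<Otimes>\<^bsub>G\<^esub>b\<in>B. b [^]\<^bsub>G\<^esub> c b) = \<one>\<^bsub>G\<^esub> \<longrightarrow> (\<forall>b\<in>B. c b = 0))"

definition free_rank :: "('l, 'c) monoid_scheme \<Rightarrow> nat" where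
  "free_rank G = Max {card B | B. int_independent G B}"

definition free_with_basis ::
  "('l, 'c) monoid_scheme \<Rightarrow> 'l set \<Rightarrow> nat \<Rightarrow> (nat \<Rightarrow> 'l) \<Rightarrow> bool" where
  "free_with_basis G \<Gamma> D \<gamma> \<longleftrightarrow> \<gamma> \<in> {1..D} \<rightarrow> \<Gamma> \<and>
     bij_betw (\<lambda>c. \<Otimes>\<^bsub>G\<^esub>j\<in>{1..D}. \<gamma> j [^]\<^bsub>G\<^esub> c j) ({1..D} \<rightarrow>\<^sub>E (UNIV :: int set)) \<Gamma>"


section \<open>Group rings\<close>

definition group_ring :: "('k, 'c) ring_scheme \<Rightarrow> ('l, 'd) monoid_scheme \<Rightarrow> ('l \<Rightarrow> 'k) ring" where
  "group_ring K G = \<lparr>carrier = fin_supp (carrier G) (carrier K) \<zero>\<^bsub>K\<^esub>,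
     monoid.mult = (\<lambda>f g x. if x \<in> carrier G
       then \<Oplus>\<^bsub>K\<^esub>y\<in>{y \<in> carrier G. f y \<noteq> \<zero>\<^bsub>K\<^esub>}. f y \<otimes>\<^bsub>K\<^esub> g (inv\<^bsub>G\<^esub> y \<otimes>\<^bsub>G\<^esub> x) else \<zero>\<^bsub>K\<^esub>),
     monoid.one = (\<lambda>x. if x = \<one>\<^bsub>G\<^esub> then \<one>\<^bsub>K\<^esub> else \<zero>\<^bsub>K\<^esub>),
     ring.zero = (\<lambda>x. \<zero>\<^bsub>K\<^esub>),
     ring.add = (\<lambda>f g x. f x \<oplus>\<^bsub>K\<^esub> g x)\<rparr>"

definition group_elt :: "('k, 'c) ring_scheme \<Rightarrow> 'l \<Rightarrow> 'l \<Rightarrow> 'k" where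
  "group_elt K y = (\<lambda>x. if x = y then \<one>\<^bsub>K\<^esub> else \<zero>\<^bsub>K\<^esub>)"

definition antipode ::
  "('k, 'c) ring_scheme \<Rightarrow> ('l, 'd) monoid_scheme \<Rightarrow> ('l \<Rightarrow> 'k) \<Rightarrow> 'l \<Rightarrow> 'k" where
  "antipode K G f = (\<lambda>x. if x \<in> carrier G then f (inv\<^bsub>G\<^esub> x) else \<zero>\<^bsub>K\<^esub>)"

definition antipode_twist ::
  "('k, 'c) ring_scheme \<Rightarrow> ('l, 'd) monoid_scheme \<Rightarrow> ('l \<Rightarrow> 'k, 'm) module
    \<Rightarrow> ('l \<Rightarrow> 'k, 'm) module" where
  "antipode_twist K G M = M\<lparr>smult := (\<lambda>r x. antipode K G r \<odot>\<^bsub>M\<^esub> x)\<rparr>"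

text \<open>The module \<open>M[G]\<close> over the group ring, for a module \<open>M\<close> over \<open>K\<close>.\<close>

definition group_module ::
  "('k, 'c) ring_scheme \<Rightarrow> ('l, 'd) monoid_scheme \<Rightarrow> ('k, 'p, 'e) module_scheme
    \<Rightarrow> ('l \<Rightarrow> 'k, 'l \<Rightarrow> 'p) module" where
  "group_module K G M = \<lparr>carrier = fin_supp (carrier G) (carrier M) \<zero>\<^bsub>M\<^esub>,
     monoid.mult = undefined, monoid.one = undefined, ring.zero = (\<lambda>x. \<zero>\<^bsub>M\<^esub>),
     ring.add = (\<lambda>p q x. p x \<oplus>\<^bsub>M\<^esub> q x),
     smult = (\<lambda>f p x. if x \<in> carrier G
       then \<Oplus>\<^bsub>M\<^esub>y\<in>{y \<in> carrier G. f y \<noteq> \<zero>\<^bsub>K\<^esub>}. f y \<odot>\<^bsub>M\<^esub> p (inv\<^bsub>G\<^esub> y \<otimes>\<^bsub>G\<^esub> x) else \<zero>\<^bsub>M\<^esub>)\<rparr>"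

text \<open>The form with \<open>\<omega>(a x\<^sup>\<lambda>, b x\<^sup>\<mu>) = \<omega>\<^sub>0(a, b) x\<^bsup>\<mu>-\<lambda>\<^esup>\<close>: the coefficient at \<open>\<nu>\<close> of \<open>\<omega>(p, q)\<close> is the
  sum over all \<open>\<lambda>\<close> of \<open>\<omega>\<^sub>0(p\<^bsub>\<lambda>\<^esub>, q\<^bsub>\<lambda>+\<nu>\<^esub>)\<close>.\<close>

definition group_form ::
  "('k, 'c) ring_scheme \<Rightarrow> ('l, 'd) monoid_scheme \<Rightarrow> ('k, 'p, 'e) module_scheme
    \<Rightarrow> ('p \<Rightarrow> 'p \<Rightarrow> 'k) \<Rightarrow> ('l \<Rightarrow> 'p) \<Rightarrow> ('l \<Rightarrow> 'p) \<Rightarrow> 'l \<Rightarrow> 'k" where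
  "group_form K G M \<omega>\<^sub>0 p q = (\<lambda>\<nu>. if \<nu> \<in> carrier G
     then \<Oplus>\<^bsub>K\<^esub>x\<in>{x \<in> carrier G. p x \<noteq> \<zero>\<^bsub>M\<^esub>}. \<omega>\<^sub>0 (p x) (q (x \<otimes>\<^bsub>G\<^esub> \<nu>)) else \<zero>\<^bsub>K\<^esub>)"


section \<open>Stabilizer codes\<close>

definition bilinear_form ::
  "('k, 'c) ring_scheme \<Rightarrow> ('k, 'p, 'e) module_scheme \<Rightarrow> ('p \<Rightarrow> 'p \<Rightarrow> 'k) \<Rightarrow> bool" where
  "bilinear_form K M \<omega>\<^sub>0 \<longleftrightarrow>
     (\<forall>a\<in>carrier M. \<omega>\<^sub>0 a \<in> mod_homs K M (self_module K)) \<and>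
     (\<forall>a\<in>carrier M. (\<lambda>b. \<omega>\<^sub>0 b a) \<in> mod_homs K M (self_module K))"

definition alternating_form ::
  "('k, 'c) ring_scheme \<Rightarrow> ('k, 'p, 'e) module_scheme \<Rightarrow> ('p \<Rightarrow> 'p \<Rightarrow> 'k) \<Rightarrow> bool" where
  "alternating_form K M \<omega>\<^sub>0 \<longleftrightarrow> (\<forall>a\<in>carrier M. \<omega>\<^sub>0 a a = \<zero>\<^bsub>K\<^esub>)"

definition nondegenerate_form ::
  "('k, 'c) ring_scheme \<Rightarrow> ('k, 'p, 'e) module_scheme \<Rightarrow> ('p \<Rightarrow> 'p \<Rightarrow> 'k) \<Rightarrow> bool" where
  "nondegenerate_form K M \<omega>\<^sub>0 \<longleftrightarrow>
     (\<forall>a\<in>carrier M. (\<forall>b\<in>carrier M. \<omega>\<^sub>0 b a = \<zero>\<^bsub>K\<^esub>) \<longrightarrow> a = \<zero>\<^bsub>M\<^esub>)"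

text \<open>\<open>ZFact (int n)\<close> is the ring of integers modulo \<open>n\<close>, and \<open>P\<close> is determined by \<open>P\<^sub>0\<close>.\<close>

abbreviation lattice_ring :: "nat \<Rightarrow> 'l monoid \<Rightarrow> ('l \<Rightarrow> int set) ring" where
  "lattice_ring n \<Lambda> \<equiv> group_ring (ZFact (int n)) \<Lambda>"

abbreviation qudit_module ::
  "nat \<Rightarrow> 'l monoid \<Rightarrow> (int set, 'p) module \<Rightarrow> ('l \<Rightarrow> int set, 'l \<Rightarrow> 'p) module" where
  "qudit_module n \<Lambda> P\<^sub>0 \<equiv> group_module (ZFact (int n)) \<Lambda> P\<^sub>0"

abbreviation qudit_form ::
  "nat \<Rightarrow> 'l monoid \<Rightarrow> (int set, 'p) module \<Rightarrow> ('p \<Rightarrow> 'p \<Rightarrow> int set)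
    \<Rightarrow> ('l \<Rightarrow> 'p) \<Rightarrow> ('l \<Rightarrow> 'p) \<Rightarrow> 'l \<Rightarrow> int set" where
  "qudit_form n \<Lambda> P\<^sub>0 \<omega>\<^sub>0 \<equiv> group_form (ZFact (int n)) \<Lambda> P\<^sub>0 \<omega>\<^sub>0"

locale stabilizer_code =
  fixes n :: nat
    and \<Lambda> :: "'l monoid"
    and L :: "('l \<Rightarrow> 'p) set"
    and P\<^sub>0 :: "(int set, 'p) module"
    and \<omega>\<^sub>0 :: "'p \<Rightarrow> 'p \<Rightarrow> int set"
  assumes n_pos: "0 < n"
    and comm_group: "comm_group \<Lambda>"
    and fin_gen_group: "fin_gen_group \<Lambda>"
    and module: "Module.module (ZFact (int n)) P\<^sub>0"
    and fin_gen_module: "fin_gen_module (ZFact (int n)) P\<^sub>0"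
    and bilinear: "bilinear_form (ZFact (int n)) P\<^sub>0 \<omega>\<^sub>0"
    and alternating: "alternating_form (ZFact (int n)) P\<^sub>0 \<omega>\<^sub>0"
    and nondegenerate: "nondegenerate_form (ZFact (int n)) P\<^sub>0 \<omega>\<^sub>0"
    and submodule: "submodule L (lattice_ring n \<Lambda>) (qudit_module n \<Lambda> P\<^sub>0)"
    and isotropic: "\<And>l l'. l \<in> L \<Longrightarrow> l' \<in> L \<Longrightarrow> qudit_form n \<Lambda> P\<^sub>0 \<omega>\<^sub>0 l l' = \<zero>\<^bsub>lattice_ring n \<Lambda>\<^esub>"

definition code_orthogonal ::
  "nat \<Rightarrow> 'l monoid \<Rightarrow> ('l \<Rightarrow> 'p) set \<Rightarrow> (int set, 'p) module \<Rightarrow> ('p \<Rightarrow> 'p \<Rightarrow> int set)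
    \<Rightarrow> ('l \<Rightarrow> 'p) set" where
  "code_orthogonal n \<Lambda> L P\<^sub>0 \<omega>\<^sub>0 = {p \<in> carrier (qudit_module n \<Lambda> P\<^sub>0).
     \<forall>l\<in>L. qudit_form n \<Lambda> P\<^sub>0 \<omega>\<^sub>0 l p = \<zero>\<^bsub>lattice_ring n \<Lambda>\<^esub>}"

locale lagrangian_code = stabilizer_code +
  assumes lagrangian: "code_orthogonal n \<Lambda> L P\<^sub>0 \<omega>\<^sub>0 = L"

definition charge_module ::
  "nat \<Rightarrow> 'l monoid \<Rightarrow> ('l \<Rightarrow> 'p) set \<Rightarrow> (int set, 'p) module \<Rightarrow> nat
    \<Rightarrow> ('l \<Rightarrow> int set,
        ((('l \<Rightarrow> int set, ('l \<Rightarrow> 'p) set) res_gen \<Rightarrow> 'l \<Rightarrow> int set) \<Rightarrow> 'l \<Rightarrow> int set) set) module" where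
  "charge_module n \<Lambda> L P\<^sub>0 i = Ext (lattice_ring n \<Lambda>) (i + 1)
     (antipode_twist (ZFact (int n)) \<Lambda> (quot_module (qudit_module n \<Lambda> P\<^sub>0) L))
     (self_module (lattice_ring n \<Lambda>))"

end

theory Submission
  imports Defs
begin

text \<open>
  Let \<open>E\<close> be the dual of the canonical free resolution of \<open>P / L\<close> with the action twisted by the
  antipode, so that \<open>Q\<^sup>i = H\<^sup>i\<^sup>+\<^sup>1(E)\<close>.  A character sum argument shows that the form identifies \<open>P\<close> with
  the dual of the twisted \<open>P\<close>; hence the kernel of \<open>E\<^sup>0 \<rightarrow> E\<^sup>1\<close> is the orthogonal complement of \<open>L\<close>,
  which is \<open>L\<close>.  Since the \<open>t\<^sub>j\<close> kill the cohomology of \<open>E\<close> in positive degrees, \<open>E\<close> becomes a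
  resolution of \<open>L\<close> when a \<open>t\<^sub>j\<close> is inverted.  Since \<open>t\<^sub>1, \<dots>, t\<^sub>D\<close> is regular on every \<open>A[\<Lambda>]\<close>, the
  \<open>E\<^sup>r\<close> and \<open>P\<close> have no Cech or Koszul cohomology below the top degree.  In the double complex of the
  Koszul cochains of \<open>t\<^sub>1\<^sup>k, \<dots>, t\<^sub>D\<^sup>k\<close> with values in \<open>E\<close>, for large \<open>k\<close>, these two facts identify
  \<open>H\<^sup>i\<^sup>+\<^sup>1(E)\<close> with the local cohomology of \<open>L\<close> in degree \<open>i + 2\<close>, and the sequence
  \<open>0 \<rightarrow> L \<rightarrow> P \<rightarrow> P / L \<rightarrow> 0\<close> identifies the latter with the Cech cohomology of \<open>P / L\<close> in degree \<open>i + 1\<close>.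
\<close>

section \<open>Modules, quotients and homomorphisms\<close>

text \<open>The canonical resolution is not finitely generated, so in general the
  \<open>E\<^sup>r\<close> are infinite products of copies of \<open>R\<close>, with which
  localization does not commute. Fractions with values in \<open>E\<close> are therefore avoided:
  Koszul cochains for one exponent \<open>k\<close> at a time allow exactness to be checked
  coordinate by coordinate, and \<open>k\<close> is raised when necessary. Raising \<open>k\<close>
  by \<open>m\<close> multiplies the entry at an index set \<open>I\<close> by the
  \<open>m\<close>-th power of the product of the \<open>t\<^sub>i\<close> with \<open>i\<close> in
  \<open>I\<close>. This pays for the failure of \<open>E\<close> to be exact: a lift against the
  differential of \<open>E\<close> exists only after multiplication by some \<open>t\<^sub>i\<close>
  and costs one unit of \<open>k\<close>, while a lift against the Koszul differential is free.

  The bound \<open>i + 2 \<le> D\<close> is where the free lifts end: they are used in degrees up to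
  \<open>i + 1\<close>, and Koszul exactness holds only below degree \<open>D\<close>. One step,
  finding a cochain of \<open>P\<close> for a given cocycle of \<open>E\<close>, meets degree
  \<open>i + 2\<close>, possibly equal to \<open>D\<close>; there a cochain of \<open>L\<close> has
  to bound in \<open>P\<close>, and the knowledge that it bounds in \<open>E\<^sup>0\<close> takes
  the place of exactness.\<close>

lemma mod_homs_closed: "f \<in> mod_homs R M N \<Longrightarrow> x \<in> carrier M \<Longrightarrow> f x \<in> carrier N"
  and mod_homs_add: "f \<in> mod_homs R M N \<Longrightarrow> x \<in> carrier M \<Longrightarrow> y \<in> carrier M \<Longrightarrow>
    f (x \<oplus>\<^bsub>M\<^esub> y) = f x \<oplus>\<^bsub>N\<^esub> f y"
  and mod_homs_smult: "f \<in> mod_homs R M N \<Longrightarrow> r \<in> carrier R \<Longrightarrow> x \<in> carrier M \<Longrightarrow>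
    f (r \<odot>\<^bsub>M\<^esub> x) = r \<odot>\<^bsub>N\<^esub> f x"
  by (auto simp: mod_homs_def)

lemma mod_homsI:
  assumes "\<And>x. x \<in> carrier M \<Longrightarrow> f x \<in> carrier N"
    and "\<And>x y. x \<in> carrier M \<Longrightarrow> y \<in> carrier M \<Longrightarrow> f (x \<oplus>\<^bsub>M\<^esub> y) = f x \<oplus>\<^bsub>N\<^esub> f y"
    and "\<And>r x. r \<in> carrier R \<Longrightarrow> x \<in> carrier M \<Longrightarrow> f (r \<odot>\<^bsub>M\<^esub> x) = r \<odot>\<^bsub>N\<^esub> f x"
  shows "f \<in> mod_homs R M N"
  using assms by (auto simp: mod_homs_def)

lemma mod_homs_zero:
  assumes "Module.module R M" "Module.module R N" "f \<in> mod_homs R M N"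
  shows "f \<zero>\<^bsub>M\<^esub> = \<zero>\<^bsub>N\<^esub>"
proof -
  interpret M: module R M by fact
  interpret N: module R N by fact
  have "f (\<zero>\<^bsub>R\<^esub> \<odot>\<^bsub>M\<^esub> \<zero>\<^bsub>M\<^esub>) = \<zero>\<^bsub>R\<^esub> \<odot>\<^bsub>N\<^esub> f \<zero>\<^bsub>M\<^esub>"
    using mod_homs_smult[OF assms(3) M.R.zero_closed M.zero_closed] .
  moreover have "f \<zero>\<^bsub>M\<^esub> \<in> carrier N" using mod_homs_closed[OF assms(3) M.zero_closed] .
  ultimately show ?thesis by simp
qed

lemma mod_homs_uminus:
  assumes "Module.module R M" "Module.module R N" "f \<in> mod_homs R M N" "x \<in> carrier M"
  shows "f (\<ominus>\<^bsub>M\<^esub> x) = \<ominus>\<^bsub>N\<^esub> f x"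
proof -
  interpret M: module R M by fact
  interpret N: module R N by fact
  have "f x \<in> carrier N" "f (\<ominus>\<^bsub>M\<^esub> x) \<in> carrier N"
    using mod_homs_closed[OF assms(3)] assms(4) by auto
  moreover have "f (\<ominus>\<^bsub>M\<^esub> x) \<oplus>\<^bsub>N\<^esub> f x = \<zero>\<^bsub>N\<^esub>"
    using mod_homs_add[OF assms(3), of "\<ominus>\<^bsub>M\<^esub> x" x] assms(4) mod_homs_zero[OF assms(1-3)]
    by (simp add: M.l_neg)
  ultimately show ?thesis by (metis N.minus_equality)
qed

lemma mod_homs_minus:
  assumes "Module.module R M" "Module.module R N" "f \<in> mod_homs R M N"
    "x \<in> carrier M" "y \<in> carrier M"
  shows "f (x \<ominus>\<^bsub>M\<^esub> y) = f x \<ominus>\<^bsub>N\<^esub> f y"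
proof -
  interpret M: module R M by fact
  show ?thesis
    using mod_homs_add[OF assms(3,4), of "\<ominus>\<^bsub>M\<^esub> y"] mod_homs_uminus[OF assms(1-3,5)] assms(5)
    by (simp add: a_minus_def)
qed

lemma mod_homs_finsum:
  assumes "Module.module R M" "Module.module R N" "f \<in> mod_homs R M N"
    "finite A" "g \<in> A \<rightarrow> carrier M"
  shows "f (\<Oplus>\<^bsub>M\<^esub>a\<in>A. g a) = (\<Oplus>\<^bsub>N\<^esub>a\<in>A. f (g a))"
proof -
  interpret M: module R M by fact
  interpret N: module R N by fact
  show ?thesis using assms(4,5)
  proof (induction A rule: finite_induct)
    case empty show ?case by (simp add: mod_homs_zero[OF assms(1-3)])
  next
    case (insert a A)
    have "f (\<Oplus>\<^bsub>M\<^esub>a\<in>insert a A. g a) = f (g a \<oplus>\<^bsub>M\<^esub> (\<Oplus>\<^bsub>M\<^esub>a\<in>A. g a))"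
      using insert by (subst M.finsum_insert) auto
    also have "\<dots> = f (g a) \<oplus>\<^bsub>N\<^esub> f (\<Oplus>\<^bsub>M\<^esub>a\<in>A. g a)"
      using insert by (intro mod_homs_add[OF assms(3)] M.finsum_closed) auto
    also have "\<dots> = (\<Oplus>\<^bsub>N\<^esub>a\<in>insert a A. f (g a))"
      using insert mod_homs_closed[OF assms(3)] by (subst N.finsum_insert) auto
    finally show ?case .
  qed
qed

lemma mod_homs_comp:
  "f \<in> mod_homs R M N \<Longrightarrow> g \<in> mod_homs R N N' \<Longrightarrow> (\<lambda>x. g (f x)) \<in> mod_homs R M N'"
  unfolding mod_homs_def by (auto simp: Pi_iff)

lemma (in abelian_group) minus_zero_eq [simp]: "\<ominus> \<zero> = \<zero>"
  by (rule minus_equality) auto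

lemma self_module_sel [simp]:
  "carrier (self_module R) = carrier R" "\<zero>\<^bsub>self_module R\<^esub> = \<zero>\<^bsub>R\<^esub>"
  "x \<oplus>\<^bsub>self_module R\<^esub> y = x \<oplus>\<^bsub>R\<^esub> y" "r \<odot>\<^bsub>self_module R\<^esub> x = r \<otimes>\<^bsub>R\<^esub> x"
  by (simp_all add: self_module_def)

lemma (in cring) self_module_module: "Module.module R (self_module R)"
proof (rule moduleI[OF cring_axioms])
  show "abelian_group (self_module R)"
  proof (rule abelian_groupI)
    fix x assume "x \<in> carrier (self_module R)"
    thus "\<exists>y\<in>carrier (self_module R). y \<oplus>\<^bsub>self_module R\<^esub> x = \<zero>\<^bsub>self_module R\<^esub>"
      by (intro bexI[of _ "\<ominus> x"]) (auto simp: l_neg)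
  qed (auto simp: a_ac)
qed (auto simp: l_distr r_distr m_assoc)

lemma hom_module_sel [simp]:
  "carrier (hom_module R M N) = mod_homs R M N \<inter> extensional (carrier M)"
  "\<zero>\<^bsub>hom_module R M N\<^esub> = (\<lambda>x\<in>carrier M. \<zero>\<^bsub>N\<^esub>)"
  "f \<oplus>\<^bsub>hom_module R M N\<^esub> g = (\<lambda>x\<in>carrier M. f x \<oplus>\<^bsub>N\<^esub> g x)"
  "r \<odot>\<^bsub>hom_module R M N\<^esub> f = (\<lambda>x\<in>carrier M. r \<odot>\<^bsub>N\<^esub> f x)"
  by (simp_all add: hom_module_def)

lemma hom_module_module:
  assumes "Module.module R M" "Module.module R N"
  shows "Module.module R (hom_module R M N)"
proof -
  interpret M: module R M by fact
  interpret N: module R N by fact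
  note c = mod_homs_closed mod_homs_add mod_homs_smult
  have add: "(\<lambda>x\<in>carrier M. f x \<oplus>\<^bsub>N\<^esub> g x) \<in> mod_homs R M N"
    if "f \<in> mod_homs R M N" "g \<in> mod_homs R M N" for f g
    by (rule mod_homsI) (use that in \<open>auto simp: c[OF that(1)] c[OF that(2)] N.a_ac N.smult_r_distr\<close>)
  have sm: "(\<lambda>x\<in>carrier M. r \<odot>\<^bsub>N\<^esub> f x) \<in> mod_homs R M N"
    if "f \<in> mod_homs R M N" "r \<in> carrier R" for f r
    by (rule mod_homsI)
      (use that in \<open>auto simp: c[OF that(1)] N.smult_r_distr N.smult_assoc1[symmetric] M.R.m_comm\<close>)
  have z: "(\<lambda>x\<in>carrier M. \<zero>\<^bsub>N\<^esub>) \<in> mod_homs R M N" by (rule mod_homsI) auto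
  have neg: "(\<lambda>x\<in>carrier M. \<ominus>\<^bsub>N\<^esub> f x) \<in> mod_homs R M N" if "f \<in> mod_homs R M N" for f
    by (rule mod_homsI) (use that in \<open>auto simp: c[OF that] N.smult_r_minus N.minus_add\<close>)
  have ab: "abelian_group (hom_module R M N)"
  proof (rule abelian_groupI)
    fix f assume f: "f \<in> carrier (hom_module R M N)"
    show "\<exists>g\<in>carrier (hom_module R M N). g \<oplus>\<^bsub>hom_module R M N\<^esub> f = \<zero>\<^bsub>hom_module R M N\<^esub>"
      by (rule bexI[of _ "\<lambda>x\<in>carrier M. \<ominus>\<^bsub>N\<^esub> f x"])
        (use f neg[of f] in \<open>auto simp: c(1) N.l_neg intro!: restrict_ext\<close>)
  qed (use add z in \<open>auto simp: c(1) N.a_ac intro!: extensionalityI[where A = "carrier M"]\<close>)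
  show ?thesis
    by (rule moduleI[OF M.R.cring_axioms ab])
      (use sm add in \<open>auto simp: c(1) N.smult_l_distr N.smult_r_distr N.smult_assoc1 intro!: extensionalityI[where A = "carrier M"]\<close>)
qed

section \<open>Submodules, cosets and quotient modules\<close>

context module begin

lemma sub_facts:
  assumes "submodule H R M"
  shows "H \<subseteq> carrier M" "\<zero>\<^bsub>M\<^esub> \<in> H" "x \<in> H \<Longrightarrow> y \<in> H \<Longrightarrow> x \<oplus>\<^bsub>M\<^esub> y \<in> H"
    "r \<in> carrier R \<Longrightarrow> x \<in> H \<Longrightarrow> r \<odot>\<^bsub>M\<^esub> x \<in> H" "x \<in> H \<Longrightarrow> \<ominus>\<^bsub>M\<^esub> x \<in> H"
    "x \<in> H \<Longrightarrow> y \<in> H \<Longrightarrow> x \<ominus>\<^bsub>M\<^esub> y \<in> H"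
proof -
  show "H \<subseteq> carrier M" "\<zero>\<^bsub>M\<^esub> \<in> H"
    using submoduleE[OF assms] submodule.axioms(1)[OF assms] subgroup.one_closed by fastforce+
  show 1: "x \<in> H \<Longrightarrow> y \<in> H \<Longrightarrow> x \<oplus>\<^bsub>M\<^esub> y \<in> H" "r \<in> carrier R \<Longrightarrow> x \<in> H \<Longrightarrow> r \<odot>\<^bsub>M\<^esub> x \<in> H"
    "x \<in> H \<Longrightarrow> \<ominus>\<^bsub>M\<^esub> x \<in> H" for r x y
    using submoduleE[OF assms] by auto
  show "x \<in> H \<Longrightarrow> y \<in> H \<Longrightarrow> x \<ominus>\<^bsub>M\<^esub> y \<in> H" using 1 by (simp add: a_minus_def)
qed

lemma sub_finsum:
  assumes "submodule H R M" "finite A" "f \<in> A \<rightarrow> H"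
  shows "(\<Oplus>\<^bsub>M\<^esub>a\<in>A. f a) \<in> H"
  using assms(2,3)
proof (induction A rule: finite_induct)
  case empty thus ?case using sub_facts[OF assms(1)] by simp
next
  case (insert a A)
  have "(\<Oplus>\<^bsub>M\<^esub>a\<in>insert a A. f a) = f a \<oplus>\<^bsub>M\<^esub> (\<Oplus>\<^bsub>M\<^esub>a\<in>A. f a)"
    using insert sub_facts(1)[OF assms(1)] by (subst M.finsum_insert) auto
  thus ?case using insert sub_facts(3)[OF assms(1)] by auto
qed

lemma zero_submodule: "submodule {\<zero>\<^bsub>M\<^esub>} R M"
  by (rule submoduleI) auto

lemma kernel_submodule:
  assumes "Module.module R N" "f \<in> mod_homs R M N"
  shows "submodule {x \<in> carrier M. f x = \<zero>\<^bsub>N\<^esub>} R M"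
proof -
  interpret N: module R N by fact
  show ?thesis
    by (rule submoduleI)
      (auto simp: mod_homs_zero[OF module_axioms assms] mod_homs_uminus[OF module_axioms assms]
        mod_homs_add[OF assms(2)] mod_homs_smult[OF assms(2)])
qed

lemma image_submodule:
  assumes "Module.module R N" "f \<in> mod_homs R N M"
  shows "submodule (f ` carrier N) R M"
proof -
  interpret N: module R N by fact
  show ?thesis
  proof (rule submoduleI)
    show "f ` carrier N \<subseteq> carrier M" using mod_homs_closed[OF assms(2)] by auto
    show "\<zero>\<^bsub>M\<^esub> \<in> f ` carrier N"
      using mod_homs_zero[OF assms(1) module_axioms assms(2)] N.zero_closed by (metis imageI)
    show "\<ominus>\<^bsub>M\<^esub> x \<in> f ` carrier N" if "x \<in> f ` carrier N" for x
      using that by (auto simp: mod_homs_uminus[OF assms(1) module_axioms assms(2), symmetric])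
    show "x \<oplus>\<^bsub>M\<^esub> y \<in> f ` carrier N" if "x \<in> f ` carrier N" "y \<in> f ` carrier N" for x y
      using that by (auto simp: mod_homs_add[OF assms(2), symmetric])
    show "r \<odot>\<^bsub>M\<^esub> x \<in> f ` carrier N" if "r \<in> carrier R" "x \<in> f ` carrier N" for r x
      using that by (auto simp: mod_homs_smult[OF assms(2), symmetric])
  qed
qed

lemma sub_abelian_subgroup:
  assumes "submodule H R M" shows "abelian_subgroup H M"
  by (rule abelian_subgroupI3)
    (use submodule.axioms(1)[OF assms] M.abelian_group_axioms in \<open>auto intro: additive_subgroupI\<close>)

lemma rcos_eq_iff:
  assumes "submodule H R M" "x \<in> carrier M" "y \<in> carrier M"
  shows "H +>\<^bsub>M\<^esub> x = H +>\<^bsub>M\<^esub> y \<longleftrightarrow> x \<ominus>\<^bsub>M\<^esub> y \<in> H"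
proof -
  interpret H: abelian_subgroup H M by (rule sub_abelian_subgroup[OF assms(1)])
  show ?thesis using assms(2,3)
    by (metis H.a_rcos_module H.a_repr_independence' H.a_repr_independenceD a_minus_def)
qed

lemma rcos_mem_iff:
  assumes "submodule H R M" "x \<in> carrier M"
  shows "y \<in> H +>\<^bsub>M\<^esub> x \<longleftrightarrow> y \<in> carrier M \<and> y \<ominus>\<^bsub>M\<^esub> x \<in> H"
proof -
  interpret H: abelian_subgroup H M by (rule sub_abelian_subgroup[OF assms(1)])
  show ?thesis
    by (metis H.a_elemrcos_carrier H.a_rcos_module a_minus_def assms(2))
qed

lemma quot_carrier: "carrier (quot_module M H) = (\<lambda>x. H +>\<^bsub>M\<^esub> x) ` carrier M"
  by (auto simp: quot_module_def A_RCOSETS_def')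

lemma quot_zero: "\<zero>\<^bsub>quot_module M H\<^esub> = H"
  by (simp add: quot_module_def)

lemma quot_add:
  assumes "submodule H R M" "x \<in> carrier M" "y \<in> carrier M"
  shows "(H +>\<^bsub>M\<^esub> x) \<oplus>\<^bsub>quot_module M H\<^esub> (H +>\<^bsub>M\<^esub> y) = H +>\<^bsub>M\<^esub> (x \<oplus>\<^bsub>M\<^esub> y)"
proof -
  interpret H: abelian_subgroup H M by (rule sub_abelian_subgroup[OF assms(1)])
  show ?thesis using H.a_rcos_sum assms by (simp add: quot_module_def)
qed

lemma smult_minus_distrib:
  "r \<in> carrier R \<Longrightarrow> x \<in> carrier M \<Longrightarrow> y \<in> carrier M \<Longrightarrow>
    r \<odot>\<^bsub>M\<^esub> (x \<ominus>\<^bsub>M\<^esub> y) = r \<odot>\<^bsub>M\<^esub> x \<ominus>\<^bsub>M\<^esub> r \<odot>\<^bsub>M\<^esub> y"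
  by (simp add: a_minus_def smult_r_distr smult_r_minus)

lemma quot_smult:
  assumes H: "submodule H R M" and r: "r \<in> carrier R" and x: "x \<in> carrier M"
  shows "r \<odot>\<^bsub>quot_module M H\<^esub> (H +>\<^bsub>M\<^esub> x) = H +>\<^bsub>M\<^esub> (r \<odot>\<^bsub>M\<^esub> x)"
proof -
  \<comment> \<open>The scalar action on cosets is a union over all representatives, so each of them
    has to contribute the same coset.\<close>
  have "H +>\<^bsub>M\<^esub> (r \<odot>\<^bsub>M\<^esub> y) = H +>\<^bsub>M\<^esub> (r \<odot>\<^bsub>M\<^esub> x)" if "y \<in> H +>\<^bsub>M\<^esub> x" for y
  proof -
    have y: "y \<in> carrier M" "y \<ominus>\<^bsub>M\<^esub> x \<in> H" using that rcos_mem_iff[OF H x] by auto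
    show ?thesis
      using sub_facts(4)[OF H r y(2)] r x y by (simp add: rcos_eq_iff[OF H] smult_minus_distrib)
  qed
  moreover have "x \<in> H +>\<^bsub>M\<^esub> x"
    using rcos_mem_iff[OF H x] x sub_facts(2)[OF H] by (simp add: M.minus_eq M.r_neg)
  ultimately have "(\<Union>y\<in>H +>\<^bsub>M\<^esub> x. H +>\<^bsub>M\<^esub> (r \<odot>\<^bsub>M\<^esub> y)) = H +>\<^bsub>M\<^esub> (r \<odot>\<^bsub>M\<^esub> x)"
    by (intro SUP_eq_const) blast+
  thus ?thesis by (simp only: quot_module_def module.simps)
qed

lemma quot_module_module:
  assumes H: "submodule H R M"
  shows "Module.module R (quot_module M H)"
proof -
  note q = quot_add[OF H] quot_smult[OF H] quot_zero
  have 0: "H +>\<^bsub>M\<^esub> \<zero>\<^bsub>M\<^esub> = H" using sub_facts(1)[OF H] by simp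
  have ab: "abelian_group (quot_module M H)"
  proof (rule abelian_groupI)
    fix x assume "x \<in> carrier (quot_module M H)"
    then obtain y where y: "y \<in> carrier M" "x = H +>\<^bsub>M\<^esub> y" by (auto simp: quot_carrier)
    show "\<exists>y\<in>carrier (quot_module M H). y \<oplus>\<^bsub>quot_module M H\<^esub> x = \<zero>\<^bsub>quot_module M H\<^esub>"
      by (rule bexI[of _ "H +>\<^bsub>M\<^esub> (\<ominus>\<^bsub>M\<^esub> y)"])
        (use y 0 in \<open>simp_all add: q quot_carrier M.l_neg\<close>)
  next
    show "\<zero>\<^bsub>quot_module M H\<^esub> \<in> carrier (quot_module M H)"
      using imageI[OF M.zero_closed, of "\<lambda>x. H +>\<^bsub>M\<^esub> x"] unfolding quot_carrier quot_zero 0 .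
  next
    fix x assume "x \<in> carrier (quot_module M H)"
    then obtain y where y: "y \<in> carrier M" "x = H +>\<^bsub>M\<^esub> y" by (auto simp: quot_carrier)
    show "\<zero>\<^bsub>quot_module M H\<^esub> \<oplus>\<^bsub>quot_module M H\<^esub> x = x"
      using quot_add[OF H M.zero_closed y(1)] y(1) unfolding y(2) quot_zero 0 by simp
  qed (auto simp: q quot_carrier M.a_ac)
  show ?thesis
    by (rule moduleI[OF R.cring_axioms ab])
      (auto simp: q quot_carrier smult_l_distr smult_r_distr smult_assoc1)
qed

lemma quot_proj_hom:
  assumes "submodule H R M"
  shows "(\<lambda>x. H +>\<^bsub>M\<^esub> x) \<in> mod_homs R M (quot_module M H)"
  by (rule mod_homsI) (auto simp: quot_carrier quot_add[OF assms] quot_smult[OF assms])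

lemma rcos_zero_iff:
  assumes "submodule H R M" "x \<in> carrier M"
  shows "H +>\<^bsub>M\<^esub> x = H \<longleftrightarrow> x \<in> H"
proof -
  have "H = H +>\<^bsub>M\<^esub> \<zero>\<^bsub>M\<^esub>" using sub_facts(1)[OF assms(1)] by simp
  thus ?thesis using rcos_eq_iff[OF assms(1,2) M.zero_closed] assms(2)
    by (simp add: a_minus_def minus_zero_eq)
qed

end

text \<open>A zigzag determines its end only up to boundaries, and choosing one end for each start
  would lose linearity. The isomorphism is therefore extracted from a relation: an additive relation
  that is total on both sides carries cosets to cosets as soon as it matches \<open>H\<close> with
  \<open>J\<close>. Applied to differences, \<open>iff\<close> gives well-definedness and
  injectivity at once, and \<open>right\<close> gives surjectivity.\<close>

lemma quot_iso_of_relation: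
  fixes A :: "('r, 'x) module" and B :: "('r, 'y) module"
  assumes A: "Module.module R A" and B: "Module.module R B"
    and H: "submodule H R A" and J: "submodule J R B"
    and S: "\<And>x y. S x y \<Longrightarrow> x \<in> carrier A \<and> y \<in> carrier B"
    and left: "\<And>x. x \<in> carrier A \<Longrightarrow> \<exists>y. S x y"
    and right: "\<And>y. y \<in> carrier B \<Longrightarrow> \<exists>x. S x y"
    and add: "\<And>x y x' y'. S x y \<Longrightarrow> S x' y' \<Longrightarrow> S (x \<oplus>\<^bsub>A\<^esub> x') (y \<oplus>\<^bsub>B\<^esub> y')"
    and smult: "\<And>r x y. r \<in> carrier R \<Longrightarrow> S x y \<Longrightarrow> S (r \<odot>\<^bsub>A\<^esub> x) (r \<odot>\<^bsub>B\<^esub> y)"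
    and iff: "\<And>x y. S x y \<Longrightarrow> x \<in> H \<longleftrightarrow> y \<in> J"
  shows "mod_isomorphic R (quot_module A H) (quot_module B J)"
proof -
  interpret A: module R A by fact
  interpret B: module R B by fact
  define f where "f U = {y. \<exists>x\<in>U. S x y}" for U
  have minus: "S (x \<ominus>\<^bsub>A\<^esub> x') (y \<ominus>\<^bsub>B\<^esub> y')" if "S x y" "S x' y'" for x y x' y'
  proof -
    have "S (x \<oplus>\<^bsub>A\<^esub> (\<ominus>\<^bsub>R\<^esub> \<one>\<^bsub>R\<^esub>) \<odot>\<^bsub>A\<^esub> x') (y \<oplus>\<^bsub>B\<^esub> (\<ominus>\<^bsub>R\<^esub> \<one>\<^bsub>R\<^esub>) \<odot>\<^bsub>B\<^esub> y')"
      using add smult that by simp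
    thus ?thesis using S[OF that(1)] S[OF that(2)]
      by (simp add: a_minus_def A.smult_l_minus B.smult_l_minus)
  qed
  have f: "f (H +>\<^bsub>A\<^esub> x) = J +>\<^bsub>B\<^esub> y" if "S x y" for x y
  proof (intro equalityI subsetI)
    have xy: "x \<in> carrier A" "y \<in> carrier B" using S[OF that] by auto
    fix y' assume "y' \<in> f (H +>\<^bsub>A\<^esub> x)"
    then obtain x' where x': "S x' y'" "x' \<ominus>\<^bsub>A\<^esub> x \<in> H"
      using A.rcos_mem_iff[OF H xy(1)] by (auto simp: f_def)
    thus "y' \<in> J +>\<^bsub>B\<^esub> y"
      using iff[OF minus[OF x'(1) that]] S[OF x'(1)] B.rcos_mem_iff[OF J xy(2)] by simp
  next
    have xy: "x \<in> carrier A" "y \<in> carrier B" using S[OF that] by auto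
    fix y' assume "y' \<in> J +>\<^bsub>B\<^esub> y"
    hence y': "y' \<in> carrier B" "y' \<ominus>\<^bsub>B\<^esub> y \<in> J" using B.rcos_mem_iff[OF J xy(2)] by auto
    obtain x' where x': "S x' y'" using right y'(1) by blast
    hence "x' \<ominus>\<^bsub>A\<^esub> x \<in> H" using iff[OF minus[OF x' that]] y' by simp
    thus "y' \<in> f (H +>\<^bsub>A\<^esub> x)"
      using x' S[OF x'] A.rcos_mem_iff[OF H xy(1)] unfolding f_def by blast
  qed
  have "f \<in> mod_homs R (quot_module A H) (quot_module B J)"
  proof (rule mod_homsI)
    fix U assume "U \<in> carrier (quot_module A H)"
    then obtain x where x: "x \<in> carrier A" "U = H +>\<^bsub>A\<^esub> x" by (auto simp: A.quot_carrier)
    obtain y where y: "S x y" using left x by blast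
    show "f U \<in> carrier (quot_module B J)" using f[OF y] x S[OF y] by (simp add: B.quot_carrier)
    { fix r assume r: "r \<in> carrier R"
      show "f (r \<odot>\<^bsub>quot_module A H\<^esub> U) = r \<odot>\<^bsub>quot_module B J\<^esub> f U"
        using f[OF y] f[OF smult[OF r y]] x S[OF y] r
        by (simp add: A.quot_smult[OF H] B.quot_smult[OF J]) }
    fix V assume "V \<in> carrier (quot_module A H)"
    then obtain x' where x': "x' \<in> carrier A" "V = H +>\<^bsub>A\<^esub> x'" by (auto simp: A.quot_carrier)
    obtain y' where y': "S x' y'" using left x' by blast
    show "f (U \<oplus>\<^bsub>quot_module A H\<^esub> V) = f U \<oplus>\<^bsub>quot_module B J\<^esub> f V"
      using f[OF y] f[OF y'] f[OF add[OF y y']] x x' S[OF y] S[OF y']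
      by (simp add: A.quot_add[OF H] B.quot_add[OF J])
  qed
  moreover have "bij_betw f (carrier (quot_module A H)) (carrier (quot_module B J))"
    unfolding bij_betw_def
  proof
    show "inj_on f (carrier (quot_module A H))"
    proof (rule inj_onI)
      fix U V assume "U \<in> carrier (quot_module A H)" "V \<in> carrier (quot_module A H)" and eq: "f U = f V"
      then obtain x x' where x: "x \<in> carrier A" "U = H +>\<^bsub>A\<^esub> x" and x': "x' \<in> carrier A" "V = H +>\<^bsub>A\<^esub> x'"
        by (auto simp: A.quot_carrier)
      obtain y y' where y: "S x y" and y': "S x' y'" using left x x' by meson
      have "y \<ominus>\<^bsub>B\<^esub> y' \<in> J"
        using eq f[OF y] f[OF y'] x x' B.rcos_eq_iff[OF J] S[OF y] S[OF y'] by metis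
      thus "U = V" using iff[OF minus[OF y y']] x x' by (simp add: A.rcos_eq_iff[OF H])
    qed
    show "f ` carrier (quot_module A H) = carrier (quot_module B J)"
    proof
      show "f ` carrier (quot_module A H) \<subseteq> carrier (quot_module B J)"
        using calculation mod_homs_closed by fast
      show "carrier (quot_module B J) \<subseteq> f ` carrier (quot_module A H)"
      proof
        fix V assume "V \<in> carrier (quot_module B J)"
        then obtain y where y: "y \<in> carrier B" "V = J +>\<^bsub>B\<^esub> y" by (auto simp: B.quot_carrier)
        obtain x where "S x y" using right y by blast
        thus "V \<in> f ` carrier (quot_module A H)"
          using f y(2) S by (auto simp: A.quot_carrier intro!: image_eqI[of _ f])
      qed
    qed
  qed
  ultimately show ?thesis unfolding mod_isomorphic_def by blast
qed

declare One_nat_def [simp del]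

section \<open>Koszul complexes\<close>

text \<open>The Koszul differential of the sequence \<open>v\<close>, written for one target set
  \<open>I\<close>. The exponent of the sign is the position of \<open>i\<close> in
  \<open>I\<close>, as in the Cech differential; this lets the two be identified once denominators
  are fixed.\<close>

definition kos ::
  "('r, 'c) ring_scheme \<Rightarrow> ('r, 'm, 'd) module_scheme \<Rightarrow> (nat \<Rightarrow> 'r) \<Rightarrow> (nat set \<Rightarrow> 'm)
    \<Rightarrow> nat set \<Rightarrow> 'm" where
  "kos R M v c I = (\<Oplus>\<^bsub>M\<^esub>i\<in>I. ((\<ominus>\<^bsub>R\<^esub> \<one>\<^bsub>R\<^esub>) [^]\<^bsub>R\<^esub> card {i' \<in> I. i' < i}) \<odot>\<^bsub>M\<^esub> (v i \<odot>\<^bsub>M\<^esub> c (I - {i})))"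

text \<open>Cochains are not graded: the part of degree \<open>p\<close> consists of the values at the sets with \<open>p\<close>
  elements.\<close>

definition cochains :: "nat \<Rightarrow> 'm set \<Rightarrow> (nat set \<Rightarrow> 'm) set" where
  "cochains s A = {c. \<forall>I\<subseteq>{1..s}. c I \<in> A}"

lemma cochainsD: "c \<in> cochains s A \<Longrightarrow> I \<subseteq> {1..s} \<Longrightarrow> c I \<in> A"
  by (auto simp: cochains_def)

lemma cochainsI: "(\<And>I. I \<subseteq> {1..s} \<Longrightarrow> c I \<in> A) \<Longrightarrow> c \<in> cochains s A"
  by (auto simp: cochains_def)

lemma cochains_Diff: "c \<in> cochains s A \<Longrightarrow> I \<subseteq> {1..s} \<Longrightarrow> c (I - {i}) \<in> A"
  by (rule cochainsD) auto

lemma cochains_Suc: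
  assumes "b \<in> cochains s A" "b' \<in> cochains s A"
  shows "(\<lambda>J. if Suc s \<in> J then b (J - {Suc s}) else b' J) \<in> cochains (Suc s) A"
proof (rule cochainsI)
  fix I assume I: "I \<subseteq> {1..Suc s}"
  have "I - {Suc s} \<subseteq> {1..s}" using I by (force simp: subset_iff)
  thus "(if Suc s \<in> I then b (I - {Suc s}) else b' I) \<in> A"
    using assms by (auto simp: cochains_def)
qed

lemma (in ring) sign_closed [simp]: "(\<ominus> \<one>) [^] (k::nat) \<in> carrier R"
  by simp

lemma (in ring) sign_square: "((\<ominus> \<one>) [^] (k::nat)) \<otimes> ((\<ominus> \<one>) [^] k) = \<one>"
proof (induction k)
  case (Suc k)
  have "((\<ominus> \<one>) [^] Suc k) \<otimes> ((\<ominus> \<one>) [^] Suc k) = ((\<ominus> \<one>) [^] k) \<otimes> ((\<ominus> \<one>) [^] k)"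
    by (simp add: l_minus r_minus)
  thus ?case using Suc by simp
qed simp

context module begin

lemma smult_lcomm:
  "r \<in> carrier R \<Longrightarrow> s \<in> carrier R \<Longrightarrow> x \<in> carrier M \<Longrightarrow> r \<odot>\<^bsub>M\<^esub> (s \<odot>\<^bsub>M\<^esub> x) = s \<odot>\<^bsub>M\<^esub> (r \<odot>\<^bsub>M\<^esub> x)"
  by (metis R.m_comm smult_assoc1)

lemma sign_smult_twice:
  "x \<in> carrier M \<Longrightarrow> ((\<ominus> \<one>) [^] (k::nat)) \<odot>\<^bsub>M\<^esub> (((\<ominus> \<one>) [^] k) \<odot>\<^bsub>M\<^esub> x) = x"
  by (simp add: smult_assoc1[symmetric] R.sign_square)

lemma sign_smult_Suc:
  "x \<in> carrier M \<Longrightarrow> ((\<ominus> \<one>) [^] Suc k) \<odot>\<^bsub>M\<^esub> x = \<ominus>\<^bsub>M\<^esub> (((\<ominus> \<one>) [^] (k::nat)) \<odot>\<^bsub>M\<^esub> x)"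
  by (simp add: R.r_minus smult_l_minus)

lemma kos_closed:
  "v \<in> I \<rightarrow> carrier R \<Longrightarrow> (\<And>i. i \<in> I \<Longrightarrow> c (I - {i}) \<in> carrier M) \<Longrightarrow> kos R M v c I \<in> carrier M"
  unfolding kos_def by (rule M.finsum_closed) auto

lemma kos_cong:
  assumes "v \<in> I \<rightarrow> carrier R" "\<And>i. i \<in> I \<Longrightarrow> c (I - {i}) \<in> carrier M"
    "\<And>i. i \<in> I \<Longrightarrow> c (I - {i}) = c' (I - {i})"
  shows "kos R M v c I = kos R M v c' I"
  unfolding kos_def by (rule M.finsum_cong') (use assms in auto)

lemma kos_empty [simp]: "kos R M v c {} = \<zero>\<^bsub>M\<^esub>"
  by (simp add: kos_def)

lemma kos_sub:
  assumes "submodule H R M" "finite I" "v \<in> I \<rightarrow> carrier R" "\<And>i. i \<in> I \<Longrightarrow> c (I - {i}) \<in> H"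
  shows "kos R M v c I \<in> H"
  unfolding kos_def
  by (rule sub_finsum[OF assms(1,2)]) (use assms sub_facts(4)[OF assms(1)] in \<open>auto simp: Pi_iff\<close>)

lemma kos_add:
  assumes "finite I" "v \<in> I \<rightarrow> carrier R" "\<And>i. i \<in> I \<Longrightarrow> c (I - {i}) \<in> carrier M"
    "\<And>i. i \<in> I \<Longrightarrow> c' (I - {i}) \<in> carrier M"
  shows "kos R M v (\<lambda>J. c J \<oplus>\<^bsub>M\<^esub> c' J) I = kos R M v c I \<oplus>\<^bsub>M\<^esub> kos R M v c' I"
proof -
  have "kos R M v (\<lambda>J. c J \<oplus>\<^bsub>M\<^esub> c' J) I = (\<Oplus>\<^bsub>M\<^esub>i\<in>I.
      ((\<ominus> \<one>) [^] card {i' \<in> I. i' < i}) \<odot>\<^bsub>M\<^esub> (v i \<odot>\<^bsub>M\<^esub> c (I - {i})) \<oplus>\<^bsub>M\<^esub>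
      ((\<ominus> \<one>) [^] card {i' \<in> I. i' < i}) \<odot>\<^bsub>M\<^esub> (v i \<odot>\<^bsub>M\<^esub> c' (I - {i})))"
    unfolding kos_def
    by (rule M.finsum_cong') (use assms in \<open>auto simp: smult_r_distr Pi_iff\<close>)
  also have "\<dots> = kos R M v c I \<oplus>\<^bsub>M\<^esub> kos R M v c' I"
    unfolding kos_def by (rule M.finsum_addf) (use assms in \<open>auto simp: Pi_iff\<close>)
  finally show ?thesis .
qed

lemma kos_smult:
  assumes "finite I" "v \<in> I \<rightarrow> carrier R" "\<And>i. i \<in> I \<Longrightarrow> c (I - {i}) \<in> carrier M" "r \<in> carrier R"
  shows "kos R M v (\<lambda>J. r \<odot>\<^bsub>M\<^esub> c J) I = r \<odot>\<^bsub>M\<^esub> kos R M v c I"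
proof -
  have "r \<odot>\<^bsub>M\<^esub> kos R M v c I =
      (\<Oplus>\<^bsub>M\<^esub>i\<in>I. r \<odot>\<^bsub>M\<^esub> (((\<ominus> \<one>) [^] card {i' \<in> I. i' < i}) \<odot>\<^bsub>M\<^esub> (v i \<odot>\<^bsub>M\<^esub> c (I - {i}))))"
    unfolding kos_def by (rule finsum_smult_ldistr) (use assms in \<open>auto simp: Pi_iff\<close>)
  also have "\<dots> = kos R M v (\<lambda>J. r \<odot>\<^bsub>M\<^esub> c J) I"
    unfolding kos_def
    by (rule M.finsum_cong') (use assms in \<open>auto simp: Pi_iff smult_lcomm[of r]\<close>)
  finally show ?thesis by simp
qed

lemma kos_minus:
  assumes "finite I" "v \<in> I \<rightarrow> carrier R" "\<And>i. i \<in> I \<Longrightarrow> c (I - {i}) \<in> carrier M"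
    "\<And>i. i \<in> I \<Longrightarrow> c' (I - {i}) \<in> carrier M"
  shows "kos R M v (\<lambda>J. c J \<ominus>\<^bsub>M\<^esub> c' J) I = kos R M v c I \<ominus>\<^bsub>M\<^esub> kos R M v c' I"
proof -
  have "kos R M v (\<lambda>J. c J \<ominus>\<^bsub>M\<^esub> c' J) I = kos R M v (\<lambda>J. c J \<oplus>\<^bsub>M\<^esub> (\<ominus> \<one>) \<odot>\<^bsub>M\<^esub> c' J) I"
    by (rule kos_cong) (use assms in \<open>auto simp: a_minus_def smult_l_minus\<close>)
  also have "\<dots> = kos R M v c I \<oplus>\<^bsub>M\<^esub> (\<ominus> \<one>) \<odot>\<^bsub>M\<^esub> kos R M v c' I"
    using assms by (subst kos_add) (auto simp: kos_smult)
  finally show ?thesis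
    using kos_closed[of v I c'] assms by (simp add: a_minus_def smult_l_minus)
qed

lemma kos_zero:
  assumes "v \<in> I \<rightarrow> carrier R" "\<And>i. i \<in> I \<Longrightarrow> c (I - {i}) = \<zero>\<^bsub>M\<^esub>"
  shows "kos R M v c I = \<zero>\<^bsub>M\<^esub>"
  unfolding kos_def by (rule M.add.finprod_one_eqI) (use assms in \<open>auto simp: Pi_iff\<close>)

lemma kos_hom:
  assumes "Module.module R N" "f \<in> mod_homs R M N" "finite I" "v \<in> I \<rightarrow> carrier R"
    "\<And>i. i \<in> I \<Longrightarrow> c (I - {i}) \<in> carrier M"
  shows "f (kos R M v c I) = kos R N v (\<lambda>J. f (c J)) I"
proof -
  interpret N: module R N by fact
  have "f (kos R M v c I) =
      (\<Oplus>\<^bsub>N\<^esub>i\<in>I. f (((\<ominus> \<one>) [^] card {i' \<in> I. i' < i}) \<odot>\<^bsub>M\<^esub> (v i \<odot>\<^bsub>M\<^esub> c (I - {i}))))"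
    unfolding kos_def by (rule mod_homs_finsum[OF module_axioms assms(1,2,3)]) (use assms in auto)
  also have "\<dots> = kos R N v (\<lambda>J. f (c J)) I"
    unfolding kos_def
    by (rule N.finsum_cong') (use assms mod_homs_closed[OF assms(2)] in
      \<open>auto simp: Pi_iff mod_homs_smult[OF assms(2)]\<close>)
  finally show ?thesis .
qed

text \<open>The largest index is counted in no other sign, so the terms of \<open>J\<close> keep
  their signs and the new term has sign exponent \<open>card J\<close>. Up to signs this presents
  the Koszul complex of one more element as the cone of multiplication by that element on the
  previous complex, which is what the inductions below rest on.\<close>

lemma kos_insert_max:
  assumes J: "finite J" "\<And>j. j \<in> J \<Longrightarrow> j < m" and v: "v \<in> insert m J \<rightarrow> carrier R"
    and c: "\<And>i. i \<in> J \<Longrightarrow> c (insert m (J - {i})) \<in> carrier M" "c J \<in> carrier M"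
  shows "kos R M v c (insert m J) = kos R M v (\<lambda>J'. c (insert m J')) J \<oplus>\<^bsub>M\<^esub>
    ((\<ominus> \<one>) [^] card J) \<odot>\<^bsub>M\<^esub> (v m \<odot>\<^bsub>M\<^esub> c J)"
proof -
  let ?g = "\<lambda>i. ((\<ominus> \<one>) [^] card {i' \<in> insert m J. i' < i}) \<odot>\<^bsub>M\<^esub> (v i \<odot>\<^bsub>M\<^esub> c (insert m J - {i}))"
  have mJ: "m \<notin> J" using J(2) by blast
  have e: "insert m J - {i} = insert m (J - {i})" if "i \<in> J" for i using that mJ by auto
  have e': "insert m J - {m} = J" using mJ by auto
  have g: "?g \<in> J \<rightarrow> carrier M" "?g m \<in> carrier M"
    using v c by (auto simp: e e' Pi_iff)
  have "kos R M v c (insert m J) = ?g m \<oplus>\<^bsub>M\<^esub> (\<Oplus>\<^bsub>M\<^esub>i\<in>J. ?g i)"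
    unfolding kos_def by (rule M.finsum_insert[OF J(1) mJ g])
  moreover have "{i' \<in> insert m J. i' < m} = J" using J(2) by auto
  moreover have "(\<Oplus>\<^bsub>M\<^esub>i\<in>J. ?g i) = kos R M v (\<lambda>J'. c (insert m J')) J"
    unfolding kos_def
  proof (rule M.finsum_cong')
    show "(\<lambda>i. ((\<ominus> \<one>) [^] card {i' \<in> J. i' < i}) \<odot>\<^bsub>M\<^esub> (v i \<odot>\<^bsub>M\<^esub> c (insert m (J - {i})))) \<in> J \<rightarrow> carrier M"
      using v c by auto
    fix i assume i: "i \<in> J"
    have "{i' \<in> insert m J. i' < i} = {i' \<in> J. i' < i}" using J(2)[OF i] by auto
    thus "?g i = ((\<ominus> \<one>) [^] card {i' \<in> J. i' < i}) \<odot>\<^bsub>M\<^esub> (v i \<odot>\<^bsub>M\<^esub> c (insert m (J - {i})))"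
      by (simp add: e[OF i])
  qed simp
  moreover have "kos R M v (\<lambda>J'. c (insert m J')) J \<in> carrier M"
    using v c by (intro kos_closed) auto
  ultimately show ?thesis using g(2) by (simp add: e' M.a_comm)
qed

lemma kos_cochain_closed:
  "c \<in> cochains s (carrier M) \<Longrightarrow> v \<in> {1..s} \<rightarrow> carrier R \<Longrightarrow> I \<subseteq> {1..s} \<Longrightarrow> kos R M v c I \<in> carrier M"
  by (rule kos_closed) (auto simp: Pi_iff intro: cochains_Diff)

lemma kos_insert_cochain:
  assumes b: "b \<in> cochains (Suc s) (carrier M)" and v: "v \<in> {1..Suc s} \<rightarrow> carrier R" and J: "J \<subseteq> {1..s}"
  shows "kos R M v b (insert (Suc s) J) = kos R M v (\<lambda>J. b (insert (Suc s) J)) J \<oplus>\<^bsub>M\<^esub>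
    ((\<ominus> \<one>) [^] card J) \<odot>\<^bsub>M\<^esub> (v (Suc s) \<odot>\<^bsub>M\<^esub> b J)"
proof (rule kos_insert_max)
  show "finite J" using finite_subset[OF J] by simp
  show "j < Suc s" if "j \<in> J" for j using J that by auto
  show "v \<in> insert (Suc s) J \<rightarrow> carrier R" using v J by (auto simp: Pi_iff subset_iff)
  show "b J \<in> carrier M" by (rule cochainsD[OF b]) (use J in auto)
  show "b (insert (Suc s) (J - {i})) \<in> carrier M" for i by (rule cochainsD[OF b]) (use J in auto)
qed

text \<open>Peeling off the largest index leaves the square of the smaller differential, zero by
  induction, and two copies of one mixed term. Their signs have the consecutive exponents
  \<open>card J - 1\<close> and \<open>card J\<close>, so they cancel; for empty \<open>J\<close>
  the mixed term is itself zero.\<close>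

lemma kos_kos:
  assumes "finite I" "v \<in> I \<rightarrow> carrier R" "\<And>J. J \<subseteq> I \<Longrightarrow> c J \<in> carrier M"
  shows "kos R M v (kos R M v c) I = \<zero>\<^bsub>M\<^esub>"
  using assms
proof (induction I arbitrary: c rule: finite_linorder_max_induct)
  case empty show ?case by simp
next
  case (insert m J)
  let ?k = "kos R M v" and ?c = "\<lambda>J'. c (insert m J')"
  have v: "v m \<in> carrier R" "v \<in> J \<rightarrow> carrier R" using insert.prems by auto
  have cl: "?k c' J' \<in> carrier M" if "J' \<subseteq> insert m J" "\<And>J'. J' \<subseteq> insert m J \<Longrightarrow> c' J' \<in> carrier M"
    for c' J'
  proof (rule kos_closed)
    show "v \<in> J' \<rightarrow> carrier R" using that(1) insert.prems(1) by (auto simp: Pi_iff)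
    show "c' (J' - {i}) \<in> carrier M" if "i \<in> J'" for i
      by (rule \<open>\<And>J'. J' \<subseteq> insert m J \<Longrightarrow> c' J' \<in> carrier M\<close>) (use \<open>J' \<subseteq> insert m J\<close> in blast)
  qed
  have c: "c J' \<in> carrier M" "c (insert m J') \<in> carrier M" if "J' \<subseteq> J" for J'
    by (rule insert.prems(2), use that in blast)+
  have fin: "finite J'" if "J' \<subseteq> J" for J' using that insert.hyps(1) finite_subset by blast
  have kc: "?k c J' \<in> carrier M" "?k ?c J' \<in> carrier M" if "J' \<subseteq> J" for J'
    by (rule cl; use that insert.prems(2) in auto)+
  have step: "?k c (insert m J') = ?k ?c J' \<oplus>\<^bsub>M\<^esub> ((\<ominus> \<one>) [^] card J') \<odot>\<^bsub>M\<^esub> (v m \<odot>\<^bsub>M\<^esub> c J')"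
    if "J' \<subseteq> J" for J'
  proof (rule kos_insert_max)
    show "finite J'" by (rule fin[OF that])
    show "j < m" if "j \<in> J'" for j using that \<open>J' \<subseteq> J\<close> insert.hyps(2) by blast
    show "v \<in> insert m J' \<rightarrow> carrier R" using insert.prems(1) that by auto
    show "c J' \<in> carrier M" by (rule c(1)[OF that])
    show "c (insert m (J' - {i})) \<in> carrier M" for i by (rule c(2)) (use that in blast)
  qed
  have "?k (?k c) (insert m J) =
      ?k (\<lambda>J'. ?k c (insert m J')) J \<oplus>\<^bsub>M\<^esub> ((\<ominus> \<one>) [^] card J) \<odot>\<^bsub>M\<^esub> (v m \<odot>\<^bsub>M\<^esub> ?k c J)"
    by (rule kos_insert_max) (use insert.hyps insert.prems in \<open>auto intro!: cl\<close>)
  \<comment> \<open>Inside this sum the decomposition is applied to the sets \<open>J - {i}\<close>,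
    all of which have \<open>card J - 1\<close> elements; hence a sign that does not depend on the
    set.\<close>
  also have "?k (\<lambda>J'. ?k c (insert m J')) J =
      ?k (\<lambda>J'. ?k ?c J' \<oplus>\<^bsub>M\<^esub> ((\<ominus> \<one>) [^] (card J - 1)) \<odot>\<^bsub>M\<^esub> (v m \<odot>\<^bsub>M\<^esub> c J')) J"
  proof (rule kos_cong[OF v(2)])
    fix i assume i: "i \<in> J"
    show "?k c (insert m (J - {i})) \<in> carrier M"
      by (rule cl) (use i insert.prems(2) in auto)
    show "?k c (insert m (J - {i})) = ?k ?c (J - {i}) \<oplus>\<^bsub>M\<^esub>
        ((\<ominus> \<one>) [^] (card J - 1)) \<odot>\<^bsub>M\<^esub> (v m \<odot>\<^bsub>M\<^esub> c (J - {i}))"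
      using step[of "J - {i}"] i by (simp add: card_Diff_singleton Diff_subset)
  qed
  also have "\<dots> = ?k (?k ?c) J \<oplus>\<^bsub>M\<^esub> ((\<ominus> \<one>) [^] (card J - 1)) \<odot>\<^bsub>M\<^esub> (v m \<odot>\<^bsub>M\<^esub> ?k c J)"
  proof -
    let ?s = "(\<ominus> \<one>) [^] (card J - 1)"
    have cJ: "c (J - {i}) \<in> carrier M" "?k ?c (J - {i}) \<in> carrier M" if "i \<in> J" for i
      by (auto intro!: c kc)
    have "?k (\<lambda>J'. ?k ?c J' \<oplus>\<^bsub>M\<^esub> ?s \<odot>\<^bsub>M\<^esub> (v m \<odot>\<^bsub>M\<^esub> c J')) J =
        ?k (?k ?c) J \<oplus>\<^bsub>M\<^esub> ?k (\<lambda>J'. ?s \<odot>\<^bsub>M\<^esub> (v m \<odot>\<^bsub>M\<^esub> c J')) J"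
      by (rule kos_add[OF insert.hyps(1) v(2)]) (use cJ v(1) in simp_all)
    also have "?k (\<lambda>J'. ?s \<odot>\<^bsub>M\<^esub> (v m \<odot>\<^bsub>M\<^esub> c J')) J = ?s \<odot>\<^bsub>M\<^esub> ?k (\<lambda>J'. v m \<odot>\<^bsub>M\<^esub> c J') J"
      by (rule kos_smult[OF insert.hyps(1) v(2)]) (use cJ(1) v(1) in simp_all)
    also have "?k (\<lambda>J'. v m \<odot>\<^bsub>M\<^esub> c J') J = v m \<odot>\<^bsub>M\<^esub> ?k c J"
      by (rule kos_smult[OF insert.hyps(1) v(2)]) (use cJ(1) v(1) in simp_all)
    finally show ?thesis .
  qed
  also have "?k (?k ?c) J = \<zero>\<^bsub>M\<^esub>" by (rule insert.IH[OF v(2)]) (rule c(2))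
  also have "(\<zero>\<^bsub>M\<^esub> \<oplus>\<^bsub>M\<^esub> ((\<ominus> \<one>) [^] (card J - 1)) \<odot>\<^bsub>M\<^esub> (v m \<odot>\<^bsub>M\<^esub> ?k c J)) \<oplus>\<^bsub>M\<^esub>
      ((\<ominus> \<one>) [^] card J) \<odot>\<^bsub>M\<^esub> (v m \<odot>\<^bsub>M\<^esub> ?k c J) = \<zero>\<^bsub>M\<^esub>"
  proof (cases "J = {}")
    case True thus ?thesis using v by simp
  next
    case False
    then obtain k where k: "card J = Suc k" using insert.hyps(1) by (metis card_0_eq not0_implies_Suc)
    show ?thesis using v kc[of J] sign_smult_Suc[of "v m \<odot>\<^bsub>M\<^esub> ?k c J" k]
      by (simp add: k M.r_neg del: R.nat_pow_Suc)
  qed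
  finally show ?case .
qed

text \<open>Since the product over \<open>I\<close> is \<open>t i\<close> times the product over
  \<open>I - {i}\<close>, multiplying each entry by the \<open>j\<close>-th power of its own product
  is a map from the Koszul complex of the \<open>k\<close>-th powers to that of the
  \<open>(k + j)\<close>-th powers. These are the transition maps whose colimit is the Cech
  complex.\<close>

lemma kos_rescale:
  assumes I: "finite I" and t: "t \<in> I \<rightarrow> carrier R" and c: "\<And>i. i \<in> I \<Longrightarrow> c (I - {i}) \<in> carrier M"
  shows "kos R M (\<lambda>i. t i [^] (k + j)) (\<lambda>J. (\<Otimes>i\<in>J. t i) [^] j \<odot>\<^bsub>M\<^esub> c J) I =
    (\<Otimes>i\<in>I. t i) [^] (j::nat) \<odot>\<^bsub>M\<^esub> kos R M (\<lambda>i. t i [^] (k::nat)) c I"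
proof -
  have p: "(\<Otimes>i\<in>J. t i) \<in> carrier R" if "J \<subseteq> I" for J
    using t that by (intro R.finprod_closed) auto
  have "(\<Otimes>i\<in>I. t i) [^] j \<odot>\<^bsub>M\<^esub> kos R M (\<lambda>i. t i [^] k) c I =
     (\<Oplus>\<^bsub>M\<^esub>i\<in>I. (\<Otimes>i\<in>I. t i) [^] j \<odot>\<^bsub>M\<^esub> (((\<ominus> \<one>) [^] card {i' \<in> I. i' < i}) \<odot>\<^bsub>M\<^esub> (t i [^] k \<odot>\<^bsub>M\<^esub> c (I - {i}))))"
    unfolding kos_def by (rule finsum_smult_ldistr) (use I p t c in \<open>auto simp: Pi_iff\<close>)
  also have "\<dots> = kos R M (\<lambda>i. t i [^] (k + j)) (\<lambda>J. (\<Otimes>i\<in>J. t i) [^] j \<odot>\<^bsub>M\<^esub> c J) I"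
    unfolding kos_def
  proof (rule M.finsum_cong')
    show "(\<lambda>i. ((\<ominus> \<one>) [^] card {i' \<in> I. i' < i}) \<odot>\<^bsub>M\<^esub> (t i [^] (k + j) \<odot>\<^bsub>M\<^esub>
        ((\<Otimes>i\<in>I - {i}. t i) [^] j \<odot>\<^bsub>M\<^esub> c (I - {i})))) \<in> I \<rightarrow> carrier M"
      using t p c by (auto simp: Pi_iff)
    fix i assume i: "i \<in> I"
    have ti: "t i \<in> carrier R" using t i by auto
    have pi: "(\<Otimes>i\<in>I - {i}. t i) \<in> carrier R" by (rule p) auto
    have "(\<Otimes>i\<in>I. t i) = (\<Otimes>i\<in>insert i (I - {i}). t i)" using i by (simp add: insert_absorb)
    also have "\<dots> = t i \<otimes> (\<Otimes>i\<in>I - {i}. t i)"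
      by (rule R.finprod_insert) (use I t ti in auto)
    finally have "(\<Otimes>i\<in>I. t i) [^] j \<otimes> t i [^] k = t i [^] (k + j) \<otimes> (\<Otimes>i\<in>I - {i}. t i) [^] j"
      using ti pi by (simp add: R.nat_pow_distrib R.nat_pow_mult[symmetric] R.m_ac)
    moreover have "(\<Otimes>i\<in>I. t i) [^] j \<odot>\<^bsub>M\<^esub> (\<sigma> \<odot>\<^bsub>M\<^esub> (t i [^] k \<odot>\<^bsub>M\<^esub> c (I - {i}))) =
        \<sigma> \<odot>\<^bsub>M\<^esub> (((\<Otimes>i\<in>I. t i) [^] j \<otimes> t i [^] k) \<odot>\<^bsub>M\<^esub> c (I - {i}))" if "\<sigma> \<in> carrier R" for \<sigma>
      using ti p[of I] c[OF i] that
      by (simp only: smult_assoc1 smult_closed R.nat_pow_closed smult_lcomm[of "(\<Otimes>i\<in>I. t i) [^] j" \<sigma>])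
    ultimately show "(\<Otimes>i\<in>I. t i) [^] j \<odot>\<^bsub>M\<^esub>
        (((\<ominus> \<one>) [^] card {i' \<in> I. i' < i}) \<odot>\<^bsub>M\<^esub> (t i [^] k \<odot>\<^bsub>M\<^esub> c (I - {i}))) =
      ((\<ominus> \<one>) [^] card {i' \<in> I. i' < i}) \<odot>\<^bsub>M\<^esub>
        (t i [^] (k + j) \<odot>\<^bsub>M\<^esub> ((\<Otimes>i\<in>I - {i}. t i) [^] j \<odot>\<^bsub>M\<^esub> c (I - {i})))"
      using ti pi c[OF i] by (simp only: smult_assoc1 R.sign_closed R.nat_pow_closed)
  qed simp
  finally show ?thesis by simp
qed

end

text \<open>The submodule \<open>H + v 1 M + ... + v s M\<close>. Adding one generator at a time
  matches the induction in the Koszul complex, and carrying \<open>H\<close> along allows statements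
  about \<open>M\<close> modulo \<open>H\<close> without forming the quotient.\<close>

fun span_mod ::
  "('r, 'c) ring_scheme \<Rightarrow> ('r, 'm, 'd) module_scheme \<Rightarrow> (nat \<Rightarrow> 'r) \<Rightarrow> 'm set \<Rightarrow> nat \<Rightarrow> 'm set" where
  "span_mod R M v H 0 = H"
| "span_mod R M v H (Suc s) =
     {x \<oplus>\<^bsub>M\<^esub> v (Suc s) \<odot>\<^bsub>M\<^esub> m | x m. x \<in> span_mod R M v H s \<and> m \<in> carrier M}"

section \<open>Exactness of the Koszul complex of a regular sequence, relative to a
  submodule\<close>

context module begin

lemma span_mod_SucI:
  "x \<in> span_mod R M v H s \<Longrightarrow> m \<in> carrier M \<Longrightarrow> y = x \<oplus>\<^bsub>M\<^esub> v (Suc s) \<odot>\<^bsub>M\<^esub> m \<Longrightarrow>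
    y \<in> span_mod R M v H (Suc s)"
  by auto

lemma span_mod_submodule:
  assumes H: "submodule H R M" and v: "v \<in> {1..s} \<rightarrow> carrier R"
  shows "submodule (span_mod R M v H s) R M"
  using v
proof (induction s)
  case 0 show ?case using H by simp
next
  case (Suc s)
  have S: "submodule (span_mod R M v H s) R M"
    by (rule Suc.IH) (use Suc.prems in \<open>auto simp: Pi_iff\<close>)
  note sf = sub_facts[OF S]
  have u: "v (Suc s) \<in> carrier R" using Suc.prems by auto
  let ?u = "v (Suc s)"
  show ?case
  proof (rule submoduleI)
    show "span_mod R M v H (Suc s) \<subseteq> carrier M" using sf(1) u by auto
    show "\<zero>\<^bsub>M\<^esub> \<in> span_mod R M v H (Suc s)"
      using sf(2) u by (auto intro!: exI[of _ "\<zero>\<^bsub>M\<^esub>"])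
  next
    fix a assume "a \<in> span_mod R M v H (Suc s)"
    then obtain x m where a: "a = x \<oplus>\<^bsub>M\<^esub> ?u \<odot>\<^bsub>M\<^esub> m" "x \<in> span_mod R M v H s" "m \<in> carrier M" by auto
    have "\<ominus>\<^bsub>M\<^esub> a = \<ominus>\<^bsub>M\<^esub> x \<oplus>\<^bsub>M\<^esub> ?u \<odot>\<^bsub>M\<^esub> (\<ominus>\<^bsub>M\<^esub> m)"
      using a sf(1) u by (auto simp: M.minus_add smult_r_minus)
    thus "\<ominus>\<^bsub>M\<^esub> a \<in> span_mod R M v H (Suc s)" using a sf(5) by auto
    fix b assume "b \<in> span_mod R M v H (Suc s)"
    then obtain y n where b: "b = y \<oplus>\<^bsub>M\<^esub> ?u \<odot>\<^bsub>M\<^esub> n" "y \<in> span_mod R M v H s" "n \<in> carrier M" by auto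
    have "a \<oplus>\<^bsub>M\<^esub> b = (x \<oplus>\<^bsub>M\<^esub> y) \<oplus>\<^bsub>M\<^esub> ?u \<odot>\<^bsub>M\<^esub> (m \<oplus>\<^bsub>M\<^esub> n)"
      using a b subsetD[OF sf(1)] u by (simp add: smult_r_distr M.a_ac)
    thus "a \<oplus>\<^bsub>M\<^esub> b \<in> span_mod R M v H (Suc s)" using a b sf(3) by auto
  next
    fix r a assume r: "r \<in> carrier R" "a \<in> span_mod R M v H (Suc s)"
    then obtain x m where a: "a = x \<oplus>\<^bsub>M\<^esub> ?u \<odot>\<^bsub>M\<^esub> m" "x \<in> span_mod R M v H s" "m \<in> carrier M" by auto
    have "r \<odot>\<^bsub>M\<^esub> a = r \<odot>\<^bsub>M\<^esub> x \<oplus>\<^bsub>M\<^esub> ?u \<odot>\<^bsub>M\<^esub> (r \<odot>\<^bsub>M\<^esub> m)"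
      using a subsetD[OF sf(1)] u r by (simp add: smult_r_distr smult_lcomm[of r])
    thus "r \<odot>\<^bsub>M\<^esub> a \<in> span_mod R M v H (Suc s)" using a sf(4) r by auto
  qed
qed

lemma span_mod_mono: "submodule H R M \<Longrightarrow> v \<in> {1..s} \<rightarrow> carrier R \<Longrightarrow> H \<subseteq> span_mod R M v H s"
proof (induction s)
  case (Suc s)
  have v: "v \<in> {1..s} \<rightarrow> carrier R" "v (Suc s) \<in> carrier R" using Suc.prems(2) by auto
  have "x \<in> span_mod R M v H (Suc s)" if "x \<in> H" for x
    by (rule span_mod_SucI[of x _ _ s "\<zero>\<^bsub>M\<^esub>"])
      (use v that Suc.IH[OF Suc.prems(1) v(1)] sub_facts(1)[OF Suc.prems(1)] in auto)
  thus ?case by blast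
qed simp

lemma smult_mem_span_mod:
  assumes "submodule H R M" "v \<in> {1..s} \<rightarrow> carrier R" "j \<in> {1..s}" "m \<in> carrier M"
  shows "v j \<odot>\<^bsub>M\<^esub> m \<in> span_mod R M v H s"
  using assms(2,3)
proof (induction s)
  case (Suc s)
  have S: "submodule (span_mod R M v H s) R M"
    using Suc.prems by (intro span_mod_submodule[OF assms(1)]) auto
  have v: "v (Suc s) \<in> carrier R" "v j \<in> carrier R" using Suc.prems by auto
  show ?case
  proof (cases "j = Suc s")
    case True
    show ?thesis
      by (rule span_mod_SucI[of "\<zero>\<^bsub>M\<^esub>" _ _ s m]) (use True sub_facts(2)[OF S] v assms(4) in auto)
  next
    case False
    hence "v j \<odot>\<^bsub>M\<^esub> m \<in> span_mod R M v H s"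
      using Suc.prems by (intro Suc.IH) (auto simp: Pi_iff)
    thus ?thesis by (rule span_mod_SucI[of _ _ _ s "\<zero>\<^bsub>M\<^esub>"]) (use v assms(4) in auto)
  qed
qed simp

lemma kos_mem_span_mod:
  assumes H: "submodule H R M" and v: "v \<in> {1..s} \<rightarrow> carrier R" and c: "c \<in> cochains s (carrier M)"
    and I: "I \<subseteq> {1..s}"
  shows "kos R M v c I \<in> span_mod R M v H s"
proof -
  note S = span_mod_submodule[OF H v]
  show ?thesis unfolding kos_def
  proof (rule sub_finsum[OF S finite_subset[OF I]])
    have "v i \<odot>\<^bsub>M\<^esub> c (I - {i}) \<in> span_mod R M v H s" if "i \<in> I" for i
      by (rule smult_mem_span_mod[OF H v]) (use that I in \<open>auto intro!: cochainsD[OF c]\<close>)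
    thus "(\<lambda>i. ((\<ominus> \<one>) [^] card {i' \<in> I. i' < i}) \<odot>\<^bsub>M\<^esub> (v i \<odot>\<^bsub>M\<^esub> c (I - {i}))) \<in> I \<rightarrow> span_mod R M v H s"
      using sub_facts(4)[OF S] by (intro funcsetI) (auto simp del: R.nat_pow_Suc)
  qed simp
qed

text \<open>The entries of a cochain at the sets \<open>{1..s} - {i}\<close> can be prescribed
  independently of each other, so in top degree the boundaries fill the whole span modulo
  \<open>H\<close>.\<close>

lemma span_mod_kos:
  assumes H: "submodule H R M"
  shows "v \<in> {1..s} \<rightarrow> carrier R \<Longrightarrow> x \<in> span_mod R M v H s \<Longrightarrow>
    \<exists>b\<in>cochains s (carrier M). x \<ominus>\<^bsub>M\<^esub> kos R M v b {1..s} \<in> H"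
proof (induction s arbitrary: x)
  case 0
  have "x \<in> carrier M" using 0 sub_facts(1)[OF H] by auto
  thus ?case using 0
    by (intro bexI[of _ "\<lambda>_. \<zero>\<^bsub>M\<^esub>"]) (auto simp: a_minus_def cochains_def)
next
  case (Suc s)
  then obtain y m where x: "x = y \<oplus>\<^bsub>M\<^esub> v (Suc s) \<odot>\<^bsub>M\<^esub> m" "y \<in> span_mod R M v H s" "m \<in> carrier M" by auto
  have vs: "v \<in> {1..s} \<rightarrow> carrier R" and u: "v (Suc s) \<in> carrier R" using Suc.prems by auto
  obtain b where b: "b \<in> cochains s (carrier M)" "y \<ominus>\<^bsub>M\<^esub> kos R M v b {1..s} \<in> H"
    using Suc.IH[OF vs x(2)] by blast
  \<comment> \<open>In the term of the largest index the entry meets a sign with exponent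
    \<open>card {1..s}\<close>; this factor cancels it in advance.\<close>
  define m' where "m' = ((\<ominus> \<one>) [^] s) \<odot>\<^bsub>M\<^esub> m"
  define b' where "b' = (\<lambda>J. if Suc s \<in> J then b (J - {Suc s}) else m')"
  have m': "m' \<in> carrier M" using x by (simp add: m'_def)
  have b'c: "b' \<in> cochains (Suc s) (carrier M)"
    unfolding b'_def by (rule cochains_Suc[OF b(1)]) (use m' in \<open>auto intro: cochainsI\<close>)
  have e: "{1..Suc s} = insert (Suc s) {1..s}" by auto
  have y: "y \<in> carrier M" using x(2) sub_facts(1)[OF span_mod_submodule[OF H vs]] by auto
  have k: "kos R M v b {1..s} \<in> carrier M"
    by (rule kos_cochain_closed[OF b(1) vs]) simp
  have "kos R M v b' {1..Suc s} = kos R M v (\<lambda>J'. b' (insert (Suc s) J')) {1..s} \<oplus>\<^bsub>M\<^esub>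
      ((\<ominus> \<one>) [^] card {1..s}) \<odot>\<^bsub>M\<^esub> (v (Suc s) \<odot>\<^bsub>M\<^esub> b' {1..s})"
    unfolding e by (rule kos_insert_cochain[OF b'c Suc.prems(1)]) simp
  also have "kos R M v (\<lambda>J'. b' (insert (Suc s) J')) {1..s} = kos R M v b {1..s}"
    by (rule kos_cong) (use vs in \<open>auto simp: b'_def intro: cochains_Diff[OF b(1)]\<close>)
  also have "((\<ominus> \<one>) [^] card {1..s}) \<odot>\<^bsub>M\<^esub> (v (Suc s) \<odot>\<^bsub>M\<^esub> b' {1..s}) = v (Suc s) \<odot>\<^bsub>M\<^esub> m"
    using u x(3) by (simp add: b'_def m'_def smult_lcomm[of "(\<ominus> \<one>) [^] s" "v (Suc s)"] sign_smult_twice)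
  finally have "x \<ominus>\<^bsub>M\<^esub> kos R M v b' {1..Suc s} = y \<ominus>\<^bsub>M\<^esub> kos R M v b {1..s}"
    using x y u k by (simp add: a_minus_def M.minus_add M.a_ac M.r_neg2 M.r_neg1 M.r_neg)
  thus ?case using b(2) b'c by (intro bexI[of _ b']) simp_all
qed

text \<open>The hypothesis on \<open>v\<close> says that each \<open>v (Suc j)\<close> is a
  nonzerodivisor on \<open>M\<close> modulo \<open>H\<close> and the multiples of the earlier
  elements. In the cone decomposition the entries at sets without \<open>Suc s\<close> are bounded
  first, by \<open>b0\<close>. The entries at sets with \<open>Suc s\<close>, corrected by
  \<open>v (Suc s)\<close> times \<open>b0\<close>, then form a cocycle modulo \<open>H\<close> of
  one degree less for the shorter sequence.\<close>

lemma kos_exact: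
  assumes H: "submodule H R M"
  shows "v \<in> {1..s} \<rightarrow> carrier R \<Longrightarrow>
    (\<And>j m. j < s \<Longrightarrow> m \<in> carrier M \<Longrightarrow> v (Suc j) \<odot>\<^bsub>M\<^esub> m \<in> span_mod R M v H j \<Longrightarrow>
       m \<in> span_mod R M v H j) \<Longrightarrow>
    p < s \<Longrightarrow> c \<in> cochains s (carrier M) \<Longrightarrow>
    (\<And>I. I \<subseteq> {1..s} \<Longrightarrow> card I = Suc p \<Longrightarrow> kos R M v c I \<in> H) \<Longrightarrow>
    \<exists>b\<in>cochains s (carrier M). \<forall>I. I \<subseteq> {1..s} \<longrightarrow> card I = p \<longrightarrow> c I \<ominus>\<^bsub>M\<^esub> kos R M v b I \<in> H"
proof (induction s arbitrary: p c)
  case 0 thus ?case by simp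
next
  case (Suc s)
  note H' = sub_facts[OF H]
  let ?m = "Suc s" and ?u = "v (Suc s)" and ?k = "kos R M v"
  define c' where "c' = (\<lambda>J. c (insert ?m J))"
  define \<sigma> where "\<sigma> = (\<ominus> \<one>) [^] p"
  have \<sigma>: "\<sigma> \<in> carrier R" by (simp add: \<sigma>_def)
  have vs: "v \<in> {1..s} \<rightarrow> carrier R" and u: "?u \<in> carrier R" using Suc.prems(1) by auto
  have sub: "insert ?m J \<subseteq> {1..?m}" "J \<subseteq> {1..?m}" if "J \<subseteq> {1..s}" for J using that by auto
  have cc: "c \<in> cochains s (carrier M)" "c' \<in> cochains s (carrier M)"
    using cochainsD[OF Suc.prems(4)] sub by (auto intro!: cochainsI simp: c'_def)
  have kc: "?k b I \<in> carrier M" if "b \<in> cochains s (carrier M)" "I \<subseteq> {1..s}" for b I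
    using kos_cochain_closed that vs by blast
  note ins = kos_insert_cochain[OF _ Suc.prems(1)]
  have top: "?k c' J \<oplus>\<^bsub>M\<^esub> \<sigma> \<odot>\<^bsub>M\<^esub> (?u \<odot>\<^bsub>M\<^esub> c J) \<in> H" if "J \<subseteq> {1..s}" "card J = p" for J
  proof -
    have "card (insert ?m J) = Suc p"
      using that finite_subset[OF that(1)] by (subst card_insert_disjoint) auto
    thus ?thesis
      using Suc.prems(5)[OF sub(1)[OF that(1)]] ins[OF Suc.prems(4) that(1)] that(2)
      by (simp add: c'_def \<sigma>_def)
  qed
  have "\<exists>b\<in>cochains s (carrier M). \<forall>I. I \<subseteq> {1..s} \<longrightarrow> card I = p \<longrightarrow> c I \<ominus>\<^bsub>M\<^esub> ?k b I \<in> H"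
  proof (cases "p < s")
    case True
    show ?thesis
      by (rule Suc.IH[OF vs _ True cc(1)]) (use Suc.prems(2) Suc.prems(5)[OF sub(2)] in auto)
  next
    \<comment> \<open>In degree \<open>p = s\<close> the induction hypothesis says nothing. Here
      \<open>{1..s}\<close> is the only set of size \<open>p\<close>; the cocycle condition puts
      \<open>?u\<close> times the entry into the span of the earlier elements, and regularity of
      \<open>?u\<close> puts the entry itself there, where it is a boundary modulo
      \<open>H\<close>.\<close>
    case False
    hence p: "p = s" using Suc.prems(3) by simp
    have all: "I = {1..s}" if "I \<subseteq> {1..s}" "card I = p" for I
      using that p card_subset_eq[of "{1..s}" I] by auto
    let ?I = "{1..s}"
    note S = span_mod_submodule[OF H vs]
    have cI: "c ?I \<in> carrier M" using cochainsD[OF cc(1)] by auto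
    have 1: "?k c' ?I \<oplus>\<^bsub>M\<^esub> \<sigma> \<odot>\<^bsub>M\<^esub> (?u \<odot>\<^bsub>M\<^esub> c ?I) \<in> span_mod R M v H s"
      using top[of ?I] p span_mod_mono[OF H vs] by auto
    have 2: "?k c' ?I \<in> span_mod R M v H s" by (rule kos_mem_span_mod[OF H vs cc(2)]) simp
    have "\<sigma> \<odot>\<^bsub>M\<^esub> (?u \<odot>\<^bsub>M\<^esub> c ?I) = (?k c' ?I \<oplus>\<^bsub>M\<^esub> \<sigma> \<odot>\<^bsub>M\<^esub> (?u \<odot>\<^bsub>M\<^esub> c ?I)) \<ominus>\<^bsub>M\<^esub> ?k c' ?I"
      using cI u \<sigma> kc[OF cc(2), of ?I] by (simp add: a_minus_def M.a_ac M.r_neg1 M.r_neg2 M.r_neg)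
    hence "\<sigma> \<odot>\<^bsub>M\<^esub> (?u \<odot>\<^bsub>M\<^esub> c ?I) \<in> span_mod R M v H s" using sub_facts(6)[OF S 1 2] by simp
    from sub_facts(4)[OF S \<sigma> this] have "?u \<odot>\<^bsub>M\<^esub> c ?I \<in> span_mod R M v H s"
      using u cI by (simp add: \<sigma>_def sign_smult_twice)
    hence "c ?I \<in> span_mod R M v H s" using Suc.prems(2)[of s] cI by auto
    from span_mod_kos[OF H vs this] show ?thesis using all by metis
  qed
  then obtain b0 where b0: "b0 \<in> cochains s (carrier M)"
    "\<And>I. I \<subseteq> {1..s} \<Longrightarrow> card I = p \<Longrightarrow> c I \<ominus>\<^bsub>M\<^esub> ?k b0 I \<in> H" by blast
  note ext = cochains_Suc[where A = "carrier M" and s = s]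
  have low: "?k (\<lambda>J. if ?m \<in> J then b (J - {?m}) else b' J) I = ?k b' I"
    if "b' \<in> cochains s (carrier M)" "I \<subseteq> {1..s}" for b b' I
    by (rule kos_cong[symmetric]) (use that vs cochainsD[OF that(1)] in \<open>auto simp: subset_iff\<close>)
  show ?case
  proof (cases p)
    case 0
    let ?b = "\<lambda>J. if ?m \<in> J then b0 (J - {?m}) else b0 J"
    have "c I \<ominus>\<^bsub>M\<^esub> ?k ?b I \<in> H" if "I \<subseteq> {1..?m}" "card I = p" for I
    proof -
      have "I = {}" using that 0 finite_subset[OF that(1)] by simp
      thus ?thesis using b0(2)[of "{}"] 0 by simp
    qed
    thus ?thesis using ext[OF b0(1) b0(1)] by blast
  next
    case (Suc p')
    \<comment> \<open>What is left of the upper entries once \<open>b0\<close> serves for the lower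
      ones. In the boundary, \<open>b0\<close> appears with sign exponent \<open>p' = p - 1\<close>;
      subtracting it produces the sign \<open>\<sigma>\<close> with a plus.\<close>
    define c3 where "c3 J = c' J \<oplus>\<^bsub>M\<^esub> \<sigma> \<odot>\<^bsub>M\<^esub> (?u \<odot>\<^bsub>M\<^esub> b0 J)" for J
    have c3: "c3 \<in> cochains s (carrier M)"
      using cochainsD[OF cc(2)] cochainsD[OF b0(1)] u \<sigma> by (auto intro!: cochainsI simp: c3_def)
    have kc3: "?k c3 J \<in> H" if "J \<subseteq> {1..s}" "card J = Suc p'" for J
    proof -
      have vJ: "v \<in> J \<rightarrow> carrier R" "finite J" using that vs finite_subset[OF that(1)] by auto
      have J: "J - {i} \<subseteq> {1..s}" for i using that by auto
      have cl: "c' (J - {i}) \<in> carrier M" "b0 (J - {i}) \<in> carrier M" for i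
        using cochainsD[OF cc(2) J] cochainsD[OF b0(1) J] by auto
      have "?k c3 J = ?k c' J \<oplus>\<^bsub>M\<^esub> \<sigma> \<odot>\<^bsub>M\<^esub> (?u \<odot>\<^bsub>M\<^esub> ?k b0 J)"
        unfolding c3_def using vJ cl \<sigma> u by (simp add: kos_add kos_smult)
      also have "\<dots> = (?k c' J \<oplus>\<^bsub>M\<^esub> \<sigma> \<odot>\<^bsub>M\<^esub> (?u \<odot>\<^bsub>M\<^esub> c J)) \<ominus>\<^bsub>M\<^esub> \<sigma> \<odot>\<^bsub>M\<^esub> (?u \<odot>\<^bsub>M\<^esub> (c J \<ominus>\<^bsub>M\<^esub> ?k b0 J))"
        using kc[OF b0(1) that(1)] kc[OF cc(2) that(1)] cochainsD[OF cc(1) that(1)] \<sigma> u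
        by (simp add: smult_r_distr smult_r_minus a_minus_def M.minus_add M.a_ac M.r_neg1 M.r_neg2)
      also have "\<dots> \<in> H"
        by (rule H'(6)[OF top[OF that(1)] H'(4)[OF \<sigma> H'(4)[OF u b0(2)[OF that(1)]]]]) (use that Suc in simp_all)
      finally show ?thesis .
    qed
    have "p' < s" using Suc Suc.prems(3) by simp
    have "\<exists>b\<in>cochains s (carrier M). \<forall>I. I \<subseteq> {1..s} \<longrightarrow> card I = p' \<longrightarrow> c3 I \<ominus>\<^bsub>M\<^esub> ?k b I \<in> H"
      by (rule Suc.IH[OF vs _ \<open>p' < s\<close> c3 kc3]) (use Suc.prems in auto)
    then obtain b1 where b1: "b1 \<in> cochains s (carrier M)"
      "\<And>I. I \<subseteq> {1..s} \<Longrightarrow> card I = p' \<Longrightarrow> c3 I \<ominus>\<^bsub>M\<^esub> ?k b1 I \<in> H" by blast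
    let ?b = "\<lambda>J. if ?m \<in> J then b1 (J - {?m}) else b0 J"
    have "c I \<ominus>\<^bsub>M\<^esub> ?k ?b I \<in> H" if I: "I \<subseteq> {1..?m}" "card I = p" for I
    proof (cases "?m \<in> I")
      case False
      hence I': "I \<subseteq> {1..s}" using I by (auto simp: atLeastAtMostSuc_conv)
      show ?thesis using b0(2)[OF I' I(2)] low[OF b0(1) I'] by simp
    next
      case True
      define J where "J = I - {?m}"
      have J: "I = insert ?m J" "?m \<notin> J" "J \<subseteq> {1..s}" using True I by (auto simp: J_def atLeastAtMostSuc_conv)
      have cJ: "card J = p'" using I True Suc finite_subset[OF I(1)] by (simp add: J_def)
      have "?k (\<lambda>J. ?b (insert ?m J)) J = ?k b1 J"
        by (rule kos_cong) (use J vs cochainsD[OF b1(1)] in \<open>auto simp: subset_iff\<close>)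
      hence "?k ?b I = ?k b1 J \<oplus>\<^bsub>M\<^esub> ((\<ominus> \<one>) [^] p') \<odot>\<^bsub>M\<^esub> (?u \<odot>\<^bsub>M\<^esub> b0 J)"
        using ins[OF ext[OF b1(1) b0(1)] J(3)] J cJ by simp
      moreover have "\<sigma> \<odot>\<^bsub>M\<^esub> (?u \<odot>\<^bsub>M\<^esub> b0 J) = \<ominus>\<^bsub>M\<^esub> (((\<ominus> \<one>) [^] p') \<odot>\<^bsub>M\<^esub> (?u \<odot>\<^bsub>M\<^esub> b0 J))"
        unfolding \<sigma>_def Suc using u cochainsD[OF b0(1) J(3)] by (intro sign_smult_Suc) auto
      ultimately have "c I \<ominus>\<^bsub>M\<^esub> ?k ?b I = c3 J \<ominus>\<^bsub>M\<^esub> ?k b1 J"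
        using u cochainsD[OF b0(1) J(3)] kc[OF b1(1) J(3)] cochainsD[OF cc(2) J(3)] J(1)
        by (simp add: c3_def c'_def a_minus_def M.minus_add M.a_ac)
      thus ?thesis using b1(2)[OF J(3) cJ] by simp
    qed
    thus ?thesis using ext[OF b1(1) b0(1)] by blast
  qed
qed

end

section \<open>The double complex\<close>

text \<open>The two directions of the double complex behave differently: by \<open>exact\<close> the
  Koszul direction is exact below degree \<open>D\<close> for every exponent, while by
  \<open>annih\<close> a cocycle of \<open>E\<close> in positive degree bounds only after
  multiplication by any of the \<open>t i\<close>. The kernel of \<open>d 0\<close> is left open; it
  is identified later.\<close>

locale koszul_complex = cring R for R :: "('r, 'c) ring_scheme" (structure) +
  fixes E :: "nat \<Rightarrow> ('r, 'm) module" and d :: "nat \<Rightarrow> 'm \<Rightarrow> 'm" and D :: nat and t :: "nat \<Rightarrow> 'r"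
  assumes E_module: "Module.module R (E r)"
    and d_hom: "d r \<in> mod_homs R (E r) (E (Suc r))"
    and d_d: "x \<in> carrier (E r) \<Longrightarrow> d (Suc r) (d r x) = \<zero>\<^bsub>E (Suc (Suc r))\<^esub>"
    and t_closed: "t \<in> {1..D} \<rightarrow> carrier R"
    and exact: "p < D \<Longrightarrow> c \<in> cochains D (carrier (E r)) \<Longrightarrow>
      (\<And>I. I \<subseteq> {1..D} \<Longrightarrow> card I = Suc p \<Longrightarrow> kos R (E r) (\<lambda>i. t i [^] (k::nat)) c I = \<zero>\<^bsub>E r\<^esub>) \<Longrightarrow>
      \<exists>b\<in>cochains D (carrier (E r)). \<forall>I. I \<subseteq> {1..D} \<longrightarrow> card I = p \<longrightarrow>
        c I = kos R (E r) (\<lambda>i. t i [^] k) b I"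
    and annih: "i \<in> {1..D} \<Longrightarrow> z \<in> carrier (E (Suc r)) \<Longrightarrow> d (Suc r) z = \<zero>\<^bsub>E (Suc (Suc r))\<^esub> \<Longrightarrow>
      \<exists>w\<in>carrier (E r). d r w = t i \<odot>\<^bsub>E (Suc r)\<^esub> z"
begin

sublocale E: Module.module R "E r" for r by (rule E_module)

abbreviation K where "K r k \<equiv> kos R (E r) (\<lambda>i. t i [^] (k::nat))"

abbreviation Ch where "Ch r \<equiv> cochains D (carrier (E r))"

abbreviation tpr :: "nat set \<Rightarrow> 'r" where "tpr I \<equiv> (\<Otimes>i\<in>I. t i)"

lemma t_pow: "(\<lambda>i. t i [^] (k::nat)) \<in> {1..D} \<rightarrow> carrier R"
  using t_closed by (auto simp: Pi_iff)

lemma t_pow_sub: "I \<subseteq> {1..D} \<Longrightarrow> (\<lambda>i. t i [^] (k::nat)) \<in> I \<rightarrow> carrier R"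
  using t_closed by (auto simp: Pi_iff)

lemma tpr_closed: "I \<subseteq> {1..D} \<Longrightarrow> tpr I \<in> carrier R"
  using t_closed by (intro finprod_closed) (auto simp: Pi_iff)

lemma fin_sub: "I \<subseteq> {1..D} \<Longrightarrow> finite I"
  using finite_subset by blast

lemma d_closed [simp]: "x \<in> carrier (E r) \<Longrightarrow> d r x \<in> carrier (E (Suc r))"
  by (rule mod_homs_closed[OF d_hom])

lemmas d_add = mod_homs_add[OF d_hom]
lemmas d_smult = mod_homs_smult[OF d_hom]
lemmas d_minus = mod_homs_minus[OF E_module E_module d_hom]

lemma Ch_d: "c \<in> Ch r \<Longrightarrow> (\<lambda>J. d r (c J)) \<in> Ch (Suc r)"
  by (auto simp: cochains_def)

lemma Ch_scale: "c \<in> Ch r \<Longrightarrow> (\<lambda>J. tpr J [^] (m::nat) \<odot>\<^bsub>E r\<^esub> c J) \<in> Ch r"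
  using tpr_closed by (auto simp: cochains_def)

lemma K_closed: "c \<in> Ch r \<Longrightarrow> I \<subseteq> {1..D} \<Longrightarrow> K r k c I \<in> carrier (E r)"
  by (rule E.kos_cochain_closed[OF _ t_pow])

lemma K_d: "c \<in> Ch r \<Longrightarrow> I \<subseteq> {1..D} \<Longrightarrow> d r (K r k c I) = K (Suc r) k (\<lambda>J. d r (c J)) I"
  by (rule E.kos_hom[OF E_module d_hom fin_sub t_pow_sub]) (auto intro: cochains_Diff)

lemma K_K: "c \<in> Ch r \<Longrightarrow> I \<subseteq> {1..D} \<Longrightarrow> K r k (K r k c) I = \<zero>\<^bsub>E r\<^esub>"
  by (rule E.kos_kos[OF fin_sub t_pow_sub]) (auto intro: cochainsD)

lemma K_cong: "c \<in> Ch r \<Longrightarrow> I \<subseteq> {1..D} \<Longrightarrow> (\<And>i. i \<in> I \<Longrightarrow> c (I - {i}) = c' (I - {i})) \<Longrightarrow>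
  K r k c I = K r k c' I"
  by (rule E.kos_cong[OF t_pow_sub]) (blast intro: cochains_Diff)+

lemma K_add: "c \<in> Ch r \<Longrightarrow> c' \<in> Ch r \<Longrightarrow> I \<subseteq> {1..D} \<Longrightarrow>
  K r k (\<lambda>J. c J \<oplus>\<^bsub>E r\<^esub> c' J) I = K r k c I \<oplus>\<^bsub>E r\<^esub> K r k c' I"
  by (rule E.kos_add[OF fin_sub t_pow_sub]) (auto intro: cochains_Diff)

lemma K_minus: "c \<in> Ch r \<Longrightarrow> c' \<in> Ch r \<Longrightarrow> I \<subseteq> {1..D} \<Longrightarrow>
  K r k (\<lambda>J. c J \<ominus>\<^bsub>E r\<^esub> c' J) I = K r k c I \<ominus>\<^bsub>E r\<^esub> K r k c' I"
  by (rule E.kos_minus[OF fin_sub t_pow_sub]) (auto intro: cochains_Diff)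

lemma K_smult: "c \<in> Ch r \<Longrightarrow> I \<subseteq> {1..D} \<Longrightarrow> s \<in> carrier R \<Longrightarrow>
  K r k (\<lambda>J. s \<odot>\<^bsub>E r\<^esub> c J) I = s \<odot>\<^bsub>E r\<^esub> K r k c I"
  by (rule E.kos_smult[OF fin_sub t_pow_sub]) (auto intro: cochains_Diff)

lemma K_scale: "c \<in> Ch r \<Longrightarrow> I \<subseteq> {1..D} \<Longrightarrow>
  K r (k + m) (\<lambda>J. tpr J [^] m \<odot>\<^bsub>E r\<^esub> c J) I = tpr I [^] m \<odot>\<^bsub>E r\<^esub> K r k c I"
  by (rule E.kos_rescale[OF fin_sub]) (use t_closed in \<open>auto simp: Pi_iff intro: cochains_Diff\<close>)

text \<open>A set of size \<open>Suc p\<close> contains some \<open>i\<close>, and the factor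
  \<open>t i\<close> already turns the cocycle at that set into a boundary. The full product is
  taken because it is the factor that appears when the exponent is raised by one, so that the lift
  fits into the Koszul complex of the next powers.\<close>

lemma scale_lift:
  assumes x: "\<And>J. J \<subseteq> {1..D} \<Longrightarrow> card J = Suc p \<Longrightarrow> x J \<in> carrier (E (Suc r))"
    "\<And>J. J \<subseteq> {1..D} \<Longrightarrow> card J = Suc p \<Longrightarrow> d (Suc r) (x J) = \<zero>\<^bsub>E (Suc (Suc r))\<^esub>"
  shows "\<exists>y\<in>Ch r. \<forall>J. J \<subseteq> {1..D} \<longrightarrow> card J = Suc p \<longrightarrow> d r (y J) = tpr J \<odot>\<^bsub>E (Suc r)\<^esub> x J"
proof -
  have "\<exists>y\<in>carrier (E r). J \<subseteq> {1..D} \<longrightarrow> card J = Suc p \<longrightarrow> d r y = tpr J \<odot>\<^bsub>E (Suc r)\<^esub> x J" for J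
  proof (cases "J \<subseteq> {1..D} \<and> card J = Suc p")
    case True
    then obtain i where i: "i \<in> J" by fastforce
    have iD: "i \<in> {1..D}" and ti: "t i \<in> carrier R" using i True t_closed by auto
    obtain w where w: "w \<in> carrier (E r)" "d r w = t i \<odot>\<^bsub>E (Suc r)\<^esub> x J"
      using annih[OF iD x] True by blast
    have J': "tpr (J - {i}) \<in> carrier R" by (rule tpr_closed) (use True in auto)
    have "tpr J = tpr (insert i (J - {i}))" using i by (simp add: insert_absorb)
    also have "\<dots> = t i \<otimes> tpr (J - {i})"
      by (rule finprod_insert) (use True fin_sub ti t_closed in \<open>auto simp: Pi_iff\<close>)
    finally have "tpr J \<odot>\<^bsub>E (Suc r)\<^esub> x J = tpr (J - {i}) \<odot>\<^bsub>E (Suc r)\<^esub> (t i \<odot>\<^bsub>E (Suc r)\<^esub> x J)"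
      using ti J' x(1)[of J] True by (simp add: E.smult_assoc1[symmetric] m_comm)
    hence "d r (tpr (J - {i}) \<odot>\<^bsub>E r\<^esub> w) = tpr J \<odot>\<^bsub>E (Suc r)\<^esub> x J" using w J' by (simp add: d_smult)
    moreover have "tpr (J - {i}) \<odot>\<^bsub>E r\<^esub> w \<in> carrier (E r)" using w J' by simp
    ultimately show ?thesis by blast
  qed (use E.zero_closed in blast)
  then obtain y where "\<And>J. y J \<in> carrier (E r)"
    "\<And>J. J \<subseteq> {1..D} \<Longrightarrow> card J = Suc p \<Longrightarrow> d r (y J) = tpr J \<odot>\<^bsub>E (Suc r)\<^esub> x J"
    by metis
  thus ?thesis by (intro bexI[of _ y]) (auto simp: cochains_def)
qed

text \<open>The iterated connecting map of the double complex is kept as a relation, because the choices on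
  the way make it well defined only up to boundaries.\<close>

primrec zigzag :: "nat \<Rightarrow> nat \<Rightarrow> nat \<Rightarrow> (nat set \<Rightarrow> 'm) \<Rightarrow> 'm \<Rightarrow> bool" where
  "zigzag k 0 r e z \<longleftrightarrow> e {} = z"
| "zigzag k (Suc j) r e z \<longleftrightarrow> (\<exists>e'\<in>Ch (Suc r).
     (\<forall>I. I \<subseteq> {1..D} \<longrightarrow> card I = Suc j \<longrightarrow> d r (e I) = K (Suc r) k e' I) \<and> zigzag k j (Suc r) e' z)"

lemma zigzag_add:
  "zigzag k j r e z \<Longrightarrow> zigzag k j r e' z' \<Longrightarrow> e \<in> Ch r \<Longrightarrow> e' \<in> Ch r \<Longrightarrow>
   zigzag k j r (\<lambda>J. e J \<oplus>\<^bsub>E r\<^esub> e' J) (z \<oplus>\<^bsub>E (r + j)\<^esub> z')"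
proof (induction j arbitrary: r e e')
  case (Suc j)
  obtain f where f: "f \<in> Ch (Suc r)" "zigzag k j (Suc r) f z"
    "\<And>I. I \<subseteq> {1..D} \<Longrightarrow> card I = Suc j \<Longrightarrow> d r (e I) = K (Suc r) k f I" using Suc.prems by auto
  obtain f' where f': "f' \<in> Ch (Suc r)" "zigzag k j (Suc r) f' z'"
    "\<And>I. I \<subseteq> {1..D} \<Longrightarrow> card I = Suc j \<Longrightarrow> d r (e' I) = K (Suc r) k f' I" using Suc.prems by auto
  have "(\<lambda>J. f J \<oplus>\<^bsub>E (Suc r)\<^esub> f' J) \<in> Ch (Suc r)" using f f' by (auto simp: cochains_def)
  moreover have "d r (e I \<oplus>\<^bsub>E r\<^esub> e' I) = K (Suc r) k (\<lambda>J. f J \<oplus>\<^bsub>E (Suc r)\<^esub> f' J) I"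
    if "I \<subseteq> {1..D}" "card I = Suc j" for I
    using f(3)[OF that] f'(3)[OF that] K_add[OF f(1) f'(1) that(1)]
      cochainsD[OF Suc.prems(3) that(1)] cochainsD[OF Suc.prems(4) that(1)] by (simp add: d_add)
  moreover have "zigzag k j (Suc r) (\<lambda>J. f J \<oplus>\<^bsub>E (Suc r)\<^esub> f' J) (z \<oplus>\<^bsub>E (r + Suc j)\<^esub> z')"
    using Suc.IH[OF f(2) f'(2) f(1) f'(1)] by simp
  ultimately show ?case by auto
qed simp

lemma zigzag_smult:
  "zigzag k j r e z \<Longrightarrow> e \<in> Ch r \<Longrightarrow> s \<in> carrier R \<Longrightarrow>
   zigzag k j r (\<lambda>J. s \<odot>\<^bsub>E r\<^esub> e J) (s \<odot>\<^bsub>E (r + j)\<^esub> z)"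
proof (induction j arbitrary: r e)
  case (Suc j)
  obtain f where f: "f \<in> Ch (Suc r)" "zigzag k j (Suc r) f z"
    "\<And>I. I \<subseteq> {1..D} \<Longrightarrow> card I = Suc j \<Longrightarrow> d r (e I) = K (Suc r) k f I" using Suc.prems by auto
  have "(\<lambda>J. s \<odot>\<^bsub>E (Suc r)\<^esub> f J) \<in> Ch (Suc r)" using f Suc.prems by (auto simp: cochains_def)
  moreover have "d r (s \<odot>\<^bsub>E r\<^esub> e I) = K (Suc r) k (\<lambda>J. s \<odot>\<^bsub>E (Suc r)\<^esub> f J) I"
    if "I \<subseteq> {1..D}" "card I = Suc j" for I
    using f(3)[OF that] K_smult[OF f(1) that(1) Suc.prems(3)] Suc.prems(3)
      cochainsD[OF Suc.prems(2) that(1)] by (simp add: d_smult)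
  moreover have "zigzag k j (Suc r) (\<lambda>J. s \<odot>\<^bsub>E (Suc r)\<^esub> f J) (s \<odot>\<^bsub>E (r + Suc j)\<^esub> z)"
    using Suc.IH[OF f(2) f(1) Suc.prems(3)] by simp
  ultimately show ?case by auto
qed simp

text \<open>The end point is read off at the empty set, where the product is 1; raising the exponent
  therefore changes the cochains on the way but not \<open>z\<close>.\<close>

lemma zigzag_scale:
  "zigzag k j r e z \<Longrightarrow> e \<in> Ch r \<Longrightarrow> zigzag (k + m) j r (\<lambda>J. tpr J [^] (m::nat) \<odot>\<^bsub>E r\<^esub> e J) z"
proof (induction j arbitrary: r e)
  case 0 thus ?case using cochainsD[of e D "carrier (E r)" "{}"] by simp
next
  case (Suc j)
  obtain f where f: "f \<in> Ch (Suc r)" "zigzag k j (Suc r) f z"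
    "\<And>I. I \<subseteq> {1..D} \<Longrightarrow> card I = Suc j \<Longrightarrow> d r (e I) = K (Suc r) k f I" using Suc.prems by auto
  have "d r (tpr I [^] m \<odot>\<^bsub>E r\<^esub> e I) = K (Suc r) (k + m) (\<lambda>J. tpr J [^] m \<odot>\<^bsub>E (Suc r)\<^esub> f J) I"
    if "I \<subseteq> {1..D}" "card I = Suc j" for I
    using f(3)[OF that] K_scale[OF f(1) that(1)] tpr_closed[OF that(1)]
      cochainsD[OF Suc.prems(2) that(1)] by (simp add: d_smult)
  thus ?case using Suc.IH[OF f(2) f(1)] Ch_scale[OF f(1)] by auto
qed

text \<open>Each application of \<open>d\<close> is followed by a lift against the Koszul
  differential, which exists because all degrees met are at most \<open>j < D\<close>. At the empty
  set a Koszul boundary is zero, which makes the end point a cocycle of \<open>E\<close>.\<close>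

lemma zigzag_exists:
  "e \<in> Ch r \<Longrightarrow> j < D \<Longrightarrow>
   (\<And>I. I \<subseteq> {1..D} \<Longrightarrow> card I = Suc j \<Longrightarrow> K (Suc r) k (\<lambda>J. d r (e J)) I = \<zero>\<^bsub>E (Suc r)\<^esub>) \<Longrightarrow>
   \<exists>z\<in>carrier (E (r + j)). d (r + j) z = \<zero>\<^bsub>E (Suc (r + j))\<^esub> \<and> zigzag k j r e z"
proof (induction j arbitrary: r e)
  case 0
  have "\<exists>b\<in>Ch (Suc r). \<forall>I. I \<subseteq> {1..D} \<longrightarrow> card I = 0 \<longrightarrow> d r (e I) = K (Suc r) k b I"
    by (rule exact[OF _ Ch_d[OF 0(1)]]) (use 0 in auto)
  thus ?case using cochainsD[OF 0(1), of "{}"] by auto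
next
  case (Suc j)
  have "\<exists>b\<in>Ch (Suc r). \<forall>I. I \<subseteq> {1..D} \<longrightarrow> card I = Suc j \<longrightarrow> d r (e I) = K (Suc r) k b I"
    by (rule exact[OF _ Ch_d[OF Suc.prems(1)]]) (use Suc.prems in auto)
  then obtain b where b: "b \<in> Ch (Suc r)"
    "\<And>I. I \<subseteq> {1..D} \<Longrightarrow> card I = Suc j \<Longrightarrow> d r (e I) = K (Suc r) k b I" by blast
  have "K (Suc (Suc r)) k (\<lambda>J. d (Suc r) (b J)) I = \<zero>\<^bsub>E (Suc (Suc r))\<^esub>"
    if "I \<subseteq> {1..D}" "card I = Suc j" for I
    using b(2)[OF that] K_d[OF b(1) that(1)] d_d cochainsD[OF Suc.prems(1) that(1)] by metis
  from Suc.IH[OF b(1) Suc_lessD[OF Suc.prems(2)] this] obtain z where z: "z \<in> carrier (E (Suc r + j))"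
    "d (Suc r + j) z = \<zero>\<^bsub>E (Suc (Suc r + j))\<^esub>" "zigzag k j (Suc r) b z" by blast
  have "zigzag k (Suc j) r e z" unfolding zigzag.simps using b z(3) by blast
  thus ?case using z(1,2) by (metis add_Suc_shift)
qed

text \<open>The staircase is climbed backwards from \<open>z\<close>. Now the lifts are against
  \<open>d\<close>, and each of them costs one more power of the \<open>t i\<close>, whence the
  existential \<open>k\<close>.\<close>

lemma zigzag_reaches:
  "z \<in> carrier (E (r + j)) \<Longrightarrow> d (r + j) z = \<zero>\<^bsub>E (Suc (r + j))\<^esub> \<Longrightarrow>
   \<exists>k. \<exists>e\<in>Ch r. (\<forall>I. I \<subseteq> {1..D} \<longrightarrow> card I = Suc j \<longrightarrow> d r (K r k e I) = \<zero>\<^bsub>E (Suc r)\<^esub>) \<and> zigzag k j r e z"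
proof (induction j arbitrary: r)
  case 0
  \<comment> \<open>Only the value at the empty set is prescribed, and \<open>d\<close> kills every
    entry of the constant cochain, so the exponent can start at 0.\<close>
  have "(\<lambda>_. z) \<in> Ch r" using 0 by (simp add: cochains_def)
  moreover have "d r (K r 0 (\<lambda>_. z) I) = \<zero>\<^bsub>E (Suc r)\<^esub>" if "I \<subseteq> {1..D}" for I
    unfolding K_d[OF calculation that] by (rule E.kos_zero[OF t_pow_sub[OF that]]) (use 0 in auto)
  ultimately show ?case by (intro exI[of _ 0] bexI[of _ "\<lambda>_. z"]) simp_all
next
  case (Suc j)
  obtain k e where e: "e \<in> Ch (Suc r)" "zigzag k j (Suc r) e z"
    "\<And>I. I \<subseteq> {1..D} \<Longrightarrow> card I = Suc j \<Longrightarrow> d (Suc r) (K (Suc r) k e I) = \<zero>\<^bsub>E (Suc (Suc r))\<^esub>"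
    using Suc.IH[of "Suc r"] Suc.prems by auto
  obtain y where y: "y \<in> Ch r"
    "\<And>J. J \<subseteq> {1..D} \<Longrightarrow> card J = Suc j \<Longrightarrow> d r (y J) = tpr J \<odot>\<^bsub>E (Suc r)\<^esub> K (Suc r) k e J"
    using scale_lift[of j "K (Suc r) k e" r] K_closed[OF e(1)] e(3) by blast
  let ?e = "\<lambda>J. tpr J [^] (1::nat) \<odot>\<^bsub>E (Suc r)\<^esub> e J"
  have dy: "d r (y J) = K (Suc r) (k + 1) ?e J" if "J \<subseteq> {1..D}" "card J = Suc j" for J
    using y(2)[OF that] K_scale[OF e(1) that(1), of k 1] tpr_closed[OF that(1)] by simp
  have "d r (K r (k + 1) y I) = \<zero>\<^bsub>E (Suc r)\<^esub>" if I: "I \<subseteq> {1..D}" "card I = Suc (Suc j)" for I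
  proof -
    have "d r (K r (k + 1) y I) = K (Suc r) (k + 1) (\<lambda>J. d r (y J)) I" by (rule K_d[OF y(1) I(1)])
    also have "\<dots> = K (Suc r) (k + 1) (K (Suc r) (k + 1) ?e) I"
      by (rule K_cong[OF Ch_d[OF y(1)] I(1)], rule dy) (use I fin_sub in \<open>auto simp: card_Diff_singleton\<close>)
    also have "\<dots> = \<zero>\<^bsub>E (Suc r)\<^esub>" by (rule K_K[OF Ch_scale[OF e(1)] I(1)])
    finally show ?thesis .
  qed
  moreover have "zigzag (k + 1) (Suc j) r y z"
    unfolding zigzag.simps using zigzag_scale[OF e(2,1), of 1] Ch_scale[OF e(1), of 1] dy by blast
  ultimately show ?case using y(1) by blast
qed

text \<open>The hypothesis reproduces itself along the zigzag: the next cochain minus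
  \<open>d\<close> of \<open>f\<close> is a Koszul cocycle, hence the boundary of some
  \<open>f'\<close>, and applying \<open>d\<close> removes the term in \<open>f\<close>. At the end
  a Koszul cocycle in degree 0 vanishes, which leaves \<open>z\<close> as \<open>d\<close> of the
  last value.\<close>

lemma zigzag_trivial:
  "zigzag k (Suc j) r e z \<Longrightarrow> e \<in> Ch r \<Longrightarrow> f \<in> Ch r \<Longrightarrow> j < D \<Longrightarrow>
   (\<And>I. I \<subseteq> {1..D} \<Longrightarrow> card I = Suc j \<Longrightarrow> d r (e I) = d r (K r k f I)) \<Longrightarrow>
   \<exists>w\<in>carrier (E (r + j)). z = d (r + j) w"
proof (induction j arbitrary: r e f)
  case (0 r e f)
  obtain e' where e': "e' \<in> Ch (Suc r)" "e' {} = z"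
    "\<And>I. I \<subseteq> {1..D} \<Longrightarrow> card I = Suc 0 \<Longrightarrow> d r (e I) = K (Suc r) k e' I" using 0(1) by auto
  let ?g = "\<lambda>J. e' J \<ominus>\<^bsub>E (Suc r)\<^esub> d r (f J)"
  have g: "?g \<in> Ch (Suc r)" using e'(1) 0(3) by (auto simp: cochains_def)
  have "K (Suc r) k ?g I = \<zero>\<^bsub>E (Suc r)\<^esub>" if "I \<subseteq> {1..D}" "card I = Suc 0" for I
    using K_minus[OF e'(1) Ch_d[OF 0(3)] that(1)] K_d[OF 0(3) that(1)] 0(5)[OF that] e'(3)[OF that]
      K_closed[OF Ch_d[OF 0(3)] that(1)] by (simp add: a_minus_def E.r_neg)
  from exact[OF 0(4) g this] have "e' {} \<ominus>\<^bsub>E (Suc r)\<^esub> d r (f {}) = \<zero>\<^bsub>E (Suc r)\<^esub>" by auto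
  hence "e' {} = d r (f {})"
    using cochainsD[OF e'(1), of "{}"] cochainsD[OF 0(3), of "{}"]
    by (metis E.r_neg E.add.inv_closed E.add.r_cancel a_minus_def d_closed empty_subsetI)
  thus ?case using e'(2) cochainsD[OF 0(3), of "{}"] by auto
next
  case (Suc j r e f)
  obtain e' where e': "e' \<in> Ch (Suc r)" "zigzag k (Suc j) (Suc r) e' z"
    "\<And>I. I \<subseteq> {1..D} \<Longrightarrow> card I = Suc (Suc j) \<Longrightarrow> d r (e I) = K (Suc r) k e' I"
    using Suc.prems(1) by (auto simp del: zigzag.simps(2) simp: zigzag.simps(2)[of k "Suc j"])
  let ?g = "\<lambda>J. e' J \<ominus>\<^bsub>E (Suc r)\<^esub> d r (f J)"
  have g: "?g \<in> Ch (Suc r)" using e'(1) Suc.prems(3) by (auto simp: cochains_def)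
  have "K (Suc r) k ?g I = \<zero>\<^bsub>E (Suc r)\<^esub>" if "I \<subseteq> {1..D}" "card I = Suc (Suc j)" for I
    using K_minus[OF e'(1) Ch_d[OF Suc.prems(3)] that(1)] K_d[OF Suc.prems(3) that(1)]
      Suc.prems(5)[OF that] e'(3)[OF that]
      K_closed[OF Ch_d[OF Suc.prems(3)] that(1)] by (simp add: a_minus_def E.r_neg)
  from exact[OF Suc.prems(4) g this] obtain f' where f': "f' \<in> Ch (Suc r)"
    "\<And>I. I \<subseteq> {1..D} \<Longrightarrow> card I = Suc j \<Longrightarrow> e' I \<ominus>\<^bsub>E (Suc r)\<^esub> d r (f I) = K (Suc r) k f' I" by blast
  have "d (Suc r) (e' I) = d (Suc r) (K (Suc r) k f' I)" if "I \<subseteq> {1..D}" "card I = Suc j" for I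
    using f'(2)[OF that, symmetric] cochainsD[OF e'(1) that(1)] cochainsD[OF Suc.prems(3) that(1)]
    by (simp add: d_minus d_d) (simp add: a_minus_def)
  from Suc.IH[OF e'(2,1) f'(1) Suc_lessD[OF Suc.prems(4)] this] show ?case
    unfolding add_Suc_shift .
qed

text \<open>Here the argument runs backwards from \<open>z = d w\<close>, so the lifts are against
  \<open>d\<close>, and each step after the first adds one to \<open>m\<close>.\<close>

lemma zigzag_trivial_converse:
  "zigzag k (Suc j) r e z \<Longrightarrow> e \<in> Ch r \<Longrightarrow> w \<in> carrier (E (r + j)) \<Longrightarrow> z = d (r + j) w \<Longrightarrow>
   \<exists>m. \<exists>f\<in>Ch r. \<forall>I. I \<subseteq> {1..D} \<longrightarrow> card I = Suc j \<longrightarrow>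
     d r (tpr I [^] m \<odot>\<^bsub>E r\<^esub> e I) = d r (K r (k + m) f I)"
proof (induction j arbitrary: r e)
  case (0 r e)
  obtain e' where e': "e' \<in> Ch (Suc r)" "e' {} = z"
    "\<And>I. I \<subseteq> {1..D} \<Longrightarrow> card I = Suc 0 \<Longrightarrow> d r (e I) = K (Suc r) k e' I" using 0(1) by auto
  have w: "(\<lambda>_. w) \<in> Ch r" using 0 by (simp add: cochains_def)
  have "d r (tpr I [^] (0::nat) \<odot>\<^bsub>E r\<^esub> e I) = d r (K r (k + 0) (\<lambda>_. w) I)"
    if I: "I \<subseteq> {1..D}" "card I = Suc 0" for I
  proof -
    have e: "I - {i} = {}" if "i \<in> I" for i using that I by (auto simp: card_Suc_eq)
    have "K (Suc r) k e' I = K (Suc r) k (\<lambda>_. d r w) I"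
      by (rule K_cong[OF e'(1) I(1)]) (simp only: e e'(2) 0(4) add_0_right)
    thus ?thesis using e'(3)[OF I] K_d[OF w I(1)] cochainsD[OF 0(2) I(1)] by simp
  qed
  thus ?case using w by blast
next
  case (Suc j r e)
  obtain e' where e': "e' \<in> Ch (Suc r)" "zigzag k (Suc j) (Suc r) e' z"
    "\<And>I. I \<subseteq> {1..D} \<Longrightarrow> card I = Suc (Suc j) \<Longrightarrow> d r (e I) = K (Suc r) k e' I"
    using Suc.prems(1) by (auto simp del: zigzag.simps(2) simp: zigzag.simps(2)[of k "Suc j"])
  have "w \<in> carrier (E (Suc r + j))" "z = d (Suc r + j) w" using Suc.prems by simp_all
  from Suc.IH[OF e'(2,1) this] obtain m f where f: "f \<in> Ch (Suc r)"
    "\<And>I. I \<subseteq> {1..D} \<Longrightarrow> card I = Suc j \<Longrightarrow>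
      d (Suc r) (tpr I [^] m \<odot>\<^bsub>E (Suc r)\<^esub> e' I) = d (Suc r) (K (Suc r) (k + m) f I)" by blast
  let ?e = "\<lambda>J. tpr J [^] m \<odot>\<^bsub>E (Suc r)\<^esub> e' J"
  \<comment> \<open>By the induction hypothesis \<open>d\<close> kills \<open>?x\<close> at the sets
    of size \<open>Suc j\<close>, so \<open>y\<close> lifts it after scaling. In the Koszul boundary
    of \<open>?x\<close> the part coming from \<open>f\<close> is a boundary of a boundary, and only
    the scaled \<open>d r (e I)\<close> survives.\<close>
  let ?x = "\<lambda>J. ?e J \<ominus>\<^bsub>E (Suc r)\<^esub> K (Suc r) (k + m) f J"
  have e: "?e \<in> Ch (Suc r)" by (rule Ch_scale[OF e'(1)])
  have Kf: "K (Suc r) (k + m) f \<in> Ch (Suc r)" using K_closed[OF f(1)] by (simp add: cochains_def)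
  have x: "?x \<in> Ch (Suc r)" using e Kf by (auto simp: cochains_def)
  have "d (Suc r) (?x J) = \<zero>\<^bsub>E (Suc (Suc r))\<^esub>" if "J \<subseteq> {1..D}" "card J = Suc j" for J
    using f(2)[OF that] cochainsD[OF e that(1)] cochainsD[OF Kf that(1)]
    by (simp add: d_minus) (simp add: a_minus_def E.r_neg)
  then obtain y where y: "y \<in> Ch r"
    "\<And>J. J \<subseteq> {1..D} \<Longrightarrow> card J = Suc j \<Longrightarrow> d r (y J) = tpr J \<odot>\<^bsub>E (Suc r)\<^esub> ?x J"
    using scale_lift[of j ?x r] cochainsD[OF x] by blast
  have "d r (tpr I [^] (m + 1) \<odot>\<^bsub>E r\<^esub> e I) = d r (K r (k + (m + 1)) y I)"
    if I: "I \<subseteq> {1..D}" "card I = Suc (Suc j)" for I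
  proof -
    note ti = tpr_closed[OF I(1)]
    have "d r (K r (k + (m + 1)) y I) = K (Suc r) (k + m + 1) (\<lambda>J. d r (y J)) I"
      using K_d[OF y(1) I(1)] by (simp add: add.assoc)
    also have "\<dots> = K (Suc r) (k + m + 1) (\<lambda>J. tpr J [^] (1::nat) \<odot>\<^bsub>E (Suc r)\<^esub> ?x J) I"
    proof (rule K_cong[OF Ch_d[OF y(1)] I(1)])
      fix i assume i: "i \<in> I"
      have J: "I - {i} \<subseteq> {1..D}" "card (I - {i}) = Suc j" using i I fin_sub by (auto simp: card_Diff_singleton)
      show "d r (y (I - {i})) = tpr (I - {i}) [^] (1::nat) \<odot>\<^bsub>E (Suc r)\<^esub> ?x (I - {i})"
        using y(2)[OF J] tpr_closed[OF J(1)] by simp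
    qed
    also have "\<dots> = tpr I [^] (1::nat) \<odot>\<^bsub>E (Suc r)\<^esub> K (Suc r) (k + m) ?x I" by (rule K_scale[OF x I(1)])
    also have "K (Suc r) (k + m) ?x I = K (Suc r) (k + m) ?e I \<ominus>\<^bsub>E (Suc r)\<^esub> K (Suc r) (k + m) (K (Suc r) (k + m) f) I"
      by (rule K_minus[OF e Kf I(1)])
    also have "\<dots> = tpr I [^] m \<odot>\<^bsub>E (Suc r)\<^esub> d r (e I)"
      using K_scale[OF e'(1) I(1)] K_K[OF f(1) I(1)] e'(3)[OF I] ti
        K_closed[OF e'(1) I(1), of k]
      by (simp add: a_minus_def)
    also have "tpr I [^] (1::nat) \<odot>\<^bsub>E (Suc r)\<^esub> (tpr I [^] m \<odot>\<^bsub>E (Suc r)\<^esub> d r (e I)) =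
        (tpr I [^] (m + 1)) \<odot>\<^bsub>E (Suc r)\<^esub> d r (e I)"
      using ti cochainsD[OF Suc.prems(2) I(1)]
      by (simp add: E.smult_assoc1[symmetric] nat_pow_mult[symmetric] m_comm)
    finally show ?thesis using ti cochainsD[OF Suc.prems(2) I(1)] by (simp add: d_smult)
  qed
  thus ?case using y(1) by blast
qed

end

section \<open>Localization and the Cech complex\<close>

lemma loc_module_sel:
  "carrier (loc_module R M s) = {frac R M s m k | m k. m \<in> carrier M}"
  "\<zero>\<^bsub>loc_module R M s\<^esub> = frac R M s \<zero>\<^bsub>M\<^esub> 0"
  by (simp_all add: loc_module_def)

section \<open>Fractions with powers of one element as denominators\<close>

context module begin

lemma pow_smult:
  "s \<in> carrier R \<Longrightarrow> x \<in> carrier M \<Longrightarrow> s [^] (a + b :: nat) \<odot>\<^bsub>M\<^esub> x = s [^] a \<odot>\<^bsub>M\<^esub> (s [^] b \<odot>\<^bsub>M\<^esub> x)"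
  by (simp add: R.nat_pow_mult[symmetric] smult_assoc1)

text \<open>Multiply the first equation by the power \<open>i + k''\<close> of \<open>s\<close> and
  the second by the power \<open>j + k\<close>: both then contain \<open>m'\<close> with the same
  total power.\<close>

lemma frac_trans:
  assumes s: "s \<in> carrier R" and m: "m \<in> carrier M" "m' \<in> carrier M" "m'' \<in> carrier M"
    and 1: "s [^] (j + k' :: nat) \<odot>\<^bsub>M\<^esub> m = s [^] (j + k) \<odot>\<^bsub>M\<^esub> m'"
    and 2: "s [^] (i + k'' :: nat) \<odot>\<^bsub>M\<^esub> m' = s [^] (i + k') \<odot>\<^bsub>M\<^esub> m''"
  shows "s [^] ((i + j + k') + k'') \<odot>\<^bsub>M\<^esub> m = s [^] ((i + j + k') + k) \<odot>\<^bsub>M\<^esub> m''"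
proof -
  have "s [^] ((i + j + k') + k'') \<odot>\<^bsub>M\<^esub> m = s [^] (i + k'') \<odot>\<^bsub>M\<^esub> (s [^] (j + k') \<odot>\<^bsub>M\<^esub> m)"
    using s m by (simp add: pow_smult[symmetric] ac_simps)
  also have "\<dots> = s [^] (j + k) \<odot>\<^bsub>M\<^esub> (s [^] (i + k'') \<odot>\<^bsub>M\<^esub> m')"
    unfolding 1 using s m by (simp add: pow_smult[symmetric] ac_simps)
  also have "\<dots> = s [^] ((i + j + k') + k) \<odot>\<^bsub>M\<^esub> m''"
    unfolding 2 using s m by (simp add: pow_smult[symmetric] ac_simps)
  finally show ?thesis .
qed

lemma frac_eq_iff:
  assumes s: "s \<in> carrier R" and m: "m \<in> carrier M" "m' \<in> carrier M"
  shows "frac R M s m k = frac R M s m' k' \<longleftrightarrow>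
    (\<exists>j::nat. s [^] (j + k') \<odot>\<^bsub>M\<^esub> m = s [^] (j + k) \<odot>\<^bsub>M\<^esub> m')"
proof
  assume eq: "frac R M s m k = frac R M s m' k'"
  have "(m', k') \<in> frac R M s m' k'" using m by (simp add: frac_def)
  thus "\<exists>j::nat. s [^] (j + k') \<odot>\<^bsub>M\<^esub> m = s [^] (j + k) \<odot>\<^bsub>M\<^esub> m'"
    unfolding eq[symmetric] by (simp add: frac_def)
next
  have sub: "frac R M s m' k' \<subseteq> frac R M s m k"
    if m: "m \<in> carrier M" "m' \<in> carrier M" "s [^] (j + k') \<odot>\<^bsub>M\<^esub> m = s [^] (j + k) \<odot>\<^bsub>M\<^esub> m'"
    for m m' k k' and j :: nat
  proof
    fix x assume "x \<in> frac R M s m' k'"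
    then obtain m'' k'' i where x: "x = (m'', k'')" "m'' \<in> carrier M"
      "s [^] (i + k'' :: nat) \<odot>\<^bsub>M\<^esub> m' = s [^] (i + k') \<odot>\<^bsub>M\<^esub> m''" by (auto simp: frac_def)
    show "x \<in> frac R M s m k"
      unfolding x(1) frac_def using x(2) frac_trans[OF s m(1,2) x(2) m(3) x(3)] by blast
  qed
  assume "\<exists>j::nat. s [^] (j + k') \<odot>\<^bsub>M\<^esub> m = s [^] (j + k) \<odot>\<^bsub>M\<^esub> m'"
  then obtain j :: nat where j: "s [^] (j + k') \<odot>\<^bsub>M\<^esub> m = s [^] (j + k) \<odot>\<^bsub>M\<^esub> m'" by blast
  show "frac R M s m k = frac R M s m' k'"
    using sub[OF m j] sub[OF m(2,1) j[symmetric]] by blast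
qed

lemma fracD:
  "(a, i) \<in> frac R M s m k \<Longrightarrow> a \<in> carrier M \<and> (\<exists>j::nat. s [^] (j + i) \<odot>\<^bsub>M\<^esub> m = s [^] (j + k) \<odot>\<^bsub>M\<^esub> a)"
  by (simp add: frac_def)

lemma frac_self: "m \<in> carrier M \<Longrightarrow> (m, k) \<in> frac R M s m k"
  by (simp add: frac_def)

lemma frac_scale:
  assumes "s \<in> carrier R" "m \<in> carrier M"
  shows "frac R M s (s [^] (j::nat) \<odot>\<^bsub>M\<^esub> m) (k + j) = frac R M s m k"
proof -
  have "s [^] (0 + k) \<odot>\<^bsub>M\<^esub> (s [^] j \<odot>\<^bsub>M\<^esub> m) = s [^] (0 + (k + j)) \<odot>\<^bsub>M\<^esub> m"
    using assms by (simp add: pow_smult[symmetric])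
  thus ?thesis
    using assms by (intro iffD2[OF frac_eq_iff] exI[of _ 0]) simp_all
qed

text \<open>An operation on fractions is a union over all representatives of its argument; once they
  all give one class, the union is that class.\<close>

lemma frac_UN:
  assumes "m \<in> carrier M" "\<And>a i. (a, i) \<in> frac R M s m k \<Longrightarrow> F a i = F m k"
  shows "(\<Union>(a, i)\<in>frac R M s m k. F a i) = F m k"
proof (rule SUP_eq_const)
  show "frac R M s m k \<noteq> {}" using frac_self[OF assms(1)] by blast
  show "(case x of (a, i) \<Rightarrow> F a i) = F m k" if "x \<in> frac R M s m k" for x
    using assms(2)[of "fst x" "snd x"] that by (simp add: case_prod_beta)
qed

lemma frac_add:
  assumes s: "s \<in> carrier R" and m: "m \<in> carrier M" "m' \<in> carrier M"
  shows "frac R M s m k \<oplus>\<^bsub>loc_module R M s\<^esub> frac R M s m' k = frac R M s (m \<oplus>\<^bsub>M\<^esub> m') k"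
proof -
  have *: "frac R M s (s [^] i' \<odot>\<^bsub>M\<^esub> a \<oplus>\<^bsub>M\<^esub> s [^] i \<odot>\<^bsub>M\<^esub> b) (i + i') = frac R M s (m \<oplus>\<^bsub>M\<^esub> m') k"
    if ab: "(a, i) \<in> frac R M s m k" "(b, i') \<in> frac R M s m' k" for a b i i'
  proof -
    obtain j j' :: nat where c: "a \<in> carrier M" "b \<in> carrier M"
      and j: "s [^] (j + i) \<odot>\<^bsub>M\<^esub> m = s [^] (j + k) \<odot>\<^bsub>M\<^esub> a"
        "s [^] (j' + i') \<odot>\<^bsub>M\<^esub> m' = s [^] (j' + k) \<odot>\<^bsub>M\<^esub> b"
      using fracD[OF ab(1)] fracD[OF ab(2)] by blast
    have 1: "s [^] (j + j' + k) \<odot>\<^bsub>M\<^esub> (s [^] i' \<odot>\<^bsub>M\<^esub> a) = s [^] (j' + i') \<odot>\<^bsub>M\<^esub> (s [^] (j + k) \<odot>\<^bsub>M\<^esub> a)"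
      using s c by (simp add: pow_smult[symmetric] ac_simps)
    have 2: "s [^] (j + j' + k) \<odot>\<^bsub>M\<^esub> (s [^] i \<odot>\<^bsub>M\<^esub> b) = s [^] (j + i) \<odot>\<^bsub>M\<^esub> (s [^] (j' + k) \<odot>\<^bsub>M\<^esub> b)"
      using s c by (simp add: pow_smult[symmetric] ac_simps)
    have "s [^] (j + j' + k) \<odot>\<^bsub>M\<^esub> (s [^] i' \<odot>\<^bsub>M\<^esub> a \<oplus>\<^bsub>M\<^esub> s [^] i \<odot>\<^bsub>M\<^esub> b) =
        s [^] (j + j' + k) \<odot>\<^bsub>M\<^esub> (s [^] i' \<odot>\<^bsub>M\<^esub> a) \<oplus>\<^bsub>M\<^esub> s [^] (j + j' + k) \<odot>\<^bsub>M\<^esub> (s [^] i \<odot>\<^bsub>M\<^esub> b)"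
      using s c by (simp add: smult_r_distr)
    also have "\<dots> = s [^] (j + j' + (i + i')) \<odot>\<^bsub>M\<^esub> (m \<oplus>\<^bsub>M\<^esub> m')"
      unfolding 1 2 j[symmetric] using s m by (simp add: pow_smult[symmetric] smult_r_distr ac_simps)
    finally show ?thesis using frac_eq_iff[OF s] s c m by auto
  qed
  have "frac R M s m k \<oplus>\<^bsub>loc_module R M s\<^esub> frac R M s m' k =
      (\<Union>(a, i)\<in>frac R M s m k. \<Union>(b, i')\<in>frac R M s m' k.
        frac R M s (s [^] i' \<odot>\<^bsub>M\<^esub> a \<oplus>\<^bsub>M\<^esub> s [^] i \<odot>\<^bsub>M\<^esub> b) (i + i'))"
    by (simp add: loc_module_def)
  also have "\<dots> = frac R M s (m \<oplus>\<^bsub>M\<^esub> m') k"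
    using frac_self[OF m(1), where k = k and s = s] frac_self[OF m(2), where k = k and s = s]
    by (intro SUP_eq_const) (auto simp: * intro!: SUP_eq_const)
  finally show ?thesis .
qed

lemma frac_smult:
  assumes s: "s \<in> carrier R" and m: "m \<in> carrier M" and r: "r \<in> carrier R"
  shows "r \<odot>\<^bsub>loc_module R M s\<^esub> frac R M s m k = frac R M s (r \<odot>\<^bsub>M\<^esub> m) k"
proof -
  have "r \<odot>\<^bsub>loc_module R M s\<^esub> frac R M s m k = (\<Union>(a, i)\<in>frac R M s m k. frac R M s (r \<odot>\<^bsub>M\<^esub> a) i)"
    by (simp add: loc_module_def)
  also have "\<dots> = frac R M s (r \<odot>\<^bsub>M\<^esub> m) k"
  proof (rule frac_UN[OF m])
    fix a i assume "(a, i) \<in> frac R M s m k"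
    then obtain j :: nat where a: "a \<in> carrier M" "s [^] (j + i) \<odot>\<^bsub>M\<^esub> m = s [^] (j + k) \<odot>\<^bsub>M\<^esub> a"
      using fracD by blast
    have "s [^] (j + k) \<odot>\<^bsub>M\<^esub> (r \<odot>\<^bsub>M\<^esub> a) = s [^] (j + i) \<odot>\<^bsub>M\<^esub> (r \<odot>\<^bsub>M\<^esub> m)"
      using s r a m smult_lcomm[of _ r] by simp
    thus "frac R M s (r \<odot>\<^bsub>M\<^esub> a) i = frac R M s (r \<odot>\<^bsub>M\<^esub> m) k"
      using frac_eq_iff[OF s] r a m by blast
  qed
  finally show ?thesis .
qed

lemma frac_zero: "s \<in> carrier R \<Longrightarrow> frac R M s \<zero>\<^bsub>M\<^esub> k = \<zero>\<^bsub>loc_module R M s\<^esub>"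
  using frac_scale[of s "\<zero>\<^bsub>M\<^esub>" k 0] by (simp add: loc_module_sel)

lemma loc_common:
  assumes s: "s \<in> carrier R" and U: "U \<in> carrier (loc_module R M s)" and V: "V \<in> carrier (loc_module R M s)"
  shows "\<exists>m\<in>carrier M. \<exists>m'\<in>carrier M. \<exists>k. U = frac R M s m k \<and> V = frac R M s m' k"
proof -
  obtain m k m' k' where *: "m \<in> carrier M" "U = frac R M s m k" "m' \<in> carrier M" "V = frac R M s m' k'"
    using U V by (auto simp: loc_module_sel)
  have "U = frac R M s (s [^] k' \<odot>\<^bsub>M\<^esub> m) (k + k')" "V = frac R M s (s [^] k \<odot>\<^bsub>M\<^esub> m') (k + k')"
    using frac_scale[OF s *(1), of k' k] frac_scale[OF s *(3), of k k'] *(2,4) by (simp_all add: add.commute)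
  thus ?thesis using s * by blast
qed

lemma loc_module_module:
  assumes s: "s \<in> carrier R"
  shows "Module.module R (loc_module R M s)"
proof -
  let ?L = "loc_module R M s"
  note q = frac_add[OF s] frac_smult[OF s]
  have in_L: "frac R M s m k \<in> carrier ?L" if "m \<in> carrier M" for m k
    using that by (auto simp: loc_module_sel)
  have ab: "abelian_group ?L"
  proof (rule abelian_groupI)
    fix U V assume UV: "U \<in> carrier ?L" "V \<in> carrier ?L"
    obtain m m' k where m: "m \<in> carrier M" "m' \<in> carrier M" "U = frac R M s m k" "V = frac R M s m' k"
      using loc_common[OF s UV] by blast
    show "U \<oplus>\<^bsub>?L\<^esub> V \<in> carrier ?L" using m in_L by (simp add: q)
    show "U \<oplus>\<^bsub>?L\<^esub> V = V \<oplus>\<^bsub>?L\<^esub> U" using m by (simp add: q M.a_comm)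
    fix W assume W: "W \<in> carrier ?L"
    then obtain n l where n: "n \<in> carrier M" "W = frac R M s n l" by (auto simp: loc_module_sel)
    have e: "U = frac R M s (s [^] l \<odot>\<^bsub>M\<^esub> m) (k + l)" "V = frac R M s (s [^] l \<odot>\<^bsub>M\<^esub> m') (k + l)"
      "W = frac R M s (s [^] k \<odot>\<^bsub>M\<^esub> n) (k + l)"
      using m(3,4) n(2) frac_scale[OF s m(1), of l k] frac_scale[OF s m(2), of l k] frac_scale[OF s n(1), of k l]
      by (simp_all add: add.commute)
    show "U \<oplus>\<^bsub>?L\<^esub> V \<oplus>\<^bsub>?L\<^esub> W = U \<oplus>\<^bsub>?L\<^esub> (V \<oplus>\<^bsub>?L\<^esub> W)"
      unfolding e using m(1,2) n(1) s by (simp add: q M.a_assoc)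
  next
    show "\<zero>\<^bsub>?L\<^esub> \<in> carrier ?L" by (auto simp: loc_module_sel)
  next
    fix U assume "U \<in> carrier ?L"
    then obtain n l where n: "n \<in> carrier M" "U = frac R M s n l" by (auto simp: loc_module_sel)
    show "\<zero>\<^bsub>?L\<^esub> \<oplus>\<^bsub>?L\<^esub> U = U" unfolding frac_zero[OF s, of l, symmetric] using n by (simp add: q)
    show "\<exists>V\<in>carrier ?L. V \<oplus>\<^bsub>?L\<^esub> U = \<zero>\<^bsub>?L\<^esub>"
      using n in_L[of "\<ominus>\<^bsub>M\<^esub> n" l]
      by (intro bexI[of _ "frac R M s (\<ominus>\<^bsub>M\<^esub> n) l"]) (simp_all add: q M.l_neg frac_zero[OF s])
  qed
  show ?thesis
  proof (rule moduleI[OF R.cring_axioms ab])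
    fix a U V assume a: "a \<in> carrier R" and UV: "U \<in> carrier ?L" "V \<in> carrier ?L"
    obtain m m' k where m: "m \<in> carrier M" "m' \<in> carrier M" "U = frac R M s m k" "V = frac R M s m' k"
      using loc_common[OF s UV] by blast
    show "a \<odot>\<^bsub>?L\<^esub> (U \<oplus>\<^bsub>?L\<^esub> V) = a \<odot>\<^bsub>?L\<^esub> U \<oplus>\<^bsub>?L\<^esub> a \<odot>\<^bsub>?L\<^esub> V"
      using m a by (simp add: q smult_r_distr)
    show "a \<odot>\<^bsub>?L\<^esub> U \<in> carrier ?L" using m a in_L by (simp add: q)
  qed (auto simp: loc_module_sel(1) q smult_l_distr smult_assoc1)
qed

lemma frac_hom:
  assumes s: "s \<in> carrier R"
  shows "(\<lambda>m. frac R M s m k) \<in> mod_homs R M (loc_module R M s)"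
  by (rule mod_homsI) (auto simp: frac_add[OF s] frac_smult[OF s] loc_module_sel)

lemma loc_map_frac:
  assumes s: "s \<in> carrier R" and u: "u \<in> carrier R" and m: "m \<in> carrier M"
  shows "loc_map R M s u (frac R M s m k) = frac R M (s \<otimes> u) ((u [^] k) \<odot>\<^bsub>M\<^esub> m) k"
  unfolding loc_map_def
proof (rule frac_UN[OF m])
  fix a i assume "(a, i) \<in> frac R M s m k"
  then obtain j :: nat where a: "a \<in> carrier M" "s [^] (j + i) \<odot>\<^bsub>M\<^esub> m = s [^] (j + k) \<odot>\<^bsub>M\<^esub> a"
    using fracD by blast
  have su: "(s \<otimes> u) [^] n \<odot>\<^bsub>M\<^esub> (u [^] l \<odot>\<^bsub>M\<^esub> x) = u [^] (n + l) \<odot>\<^bsub>M\<^esub> (s [^] n \<odot>\<^bsub>M\<^esub> x)"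
    if "x \<in> carrier M" for n l :: nat and x
    using s u that smult_lcomm[of "u [^] (n + l)" "s [^] n" x] pow_smult[of u x n l]
    by (simp add: R.nat_pow_distrib smult_assoc1)
  have "(s \<otimes> u) [^] (j + k) \<odot>\<^bsub>M\<^esub> (u [^] i \<odot>\<^bsub>M\<^esub> a) = (s \<otimes> u) [^] (j + i) \<odot>\<^bsub>M\<^esub> (u [^] k \<odot>\<^bsub>M\<^esub> m)"
    unfolding su[OF a(1)] su[OF m] a(2)[symmetric] by (simp add: ac_simps)
  thus "frac R M (s \<otimes> u) ((u [^] i) \<odot>\<^bsub>M\<^esub> a) i = frac R M (s \<otimes> u) ((u [^] k) \<odot>\<^bsub>M\<^esub> m) k"
    using frac_eq_iff[of "s \<otimes> u"] s u a(1) m by (metis R.m_closed R.nat_pow_closed smult_closed)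
qed

end

lemma cohomology_quotient:
  assumes C: "\<And>p. Module.module R (C p)" and d: "\<And>p. d p \<in> mod_homs R (C p) (C (Suc p))"
    and dd: "\<And>p x. x \<in> carrier (C p) \<Longrightarrow> d (Suc p) (d p x) = \<zero>\<^bsub>C (Suc (Suc p))\<^esub>"
  shows "Module.module R ((C p)\<lparr>carrier := cocycles C d p\<rparr>)"
    and "submodule (coboundaries C d (Suc p)) R ((C (Suc p))\<lparr>carrier := cocycles C d (Suc p)\<rparr>)"
proof -
  have Z: "submodule (cocycles C d p) R (C p)" for p
    unfolding cocycles_def by (rule module.kernel_submodule[OF C C d])
  show M: "Module.module R ((C p)\<lparr>carrier := cocycles C d p\<rparr>)" for p
    by (rule submodule.submodule_is_module[OF Z C])
  have "submodule (coboundaries C d (Suc p)) R (C (Suc p))"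
    unfolding coboundaries_def nat.case by (rule module.image_submodule[OF C C d])
  hence 1: "Module.module R ((C (Suc p))\<lparr>carrier := coboundaries C d (Suc p)\<rparr>)"
    by (rule submodule.submodule_is_module[OF _ C])
  have sub: "coboundaries C d (Suc p) \<subseteq> cocycles C d (Suc p)"
    using dd mod_homs_closed[OF d] by (auto simp: coboundaries_def cocycles_def)
  show "submodule (coboundaries C d (Suc p)) R ((C (Suc p))\<lparr>carrier := cocycles C d (Suc p)\<rparr>)"
    by (rule module.module_incl_imp_submodule[OF M]) (use sub 1 in auto)
qed

section \<open>The Cech complex in terms of Koszul cochains\<close>

locale cech = module +
  fixes D :: nat and t :: "nat \<Rightarrow> 'a"
  assumes t_closed: "t \<in> {1..D} \<rightarrow> carrier R"
begin

abbreviation tprod :: "nat set \<Rightarrow> 'a" where "tprod I \<equiv> (\<Otimes>i\<in>I. t i)"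

text \<open>There are only finitely many index sets, so every Cech cochain can be written with one
  exponent \<open>k\<close> in all its denominators. It is thus a Koszul cochain together with
  \<open>k\<close>, up to raising the exponent.\<close>

definition cech_frac :: "nat \<Rightarrow> nat \<Rightarrow> (nat set \<Rightarrow> 'c) \<Rightarrow> nat set \<Rightarrow> ('c \<times> nat) set" where
  "cech_frac p k c = (\<lambda>I\<in>cech_indices D p. frac R M (tprod I) (c I) k)"

lemma indicesD: "I \<in> cech_indices D p \<Longrightarrow> I \<subseteq> {1..D}" "I \<in> cech_indices D p \<Longrightarrow> card I = p"
  "I \<in> cech_indices D p \<Longrightarrow> finite I"
  by (auto simp: cech_indices_def intro: finite_subset)

lemma finite_indices: "finite (cech_indices D p)"
  by (rule finite_subset[of _ "Pow {1..D}"]) (auto simp: cech_indices_def)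

lemma tprod_closed: "I \<subseteq> {1..D} \<Longrightarrow> tprod I \<in> carrier R"
  using t_closed by (intro R.finprod_closed) (auto simp: Pi_iff)

lemma cech_module_sel:
  "carrier (cech_module R D t M p) = (\<Pi>\<^sub>E I\<in>cech_indices D p. carrier (loc_module R M (tprod I)))"
  "\<zero>\<^bsub>cech_module R D t M p\<^esub> = (\<lambda>I\<in>cech_indices D p. \<zero>\<^bsub>loc_module R M (tprod I)\<^esub>)"
  "\<phi> \<oplus>\<^bsub>cech_module R D t M p\<^esub> \<psi> = (\<lambda>I\<in>cech_indices D p. \<phi> I \<oplus>\<^bsub>loc_module R M (tprod I)\<^esub> \<psi> I)"
  "r \<odot>\<^bsub>cech_module R D t M p\<^esub> \<phi> = (\<lambda>I\<in>cech_indices D p. r \<odot>\<^bsub>loc_module R M (tprod I)\<^esub> \<phi> I)"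
  by (simp_all add: cech_module_def cech_loc_def)

lemma cech_frac_carrier:
  "c \<in> cochains D (carrier M) \<Longrightarrow> cech_frac p k c \<in> carrier (cech_module R D t M p)"
  by (auto simp: cech_frac_def cech_module_sel loc_module_sel dest: cochainsD indicesD)

lemma cech_frac_eq_iff:
  assumes c: "c \<in> cochains D (carrier M)" "c' \<in> cochains D (carrier M)"
  shows "cech_frac p k c = cech_frac p k' c' \<longleftrightarrow>
    (\<exists>j::nat. \<forall>I\<in>cech_indices D p. tprod I [^] (j + k') \<odot>\<^bsub>M\<^esub> c I = tprod I [^] (j + k) \<odot>\<^bsub>M\<^esub> c' I)"
proof
  have eq: "frac R M (tprod I) (c I) k = frac R M (tprod I) (c' I) k' \<longleftrightarrow>
      (\<exists>j::nat. tprod I [^] (j + k') \<odot>\<^bsub>M\<^esub> c I = tprod I [^] (j + k) \<odot>\<^bsub>M\<^esub> c' I)"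
    if "I \<in> cech_indices D p" for I
    using that by (intro frac_eq_iff tprod_closed cochainsD[OF c(1)] cochainsD[OF c(2)] indicesD)
  { assume "cech_frac p k c = cech_frac p k' c'"
    hence "\<And>I. cech_frac p k c I = cech_frac p k' c' I" by simp
    note cI = this
    have "frac R M (tprod I) (c I) k = frac R M (tprod I) (c' I) k'" if "I \<in> cech_indices D p" for I
      using cI[of I] that by (simp add: cech_frac_def)
    hence "\<forall>I\<in>cech_indices D p. \<exists>j::nat. tprod I [^] (j + k') \<odot>\<^bsub>M\<^esub> c I = tprod I [^] (j + k) \<odot>\<^bsub>M\<^esub> c' I"
      by (intro ballI iffD1[OF eq])
    then obtain j :: "nat set \<Rightarrow> nat" where j: "\<And>I. I \<in> cech_indices D p \<Longrightarrow>
        tprod I [^] (j I + k') \<odot>\<^bsub>M\<^esub> c I = tprod I [^] (j I + k) \<odot>\<^bsub>M\<^esub> c' I" by metis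
    \<comment> \<open>An exponent that serves all \<open>I\<close> at once: the sum bounds each
      summand, and a larger exponent only multiplies the equation further.\<close>
    define N where "N = (\<Sum>I\<in>cech_indices D p. j I)"
    have "tprod I [^] (N + k') \<odot>\<^bsub>M\<^esub> c I = tprod I [^] (N + k) \<odot>\<^bsub>M\<^esub> c' I" if I: "I \<in> cech_indices D p" for I
    proof -
      have tc: "tprod I \<in> carrier R" "c I \<in> carrier M" "c' I \<in> carrier M"
        using indicesD(1)[OF I] tprod_closed c by (auto dest: cochainsD)
      have "j I \<le> N" unfolding N_def by (rule member_le_sum[OF I]) (use finite_indices in auto)
      then obtain a where a: "N = a + j I" by (metis add.commute le_Suc_ex)
      have "tprod I [^] (N + k') \<odot>\<^bsub>M\<^esub> c I = tprod I [^] a \<odot>\<^bsub>M\<^esub> (tprod I [^] (j I + k') \<odot>\<^bsub>M\<^esub> c I)"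
        unfolding a using tc by (simp add: pow_smult[symmetric] add.assoc)
      also have "\<dots> = tprod I [^] (N + k) \<odot>\<^bsub>M\<^esub> c' I"
        unfolding j[OF I] a using tc by (simp add: pow_smult[symmetric] add.assoc)
      finally show ?thesis .
    qed
    thus "\<exists>j::nat. \<forall>I\<in>cech_indices D p. tprod I [^] (j + k') \<odot>\<^bsub>M\<^esub> c I = tprod I [^] (j + k) \<odot>\<^bsub>M\<^esub> c' I" by blast }
  assume "\<exists>j::nat. \<forall>I\<in>cech_indices D p. tprod I [^] (j + k') \<odot>\<^bsub>M\<^esub> c I = tprod I [^] (j + k) \<odot>\<^bsub>M\<^esub> c' I"
  thus "cech_frac p k c = cech_frac p k' c'"
    unfolding cech_frac_def using eq by (intro restrict_ext) blast
qed

lemma scale_cochains: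
  "c \<in> cochains D (carrier M) \<Longrightarrow> (\<lambda>I. tprod I [^] (j::nat) \<odot>\<^bsub>M\<^esub> c I) \<in> cochains D (carrier M)"
  using tprod_closed by (auto simp: cochains_def)

lemma cech_frac_scale:
  "c \<in> cochains D (carrier M) \<Longrightarrow> cech_frac p (k + j) (\<lambda>I. tprod I [^] (j::nat) \<odot>\<^bsub>M\<^esub> c I) = cech_frac p k c"
  unfolding cech_frac_def
  by (rule restrict_ext) (simp add: frac_scale tprod_closed[OF indicesD(1)] cochainsD[OF _ indicesD(1)])

lemma cech_frac_onto:
  assumes \<phi>: "\<phi> \<in> carrier (cech_module R D t M p)"
  shows "\<exists>k. \<exists>c\<in>cochains D (carrier M). \<phi> = cech_frac p k c"
proof -
  have "\<forall>I\<in>cech_indices D p. \<exists>m k. m \<in> carrier M \<and> \<phi> I = frac R M (tprod I) m k"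
    using \<phi> unfolding cech_module_sel loc_module_sel PiE_iff by blast
  then obtain m k where mk: "\<And>I. I \<in> cech_indices D p \<Longrightarrow> m I \<in> carrier M \<and> \<phi> I = frac R M (tprod I) (m I) (k I)"
    by metis
  define N where "N = (\<Sum>I\<in>cech_indices D p. k I)"
  define c where "c I = (if I \<in> cech_indices D p then tprod I [^] (N - k I) \<odot>\<^bsub>M\<^esub> m I else \<zero>\<^bsub>M\<^esub>)" for I
  have "c \<in> cochains D (carrier M)" using mk tprod_closed by (auto simp: cochains_def c_def)
  moreover have "\<phi> I = cech_frac p N c I" for I
  proof (cases "I \<in> cech_indices D p")
    case True
    have "k I \<le> N" unfolding N_def by (rule member_le_sum[OF True]) (use finite_indices in auto)
    hence "N = k I + (N - k I)" by simp
    thus ?thesis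
      using frac_scale[OF tprod_closed[OF indicesD(1)[OF True]], of "m I" "N - k I" "k I"] mk[OF True] True
      by (simp add: cech_frac_def c_def)
  qed (use \<phi> in \<open>auto simp: cech_frac_def cech_module_sel PiE_iff extensional_def\<close>)
  ultimately show ?thesis by blast
qed

lemma cech_frac_add:
  "c \<in> cochains D (carrier M) \<Longrightarrow> c' \<in> cochains D (carrier M) \<Longrightarrow>
    cech_frac p k c \<oplus>\<^bsub>cech_module R D t M p\<^esub> cech_frac p k c' = cech_frac p k (\<lambda>I. c I \<oplus>\<^bsub>M\<^esub> c' I)"
  unfolding cech_module_sel cech_frac_def
  by (rule restrict_ext) (simp add: frac_add tprod_closed[OF indicesD(1)] cochainsD[OF _ indicesD(1)])

lemma cech_frac_smult:
  "c \<in> cochains D (carrier M) \<Longrightarrow> r \<in> carrier R \<Longrightarrow>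
    r \<odot>\<^bsub>cech_module R D t M p\<^esub> cech_frac p k c = cech_frac p k (\<lambda>I. r \<odot>\<^bsub>M\<^esub> c I)"
  unfolding cech_module_sel cech_frac_def
  by (rule restrict_ext) (simp add: frac_smult tprod_closed[OF indicesD(1)] cochainsD[OF _ indicesD(1)])

lemma cech_frac_zero: "cech_frac p k (\<lambda>_. \<zero>\<^bsub>M\<^esub>) = \<zero>\<^bsub>cech_module R D t M p\<^esub>"
  unfolding cech_module_sel cech_frac_def
  by (rule restrict_ext) (simp add: frac_zero tprod_closed[OF indicesD(1)])

lemma cech_frac_cong:
  "(\<And>I. I \<subseteq> {1..D} \<Longrightarrow> card I = p \<Longrightarrow> c I = c' I) \<Longrightarrow> cech_frac p k c = cech_frac p k c'"
  unfolding cech_frac_def by (rule restrict_ext) (simp add: indicesD)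

lemma cech_module_module: "Module.module R (cech_module R D t M p)"
proof -
  let ?C = "cech_module R D t M p"
  have L: "Module.module R (loc_module R M (tprod I))" if "I \<in> cech_indices D p" for I
    by (rule loc_module_module[OF tprod_closed[OF indicesD(1)[OF that]]])
  note ag = module.axioms(2)[OF L]
  note lf = abelian_monoid.a_closed[OF abelian_group.axioms(1)[OF ag]]
    abelian_monoid.zero_closed[OF abelian_group.axioms(1)[OF ag]]
    abelian_monoid.a_assoc[OF abelian_group.axioms(1)[OF ag]]
    abelian_monoid.a_comm[OF abelian_group.axioms(1)[OF ag]]
    abelian_monoid.l_zero[OF abelian_group.axioms(1)[OF ag]]
    module.smult_closed[OF L] module.smult_l_distr[OF L] module.smult_r_distr[OF L]
    module.smult_assoc1[OF L] module.smult_one[OF L]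
    abelian_group.a_inv_closed[OF ag] abelian_group.l_neg[OF ag]
  have ab: "abelian_group ?C"
  proof (rule abelian_groupI)
    fix \<phi> \<psi> \<chi> assume c: "\<phi> \<in> carrier ?C" "\<psi> \<in> carrier ?C" "\<chi> \<in> carrier ?C"
    show "\<phi> \<oplus>\<^bsub>?C\<^esub> \<psi> \<oplus>\<^bsub>?C\<^esub> \<chi> = \<phi> \<oplus>\<^bsub>?C\<^esub> (\<psi> \<oplus>\<^bsub>?C\<^esub> \<chi>)"
      using c by (auto simp: cech_module_sel PiE_iff lf(3) intro!: restrict_ext)
  next
    fix \<phi> \<psi> assume c: "\<phi> \<in> carrier ?C" "\<psi> \<in> carrier ?C"
    show "\<phi> \<oplus>\<^bsub>?C\<^esub> \<psi> \<in> carrier ?C" using c by (auto simp: cech_module_sel PiE_iff lf(1))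
    show "\<phi> \<oplus>\<^bsub>?C\<^esub> \<psi> = \<psi> \<oplus>\<^bsub>?C\<^esub> \<phi>" using c by (auto simp: cech_module_sel PiE_iff lf(4) intro!: restrict_ext)
  next
    show "\<zero>\<^bsub>?C\<^esub> \<in> carrier ?C" by (auto simp: cech_module_sel lf(2))
    fix \<phi> assume c: "\<phi> \<in> carrier ?C"
    show "\<zero>\<^bsub>?C\<^esub> \<oplus>\<^bsub>?C\<^esub> \<phi> = \<phi>"
      using c by (intro extensionalityI[where A = "cech_indices D p"]) (auto simp: cech_module_sel PiE_iff lf(5))
    show "\<exists>\<psi>\<in>carrier ?C. \<psi> \<oplus>\<^bsub>?C\<^esub> \<phi> = \<zero>\<^bsub>?C\<^esub>"
      using c by (intro bexI[of _ "\<lambda>I\<in>cech_indices D p. \<ominus>\<^bsub>loc_module R M (tprod I)\<^esub> \<phi> I"])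
        (auto simp: cech_module_sel PiE_iff lf(11,12) intro!: restrict_ext)
  qed
  show ?thesis
  proof (rule moduleI[OF R.cring_axioms ab])
    fix \<phi> assume c: "\<phi> \<in> carrier ?C"
    show "\<one> \<odot>\<^bsub>?C\<^esub> \<phi> = \<phi>"
      using c by (intro extensionalityI[where A = "cech_indices D p"]) (auto simp: cech_module_sel PiE_iff lf(10))
  qed (auto simp: cech_module_sel PiE_iff lf(1,6-9) intro!: restrict_ext)
qed

lemma kos_cochains:
  "c \<in> cochains D (carrier M) \<Longrightarrow> kos R M (\<lambda>i. t i [^] (k::nat)) c \<in> cochains D (carrier M)"
  by (rule cochainsI) (rule kos_cochain_closed, use t_closed in \<open>auto simp: Pi_iff\<close>)

lemma t_pow: "I \<subseteq> {1..D} \<Longrightarrow> (\<lambda>i. t i [^] (k::nat)) \<in> I \<rightarrow> carrier R"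
  using t_closed by (auto simp: Pi_iff)

lemma kos_scale:
  assumes "c \<in> cochains D (carrier M)" "I \<subseteq> {1..D}"
  shows "kos R M (\<lambda>i. t i [^] (k + m :: nat)) (\<lambda>J. tprod J [^] m \<odot>\<^bsub>M\<^esub> c J) I =
    tprod I [^] m \<odot>\<^bsub>M\<^esub> kos R M (\<lambda>i. t i [^] k) c I"
proof (rule kos_rescale)
  show "finite I" using assms(2) finite_subset by blast
  show "t \<in> I \<rightarrow> carrier R" using t_closed assms(2) by auto
qed (rule cochains_Diff[OF assms])

text \<open>Restriction from \<open>I - {i}\<close> to \<open>I\<close> turns the denominator into
  the \<open>k\<close>-th power of the larger product and multiplies the numerator by
  \<open>t i [^] k\<close>. At fixed \<open>k\<close> the signed sum of the restrictions is
  therefore the Koszul differential of the \<open>k\<close>-th powers.\<close>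

lemma cech_diff_frac:
  assumes c: "c \<in> cochains D (carrier M)"
  shows "cech_diff R D t M p (cech_frac p k c) = cech_frac (Suc p) k (kos R M (\<lambda>i. t i [^] k) c)"
  unfolding cech_diff_def cech_frac_def[of "Suc p"] cech_loc_def
proof (rule restrict_ext)
  fix I assume I: "I \<in> cech_indices D (Suc p)"
  note I' = indicesD[OF I]
  let ?L = "loc_module R M (tprod I)"
  have tI: "tprod I \<in> carrier R" by (rule tprod_closed[OF I'(1)])
  interpret L: module R ?L by (rule loc_module_module[OF tI])
  have summand: "((\<ominus> \<one>) [^] card {i' \<in> I. i' < i}) \<odot>\<^bsub>?L\<^esub>
      loc_map R M (tprod (I - {i})) (t i) (cech_frac p k c (I - {i})) =
      frac R M (tprod I) (((\<ominus> \<one>) [^] card {i' \<in> I. i' < i}) \<odot>\<^bsub>M\<^esub> (t i [^] k \<odot>\<^bsub>M\<^esub> c (I - {i}))) k"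
    (is "?l = ?r") and summand_c: "((\<ominus> \<one>) [^] card {i' \<in> I. i' < i}) \<odot>\<^bsub>M\<^esub> (t i [^] k \<odot>\<^bsub>M\<^esub> c (I - {i})) \<in> carrier M"
    if i: "i \<in> I" for i
  proof -
    have J: "I - {i} \<in> cech_indices D p" using I i I' by (auto simp: cech_indices_def card_Diff_singleton)
    have ti: "t i \<in> carrier R" using i I' t_closed by (auto simp: Pi_iff)
    have tJ: "tprod (I - {i}) \<in> carrier R" by (rule tprod_closed[OF indicesD(1)[OF J]])
    have cJ: "c (I - {i}) \<in> carrier M" by (rule cochainsD[OF c indicesD(1)[OF J]])
    have "tprod I = tprod (insert i (I - {i}))" using i by (simp add: insert_absorb)
    also have "\<dots> = t i \<otimes> tprod (I - {i})"
      by (rule R.finprod_insert) (use I' ti t_closed in \<open>auto simp: Pi_iff\<close>)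
    finally have e: "tprod (I - {i}) \<otimes> t i = tprod I" using ti tJ by (simp add: R.m_comm)
    have "loc_map R M (tprod (I - {i})) (t i) (cech_frac p k c (I - {i})) =
        frac R M (tprod I) (t i [^] k \<odot>\<^bsub>M\<^esub> c (I - {i})) k"
      using loc_map_frac[OF tJ ti cJ] J e by (simp add: cech_frac_def)
    thus "?l = ?r" using frac_smult[OF tI] ti cJ by simp
    show "((\<ominus> \<one>) [^] card {i' \<in> I. i' < i}) \<odot>\<^bsub>M\<^esub> (t i [^] k \<odot>\<^bsub>M\<^esub> c (I - {i})) \<in> carrier M" using ti cJ by simp
  qed
  have "(\<Oplus>\<^bsub>?L\<^esub>i\<in>I. ((\<ominus> \<one>) [^] card {i' \<in> I. i' < i}) \<odot>\<^bsub>?L\<^esub>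
      loc_map R M (tprod (I - {i})) (t i) (cech_frac p k c (I - {i}))) =
    (\<Oplus>\<^bsub>?L\<^esub>i\<in>I. frac R M (tprod I) (((\<ominus> \<one>) [^] card {i' \<in> I. i' < i}) \<odot>\<^bsub>M\<^esub> (t i [^] k \<odot>\<^bsub>M\<^esub> c (I - {i}))) k)"
    by (rule L.finsum_cong') (use summand summand_c mod_homs_closed[OF frac_hom[OF tI]] in auto)
  also have "\<dots> = frac R M (tprod I) (kos R M (\<lambda>i. t i [^] k) c I) k"
    unfolding kos_def
    by (rule mod_homs_finsum[OF module_axioms L.module_axioms frac_hom[OF tI] I'(3), symmetric])
      (use summand_c in auto)
  finally show "(\<Oplus>\<^bsub>?L\<^esub>i\<in>I. ((\<ominus> \<one>) [^] card {i' \<in> I. i' < i}) \<odot>\<^bsub>?L\<^esub>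
      loc_map R M (tprod (I - {i})) (t i) (cech_frac p k c (I - {i}))) =
      frac R M (tprod I) (kos R M (\<lambda>i. t i [^] k) c I) k" .
qed

lemma cech_common:
  assumes "\<phi> \<in> carrier (cech_module R D t M p)" "\<psi> \<in> carrier (cech_module R D t M p)"
  shows "\<exists>k. \<exists>c\<in>cochains D (carrier M). \<exists>c'\<in>cochains D (carrier M). \<phi> = cech_frac p k c \<and> \<psi> = cech_frac p k c'"
proof -
  obtain k c k' c' where c: "c \<in> cochains D (carrier M)" "\<phi> = cech_frac p k c"
    "c' \<in> cochains D (carrier M)" "\<psi> = cech_frac p k' c'" using assms cech_frac_onto by meson
  have "\<phi> = cech_frac p (k + k') (\<lambda>I. tprod I [^] k' \<odot>\<^bsub>M\<^esub> c I)"
    "\<psi> = cech_frac p (k + k') (\<lambda>I. tprod I [^] k \<odot>\<^bsub>M\<^esub> c' I)"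
    using cech_frac_scale[OF c(1), of p k k'] cech_frac_scale[OF c(3), of p k' k] c(2,4)
    by (simp_all add: add.commute)
  thus ?thesis using scale_cochains[OF c(1)] scale_cochains[OF c(3)] by blast
qed

lemma cech_diff_hom: "cech_diff R D t M p \<in> mod_homs R (cech_module R D t M p) (cech_module R D t M (Suc p))"
proof (rule mod_homsI)
  fix \<phi> assume "\<phi> \<in> carrier (cech_module R D t M p)"
  then obtain k c where c: "c \<in> cochains D (carrier M)" "\<phi> = cech_frac p k c" using cech_frac_onto by blast
  show "cech_diff R D t M p \<phi> \<in> carrier (cech_module R D t M (Suc p))"
    unfolding c(2) cech_diff_frac[OF c(1)] by (rule cech_frac_carrier[OF kos_cochains[OF c(1)]])
  fix r assume r: "r \<in> carrier R"
  have rc: "(\<lambda>I. r \<odot>\<^bsub>M\<^esub> c I) \<in> cochains D (carrier M)" using c r by (auto simp: cochains_def)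
  show "cech_diff R D t M p (r \<odot>\<^bsub>cech_module R D t M p\<^esub> \<phi>) =
      r \<odot>\<^bsub>cech_module R D t M (Suc p)\<^esub> cech_diff R D t M p \<phi>"
    unfolding c(2) cech_frac_smult[OF c(1) r] cech_diff_frac[OF c(1)] cech_diff_frac[OF rc]
      cech_frac_smult[OF kos_cochains[OF c(1)] r]
    by (rule cech_frac_cong, rule kos_smult[OF _ t_pow _ r])
      (auto intro: cochains_Diff[OF c(1)] dest: finite_subset)
next
  fix \<phi> \<psi> assume "\<phi> \<in> carrier (cech_module R D t M p)" "\<psi> \<in> carrier (cech_module R D t M p)"
  then obtain k c c' where c: "c \<in> cochains D (carrier M)" "c' \<in> cochains D (carrier M)"
    "\<phi> = cech_frac p k c" "\<psi> = cech_frac p k c'" using cech_common by blast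
  have cc: "(\<lambda>I. c I \<oplus>\<^bsub>M\<^esub> c' I) \<in> cochains D (carrier M)" using c by (auto simp: cochains_def)
  show "cech_diff R D t M p (\<phi> \<oplus>\<^bsub>cech_module R D t M p\<^esub> \<psi>) =
      cech_diff R D t M p \<phi> \<oplus>\<^bsub>cech_module R D t M (Suc p)\<^esub> cech_diff R D t M p \<psi>"
    unfolding c(3,4) cech_frac_add[OF c(1,2)] cech_diff_frac[OF c(1)] cech_diff_frac[OF c(2)]
      cech_diff_frac[OF cc] cech_frac_add[OF kos_cochains[OF c(1)] kos_cochains[OF c(2)]]
    by (rule cech_frac_cong, rule kos_add[OF _ t_pow])
      (auto intro: cochains_Diff[OF c(1)] cochains_Diff[OF c(2)] dest: finite_subset)
qed

lemma cech_diff_diff: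
  assumes "\<phi> \<in> carrier (cech_module R D t M p)"
  shows "cech_diff R D t M (Suc p) (cech_diff R D t M p \<phi>) = \<zero>\<^bsub>cech_module R D t M (Suc (Suc p))\<^esub>"
proof -
  obtain k c where c: "c \<in> cochains D (carrier M)" "\<phi> = cech_frac p k c" using assms cech_frac_onto by blast
  show ?thesis
    unfolding c(2) cech_diff_frac[OF c(1)] cech_diff_frac[OF kos_cochains[OF c(1)]] cech_frac_zero[of _ k, symmetric]
    by (rule cech_frac_cong, rule kos_kos[OF _ t_pow])
      (auto intro: cochainsD[OF c(1)] dest: finite_subset)
qed

text \<open>For an arbitrary representative, the Koszul cocycle condition holds only after
  multiplication by a power of the product over \<open>I\<close>. Raising the exponent of the
  representative builds this factor into the numerators.\<close>

lemma cocycle_iff: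
  "\<phi> \<in> cocycles (cech_module R D t M) (cech_diff R D t M) p \<longleftrightarrow>
    (\<exists>k. \<exists>c\<in>cochains D (carrier M). \<phi> = cech_frac p k c \<and>
      (\<forall>I. I \<subseteq> {1..D} \<longrightarrow> card I = Suc p \<longrightarrow> kos R M (\<lambda>i. t i [^] k) c I = \<zero>\<^bsub>M\<^esub>))"
proof
  assume "\<phi> \<in> cocycles (cech_module R D t M) (cech_diff R D t M) p"
  hence \<phi>: "\<phi> \<in> carrier (cech_module R D t M p)"
    "cech_diff R D t M p \<phi> = \<zero>\<^bsub>cech_module R D t M (Suc p)\<^esub>" by (auto simp: cocycles_def)
  obtain k c where c: "c \<in> cochains D (carrier M)" "\<phi> = cech_frac p k c" using \<phi>(1) cech_frac_onto by blast
  note kc = kos_cochains[OF c(1), of k]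
  have z: "(\<lambda>_. \<zero>\<^bsub>M\<^esub>) \<in> cochains D (carrier M)" by (simp add: cochains_def)
  have "cech_frac (Suc p) k (kos R M (\<lambda>i. t i [^] k) c) = cech_frac (Suc p) k (\<lambda>_. \<zero>\<^bsub>M\<^esub>)"
    using \<phi>(2) unfolding c(2) cech_diff_frac[OF c(1)] cech_frac_zero[of _ k, symmetric] .
  then obtain j :: nat where j: "\<And>I. I \<in> cech_indices D (Suc p) \<Longrightarrow>
      tprod I [^] (j + k) \<odot>\<^bsub>M\<^esub> kos R M (\<lambda>i. t i [^] k) c I = tprod I [^] (j + k) \<odot>\<^bsub>M\<^esub> \<zero>\<^bsub>M\<^esub>"
    unfolding cech_frac_eq_iff[OF kc z] by blast
  let ?c = "\<lambda>I. tprod I [^] (j + k) \<odot>\<^bsub>M\<^esub> c I"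
  have "kos R M (\<lambda>i. t i [^] (k + (j + k))) ?c I = \<zero>\<^bsub>M\<^esub>" if "I \<subseteq> {1..D}" "card I = Suc p" for I
  proof -
    have "kos R M (\<lambda>i. t i [^] (k + (j + k))) ?c I = tprod I [^] (j + k) \<odot>\<^bsub>M\<^esub> kos R M (\<lambda>i. t i [^] k) c I"
      by (rule kos_scale[OF c(1) that(1)])
    thus ?thesis using j[of I] that tprod_closed[OF that(1)] by (simp add: cech_indices_def)
  qed
  thus "\<exists>k. \<exists>c\<in>cochains D (carrier M). \<phi> = cech_frac p k c \<and>
      (\<forall>I. I \<subseteq> {1..D} \<longrightarrow> card I = Suc p \<longrightarrow> kos R M (\<lambda>i. t i [^] k) c I = \<zero>\<^bsub>M\<^esub>)"
    using cech_frac_scale[OF c(1), of p k "j + k"] c(2) scale_cochains[OF c(1), of "j + k"]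
    by (intro exI[of _ "k + (j + k)"] bexI[of _ ?c] conjI) auto
next
  assume "\<exists>k. \<exists>c\<in>cochains D (carrier M). \<phi> = cech_frac p k c \<and>
      (\<forall>I. I \<subseteq> {1..D} \<longrightarrow> card I = Suc p \<longrightarrow> kos R M (\<lambda>i. t i [^] k) c I = \<zero>\<^bsub>M\<^esub>)"
  then obtain k c where c: "c \<in> cochains D (carrier M)" "\<phi> = cech_frac p k c"
    "\<And>I. I \<subseteq> {1..D} \<Longrightarrow> card I = Suc p \<Longrightarrow> kos R M (\<lambda>i. t i [^] k) c I = \<zero>\<^bsub>M\<^esub>" by blast
  have "cech_diff R D t M p \<phi> = \<zero>\<^bsub>cech_module R D t M (Suc p)\<^esub>"
    unfolding c(2) cech_diff_frac[OF c(1)] cech_frac_zero[of _ k, symmetric]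
    by (rule cech_frac_cong) (rule c(3))
  thus "\<phi> \<in> cocycles (cech_module R D t M) (cech_diff R D t M) p"
    using cech_frac_carrier[OF c(1)] c(2) by (simp add: cocycles_def)
qed

text \<open>A primitive may come with another exponent \<open>k'\<close>. Equality of the fractions
  scales \<open>c\<close> by the power \<open>j + k'\<close> and the boundary of \<open>b\<close> by
  the power \<open>j + k\<close>, so that both sides live at exponent \<open>k + m\<close> with
  \<open>m = j + k'\<close>.\<close>

lemma coboundary_iff:
  assumes c: "c \<in> cochains D (carrier M)"
  shows "cech_frac (Suc p) k c \<in> coboundaries (cech_module R D t M) (cech_diff R D t M) (Suc p) \<longleftrightarrow>
    (\<exists>m. \<exists>b\<in>cochains D (carrier M). \<forall>I. I \<subseteq> {1..D} \<longrightarrow> card I = Suc p \<longrightarrow>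
      tprod I [^] m \<odot>\<^bsub>M\<^esub> c I = kos R M (\<lambda>i. t i [^] (k + m)) b I)"
proof
  assume "cech_frac (Suc p) k c \<in> coboundaries (cech_module R D t M) (cech_diff R D t M) (Suc p)"
  then obtain k' b where b: "b \<in> cochains D (carrier M)"
    "cech_frac (Suc p) k c = cech_diff R D t M p (cech_frac p k' b)"
    using cech_frac_onto by (auto simp: coboundaries_def) metis
  obtain j :: nat where j: "\<And>I. I \<in> cech_indices D (Suc p) \<Longrightarrow>
      tprod I [^] (j + k') \<odot>\<^bsub>M\<^esub> c I = tprod I [^] (j + k) \<odot>\<^bsub>M\<^esub> kos R M (\<lambda>i. t i [^] k') b I"
    using b(2) unfolding cech_diff_frac[OF b(1)] cech_frac_eq_iff[OF c kos_cochains[OF b(1)]] by blast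
  have "tprod I [^] (j + k') \<odot>\<^bsub>M\<^esub> c I =
      kos R M (\<lambda>i. t i [^] (k + (j + k'))) (\<lambda>J. tprod J [^] (j + k) \<odot>\<^bsub>M\<^esub> b J) I"
    if "I \<subseteq> {1..D}" "card I = Suc p" for I
  proof -
    have "kos R M (\<lambda>i. t i [^] (k' + (j + k))) (\<lambda>J. tprod J [^] (j + k) \<odot>\<^bsub>M\<^esub> b J) I =
        tprod I [^] (j + k) \<odot>\<^bsub>M\<^esub> kos R M (\<lambda>i. t i [^] k') b I"
      by (rule kos_scale[OF b(1) that(1)])
    moreover have "k' + (j + k) = k + (j + k')" by simp
    ultimately show ?thesis using j[of I] that by (simp add: cech_indices_def)
  qed
  thus "\<exists>m. \<exists>b\<in>cochains D (carrier M). \<forall>I. I \<subseteq> {1..D} \<longrightarrow> card I = Suc p \<longrightarrow>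
      tprod I [^] m \<odot>\<^bsub>M\<^esub> c I = kos R M (\<lambda>i. t i [^] (k + m)) b I"
    using scale_cochains[OF b(1)] by blast
next
  assume "\<exists>m. \<exists>b\<in>cochains D (carrier M). \<forall>I. I \<subseteq> {1..D} \<longrightarrow> card I = Suc p \<longrightarrow>
      tprod I [^] m \<odot>\<^bsub>M\<^esub> c I = kos R M (\<lambda>i. t i [^] (k + m)) b I"
  then obtain m b where b: "b \<in> cochains D (carrier M)" "\<And>I. I \<subseteq> {1..D} \<Longrightarrow> card I = Suc p \<Longrightarrow>
      tprod I [^] m \<odot>\<^bsub>M\<^esub> c I = kos R M (\<lambda>i. t i [^] (k + m)) b I" by blast
  have "cech_frac (Suc p) k c = cech_frac (Suc p) (k + m) (\<lambda>I. tprod I [^] m \<odot>\<^bsub>M\<^esub> c I)"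
    by (rule cech_frac_scale[OF c, symmetric])
  also have "\<dots> = cech_frac (Suc p) (k + m) (kos R M (\<lambda>i. t i [^] (k + m)) b)"
    by (rule cech_frac_cong) (rule b(2))
  also have "\<dots> = cech_diff R D t M p (cech_frac p (k + m) b)" by (rule cech_diff_frac[OF b(1), symmetric])
  finally show "cech_frac (Suc p) k c \<in> coboundaries (cech_module R D t M) (cech_diff R D t M) (Suc p)"
    using cech_frac_carrier[OF b(1)] by (simp add: coboundaries_def)
qed

end

section \<open>Comparison with Cech cohomology\<close>

text \<open>In the application, \<open>E\<close> is the dual of a free resolution \<open>F\<close> of \<open>P / L\<close> (with the twisted action),
  and \<open>u\<close> is given by a lift of \<open>F\<^sub>0 \<rightarrow> P / L\<close> to \<open>P\<close>; it need not be injective outside \<open>L\<close>.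
  In the degrees \<open>Suc p < D\<close>, \<open>exact_L\<close> would follow from \<open>exact_P\<close>.\<close>

locale koszul_resolution = koszul_complex R E d D t + P: Module.module R P
  for R :: "('r, 'c) ring_scheme" (structure) and E :: "nat \<Rightarrow> ('r, 'm) module" and d D t
    and P :: "('r, 'p) module" +
  fixes L :: "'p set" and u :: "'p \<Rightarrow> 'm"
  assumes L_sub: "submodule L R P"
    and u_hom: "u \<in> mod_homs R P (E 0)"
    and u_inj: "y \<in> L \<Longrightarrow> u y = \<zero>\<^bsub>E 0\<^esub> \<Longrightarrow> y = \<zero>\<^bsub>P\<^esub>"
    and u_image: "u ` L = {x \<in> carrier (E 0). d 0 x = \<zero>\<^bsub>E 1\<^esub>}"
    and exact_P: "p < D \<Longrightarrow> c \<in> cochains D (carrier P) \<Longrightarrow>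
      (\<And>I. I \<subseteq> {1..D} \<Longrightarrow> card I = Suc p \<Longrightarrow> kos R P (\<lambda>i. t i [^] (k::nat)) c I = \<zero>\<^bsub>P\<^esub>) \<Longrightarrow>
      \<exists>b\<in>cochains D (carrier P). \<forall>I. I \<subseteq> {1..D} \<longrightarrow> card I = p \<longrightarrow> c I = kos R P (\<lambda>i. t i [^] k) b I"
    and exact_L: "p < D \<Longrightarrow> l \<in> cochains D (carrier P) \<Longrightarrow> e \<in> Ch 0 \<Longrightarrow>
      (\<And>I. I \<subseteq> {1..D} \<Longrightarrow> card I = Suc p \<Longrightarrow> l I \<in> L \<and> u (l I) = K 0 k e I) \<Longrightarrow>
      \<exists>c\<in>cochains D (carrier P). \<forall>I. I \<subseteq> {1..D} \<longrightarrow> card I = Suc p \<longrightarrow>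
        l I = kos R P (\<lambda>i. t i [^] k) c I"
begin

abbreviation N where "N \<equiv> quot_module P L"

abbreviation KP where "KP k \<equiv> kos R P (\<lambda>i. t i [^] (k::nat))"

abbreviation ChP where "ChP \<equiv> cochains D (carrier P)"

sublocale N: Module.module R N by (rule P.quot_module_module[OF L_sub])

sublocale N: cech R N D t by unfold_locales (rule t_closed)

sublocale P: cech R P D t by unfold_locales (rule t_closed)

text \<open>Two connecting maps in one relation. The class of \<open>c\<close> modulo
  \<open>L\<close> is a Koszul cocycle of \<open>P / L\<close> in degree \<open>q\<close>, and the
  boundary of \<open>c\<close> represents its image in degree \<open>q + 1\<close> of the cohomology
  of \<open>L\<close>. The same boundary, moved into \<open>E 0\<close> by \<open>u\<close>, is the
  Koszul boundary of \<open>e\<close>, from which a zigzag leads to \<open>z\<close>.\<close>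

definition rel :: "nat \<Rightarrow> nat \<Rightarrow> (nat set \<Rightarrow> 'p) \<Rightarrow> 'm \<Rightarrow> bool" where
  "rel q k c z \<longleftrightarrow> c \<in> ChP \<and> (\<forall>I. I \<subseteq> {1..D} \<longrightarrow> card I = Suc q \<longrightarrow> KP k c I \<in> L) \<and>
     z \<in> cocycles E d q \<and>
     (\<exists>e\<in>Ch 0. (\<forall>I. I \<subseteq> {1..D} \<longrightarrow> card I = Suc q \<longrightarrow> K 0 k e I = u (KP k c I)) \<and> zigzag k q 0 e z)"

lemma L_closed: "l \<in> L \<Longrightarrow> l \<in> carrier P"
  using P.sub_facts(1)[OF L_sub] by blast

lemma u_closed: "p \<in> carrier P \<Longrightarrow> u p \<in> carrier (E 0)"
  by (rule mod_homs_closed[OF u_hom])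

lemma du: "l \<in> L \<Longrightarrow> d 0 (u l) = \<zero>\<^bsub>E 1\<^esub>"
  using u_image by blast

lemmas u_add = mod_homs_add[OF u_hom]
lemmas u_smult = mod_homs_smult[OF u_hom]
lemmas u_minus = mod_homs_minus[OF P.module_axioms E_module u_hom]

lemma u_eqD:
  assumes "l \<in> L" "l' \<in> L" "u l = u l'" shows "l = l'"
proof -
  have "u (l \<ominus>\<^bsub>P\<^esub> l') = \<zero>\<^bsub>E 0\<^esub>"
    using assms L_closed u_closed by (simp add: u_minus) (simp add: a_minus_def E.r_neg)
  hence "l \<ominus>\<^bsub>P\<^esub> l' = \<zero>\<^bsub>P\<^esub>" using u_inj P.sub_facts(6)[OF L_sub] assms by blast
  thus ?thesis using assms L_closed
    by (metis P.add.inv_closed P.add.r_cancel P.r_neg a_minus_def)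
qed

lemma KP_closed: "c \<in> ChP \<Longrightarrow> I \<subseteq> {1..D} \<Longrightarrow> KP k c I \<in> carrier P"
  by (rule P.kos_cochain_closed[OF _ t_pow])

lemma KP_u: "c \<in> ChP \<Longrightarrow> I \<subseteq> {1..D} \<Longrightarrow> u (KP k c I) = K 0 k (\<lambda>J. u (c J)) I"
  by (rule P.kos_hom[OF E_module u_hom fin_sub t_pow_sub]) (auto intro: cochains_Diff)

lemma KP_KP: "c \<in> ChP \<Longrightarrow> I \<subseteq> {1..D} \<Longrightarrow> KP k (KP k c) I = \<zero>\<^bsub>P\<^esub>"
  by (rule P.kos_kos[OF fin_sub t_pow_sub]) (auto intro: cochainsD)

lemma KP_minus: "c \<in> ChP \<Longrightarrow> c' \<in> ChP \<Longrightarrow> I \<subseteq> {1..D} \<Longrightarrow>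
  KP k (\<lambda>J. c J \<ominus>\<^bsub>P\<^esub> c' J) I = KP k c I \<ominus>\<^bsub>P\<^esub> KP k c' I"
  by (rule P.kos_minus[OF fin_sub t_pow_sub]) (auto intro: cochains_Diff)

lemma KP_add: "c \<in> ChP \<Longrightarrow> c' \<in> ChP \<Longrightarrow> I \<subseteq> {1..D} \<Longrightarrow>
  KP k (\<lambda>J. c J \<oplus>\<^bsub>P\<^esub> c' J) I = KP k c I \<oplus>\<^bsub>P\<^esub> KP k c' I"
  by (rule P.kos_add[OF fin_sub t_pow_sub]) (auto intro: cochains_Diff)

lemma KP_smult: "c \<in> ChP \<Longrightarrow> I \<subseteq> {1..D} \<Longrightarrow> s \<in> carrier R \<Longrightarrow>
  KP k (\<lambda>J. s \<odot>\<^bsub>P\<^esub> c J) I = s \<odot>\<^bsub>P\<^esub> KP k c I"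
  by (rule P.kos_smult[OF fin_sub t_pow_sub]) (auto intro: cochains_Diff)

lemma Ch_u: "c \<in> ChP \<Longrightarrow> (\<lambda>J. u (c J)) \<in> Ch 0"
  using u_closed by (auto simp: cochains_def)

lemma minus_eqD:
  assumes "a \<in> carrier P" "b \<in> carrier P" "c \<in> carrier P" "a \<ominus>\<^bsub>P\<^esub> b = c"
  shows "a \<ominus>\<^bsub>P\<^esub> c = b"
  using assms by (auto simp: a_minus_def P.minus_add P.r_neg2 P.minus_minus)

lemma rel_add:
  assumes "rel q k c z" "rel q k c' z'"
  shows "rel q k (\<lambda>J. c J \<oplus>\<^bsub>P\<^esub> c' J) (z \<oplus>\<^bsub>E q\<^esub> z')"
proof -
  have c: "c \<in> ChP" "c' \<in> ChP" and z: "z \<in> cocycles E d q" "z' \<in> cocycles E d q"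
    and L: "\<And>I. I \<subseteq> {1..D} \<Longrightarrow> card I = Suc q \<Longrightarrow> KP k c I \<in> L \<and> KP k c' I \<in> L"
    using assms by (auto simp: rel_def)
  obtain e e' where e: "e \<in> Ch 0" "zigzag k q 0 e z" "e' \<in> Ch 0" "zigzag k q 0 e' z'"
    "\<And>I. I \<subseteq> {1..D} \<Longrightarrow> card I = Suc q \<Longrightarrow> K 0 k e I = u (KP k c I) \<and> K 0 k e' I = u (KP k c' I)"
    using assms by (auto simp: rel_def)
  have "(\<lambda>J. c J \<oplus>\<^bsub>P\<^esub> c' J) \<in> ChP" "(\<lambda>J. e J \<oplus>\<^bsub>E 0\<^esub> e' J) \<in> Ch 0"
    using c e by (auto simp: cochains_def)
  moreover have "KP k (\<lambda>J. c J \<oplus>\<^bsub>P\<^esub> c' J) I \<in> L" if "I \<subseteq> {1..D}" "card I = Suc q" for I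
    using KP_add[OF c that(1)] L[OF that] P.sub_facts(3)[OF L_sub] by simp
  moreover have "K 0 k (\<lambda>J. e J \<oplus>\<^bsub>E 0\<^esub> e' J) I = u (KP k (\<lambda>J. c J \<oplus>\<^bsub>P\<^esub> c' J) I)"
    if "I \<subseteq> {1..D}" "card I = Suc q" for I
    using KP_add[OF c that(1)] K_add[OF e(1,3) that(1)] e(5)[OF that] KP_closed[OF _ that(1)] c
    by (simp add: u_add)
  moreover have "z \<oplus>\<^bsub>E q\<^esub> z' \<in> cocycles E d q" using z by (auto simp: cocycles_def d_add)
  moreover have "zigzag k q 0 (\<lambda>J. e J \<oplus>\<^bsub>E 0\<^esub> e' J) (z \<oplus>\<^bsub>E q\<^esub> z')"
    using zigzag_add[OF e(2,4,1,3)] by simp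
  ultimately show ?thesis unfolding rel_def by blast
qed

lemma rel_smult:
  assumes "rel q k c z" "s \<in> carrier R"
  shows "rel q k (\<lambda>J. s \<odot>\<^bsub>P\<^esub> c J) (s \<odot>\<^bsub>E q\<^esub> z)"
proof -
  have c: "c \<in> ChP" and z: "z \<in> cocycles E d q"
    and L: "\<And>I. I \<subseteq> {1..D} \<Longrightarrow> card I = Suc q \<Longrightarrow> KP k c I \<in> L"
    using assms by (auto simp: rel_def)
  obtain e where e: "e \<in> Ch 0" "zigzag k q 0 e z"
    "\<And>I. I \<subseteq> {1..D} \<Longrightarrow> card I = Suc q \<Longrightarrow> K 0 k e I = u (KP k c I)"
    using assms by (auto simp: rel_def)
  have "(\<lambda>J. s \<odot>\<^bsub>P\<^esub> c J) \<in> ChP" "(\<lambda>J. s \<odot>\<^bsub>E 0\<^esub> e J) \<in> Ch 0"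
    using c e assms(2) by (auto simp: cochains_def)
  moreover have "KP k (\<lambda>J. s \<odot>\<^bsub>P\<^esub> c J) I \<in> L" if "I \<subseteq> {1..D}" "card I = Suc q" for I
    using KP_smult[OF c that(1) assms(2)] L[OF that] P.sub_facts(4)[OF L_sub assms(2)] by simp
  moreover have "K 0 k (\<lambda>J. s \<odot>\<^bsub>E 0\<^esub> e J) I = u (KP k (\<lambda>J. s \<odot>\<^bsub>P\<^esub> c J) I)"
    if "I \<subseteq> {1..D}" "card I = Suc q" for I
    using KP_smult[OF c that(1) assms(2)] K_smult[OF e(1) that(1) assms(2)] e(3)[OF that]
      KP_closed[OF c that(1)] assms(2) by (simp add: u_smult)
  moreover have "s \<odot>\<^bsub>E q\<^esub> z \<in> cocycles E d q" using z assms(2) by (auto simp: cocycles_def d_smult)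
  moreover have "zigzag k q 0 (\<lambda>J. s \<odot>\<^bsub>E 0\<^esub> e J) (s \<odot>\<^bsub>E q\<^esub> z)"
    using zigzag_smult[OF e(2,1) assms(2)] by simp
  ultimately show ?thesis unfolding rel_def by blast
qed

lemma rel_scale:
  assumes "rel q k c z"
  shows "rel q (k + m) (\<lambda>J. tpr J [^] m \<odot>\<^bsub>P\<^esub> c J) z"
proof -
  have c: "c \<in> ChP" and z: "z \<in> cocycles E d q"
    and L: "\<And>I. I \<subseteq> {1..D} \<Longrightarrow> card I = Suc q \<Longrightarrow> KP k c I \<in> L"
    using assms by (auto simp: rel_def)
  obtain e where e: "e \<in> Ch 0" "zigzag k q 0 e z"
    "\<And>I. I \<subseteq> {1..D} \<Longrightarrow> card I = Suc q \<Longrightarrow> K 0 k e I = u (KP k c I)"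
    using assms by (auto simp: rel_def)
  have "KP (k + m) (\<lambda>J. tpr J [^] m \<odot>\<^bsub>P\<^esub> c J) I \<in> L" if "I \<subseteq> {1..D}" "card I = Suc q" for I
    using P.kos_scale[OF c that(1)] L[OF that] P.sub_facts(4)[OF L_sub] tpr_closed[OF that(1)] by simp
  moreover have "K 0 (k + m) (\<lambda>J. tpr J [^] m \<odot>\<^bsub>E 0\<^esub> e J) I = u (KP (k + m) (\<lambda>J. tpr J [^] m \<odot>\<^bsub>P\<^esub> c J) I)"
    if "I \<subseteq> {1..D}" "card I = Suc q" for I
    using P.kos_scale[OF c that(1)] K_scale[OF e(1) that(1)] e(3)[OF that]
      KP_closed[OF c that(1)] tpr_closed[OF that(1)] by (simp add: u_smult)
  ultimately show ?thesis
    unfolding rel_def using z P.scale_cochains[OF c] Ch_scale[OF e(1)] zigzag_scale[OF e(2,1)] by blast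
qed

text \<open>The cochain \<open>u\<close> of \<open>c\<close> can serve as \<open>e\<close>: its
  Koszul boundary is \<open>u\<close> of values in \<open>L\<close>, which \<open>d\<close> kills,
  so that a zigzag starts there.\<close>

lemma rel_right:
  assumes c: "c \<in> ChP" and L: "\<And>I. I \<subseteq> {1..D} \<Longrightarrow> card I = Suc q \<Longrightarrow> KP k c I \<in> L" and q: "q < D"
  shows "\<exists>z. rel q k c z"
proof -
  have "K (Suc 0) k (\<lambda>J. d 0 (u (c J))) I = \<zero>\<^bsub>E (Suc 0)\<^esub>" if "I \<subseteq> {1..D}" "card I = Suc q" for I
    using K_d[OF Ch_u[OF c] that(1), of k] KP_u[OF c that(1), of k] du[OF L[OF that]]
    by (simp add: One_nat_def)
  from zigzag_exists[OF Ch_u[OF c] q this] obtain z where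
    "z \<in> carrier (E q)" "d q z = \<zero>\<^bsub>E (Suc q)\<^esub>" "zigzag k q 0 (\<lambda>J. u (c J)) z" unfolding add_0 by blast
  hence "rel q k c z"
    unfolding rel_def cocycles_def using c L Ch_u[OF c] KP_u[OF c, symmetric] by blast
  thus ?thesis by blast
qed

text \<open>Going backwards from \<open>z\<close> one arrives at a cochain \<open>e\<close> of
  \<open>E 0\<close> whose Koszul boundary is killed by \<open>d\<close>, hence is \<open>u\<close>
  of values in \<open>L\<close>. To obtain \<open>c\<close>, these values must bound in
  \<open>P\<close>. Their degree \<open>Suc q\<close> may equal \<open>D\<close>, where
  \<open>exact_P\<close> says nothing; this is the purpose of \<open>exact_L\<close>.\<close>

lemma rel_left:
  assumes z: "z \<in> cocycles E d q" and q: "q < D"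
  shows "\<exists>k c. rel q k c z"
proof -
  have "z \<in> carrier (E (0 + q))" "d (0 + q) z = \<zero>\<^bsub>E (Suc (0 + q))\<^esub>" using z by (auto simp: cocycles_def)
  from zigzag_reaches[OF this] obtain k e where e: "e \<in> Ch 0" "zigzag k q 0 e z"
    "\<And>I. I \<subseteq> {1..D} \<Longrightarrow> card I = Suc q \<Longrightarrow> d 0 (K 0 k e I) = \<zero>\<^bsub>E (Suc 0)\<^esub>" by auto
  have "\<exists>l\<in>L. K 0 k e I = u l" if "I \<subseteq> {1..D}" "card I = Suc q" for I
  proof -
    have "K 0 k e I \<in> u ` L"
      unfolding u_image using e(3)[OF that] K_closed[OF e(1) that(1)] by (simp add: One_nat_def)
    thus ?thesis by blast
  qed
  then obtain l where l: "\<And>I. I \<subseteq> {1..D} \<Longrightarrow> card I = Suc q \<Longrightarrow> l I \<in> L \<and> K 0 k e I = u (l I)" by metis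
  \<comment> \<open>The choice is constrained only at sets of size \<open>Suc q\<close>; zero
    elsewhere makes it a cochain with values in \<open>P\<close>.\<close>
  define l' where "l' I = (if I \<subseteq> {1..D} \<and> card I = Suc q then l I else \<zero>\<^bsub>P\<^esub>)" for I
  have l': "l' \<in> ChP" using l L_closed by (auto simp: cochains_def l'_def)
  have "\<exists>c\<in>ChP. \<forall>I. I \<subseteq> {1..D} \<longrightarrow> card I = Suc q \<longrightarrow> l' I = KP k c I"
    by (rule exact_L[OF q l' e(1)]) (use l in \<open>auto simp: l'_def\<close>)
  then obtain c where c: "c \<in> ChP" "\<And>I. I \<subseteq> {1..D} \<Longrightarrow> card I = Suc q \<Longrightarrow> l' I = KP k c I" by blast
  have cl: "KP k c I = l I" if "I \<subseteq> {1..D}" "card I = Suc q" for I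
    using c(2)[OF that] that by (simp add: l'_def)
  have "KP k c I \<in> L \<and> K 0 k e I = u (KP k c I)" if "I \<subseteq> {1..D}" "card I = Suc q" for I
    using cl[OF that] l[OF that] by simp
  hence "rel q k c z" unfolding rel_def using c(1) z e(1,2) by blast
  thus ?thesis by blast
qed

text \<open>Removing a boundary from \<open>c\<close> leaves entries in \<open>L\<close> with the
  same Koszul boundary as \<open>c\<close>. So \<open>e\<close> minus \<open>u\<close> of these
  entries is a Koszul cocycle, hence the boundary of some \<open>f\<close>; since \<open>d\<close>
  does not see the entries from \<open>L\<close>, this is the hypothesis of
  \<open>zigzag_trivial\<close>.\<close>

lemma rel_trivial:
  assumes "rel (Suc q) k c z" and q: "Suc q < D" and b: "b \<in> ChP"
    and cb: "\<And>I. I \<subseteq> {1..D} \<Longrightarrow> card I = Suc q \<Longrightarrow> c I \<ominus>\<^bsub>P\<^esub> KP k b I \<in> L"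
  shows "z \<in> coboundaries E d (Suc q)"
proof -
  have c: "c \<in> ChP" using assms by (auto simp: rel_def)
  obtain e where e: "e \<in> Ch 0" "zigzag k (Suc q) 0 e z"
    "\<And>I. I \<subseteq> {1..D} \<Longrightarrow> card I = Suc (Suc q) \<Longrightarrow> K 0 k e I = u (KP k c I)"
    using assms(1) unfolding rel_def by blast
  have kb: "KP k b \<in> ChP" using KP_closed[OF b] by (simp add: cochains_def)
  let ?l = "\<lambda>J. c J \<ominus>\<^bsub>P\<^esub> KP k b J"
  have l: "?l \<in> ChP" using c kb by (auto simp: cochains_def)
  let ?g = "\<lambda>J. e J \<ominus>\<^bsub>E 0\<^esub> u (?l J)"
  have g: "?g \<in> Ch 0" using e(1) Ch_u[OF l] by (auto simp: cochains_def)
  have "K 0 k ?g I = \<zero>\<^bsub>E 0\<^esub>" if I: "I \<subseteq> {1..D}" "card I = Suc (Suc q)" for I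
  proof -
    have "KP k ?l I = KP k c I"
      using KP_minus[OF c kb I(1), of k] KP_KP[OF b I(1), of k] KP_closed[OF c I(1), of k] by (simp add: a_minus_def)
    hence "K 0 k (\<lambda>J. u (?l J)) I = u (KP k c I)" using KP_u[OF l I(1), of k] by simp
    thus ?thesis using K_minus[OF e(1) Ch_u[OF l] I(1), of k] e(3)[OF I] u_closed[OF KP_closed[OF c I(1), of k]]
      by (simp add: a_minus_def E.r_neg)
  qed
  from exact[OF q g this] obtain f where f: "f \<in> Ch 0"
    "\<And>I. I \<subseteq> {1..D} \<Longrightarrow> card I = Suc q \<Longrightarrow> e I \<ominus>\<^bsub>E 0\<^esub> u (?l I) = K 0 k f I" by blast
  have "d 0 (e I) = d 0 (K 0 k f I)" if I: "I \<subseteq> {1..D}" "card I = Suc q" for I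
    using f(2)[OF I, symmetric] du[OF cb[OF I]] cochainsD[OF e(1) I(1)] cochainsD[OF Ch_u[OF l] I(1)]
    by (simp add: d_minus One_nat_def) (simp add: a_minus_def)
  from zigzag_trivial[OF e(2,1) f(1) Suc_lessD[OF q] this] show ?thesis
    unfolding coboundaries_def add_0 nat.case by blast
qed

text \<open>After scaling, \<open>e\<close> differs from a Koszul boundary by entries in the kernel
  of \<open>d\<close>, that is, by \<open>u\<close> of entries in \<open>L\<close>. The scaled
  \<open>c\<close> and these entries of \<open>L\<close> have the same Koszul boundary, so their
  difference is a cocycle of \<open>P\<close> and bounds there.\<close>

lemma rel_trivial_converse:
  assumes "rel (Suc q) k c z" and q: "Suc q < D" and z: "z \<in> coboundaries E d (Suc q)"
  shows "\<exists>m. \<exists>b\<in>ChP. \<forall>I. I \<subseteq> {1..D} \<longrightarrow> card I = Suc q \<longrightarrow>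
    tpr I [^] m \<odot>\<^bsub>P\<^esub> c I \<ominus>\<^bsub>P\<^esub> KP (k + m) b I \<in> L"
proof -
  have c: "c \<in> ChP" and cL: "\<And>I. I \<subseteq> {1..D} \<Longrightarrow> card I = Suc (Suc q) \<Longrightarrow> KP k c I \<in> L"
    using assms by (auto simp: rel_def)
  obtain e where e: "e \<in> Ch 0" "zigzag k (Suc q) 0 e z"
    "\<And>I. I \<subseteq> {1..D} \<Longrightarrow> card I = Suc (Suc q) \<Longrightarrow> K 0 k e I = u (KP k c I)"
    using assms(1) unfolding rel_def by blast
  obtain w where w: "w \<in> carrier (E (0 + q))" "z = d (0 + q) w" using z by (auto simp: coboundaries_def)
  from zigzag_trivial_converse[OF e(2,1) w] obtain m f where f: "f \<in> Ch 0"
    "\<And>I. I \<subseteq> {1..D} \<Longrightarrow> card I = Suc q \<Longrightarrow> d 0 (tpr I [^] m \<odot>\<^bsub>E 0\<^esub> e I) = d 0 (K 0 (k + m) f I)" by blast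
  let ?e = "\<lambda>J. tpr J [^] m \<odot>\<^bsub>E 0\<^esub> e J" and ?c = "\<lambda>J. tpr J [^] m \<odot>\<^bsub>P\<^esub> c J"
  have Kf: "K 0 (k + m) f \<in> Ch 0" using K_closed[OF f(1)] by (simp add: cochains_def)
  note se = Ch_scale[OF e(1), of m] and sc = P.scale_cochains[OF c, of m]
  let ?g = "\<lambda>J. ?e J \<ominus>\<^bsub>E 0\<^esub> K 0 (k + m) f J"
  have g: "?g \<in> Ch 0" using se Kf by (auto simp: cochains_def)
  have "\<exists>l\<in>L. ?g I = u l" if I: "I \<subseteq> {1..D}" "card I = Suc q" for I
  proof -
    have "d 0 (?g I) = \<zero>\<^bsub>E 1\<^esub>"
      using f(2)[OF I] cochainsD[OF se I(1)] cochainsD[OF Kf I(1)]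
      by (simp add: d_minus One_nat_def) (simp add: a_minus_def E.r_neg)
    hence "?g I \<in> u ` L" unfolding u_image using cochainsD[OF g I(1)] by simp
    thus ?thesis by blast
  qed
  then obtain l where l: "\<And>I. I \<subseteq> {1..D} \<Longrightarrow> card I = Suc q \<Longrightarrow> l I \<in> L \<and> ?g I = u (l I)" by metis
  define l' where "l' I = (if I \<subseteq> {1..D} \<and> card I = Suc q then l I else \<zero>\<^bsub>P\<^esub>)" for I
  have l': "l' \<in> ChP" using l L_closed by (auto simp: cochains_def l'_def)
  let ?h = "\<lambda>J. ?c J \<ominus>\<^bsub>P\<^esub> l' J"
  have h: "?h \<in> ChP" using sc l' by (auto simp: cochains_def)
  have "KP (k + m) ?h I = \<zero>\<^bsub>P\<^esub>" if I: "I \<subseteq> {1..D}" "card I = Suc (Suc q)" for I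
  proof -
    have tI: "tpr I [^] m \<in> carrier R" using tpr_closed[OF I(1)] by simp
    have J: "I - {i} \<subseteq> {1..D}" "card (I - {i}) = Suc q" if "i \<in> I" for i
      using that I fin_sub by (auto simp: card_Diff_singleton)
    have "u (KP (k + m) l' I) = K 0 (k + m) ?g I"
      unfolding KP_u[OF l' I(1)]
      by (rule K_cong[OF Ch_u[OF l'] I(1)]) (use l J in \<open>simp add: l'_def\<close>)
    also have "\<dots> = K 0 (k + m) ?e I"
      using K_minus[OF se Kf I(1), of "k + m"] K_K[OF f(1) I(1), of "k + m"] K_closed[OF se I(1), of "k + m"]
      by (simp add: a_minus_def)
    also have "\<dots> = u (KP (k + m) ?c I)"
      using K_scale[OF e(1) I(1), of k m] P.kos_scale[OF c I(1), of k m] e(3)[OF I]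
        KP_closed[OF c I(1), of k] tI by (simp add: u_smult)
    finally have 1: "u (KP (k + m) l' I) = u (KP (k + m) ?c I)" .
    \<comment> \<open>\<open>u\<close> is known to be injective on \<open>L\<close> only, so both
      boundaries have to be placed in \<open>L\<close> before they are compared through
      \<open>u\<close>.\<close>
    have "KP (k + m) l' I \<in> L"
      by (rule P.kos_sub[OF L_sub fin_sub[OF I(1)] t_pow_sub[OF I(1)]]) (use l J in \<open>simp add: l'_def\<close>)
    moreover have "KP (k + m) ?c I \<in> L"
      using P.kos_scale[OF c I(1), of k m] cL[OF I] P.sub_facts(4)[OF L_sub tI] by simp
    ultimately have "KP (k + m) l' I = KP (k + m) ?c I" using 1 by (rule u_eqD)
    thus ?thesis using KP_minus[OF sc l' I(1), of "k + m"] KP_closed[OF sc I(1), of "k + m"]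
      by (simp add: a_minus_def P.r_neg)
  qed
  from exact_P[OF q h this] obtain b where b: "b \<in> ChP"
    "\<And>I. I \<subseteq> {1..D} \<Longrightarrow> card I = Suc q \<Longrightarrow> ?h I = KP (k + m) b I" by blast
  have "?c I \<ominus>\<^bsub>P\<^esub> KP (k + m) b I \<in> L" if I: "I \<subseteq> {1..D}" "card I = Suc q" for I
  proof -
    have "?c I \<ominus>\<^bsub>P\<^esub> KP (k + m) b I = l' I"
      by (rule minus_eqD[OF cochainsD[OF sc I(1)] cochainsD[OF l' I(1)] KP_closed[OF b(1) I(1)] b(2)[OF I]])
    thus ?thesis using l[OF I] I by (simp add: l'_def)
  qed
  thus ?thesis using b(1) by blast
qed

section \<open>Passage to the quotient of P by L, and the isomorphism\<close>

abbreviation cls :: "(nat set \<Rightarrow> 'p) \<Rightarrow> nat set \<Rightarrow> 'p set" where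
  "cls c \<equiv> (\<lambda>I. L +>\<^bsub>P\<^esub> c I)"

lemma cls_cochains: "c \<in> ChP \<Longrightarrow> cls c \<in> cochains D (carrier N)"
  by (auto simp: cochains_def P.quot_carrier)

lemma cls_onto:
  assumes "c' \<in> cochains D (carrier N)"
  shows "\<exists>c\<in>ChP. \<forall>I. I \<subseteq> {1..D} \<longrightarrow> cls c I = c' I"
proof -
  have "\<exists>x\<in>carrier P. I \<subseteq> {1..D} \<longrightarrow> L +>\<^bsub>P\<^esub> x = c' I" for I
  proof (cases "I \<subseteq> {1..D}")
    case True
    hence "c' I \<in> (\<lambda>x. L +>\<^bsub>P\<^esub> x) ` carrier P" using cochainsD[OF assms] by (simp add: P.quot_carrier)
    thus ?thesis by blast
  qed (use P.zero_closed in blast)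
  then obtain c where "\<And>I. c I \<in> carrier P \<and> (I \<subseteq> {1..D} \<longrightarrow> L +>\<^bsub>P\<^esub> c I = c' I)" by metis
  thus ?thesis by (intro bexI[of _ c]) (auto simp: cochains_def)
qed

lemma kos_cls: "c \<in> ChP \<Longrightarrow> I \<subseteq> {1..D} \<Longrightarrow> kos R N (\<lambda>i. t i [^] (k::nat)) (cls c) I = L +>\<^bsub>P\<^esub> KP k c I"
  by (rule P.kos_hom[OF N.module_axioms P.quot_proj_hom[OF L_sub] fin_sub t_pow_sub, symmetric])
    (auto intro: cochains_Diff)

lemma cls_smult: "c \<in> ChP \<Longrightarrow> I \<subseteq> {1..D} \<Longrightarrow> s \<in> carrier R \<Longrightarrow> s \<odot>\<^bsub>N\<^esub> cls c I = L +>\<^bsub>P\<^esub> (s \<odot>\<^bsub>P\<^esub> c I)"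
  by (rule P.quot_smult[OF L_sub]) (auto dest: cochainsD)

theorem cech_iso:
  assumes q: "Suc q < D"
  shows "mod_isomorphic R (cohomology E d (Suc q)) (cech_cohomology R D t N (Suc q))"
proof -
  let ?C = "cech_module R D t N" and ?\<delta> = "cech_diff R D t N"
  \<comment> \<open>A Cech cocycle has many representatives \<open>(k, c)\<close>, and each
    \<open>c\<close> has many zigzags; \<open>S\<close> admits them all and leaves the ambiguity by
    boundaries to \<open>quot_iso_of_relation\<close>.\<close>
  define S where "S z \<phi> \<longleftrightarrow> (\<exists>k c. rel (Suc q) k c z \<and> \<phi> = N.cech_frac (Suc q) k (cls c))" for z \<phi>
  have Sc: "z \<in> cocycles E d (Suc q) \<and> \<phi> \<in> cocycles ?C ?\<delta> (Suc q)" if zphi: "S z \<phi>" for z \<phi>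
  proof
    obtain k c where c: "rel (Suc q) k c z" "\<phi> = N.cech_frac (Suc q) k (cls c)" using zphi by (auto simp: S_def)
    show "z \<in> cocycles E d (Suc q)" using c(1) by (simp add: rel_def)
    have cc: "c \<in> ChP" using c(1) by (simp add: rel_def)
    have "kos R N (\<lambda>i. t i [^] k) (cls c) I = \<zero>\<^bsub>N\<^esub>" if "I \<subseteq> {1..D}" "card I = Suc (Suc q)" for I
    proof -
      have "KP k c I \<in> L" using c(1) that unfolding rel_def by blast
      thus ?thesis
        unfolding kos_cls[OF cc that(1)] P.quot_zero
        by (simp add: P.rcos_zero_iff[OF L_sub KP_closed[OF cc that(1)]])
    qed
    thus "\<phi> \<in> cocycles ?C ?\<delta> (Suc q)"
      unfolding N.cocycle_iff using c(2) cls_cochains[OF cc] by blast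
  qed
  have scale: "N.cech_frac (Suc q) k (cls c) = N.cech_frac (Suc q) (k + m) (cls (\<lambda>J. tpr J [^] m \<odot>\<^bsub>P\<^esub> c J))"
    if "c \<in> ChP" for k m c
  proof -
    have "N.cech_frac (Suc q) k (cls c) = N.cech_frac (Suc q) (k + m) (\<lambda>J. tpr J [^] m \<odot>\<^bsub>N\<^esub> cls c J)"
      by (rule N.cech_frac_scale[OF cls_cochains[OF that], symmetric])
    also have "\<dots> = N.cech_frac (Suc q) (k + m) (cls (\<lambda>J. tpr J [^] m \<odot>\<^bsub>P\<^esub> c J))"
      by (rule N.cech_frac_cong) (simp add: cls_smult[OF that] tpr_closed)
    finally show ?thesis .
  qed
  have iso: "mod_isomorphic R (quot_module ((E (Suc q))\<lparr>carrier := cocycles E d (Suc q)\<rparr>) (coboundaries E d (Suc q)))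
    (quot_module ((?C (Suc q))\<lparr>carrier := cocycles ?C ?\<delta> (Suc q)\<rparr>) (coboundaries ?C ?\<delta> (Suc q)))"
  proof (rule quot_iso_of_relation[where S = S])
    show "Module.module R ((E (Suc q))\<lparr>carrier := cocycles E d (Suc q)\<rparr>)"
      "submodule (coboundaries E d (Suc q)) R ((E (Suc q))\<lparr>carrier := cocycles E d (Suc q)\<rparr>)"
      by (rule cohomology_quotient[where R = R and C = E and d = d, OF E_module d_hom d_d]; assumption)+
    show "Module.module R ((?C (Suc q))\<lparr>carrier := cocycles ?C ?\<delta> (Suc q)\<rparr>)"
      "submodule (coboundaries ?C ?\<delta> (Suc q)) R ((?C (Suc q))\<lparr>carrier := cocycles ?C ?\<delta> (Suc q)\<rparr>)"
      by (rule cohomology_quotient[where R = R and C = ?C and d = ?\<delta>,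
          OF N.cech_module_module N.cech_diff_hom N.cech_diff_diff]; assumption)+
  next
    fix z \<phi> assume "S z \<phi>"
    thus "z \<in> carrier ((E (Suc q))\<lparr>carrier := cocycles E d (Suc q)\<rparr>) \<and>
      \<phi> \<in> carrier ((?C (Suc q))\<lparr>carrier := cocycles ?C ?\<delta> (Suc q)\<rparr>)" using Sc by simp
  next
    fix z assume "z \<in> carrier ((E (Suc q))\<lparr>carrier := cocycles E d (Suc q)\<rparr>)"
    thus "\<exists>\<phi>. S z \<phi>" using rel_left[of z "Suc q"] q by (auto simp: S_def)
  next
    fix \<phi> assume "\<phi> \<in> carrier ((?C (Suc q))\<lparr>carrier := cocycles ?C ?\<delta> (Suc q)\<rparr>)"
    hence "\<phi> \<in> cocycles ?C ?\<delta> (Suc q)" by simp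
    then obtain k c' where c': "c' \<in> cochains D (carrier N)" "\<phi> = N.cech_frac (Suc q) k c'"
      "\<And>I. I \<subseteq> {1..D} \<Longrightarrow> card I = Suc (Suc q) \<Longrightarrow> kos R N (\<lambda>i. t i [^] k) c' I = \<zero>\<^bsub>N\<^esub>"
      unfolding N.cocycle_iff by blast
    obtain c where c: "c \<in> ChP" "\<And>I. I \<subseteq> {1..D} \<Longrightarrow> cls c I = c' I" using cls_onto[OF c'(1)] by blast
    have "KP k c I \<in> L" if I: "I \<subseteq> {1..D}" "card I = Suc (Suc q)" for I
    proof -
      have "kos R N (\<lambda>i. t i [^] k) c' I = kos R N (\<lambda>i. t i [^] k) (cls c) I"
        by (rule N.kos_cong[OF t_pow_sub[OF I(1)]]) (use c(2) I cochains_Diff[OF c'(1) I(1)] in \<open>auto simp: subset_iff\<close>)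
      hence "L +>\<^bsub>P\<^esub> KP k c I = L" using c'(3)[OF I] kos_cls[OF c(1) I(1)] by (simp add: P.quot_zero)
      thus ?thesis using P.rcos_zero_iff[OF L_sub KP_closed[OF c(1) I(1)]] by simp
    qed
    from rel_right[OF c(1) this q] obtain z where z: "rel (Suc q) k c z" by blast
    have "\<phi> = N.cech_frac (Suc q) k (cls c)" unfolding c'(2) by (rule N.cech_frac_cong) (simp add: c(2))
    thus "\<exists>z. S z \<phi>" using z unfolding S_def by blast
  next
    fix z \<phi> z' \<phi>' assume "S z \<phi>" "S z' \<phi>'"
    then obtain k c k' c' where c: "rel (Suc q) k c z" "\<phi> = N.cech_frac (Suc q) k (cls c)"
      and c': "rel (Suc q) k' c' z'" "\<phi>' = N.cech_frac (Suc q) k' (cls c')" unfolding S_def by blast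
    have cc: "c \<in> ChP" "c' \<in> ChP" using c(1) c'(1) by (simp_all add: rel_def)
    \<comment> \<open>Sums are formed at the common exponent \<open>k + k'\<close>; this scaling
      changes neither the Cech cochains nor the end points \<open>z\<close> and
      \<open>z'\<close>.\<close>
    let ?c = "\<lambda>J. tpr J [^] k' \<odot>\<^bsub>P\<^esub> c J" and ?c' = "\<lambda>J. tpr J [^] k \<odot>\<^bsub>P\<^esub> c' J"
    have r: "rel (Suc q) (k + k') ?c z" "rel (Suc q) (k + k') ?c' z'"
      using rel_scale[OF c(1), of k'] rel_scale[OF c'(1), of k] by (simp_all add: add.commute)
    have cc': "?c \<in> ChP" "?c' \<in> ChP" using r by (simp_all add: rel_def)
    have e: "\<phi> = N.cech_frac (Suc q) (k + k') (cls ?c)" "\<phi>' = N.cech_frac (Suc q) (k + k') (cls ?c')"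
      using c(2) c'(2) scale[OF cc(1), of k k'] scale[OF cc(2), of k' k] by (simp_all add: add.commute)
    have "\<phi> \<oplus>\<^bsub>?C (Suc q)\<^esub> \<phi>' = N.cech_frac (Suc q) (k + k') (cls (\<lambda>J. ?c J \<oplus>\<^bsub>P\<^esub> ?c' J))"
      unfolding e N.cech_frac_add[OF cls_cochains[OF cc'(1)] cls_cochains[OF cc'(2)]]
      by (rule N.cech_frac_cong) (rule P.quot_add[OF L_sub], auto dest: cochainsD[OF cc'(1)] cochainsD[OF cc'(2)])
    hence "S (z \<oplus>\<^bsub>E (Suc q)\<^esub> z') (\<phi> \<oplus>\<^bsub>?C (Suc q)\<^esub> \<phi>')"
      unfolding S_def using rel_add[OF r] by blast
    thus "S (z \<oplus>\<^bsub>(E (Suc q))\<lparr>carrier := cocycles E d (Suc q)\<rparr>\<^esub> z') (\<phi> \<oplus>\<^bsub>(?C (Suc q))\<lparr>carrier := cocycles ?C ?\<delta> (Suc q)\<rparr>\<^esub> \<phi>')"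
      by simp
  next
    fix s z \<phi> assume s: "s \<in> carrier R" and "S z \<phi>"
    then obtain k c where c: "rel (Suc q) k c z" "\<phi> = N.cech_frac (Suc q) k (cls c)" unfolding S_def by blast
    have cc: "c \<in> ChP" using c(1) by (simp add: rel_def)
    have "s \<odot>\<^bsub>?C (Suc q)\<^esub> \<phi> = N.cech_frac (Suc q) k (cls (\<lambda>J. s \<odot>\<^bsub>P\<^esub> c J))"
      unfolding c(2) N.cech_frac_smult[OF cls_cochains[OF cc] s]
      by (rule N.cech_frac_cong) (rule cls_smult[OF cc _ s])
    hence "S (s \<odot>\<^bsub>E (Suc q)\<^esub> z) (s \<odot>\<^bsub>?C (Suc q)\<^esub> \<phi>)"
      unfolding S_def using rel_smult[OF c(1) s] by blast
    thus "S (s \<odot>\<^bsub>(E (Suc q))\<lparr>carrier := cocycles E d (Suc q)\<rparr>\<^esub> z) (s \<odot>\<^bsub>(?C (Suc q))\<lparr>carrier := cocycles ?C ?\<delta> (Suc q)\<rparr>\<^esub> \<phi>)"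
      by simp
  next
    fix z \<phi> assume "S z \<phi>"
    then obtain k c where c: "rel (Suc q) k c z" "\<phi> = N.cech_frac (Suc q) k (cls c)" unfolding S_def by blast
    have cc: "c \<in> ChP" using c(1) by (simp add: rel_def)
    \<comment> \<open>Translates a boundary condition in \<open>P / L\<close> into membership of a
      difference in \<open>L\<close>, the form in which \<open>rel_trivial\<close> and its converse
      are stated.\<close>
    have triv: "tpr I [^] m \<odot>\<^bsub>N\<^esub> cls c I = kos R N (\<lambda>i. t i [^] (k + m)) (cls b) I \<longleftrightarrow>
        tpr I [^] m \<odot>\<^bsub>P\<^esub> c I \<ominus>\<^bsub>P\<^esub> KP (k + m) b I \<in> L" if "b \<in> ChP" "I \<subseteq> {1..D}" for m b I
      unfolding kos_cls[OF that] using cls_smult[OF cc that(2)] tpr_closed[OF that(2)]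
        P.rcos_eq_iff[OF L_sub _ KP_closed[OF that]] cochainsD[OF cc that(2)] by simp
    show "z \<in> coboundaries E d (Suc q) \<longleftrightarrow> \<phi> \<in> coboundaries ?C ?\<delta> (Suc q)"
    proof
      assume z: "z \<in> coboundaries E d (Suc q)"
      obtain m b where b: "b \<in> ChP" "\<And>I. I \<subseteq> {1..D} \<Longrightarrow> card I = Suc q \<Longrightarrow>
          tpr I [^] m \<odot>\<^bsub>P\<^esub> c I \<ominus>\<^bsub>P\<^esub> KP (k + m) b I \<in> L"
        using rel_trivial_converse[OF c(1) q z] by blast
      show "\<phi> \<in> coboundaries ?C ?\<delta> (Suc q)"
        unfolding c(2) N.coboundary_iff[OF cls_cochains[OF cc]]
        using b triv[OF b(1)] cls_cochains[OF b(1)] by blast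
    next
      assume "\<phi> \<in> coboundaries ?C ?\<delta> (Suc q)"
      then obtain m b' where b': "b' \<in> cochains D (carrier N)" "\<And>I. I \<subseteq> {1..D} \<Longrightarrow> card I = Suc q \<Longrightarrow>
          tpr I [^] m \<odot>\<^bsub>N\<^esub> cls c I = kos R N (\<lambda>i. t i [^] (k + m)) b' I"
        unfolding c(2) N.coboundary_iff[OF cls_cochains[OF cc]] by blast
      obtain b where b: "b \<in> ChP" "\<And>I. I \<subseteq> {1..D} \<Longrightarrow> cls b I = b' I" using cls_onto[OF b'(1)] by blast
      have "tpr I [^] m \<odot>\<^bsub>P\<^esub> c I \<ominus>\<^bsub>P\<^esub> KP (k + m) b I \<in> L" if I: "I \<subseteq> {1..D}" "card I = Suc q" for I
      proof -
        have "kos R N (\<lambda>i. t i [^] (k + m)) b' I = kos R N (\<lambda>i. t i [^] (k + m)) (cls b) I"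
          by (rule N.kos_cong[OF t_pow_sub[OF I(1)]]) (use b(2) I cochains_Diff[OF b'(1) I(1)] in \<open>auto simp: subset_iff\<close>)
        thus ?thesis using b'(2)[OF I] triv[OF b(1) I(1), of m] by simp
      qed
      from rel_trivial[OF rel_scale[OF c(1)] q b(1) this]
      show "z \<in> coboundaries E d (Suc q)" .
    qed
  qed
  thus ?thesis unfolding cech_cohomology_def cohomology_def .
qed

end

section \<open>Group rings\<close>

definition single :: "'z \<Rightarrow> 'b \<Rightarrow> 'z \<Rightarrow> 'b \<Rightarrow> 'z" where
  "single z b c = (\<lambda>x. if x = b then c else z)"

lemma single_fin_supp: "b \<in> B \<Longrightarrow> c \<in> C \<Longrightarrow> z \<in> C \<Longrightarrow> single z b c \<in> fin_supp B C z"
  by (auto simp: fin_supp_def single_def intro: finite_subset[of _ "{b}"])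

lemma fin_supp_closed: "f \<in> fin_supp B C z \<Longrightarrow> z \<in> C \<Longrightarrow> f x \<in> C"
  by (cases "x \<in> B") (auto simp: fin_supp_def)

lemma (in abelian_group) fin_supp_add:
  assumes "f \<in> fin_supp B (carrier G) \<zero>" "g \<in> fin_supp B (carrier G) \<zero>"
  shows "(\<lambda>x. f x \<oplus> g x) \<in> fin_supp B (carrier G) \<zero>"
  by (rule fin_suppI[where S = "{x. f x \<noteq> \<zero>} \<union> {x. g x \<noteq> \<zero>}"])
    (use assms fin_supp_closed[OF assms(1)] fin_supp_closed[OF assms(2)] in
      \<open>auto simp: fin_supp_out[OF assms(1)] fin_supp_out[OF assms(2)] dest: fin_supp_finite\<close>)

text \<open>Finitely supported functions are sums of monomials, so an additive identity in a group
  ring or in \<open>M[G]\<close> has to be checked only for one coefficient at one group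
  element.\<close>

lemma (in abelian_group) fin_supp_induct [consumes 1, case_names zero single add]:
  assumes "f \<in> fin_supp B (carrier G) \<zero>"
    and zero: "P (\<lambda>_. \<zero>)"
    and single: "\<And>b c. b \<in> B \<Longrightarrow> c \<in> carrier G \<Longrightarrow> P (single \<zero> b c)"
    and add: "\<And>f g. f \<in> fin_supp B (carrier G) \<zero> \<Longrightarrow> g \<in> fin_supp B (carrier G) \<zero> \<Longrightarrow> P f \<Longrightarrow> P g \<Longrightarrow>
      P (\<lambda>x. f x \<oplus> g x)"
  shows "P f"
proof -
  have "finite S \<Longrightarrow> f \<in> fin_supp B (carrier G) \<zero> \<Longrightarrow> {x. f x \<noteq> \<zero>} \<subseteq> S \<Longrightarrow> P f" for S f
  proof (induction S arbitrary: f rule: finite_induct)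
    case empty
    hence "f = (\<lambda>_. \<zero>)" by auto
    thus ?case using zero by simp
  next
    case (insert b S)
    show ?case
    proof (cases "b \<in> B")
      case False
      hence "f b = \<zero>" using insert.prems(1) fin_supp_out by fast
      thus ?thesis using insert.prems by (intro insert.IH) auto
    next
      case True
      let ?g = "\<lambda>x. if x = b then \<zero> else f x"
      have fb: "f b \<in> carrier G" using fin_supp_in[OF insert.prems(1) True] .
      have g: "?g \<in> fin_supp B (carrier G) \<zero>"
        by (rule fin_suppI[where S = "{x. f x \<noteq> \<zero>}"])
          (auto simp: fin_supp_in[OF insert.prems(1)] fin_supp_out[OF insert.prems(1)]
            fin_supp_finite[OF insert.prems(1)] split: if_splits)
      have s: "single \<zero> b (f b) \<in> fin_supp B (carrier G) \<zero>"
        by (rule single_fin_supp[OF True fb zero_closed])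
      have "P ?g" by (rule insert.IH[OF g]) (use insert.prems in auto)
      hence "P (\<lambda>x. single \<zero> b (f b) x \<oplus> ?g x)" by (rule add[OF s g single[OF True fb]])
      moreover have "(\<lambda>x. single \<zero> b (f b) x \<oplus> ?g x) = f"
        using fb fin_supp_closed[OF insert.prems(1) zero_closed] by (auto simp: single_def fun_eq_iff)
      ultimately show ?thesis by simp
    qed
  qed
  from this[OF fin_supp_finite[OF assms(1)] assms(1) order_refl] show ?thesis .
qed

lemma finsum_self_module: "finsum (self_module K) f A = finsum K f A"
  by (simp add: finsum_def finprod_def self_module_def)

locale group_algebra = K?: cring K + G?: comm_group G
  for K :: "('k, 'c) ring_scheme" and G :: "('l, 'd) monoid_scheme"
begin

abbreviation R where "R \<equiv> group_ring K G"

abbreviation CR where "CR \<equiv> fin_supp (carrier G) (carrier K) \<zero>\<^bsub>K\<^esub>"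

end

section \<open>The module M[G] over the group ring\<close>

locale group_algebra_module = group_algebra K G + M: Module.module K M
  for K :: "('k, 'c) ring_scheme" and G :: "('l, 'd) monoid_scheme" and M :: "('k, 'p) module"
begin

abbreviation MG where "MG \<equiv> group_module K G M"

abbreviation CM where "CM \<equiv> fin_supp (carrier G) (carrier M) \<zero>\<^bsub>M\<^esub>"

lemma MG_sel:
  "carrier MG = CM" "\<zero>\<^bsub>MG\<^esub> = (\<lambda>x. \<zero>\<^bsub>M\<^esub>)" "p \<oplus>\<^bsub>MG\<^esub> q = (\<lambda>x. p x \<oplus>\<^bsub>M\<^esub> q x)"
  by (simp_all add: group_module_def)

lemma CR_closed: "f \<in> CR \<Longrightarrow> f x \<in> carrier K"
  by (rule fin_supp_closed) auto

lemma CM_closed: "p \<in> CM \<Longrightarrow> p x \<in> carrier M"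
  by (rule fin_supp_closed) auto

text \<open>Terms outside the support of \<open>f\<close> vanish, so the sum may be enlarged.
  Elements with different supports can then be treated under one common sum.\<close>

lemma smult_eq:
  assumes f: "f \<in> CR" and p: "p \<in> CM" and A: "finite A" "{y. f y \<noteq> \<zero>\<^bsub>K\<^esub>} \<subseteq> A" "A \<subseteq> carrier G"
  shows "f \<odot>\<^bsub>MG\<^esub> p = (\<lambda>x. if x \<in> carrier G then
    \<Oplus>\<^bsub>M\<^esub>y\<in>A. f y \<odot>\<^bsub>M\<^esub> p (inv\<^bsub>G\<^esub> y \<otimes>\<^bsub>G\<^esub> x) else \<zero>\<^bsub>M\<^esub>)"
proof -
  have *: "(\<Oplus>\<^bsub>M\<^esub>y\<in>{y \<in> carrier G. f y \<noteq> \<zero>\<^bsub>K\<^esub>}. f y \<odot>\<^bsub>M\<^esub> p (inv\<^bsub>G\<^esub> y \<otimes>\<^bsub>G\<^esub> x)) =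
      (\<Oplus>\<^bsub>M\<^esub>y\<in>A. f y \<odot>\<^bsub>M\<^esub> p (inv\<^bsub>G\<^esub> y \<otimes>\<^bsub>G\<^esub> x))" for x
    by (rule M.add.finprod_mono_neutral_cong_left)
      (use A CR_closed[OF f] CM_closed[OF p] in auto)
  show ?thesis by (rule ext) (simp add: group_module_def *)
qed

lemma smult_closed_aux:
  assumes f: "f \<in> CR" and p: "p \<in> CM"
  shows "f \<odot>\<^bsub>MG\<^esub> p \<in> CM"
proof (rule fin_suppI)
  let ?A = "{y. f y \<noteq> \<zero>\<^bsub>K\<^esub>}"
  have A: "finite ?A" "?A \<subseteq> carrier G" using fin_supp_finite[OF f] fin_supp_sub[OF f] by auto
  note eq = smult_eq[OF f p A(1) order_refl A(2)]
  show "finite ((\<lambda>(y, z). y \<otimes>\<^bsub>G\<^esub> z) ` (?A \<times> {z. p z \<noteq> \<zero>\<^bsub>M\<^esub>}))"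
    using A(1) fin_supp_finite[OF p] by simp
  show "(f \<odot>\<^bsub>MG\<^esub> p) x \<in> carrier M" if "x \<in> carrier G" for x
    unfolding eq using CR_closed[OF f] CM_closed[OF p] by (auto intro!: M.finsum_closed)
  show "(f \<odot>\<^bsub>MG\<^esub> p) x = \<zero>\<^bsub>M\<^esub>" if "x \<notin> carrier G" for x unfolding eq using that by simp
  show "x \<in> (\<lambda>(y, z). y \<otimes>\<^bsub>G\<^esub> z) ` (?A \<times> {z. p z \<noteq> \<zero>\<^bsub>M\<^esub>})"
    if x: "x \<in> carrier G" "(f \<odot>\<^bsub>MG\<^esub> p) x \<noteq> \<zero>\<^bsub>M\<^esub>" for x
  proof (rule ccontr)
    assume "\<not> ?thesis"
    hence n: "x \<noteq> y \<otimes>\<^bsub>G\<^esub> z" if "y \<in> ?A" "p z \<noteq> \<zero>\<^bsub>M\<^esub>" for y z using that by auto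
    have "p (inv\<^bsub>G\<^esub> y \<otimes>\<^bsub>G\<^esub> x) = \<zero>\<^bsub>M\<^esub>" if "y \<in> ?A" for y
      using n[OF that, of "inv\<^bsub>G\<^esub> y \<otimes>\<^bsub>G\<^esub> x"] that A(2) x(1)
      by (auto simp: G.m_assoc[symmetric] subset_iff)
    hence "(\<Oplus>\<^bsub>M\<^esub>y\<in>?A. f y \<odot>\<^bsub>M\<^esub> p (inv\<^bsub>G\<^esub> y \<otimes>\<^bsub>G\<^esub> x)) = \<zero>\<^bsub>M\<^esub>"
      by (intro M.add.finprod_one_eqI) (use CR_closed[OF f] in auto)
    thus False using x unfolding eq by simp
  qed
qed

lemma smult_add_left:
  assumes f: "f \<in> CR" "g \<in> CR" and p: "p \<in> CM"
  shows "(\<lambda>x. f x \<oplus>\<^bsub>K\<^esub> g x) \<odot>\<^bsub>MG\<^esub> p = (\<lambda>x. (f \<odot>\<^bsub>MG\<^esub> p) x \<oplus>\<^bsub>M\<^esub> (g \<odot>\<^bsub>MG\<^esub> p) x)"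
proof -
  let ?A = "{y. f y \<noteq> \<zero>\<^bsub>K\<^esub>} \<union> {y. g y \<noteq> \<zero>\<^bsub>K\<^esub>}"
  have A: "finite ?A" "?A \<subseteq> carrier G"
    using fin_supp_finite[OF f(1)] fin_supp_finite[OF f(2)] fin_supp_sub[OF f(1)] fin_supp_sub[OF f(2)] by auto
  have fg: "(\<lambda>x. f x \<oplus>\<^bsub>K\<^esub> g x) \<in> CR" by (rule K.fin_supp_add[OF f])
  have s: "{y. f y \<oplus>\<^bsub>K\<^esub> g y \<noteq> \<zero>\<^bsub>K\<^esub>} \<subseteq> ?A" by auto
  have "(\<Oplus>\<^bsub>M\<^esub>y\<in>?A. (f y \<oplus>\<^bsub>K\<^esub> g y) \<odot>\<^bsub>M\<^esub> p (inv\<^bsub>G\<^esub> y \<otimes>\<^bsub>G\<^esub> x)) =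
     (\<Oplus>\<^bsub>M\<^esub>y\<in>?A. f y \<odot>\<^bsub>M\<^esub> p (inv\<^bsub>G\<^esub> y \<otimes>\<^bsub>G\<^esub> x)) \<oplus>\<^bsub>M\<^esub>
     (\<Oplus>\<^bsub>M\<^esub>y\<in>?A. g y \<odot>\<^bsub>M\<^esub> p (inv\<^bsub>G\<^esub> y \<otimes>\<^bsub>G\<^esub> x))" (is "?l = ?r") for x
  proof -
    have "?l = (\<Oplus>\<^bsub>M\<^esub>y\<in>?A. f y \<odot>\<^bsub>M\<^esub> p (inv\<^bsub>G\<^esub> y \<otimes>\<^bsub>G\<^esub> x) \<oplus>\<^bsub>M\<^esub> g y \<odot>\<^bsub>M\<^esub> p (inv\<^bsub>G\<^esub> y \<otimes>\<^bsub>G\<^esub> x))"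
      using CR_closed[OF f(1)] CR_closed[OF f(2)] CM_closed[OF p]
      by (intro M.finsum_cong') (simp_all add: M.smult_l_distr Pi_iff)
    also have "\<dots> = ?r"
      using CR_closed[OF f(1)] CR_closed[OF f(2)] CM_closed[OF p]
      by (intro M.finsum_addf) (simp_all add: Pi_iff)
    finally show ?thesis .
  qed
  thus ?thesis
    unfolding smult_eq[OF fg p A(1) s A(2)] smult_eq[OF f(1) p A(1) Un_upper1 A(2)]
      smult_eq[OF f(2) p A(1) Un_upper2 A(2)] by (auto simp: fun_eq_iff)
qed

lemma smult_add_right:
  assumes f: "f \<in> CR" and p: "p \<in> CM" "q \<in> CM"
  shows "f \<odot>\<^bsub>MG\<^esub> (\<lambda>x. p x \<oplus>\<^bsub>M\<^esub> q x) = (\<lambda>x. (f \<odot>\<^bsub>MG\<^esub> p) x \<oplus>\<^bsub>M\<^esub> (f \<odot>\<^bsub>MG\<^esub> q) x)"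
proof -
  let ?A = "{y. f y \<noteq> \<zero>\<^bsub>K\<^esub>}"
  have A: "finite ?A" "?A \<subseteq> carrier G" using fin_supp_finite[OF f] fin_supp_sub[OF f] by auto
  have pq: "(\<lambda>x. p x \<oplus>\<^bsub>M\<^esub> q x) \<in> CM" by (rule M.fin_supp_add[OF p])
  have "(\<Oplus>\<^bsub>M\<^esub>y\<in>?A. f y \<odot>\<^bsub>M\<^esub> (p (inv\<^bsub>G\<^esub> y \<otimes>\<^bsub>G\<^esub> x) \<oplus>\<^bsub>M\<^esub> q (inv\<^bsub>G\<^esub> y \<otimes>\<^bsub>G\<^esub> x))) =
     (\<Oplus>\<^bsub>M\<^esub>y\<in>?A. f y \<odot>\<^bsub>M\<^esub> p (inv\<^bsub>G\<^esub> y \<otimes>\<^bsub>G\<^esub> x)) \<oplus>\<^bsub>M\<^esub>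
     (\<Oplus>\<^bsub>M\<^esub>y\<in>?A. f y \<odot>\<^bsub>M\<^esub> q (inv\<^bsub>G\<^esub> y \<otimes>\<^bsub>G\<^esub> x))" (is "?l = ?r") for x
  proof -
    have "?l = (\<Oplus>\<^bsub>M\<^esub>y\<in>?A. f y \<odot>\<^bsub>M\<^esub> p (inv\<^bsub>G\<^esub> y \<otimes>\<^bsub>G\<^esub> x) \<oplus>\<^bsub>M\<^esub> f y \<odot>\<^bsub>M\<^esub> q (inv\<^bsub>G\<^esub> y \<otimes>\<^bsub>G\<^esub> x))"
      using CR_closed[OF f] CM_closed[OF p(1)] CM_closed[OF p(2)]
      by (intro M.finsum_cong') (simp_all add: M.smult_r_distr Pi_iff)
    also have "\<dots> = ?r"
      using CR_closed[OF f] CM_closed[OF p(1)] CM_closed[OF p(2)]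
      by (intro M.finsum_addf) (simp_all add: Pi_iff)
    finally show ?thesis .
  qed
  thus ?thesis
    unfolding smult_eq[OF f pq A(1) order_refl A(2)] smult_eq[OF f p(1) A(1) order_refl A(2)]
      smult_eq[OF f p(2) A(1) order_refl A(2)] by (auto simp: fun_eq_iff)
qed

lemma smult_single:
  assumes y: "y \<in> carrier G" and c: "c \<in> carrier K" and p: "p \<in> CM"
  shows "single \<zero>\<^bsub>K\<^esub> y c \<odot>\<^bsub>MG\<^esub> p = (\<lambda>x. if x \<in> carrier G then c \<odot>\<^bsub>M\<^esub> p (inv\<^bsub>G\<^esub> y \<otimes>\<^bsub>G\<^esub> x) else \<zero>\<^bsub>M\<^esub>)"
proof -
  have s: "single \<zero>\<^bsub>K\<^esub> y c \<in> CR" using y c by (intro single_fin_supp) auto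
  show ?thesis
    by (subst smult_eq[OF s p, of "{y}"])
      (use y c CM_closed[OF p] in \<open>auto simp: single_def fun_eq_iff\<close>)
qed

lemma smult_single_single:
  assumes y: "y \<in> carrier G" and c: "c \<in> carrier K" and z: "z \<in> carrier G" and a: "a \<in> carrier M"
  shows "single \<zero>\<^bsub>K\<^esub> y c \<odot>\<^bsub>MG\<^esub> single \<zero>\<^bsub>M\<^esub> z a = single \<zero>\<^bsub>M\<^esub> (y \<otimes>\<^bsub>G\<^esub> z) (c \<odot>\<^bsub>M\<^esub> a)"
proof -
  have s: "single \<zero>\<^bsub>M\<^esub> z a \<in> CM" using z a by (intro single_fin_supp) auto
  have "inv\<^bsub>G\<^esub> y \<otimes>\<^bsub>G\<^esub> x = z \<longleftrightarrow> x = y \<otimes>\<^bsub>G\<^esub> z" if "x \<in> carrier G" for x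
    using y z that by (metis G.inv_solve_left)
  thus ?thesis
    unfolding smult_single[OF y c s] using y z c by (auto simp: single_def fun_eq_iff)
qed

end

context group_algebra begin

text \<open>The group ring is \<open>M[G]\<close> for \<open>M = K\<close>. Through this instance
  the module laws proved for \<open>M[G]\<close> yield ring laws as well.\<close>

lemma self_algebra: "group_algebra_module K G (self_module K)"
  by (intro group_algebra_module.intro group_algebra_axioms K.self_module_module)

end

sublocale group_algebra \<subseteq> self: group_algebra_module K G "self_module K"
  by (rule self_algebra)

context group_algebra begin

lemma R_sel:
  "carrier R = CR" "\<zero>\<^bsub>R\<^esub> = (\<lambda>x. \<zero>\<^bsub>K\<^esub>)" "f \<oplus>\<^bsub>R\<^esub> g = (\<lambda>x. f x \<oplus>\<^bsub>K\<^esub> g x)"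
  "f \<otimes>\<^bsub>R\<^esub> g = f \<odot>\<^bsub>group_module K G (self_module K)\<^esub> g" "\<one>\<^bsub>R\<^esub> = single \<zero>\<^bsub>K\<^esub> \<one>\<^bsub>G\<^esub> \<one>\<^bsub>K\<^esub>"
  by (simp_all add: group_ring_def group_module_def finsum_self_module single_def fun_eq_iff)

lemma mult_closed: "f \<in> CR \<Longrightarrow> g \<in> CR \<Longrightarrow> f \<otimes>\<^bsub>R\<^esub> g \<in> CR"
  using self.smult_closed_aux[of f g] by (simp add: R_sel)

lemma mult_add_left: "f \<in> CR \<Longrightarrow> g \<in> CR \<Longrightarrow> h \<in> CR \<Longrightarrow>
  (\<lambda>x. f x \<oplus>\<^bsub>K\<^esub> g x) \<otimes>\<^bsub>R\<^esub> h = (\<lambda>x. (f \<otimes>\<^bsub>R\<^esub> h) x \<oplus>\<^bsub>K\<^esub> (g \<otimes>\<^bsub>R\<^esub> h) x)"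
  using self.smult_add_left[of f g h] by (simp add: R_sel)

lemma mult_add_right: "f \<in> CR \<Longrightarrow> g \<in> CR \<Longrightarrow> h \<in> CR \<Longrightarrow>
  h \<otimes>\<^bsub>R\<^esub> (\<lambda>x. f x \<oplus>\<^bsub>K\<^esub> g x) = (\<lambda>x. (h \<otimes>\<^bsub>R\<^esub> f) x \<oplus>\<^bsub>K\<^esub> (h \<otimes>\<^bsub>R\<^esub> g) x)"
  using self.smult_add_right[of h f g] by (simp add: R_sel)

lemma mult_single_single:
  "y \<in> carrier G \<Longrightarrow> c \<in> carrier K \<Longrightarrow> z \<in> carrier G \<Longrightarrow> a \<in> carrier K \<Longrightarrow>
   single \<zero>\<^bsub>K\<^esub> y c \<otimes>\<^bsub>R\<^esub> single \<zero>\<^bsub>K\<^esub> z a = single \<zero>\<^bsub>K\<^esub> (y \<otimes>\<^bsub>G\<^esub> z) (c \<otimes>\<^bsub>K\<^esub> a)"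
  using self.smult_single_single[of y c z a] by (simp add: R_sel)

lemma single_CR: "y \<in> carrier G \<Longrightarrow> c \<in> carrier K \<Longrightarrow> single \<zero>\<^bsub>K\<^esub> y c \<in> CR"
  by (rule single_fin_supp) auto

lemma zero_CR: "(\<lambda>_. \<zero>\<^bsub>K\<^esub>) \<in> CR"
  by (simp add: fin_supp_def)

end

context group_algebra_module begin

lemma single_CM: "y \<in> carrier G \<Longrightarrow> a \<in> carrier M \<Longrightarrow> single \<zero>\<^bsub>M\<^esub> y a \<in> CM"
  by (rule single_fin_supp) auto

lemma smult_zero_left: "p \<in> CM \<Longrightarrow> (\<lambda>_. \<zero>\<^bsub>K\<^esub>) \<odot>\<^bsub>MG\<^esub> p = (\<lambda>_. \<zero>\<^bsub>M\<^esub>)"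
  by (subst smult_eq[OF zero_CR, of p "{}"]) auto

lemma smult_zero_right: "f \<in> CR \<Longrightarrow> f \<odot>\<^bsub>MG\<^esub> (\<lambda>_. \<zero>\<^bsub>M\<^esub>) = (\<lambda>_. \<zero>\<^bsub>M\<^esub>)"
  using CR_closed by (auto simp: group_module_def fun_eq_iff intro!: M.add.finprod_one_eqI)

end

context group_algebra_module begin

lemma smult_assoc_single:
  assumes y: "y \<in> carrier G" "c \<in> carrier K" and g: "g \<in> CR" and p: "p \<in> CM"
  shows "(single \<zero>\<^bsub>K\<^esub> y c \<otimes>\<^bsub>R\<^esub> g) \<odot>\<^bsub>MG\<^esub> p = single \<zero>\<^bsub>K\<^esub> y c \<odot>\<^bsub>MG\<^esub> (g \<odot>\<^bsub>MG\<^esub> p)"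
  using g
proof (induction rule: K.fin_supp_induct)
  case zero
  have "single \<zero>\<^bsub>K\<^esub> y c \<otimes>\<^bsub>R\<^esub> (\<lambda>_. \<zero>\<^bsub>K\<^esub>) = (\<lambda>_. \<zero>\<^bsub>K\<^esub>)"
    using self.smult_zero_right[OF single_CR[OF y]] by (simp add: R_sel)
  thus ?case using p by (simp add: smult_zero_left smult_zero_right[OF single_CR[OF y]])
next
  case (single z b)
  have yz: "y \<otimes>\<^bsub>G\<^esub> z \<in> carrier G" "c \<otimes>\<^bsub>K\<^esub> b \<in> carrier K" using y single by auto
  have q: "single \<zero>\<^bsub>K\<^esub> z b \<odot>\<^bsub>MG\<^esub> p \<in> CM" by (rule smult_closed_aux[OF single_CR[OF single] p])
  have e: "inv\<^bsub>G\<^esub> (y \<otimes>\<^bsub>G\<^esub> z) \<otimes>\<^bsub>G\<^esub> x = inv\<^bsub>G\<^esub> z \<otimes>\<^bsub>G\<^esub> (inv\<^bsub>G\<^esub> y \<otimes>\<^bsub>G\<^esub> x)" if "x \<in> carrier G" for x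
    using y single that by (simp add: G.inv_mult_group G.m_assoc)
  show ?case
    unfolding mult_single_single[OF y single] smult_single[OF yz p] smult_single[OF y q]
    unfolding smult_single[OF single p] using y single CM_closed[OF p] by (auto simp: fun_eq_iff e M.smult_assoc1)
next
  case (add f g)
  have "(single \<zero>\<^bsub>K\<^esub> y c \<otimes>\<^bsub>R\<^esub> (\<lambda>x. f x \<oplus>\<^bsub>K\<^esub> g x)) \<odot>\<^bsub>MG\<^esub> p =
      (\<lambda>x. (single \<zero>\<^bsub>K\<^esub> y c \<odot>\<^bsub>MG\<^esub> (f \<odot>\<^bsub>MG\<^esub> p)) x \<oplus>\<^bsub>M\<^esub> (single \<zero>\<^bsub>K\<^esub> y c \<odot>\<^bsub>MG\<^esub> (g \<odot>\<^bsub>MG\<^esub> p)) x)"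
    unfolding mult_add_right[OF add(1,2) single_CR[OF y]]
      smult_add_left[OF mult_closed[OF single_CR[OF y] add(1)] mult_closed[OF single_CR[OF y] add(2)] p] add(3,4) ..
  thus ?case
    unfolding smult_add_left[OF add(1,2) p]
      smult_add_right[OF single_CR[OF y] smult_closed_aux[OF add(1) p] smult_closed_aux[OF add(2) p]] .
qed

lemma smult_assoc:
  assumes f: "f \<in> CR" and g: "g \<in> CR" and p: "p \<in> CM"
  shows "(f \<otimes>\<^bsub>R\<^esub> g) \<odot>\<^bsub>MG\<^esub> p = f \<odot>\<^bsub>MG\<^esub> (g \<odot>\<^bsub>MG\<^esub> p)"
  using f
proof (induction rule: K.fin_supp_induct)
  case zero
  have "(\<lambda>_. \<zero>\<^bsub>K\<^esub>) \<otimes>\<^bsub>R\<^esub> g = (\<lambda>_. \<zero>\<^bsub>K\<^esub>)" using self.smult_zero_left[of g] g by (simp add: R_sel)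
  thus ?case using p smult_closed_aux[OF g p] by (simp add: smult_zero_left)
next
  case (single z b)
  show ?case by (rule smult_assoc_single[OF single g p])
next
  case (add f f')
  show ?case
    unfolding mult_add_left[OF add(1,2) g] smult_add_left[OF mult_closed[OF add(1) g] mult_closed[OF add(2) g] p]
      smult_add_left[OF add(1,2) smult_closed_aux[OF g p]] add(3,4) ..
qed

lemma smult_one: "p \<in> CM \<Longrightarrow> \<one>\<^bsub>R\<^esub> \<odot>\<^bsub>MG\<^esub> p = p"
  using CM_closed fin_supp_out by (fastforce simp: R_sel smult_single)

lemma MG_abelian_group: "abelian_group MG"
proof (rule abelian_groupI)
  show "\<zero>\<^bsub>MG\<^esub> \<in> carrier MG" by (simp add: MG_sel fin_supp_def)
next
  fix p assume "p \<in> carrier MG"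
  hence p: "p \<in> CM" by (simp add: MG_sel)
  have "(\<lambda>x. \<ominus>\<^bsub>M\<^esub> p x) \<in> CM"
    by (rule fin_suppI[where S = "{x. p x \<noteq> \<zero>\<^bsub>M\<^esub>}"])
      (use CM_closed[OF p] fin_supp_out[OF p] fin_supp_finite[OF p] in auto)
  thus "\<exists>q\<in>carrier MG. q \<oplus>\<^bsub>MG\<^esub> p = \<zero>\<^bsub>MG\<^esub>"
    using CM_closed[OF p] by (intro bexI[of _ "\<lambda>x. \<ominus>\<^bsub>M\<^esub> p x"]) (auto simp: MG_sel M.l_neg)
qed (auto simp: MG_sel CM_closed M.a_ac intro: M.fin_supp_add)

end

context group_algebra begin

lemma mult_comm:
  assumes f: "f \<in> CR" and g: "g \<in> CR"
  shows "f \<otimes>\<^bsub>R\<^esub> g = g \<otimes>\<^bsub>R\<^esub> f"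
  using f
proof (induction rule: K.fin_supp_induct)
  case zero
  show ?case using self.smult_zero_left[of g] self.smult_zero_right[OF g] g by (simp add: R_sel)
next
  case (single y c)
  show ?case using g
  proof (induction rule: K.fin_supp_induct)
    case zero
    show ?case using self.smult_zero_left[of "single \<zero>\<^bsub>K\<^esub> y c"] self.smult_zero_right[OF single_CR[OF single]]
        single_CR[OF single] by (simp add: R_sel)
  next
    case (single z a)
    show ?case using \<open>y \<in> carrier G\<close> \<open>c \<in> carrier K\<close> single
      by (simp add: mult_single_single G.m_comm K.m_comm)
  next
    case (add f g)
    show ?case
      unfolding mult_add_left[OF add(1,2) single_CR[OF single]] mult_add_right[OF add(1,2) single_CR[OF single]] add(3,4) ..
  qed
next
  case (add f f')
  show ?case unfolding mult_add_left[OF add(1,2) g] mult_add_right[OF add(1,2) g] add(3,4) ..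
qed

lemma R_cring: "cring R"
proof (rule cringI)
  have ab: "abelian_group (group_module K G (self_module K))" by (rule self.MG_abelian_group)
  interpret A: abelian_group "group_module K G (self_module K)" by (rule ab)
  show "abelian_group R"
  proof (rule abelian_groupI)
    fix f assume "f \<in> carrier R"
    thus "\<exists>g\<in>carrier R. g \<oplus>\<^bsub>R\<^esub> f = \<zero>\<^bsub>R\<^esub>"
      using A.l_neg[of f] A.a_inv_closed[of f] by (auto simp: R_sel self.MG_sel)
  qed (use A.a_assoc A.a_comm A.l_zero A.zero_closed A.a_closed in \<open>auto simp: R_sel self.MG_sel\<close>)
  show "comm_monoid R"
  proof (rule comm_monoidI)
    show "\<one>\<^bsub>R\<^esub> \<in> carrier R" by (simp add: R_sel single_CR)
    show "f \<otimes>\<^bsub>R\<^esub> g \<in> carrier R" if "f \<in> carrier R" "g \<in> carrier R" for f g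
      using mult_closed[of f g] that by (simp only: R_sel(1))
    show "f \<otimes>\<^bsub>R\<^esub> g \<otimes>\<^bsub>R\<^esub> h = f \<otimes>\<^bsub>R\<^esub> (g \<otimes>\<^bsub>R\<^esub> h)"
      if "f \<in> carrier R" "g \<in> carrier R" "h \<in> carrier R" for f g h
      using self.smult_assoc[of f g h] that by (simp add: R_sel)
    show "\<one>\<^bsub>R\<^esub> \<otimes>\<^bsub>R\<^esub> f = f" if "f \<in> carrier R" for f
      using self.smult_one[of f] that by (simp add: R_sel)
    show "f \<otimes>\<^bsub>R\<^esub> g = g \<otimes>\<^bsub>R\<^esub> f" if "f \<in> carrier R" "g \<in> carrier R" for f g
      using mult_comm[of f g] that by (simp only: R_sel(1))
  qed
  show "(f \<oplus>\<^bsub>R\<^esub> g) \<otimes>\<^bsub>R\<^esub> h = f \<otimes>\<^bsub>R\<^esub> h \<oplus>\<^bsub>R\<^esub> g \<otimes>\<^bsub>R\<^esub> h"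
    if "f \<in> carrier R" "g \<in> carrier R" "h \<in> carrier R" for f g h
    using mult_add_left[of f g h] that by (simp only: R_sel(1,3))
qed

end

sublocale group_algebra \<subseteq> R: cring "group_ring K G"
  by (rule R_cring)

context group_algebra_module begin

lemma MG_module: "Module.module R MG"
proof (rule moduleI[OF R_cring MG_abelian_group])
  show "f \<odot>\<^bsub>MG\<^esub> p \<in> carrier MG" if "f \<in> carrier R" "p \<in> carrier MG" for f p
    using smult_closed_aux[of f p] that by (simp add: R_sel MG_sel)
  show "(f \<oplus>\<^bsub>R\<^esub> g) \<odot>\<^bsub>MG\<^esub> p = f \<odot>\<^bsub>MG\<^esub> p \<oplus>\<^bsub>MG\<^esub> g \<odot>\<^bsub>MG\<^esub> p"
    if "f \<in> carrier R" "g \<in> carrier R" "p \<in> carrier MG" for f g p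
    using smult_add_left[of f g p] that by (simp add: R_sel MG_sel)
  show "f \<odot>\<^bsub>MG\<^esub> (p \<oplus>\<^bsub>MG\<^esub> q) = f \<odot>\<^bsub>MG\<^esub> p \<oplus>\<^bsub>MG\<^esub> f \<odot>\<^bsub>MG\<^esub> q"
    if "f \<in> carrier R" "p \<in> carrier MG" "q \<in> carrier MG" for f p q
    using smult_add_right[of f p q] that by (simp add: R_sel MG_sel)
  show "(f \<otimes>\<^bsub>R\<^esub> g) \<odot>\<^bsub>MG\<^esub> p = f \<odot>\<^bsub>MG\<^esub> (g \<odot>\<^bsub>MG\<^esub> p)"
    if "f \<in> carrier R" "g \<in> carrier R" "p \<in> carrier MG" for f g p
    using smult_assoc[of f g p] that by (simp only: R_sel(1) MG_sel(1))
  show "\<one>\<^bsub>R\<^esub> \<odot>\<^bsub>MG\<^esub> p = p" if "p \<in> carrier MG" for p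
    using smult_one[of p] that by (simp only: MG_sel(1))
qed

end

subsection \<open>The antipode\<close>

context group_algebra begin

lemma antipode_closed: assumes f: "f \<in> CR" shows "antipode K G f \<in> CR"
proof (rule fin_suppI)
  show "finite ((\<lambda>x. inv\<^bsub>G\<^esub> x) ` {x. f x \<noteq> \<zero>\<^bsub>K\<^esub>})" using fin_supp_finite[OF f] by simp
  show "x \<in> (\<lambda>x. inv\<^bsub>G\<^esub> x) ` {x. f x \<noteq> \<zero>\<^bsub>K\<^esub>}" if "x \<in> carrier G" "antipode K G f x \<noteq> \<zero>\<^bsub>K\<^esub>" for x
    by (rule image_eqI[of _ _ "inv\<^bsub>G\<^esub> x"]) (use that in \<open>auto simp: antipode_def\<close>)
qed (use self.CR_closed[OF f] in \<open>auto simp: antipode_def\<close>)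

lemma antipode_add: "antipode K G (\<lambda>x. f x \<oplus>\<^bsub>K\<^esub> g x) = (\<lambda>x. antipode K G f x \<oplus>\<^bsub>K\<^esub> antipode K G g x)"
  by (auto simp: antipode_def fun_eq_iff)

lemma antipode_single: "y \<in> carrier G \<Longrightarrow> antipode K G (single \<zero>\<^bsub>K\<^esub> y c) = single \<zero>\<^bsub>K\<^esub> (inv\<^bsub>G\<^esub> y) c"
  by (auto simp: antipode_def single_def fun_eq_iff)

lemma antipode_zero: "antipode K G (\<lambda>_. \<zero>\<^bsub>K\<^esub>) = (\<lambda>_. \<zero>\<^bsub>K\<^esub>)"
  by (auto simp: antipode_def fun_eq_iff)

lemma antipode_antipode: "f \<in> CR \<Longrightarrow> antipode K G (antipode K G f) = f"
  using fin_supp_out[of f "carrier G" "carrier K" "\<zero>\<^bsub>K\<^esub>"] by (simp add: antipode_def fun_eq_iff)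

lemma antipode_one: "antipode K G \<one>\<^bsub>R\<^esub> = \<one>\<^bsub>R\<^esub>"
  by (simp add: R_sel antipode_single)

lemma mult_zero_left: "g \<in> CR \<Longrightarrow> (\<lambda>_. \<zero>\<^bsub>K\<^esub>) \<otimes>\<^bsub>R\<^esub> g = (\<lambda>_. \<zero>\<^bsub>K\<^esub>)"
  and mult_zero_right: "g \<in> CR \<Longrightarrow> g \<otimes>\<^bsub>R\<^esub> (\<lambda>_. \<zero>\<^bsub>K\<^esub>) = (\<lambda>_. \<zero>\<^bsub>K\<^esub>)"
  using R.l_null[of g] R.r_null[of g] by (simp_all only: R_sel(1,2))

text \<open>On monomials this is the fact that inversion is a homomorphism of a commutative group;
  both sides are biadditive.\<close>

lemma antipode_mult:
  assumes f: "f \<in> CR" and g: "g \<in> CR"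
  shows "antipode K G (f \<otimes>\<^bsub>R\<^esub> g) = antipode K G f \<otimes>\<^bsub>R\<^esub> antipode K G g"
  using f
proof (induction rule: K.fin_supp_induct)
  case zero show ?case
    by (simp add: mult_zero_left[OF g] mult_zero_left[OF antipode_closed[OF g]] antipode_zero)
next
  case (single y c)
  note s = single_CR[OF single]
  show ?case using g
  proof (induction rule: K.fin_supp_induct)
    case zero show ?case
      by (simp add: mult_zero_right[OF s] mult_zero_right[OF antipode_closed[OF s]] antipode_zero)
  next
    case (single z a)
    show ?case using \<open>y \<in> carrier G\<close> \<open>c \<in> carrier K\<close> single
      by (simp add: mult_single_single antipode_single G.inv_mult)
  next
    case (add f g)
    show ?case
      unfolding mult_add_right[OF add(1,2) s] antipode_add add(3,4)
        mult_add_right[OF antipode_closed[OF add(1)] antipode_closed[OF add(2)] antipode_closed[OF s]] ..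
  qed
next
  case (add f f')
  show ?case
    unfolding mult_add_left[OF add(1,2) g] antipode_add add(3,4)
      mult_add_left[OF antipode_closed[OF add(1)] antipode_closed[OF add(2)] antipode_closed[OF g]] ..
qed

lemma twist_sel:
  "carrier (antipode_twist K G N) = carrier N" "\<zero>\<^bsub>antipode_twist K G N\<^esub> = \<zero>\<^bsub>N\<^esub>"
  "x \<oplus>\<^bsub>antipode_twist K G N\<^esub> y = x \<oplus>\<^bsub>N\<^esub> y" "r \<odot>\<^bsub>antipode_twist K G N\<^esub> x = antipode K G r \<odot>\<^bsub>N\<^esub> x"
  by (simp_all add: antipode_twist_def)

lemma twist_module:
  assumes "Module.module R N"
  shows "Module.module R (antipode_twist K G N)"
proof -
  interpret N: module R N by fact
  have c: "antipode K G r \<in> carrier R" if "r \<in> carrier R" for r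
    using antipode_closed[of r] that by (simp only: R_sel(1))
  have ab: "abelian_group (antipode_twist K G N)"
  proof (rule abelian_groupI)
    fix x assume "x \<in> carrier (antipode_twist K G N)"
    thus "\<exists>y\<in>carrier (antipode_twist K G N). y \<oplus>\<^bsub>antipode_twist K G N\<^esub> x = \<zero>\<^bsub>antipode_twist K G N\<^esub>"
      by (intro bexI[of _ "\<ominus>\<^bsub>N\<^esub> x"]) (auto simp: twist_sel N.l_neg)
  qed (auto simp: twist_sel N.a_ac)
  show ?thesis
  proof (rule moduleI[OF R_cring ab])
    fix r s x assume r: "r \<in> carrier R" "s \<in> carrier R" and x: "x \<in> carrier (antipode_twist K G N)"
    have "antipode K G (r \<oplus>\<^bsub>R\<^esub> s) = antipode K G r \<oplus>\<^bsub>R\<^esub> antipode K G s"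
      by (simp only: R_sel(3) antipode_add)
    thus "(r \<oplus>\<^bsub>R\<^esub> s) \<odot>\<^bsub>antipode_twist K G N\<^esub> x =
        r \<odot>\<^bsub>antipode_twist K G N\<^esub> x \<oplus>\<^bsub>antipode_twist K G N\<^esub> s \<odot>\<^bsub>antipode_twist K G N\<^esub> x"
      using r x c by (simp add: twist_sel N.smult_l_distr)
    have "antipode K G (r \<otimes>\<^bsub>R\<^esub> s) = antipode K G r \<otimes>\<^bsub>R\<^esub> antipode K G s"
      using r by (intro antipode_mult) (simp_all only: R_sel(1))
    thus "(r \<otimes>\<^bsub>R\<^esub> s) \<odot>\<^bsub>antipode_twist K G N\<^esub> x =
        r \<odot>\<^bsub>antipode_twist K G N\<^esub> (s \<odot>\<^bsub>antipode_twist K G N\<^esub> x)"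
      using r x c by (simp add: twist_sel N.smult_assoc1)
  qed (use c in \<open>auto simp: twist_sel N.smult_r_distr antipode_one\<close>)
qed

end

subsection \<open>The form\<close>

locale group_algebra_form = group_algebra_module K G M
  for K :: "('k, 'c) ring_scheme" and G :: "('l, 'd) monoid_scheme" and M :: "('k, 'p) module" +
  fixes \<omega> :: "'p \<Rightarrow> 'p \<Rightarrow> 'k"
  assumes bilinear: "bilinear_form K M \<omega>"
begin

abbreviation form where "form \<equiv> group_form K G M \<omega>"

lemma \<omega>_hom: "a \<in> carrier M \<Longrightarrow> \<omega> a \<in> mod_homs K M (self_module K)"
  "a \<in> carrier M \<Longrightarrow> (\<lambda>b. \<omega> b a) \<in> mod_homs K M (self_module K)"
  using bilinear by (auto simp: bilinear_form_def)

lemma \<omega>_closed [simp]: "a \<in> carrier M \<Longrightarrow> b \<in> carrier M \<Longrightarrow> \<omega> a b \<in> carrier K"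
  using mod_homs_closed[OF \<omega>_hom(1)] by fastforce

lemma \<omega>_zero [simp]: "a \<in> carrier M \<Longrightarrow> \<omega> a \<zero>\<^bsub>M\<^esub> = \<zero>\<^bsub>K\<^esub>" "a \<in> carrier M \<Longrightarrow> \<omega> \<zero>\<^bsub>M\<^esub> a = \<zero>\<^bsub>K\<^esub>"
  using mod_homs_zero[OF M.module_axioms K.self_module_module \<omega>_hom(1)]
    mod_homs_zero[OF M.module_axioms K.self_module_module \<omega>_hom(2)] by fastforce+

lemma \<omega>_add: "a \<in> carrier M \<Longrightarrow> b \<in> carrier M \<Longrightarrow> c \<in> carrier M \<Longrightarrow> \<omega> a (b \<oplus>\<^bsub>M\<^esub> c) = \<omega> a b \<oplus>\<^bsub>K\<^esub> \<omega> a c"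
  "a \<in> carrier M \<Longrightarrow> b \<in> carrier M \<Longrightarrow> c \<in> carrier M \<Longrightarrow> \<omega> (b \<oplus>\<^bsub>M\<^esub> c) a = \<omega> b a \<oplus>\<^bsub>K\<^esub> \<omega> c a"
  using mod_homs_add[OF \<omega>_hom(1)] mod_homs_add[OF \<omega>_hom(2)] by fastforce+

lemma \<omega>_smult: "a \<in> carrier M \<Longrightarrow> b \<in> carrier M \<Longrightarrow> s \<in> carrier K \<Longrightarrow> \<omega> a (s \<odot>\<^bsub>M\<^esub> b) = s \<otimes>\<^bsub>K\<^esub> \<omega> a b"
  "a \<in> carrier M \<Longrightarrow> b \<in> carrier M \<Longrightarrow> s \<in> carrier K \<Longrightarrow> \<omega> (s \<odot>\<^bsub>M\<^esub> b) a = s \<otimes>\<^bsub>K\<^esub> \<omega> b a"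
  using mod_homs_smult[OF \<omega>_hom(1)] mod_homs_smult[OF \<omega>_hom(2)] by fastforce+

lemma form_eq:
  assumes p: "p \<in> CM" and q: "q \<in> CM" and A: "finite A" "{y. p y \<noteq> \<zero>\<^bsub>M\<^esub>} \<subseteq> A" "A \<subseteq> carrier G"
  shows "form p q = (\<lambda>\<nu>. if \<nu> \<in> carrier G then \<Oplus>\<^bsub>K\<^esub>x\<in>A. \<omega> (p x) (q (x \<otimes>\<^bsub>G\<^esub> \<nu>)) else \<zero>\<^bsub>K\<^esub>)"
proof -
  have *: "(\<Oplus>\<^bsub>K\<^esub>x\<in>{x \<in> carrier G. p x \<noteq> \<zero>\<^bsub>M\<^esub>}. \<omega> (p x) (q (x \<otimes>\<^bsub>G\<^esub> \<nu>))) =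
      (\<Oplus>\<^bsub>K\<^esub>x\<in>A. \<omega> (p x) (q (x \<otimes>\<^bsub>G\<^esub> \<nu>)))" for \<nu>
    by (rule K.add.finprod_mono_neutral_cong_left)
      (use A CM_closed[OF p] CM_closed[OF q] in auto)
  show ?thesis by (rule ext) (simp add: group_form_def *)
qed

lemma form_closed:
  assumes p: "p \<in> CM" and q: "q \<in> CM"
  shows "form p q \<in> CR"
proof (rule fin_suppI)
  let ?A = "{x. p x \<noteq> \<zero>\<^bsub>M\<^esub>}"
  have A: "finite ?A" "?A \<subseteq> carrier G" using fin_supp_finite[OF p] fin_supp_sub[OF p] by auto
  note eq = form_eq[OF p q A(1) order_refl A(2)]
  show "finite ((\<lambda>(x, z). inv\<^bsub>G\<^esub> x \<otimes>\<^bsub>G\<^esub> z) ` (?A \<times> {z. q z \<noteq> \<zero>\<^bsub>M\<^esub>}))"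
    using A(1) fin_supp_finite[OF q] by simp
  show "form p q \<nu> \<in> carrier K" if "\<nu> \<in> carrier G" for \<nu>
    unfolding eq using CM_closed[OF p] CM_closed[OF q] by (auto intro!: K.finsum_closed)
  show "form p q \<nu> = \<zero>\<^bsub>K\<^esub>" if "\<nu> \<notin> carrier G" for \<nu> unfolding eq using that by simp
  show "\<nu> \<in> (\<lambda>(x, z). inv\<^bsub>G\<^esub> x \<otimes>\<^bsub>G\<^esub> z) ` (?A \<times> {z. q z \<noteq> \<zero>\<^bsub>M\<^esub>})"
    if x: "\<nu> \<in> carrier G" "form p q \<nu> \<noteq> \<zero>\<^bsub>K\<^esub>" for \<nu>
  proof (rule ccontr)
    assume "\<not> ?thesis"
    hence n: "\<nu> \<noteq> inv\<^bsub>G\<^esub> y \<otimes>\<^bsub>G\<^esub> z" if "y \<in> ?A" "q z \<noteq> \<zero>\<^bsub>M\<^esub>" for y z using that by auto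
    have "q (y \<otimes>\<^bsub>G\<^esub> \<nu>) = \<zero>\<^bsub>M\<^esub>" if "y \<in> ?A" for y
      using n[OF that, of "y \<otimes>\<^bsub>G\<^esub> \<nu>"] that A(2) x(1)
      by (auto simp: G.m_assoc[symmetric] subset_iff)
    hence "(\<Oplus>\<^bsub>K\<^esub>x\<in>?A. \<omega> (p x) (q (x \<otimes>\<^bsub>G\<^esub> \<nu>))) = \<zero>\<^bsub>K\<^esub>"
      by (intro K.add.finprod_one_eqI) (use CM_closed[OF p] in auto)
    thus False using x unfolding eq by simp
  qed
qed

lemma form_add_left:
  assumes p: "p \<in> CM" "p' \<in> CM" and q: "q \<in> CM"
  shows "form (\<lambda>x. p x \<oplus>\<^bsub>M\<^esub> p' x) q = (\<lambda>x. form p q x \<oplus>\<^bsub>K\<^esub> form p' q x)"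
proof -
  let ?A = "{y. p y \<noteq> \<zero>\<^bsub>M\<^esub>} \<union> {y. p' y \<noteq> \<zero>\<^bsub>M\<^esub>}"
  have A: "finite ?A" "?A \<subseteq> carrier G"
    using fin_supp_finite[OF p(1)] fin_supp_finite[OF p(2)] fin_supp_sub[OF p(1)] fin_supp_sub[OF p(2)] by auto
  have pp: "(\<lambda>x. p x \<oplus>\<^bsub>M\<^esub> p' x) \<in> CM" by (rule M.fin_supp_add[OF p])
  have s: "{y. p y \<oplus>\<^bsub>M\<^esub> p' y \<noteq> \<zero>\<^bsub>M\<^esub>} \<subseteq> ?A" by auto
  have "(\<Oplus>\<^bsub>K\<^esub>x\<in>?A. \<omega> (p x \<oplus>\<^bsub>M\<^esub> p' x) (q (x \<otimes>\<^bsub>G\<^esub> \<nu>))) =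
     (\<Oplus>\<^bsub>K\<^esub>x\<in>?A. \<omega> (p x) (q (x \<otimes>\<^bsub>G\<^esub> \<nu>))) \<oplus>\<^bsub>K\<^esub> (\<Oplus>\<^bsub>K\<^esub>x\<in>?A. \<omega> (p' x) (q (x \<otimes>\<^bsub>G\<^esub> \<nu>)))" (is "?l = ?r") for \<nu>
  proof -
    have "?l = (\<Oplus>\<^bsub>K\<^esub>x\<in>?A. \<omega> (p x) (q (x \<otimes>\<^bsub>G\<^esub> \<nu>)) \<oplus>\<^bsub>K\<^esub> \<omega> (p' x) (q (x \<otimes>\<^bsub>G\<^esub> \<nu>)))"
      using CM_closed[OF p(1)] CM_closed[OF p(2)] CM_closed[OF q]
      by (intro K.finsum_cong') (simp_all add: \<omega>_add Pi_iff)
    also have "\<dots> = ?r"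
      using CM_closed[OF p(1)] CM_closed[OF p(2)] CM_closed[OF q]
      by (intro K.finsum_addf) (simp_all add: Pi_iff)
    finally show ?thesis .
  qed
  thus ?thesis
    unfolding form_eq[OF pp q A(1) s A(2)] form_eq[OF p(1) q A(1) Un_upper1 A(2)]
      form_eq[OF p(2) q A(1) Un_upper2 A(2)] by (auto simp: fun_eq_iff)
qed

lemma form_single:
  assumes x: "x \<in> carrier G" and a: "a \<in> carrier M" and q: "q \<in> CM"
  shows "form (single \<zero>\<^bsub>M\<^esub> x a) q = (\<lambda>\<nu>. if \<nu> \<in> carrier G then \<omega> a (q (x \<otimes>\<^bsub>G\<^esub> \<nu>)) else \<zero>\<^bsub>K\<^esub>)"
  by (subst form_eq[OF single_CM[OF x a] q, of "{x}"])
    (use x a CM_closed[OF q] in \<open>auto simp: single_def fun_eq_iff\<close>)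

lemma form_zero_left: "q \<in> CM \<Longrightarrow> form (\<lambda>_. \<zero>\<^bsub>M\<^esub>) q = (\<lambda>_. \<zero>\<^bsub>K\<^esub>)"
  by (subst form_eq[of _ _ "{}"]) (auto simp: fin_supp_def)

lemma form_add_right:
  assumes p: "p \<in> CM" and q: "q \<in> CM" "q' \<in> CM"
  shows "form p (\<lambda>x. q x \<oplus>\<^bsub>M\<^esub> q' x) = (\<lambda>x. form p q x \<oplus>\<^bsub>K\<^esub> form p q' x)"
  using p
proof (induction rule: M.fin_supp_induct)
  case zero show ?case using M.fin_supp_add[OF q] q by (simp add: form_zero_left)
next
  case (single x a)
  show ?case
    unfolding form_single[OF single M.fin_supp_add[OF q]] form_single[OF single q(1)] form_single[OF single q(2)]
    using single CM_closed[OF q(1)] CM_closed[OF q(2)] by (auto simp: fun_eq_iff \<omega>_add)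
next
  case (add p p')
  have c: "form p q x \<in> carrier K" if "p \<in> CM" "q \<in> CM" for p q x
    by (rule CR_closed[OF form_closed[OF that]])
  show ?case
    unfolding form_add_left[OF add(1,2) M.fin_supp_add[OF q]] form_add_left[OF add(1,2) q(1)]
      form_add_left[OF add(1,2) q(2)] add(3,4)
    using c[OF add(1) q(1)] c[OF add(1) q(2)] c[OF add(2) q(1)] c[OF add(2) q(2)] by (simp add: K.a_ac)
qed

lemma mult_eq:
  assumes f: "f \<in> CR" and g: "g \<in> CR" and A: "finite A" "{y. f y \<noteq> \<zero>\<^bsub>K\<^esub>} \<subseteq> A" "A \<subseteq> carrier G"
  shows "f \<otimes>\<^bsub>R\<^esub> g = (\<lambda>x. if x \<in> carrier G then \<Oplus>\<^bsub>K\<^esub>y\<in>A. f y \<otimes>\<^bsub>K\<^esub> g (inv\<^bsub>G\<^esub> y \<otimes>\<^bsub>G\<^esub> x) else \<zero>\<^bsub>K\<^esub>)"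
  using self.smult_eq[of f g A] assms by (simp add: R_sel finsum_self_module fun_eq_iff)

lemma form_smult_right:
  assumes r: "r \<in> CR" and p: "p \<in> CM" and q: "q \<in> CM"
  shows "form p (r \<odot>\<^bsub>MG\<^esub> q) = r \<otimes>\<^bsub>R\<^esub> form p q"
  using p
proof (induction rule: M.fin_supp_induct)
  case zero show ?case using q smult_closed_aux[OF r q] by (simp add: form_zero_left mult_zero_right[OF r])
next
  case (single x a)
  let ?A = "{y. r y \<noteq> \<zero>\<^bsub>K\<^esub>}"
  have A: "finite ?A" "?A \<subseteq> carrier G" using fin_supp_finite[OF r] fin_supp_sub[OF r] by auto
  note s = single_CM[OF single]
  have "\<omega> a (\<Oplus>\<^bsub>M\<^esub>y\<in>?A. r y \<odot>\<^bsub>M\<^esub> q (inv\<^bsub>G\<^esub> y \<otimes>\<^bsub>G\<^esub> (x \<otimes>\<^bsub>G\<^esub> \<nu>))) =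
      (\<Oplus>\<^bsub>K\<^esub>y\<in>?A. r y \<otimes>\<^bsub>K\<^esub> (if inv\<^bsub>G\<^esub> y \<otimes>\<^bsub>G\<^esub> \<nu> \<in> carrier G then \<omega> a (q (x \<otimes>\<^bsub>G\<^esub> (inv\<^bsub>G\<^esub> y \<otimes>\<^bsub>G\<^esub> \<nu>))) else \<zero>\<^bsub>K\<^esub>))"
    (is "?l = ?r") if \<nu>: "\<nu> \<in> carrier G" for \<nu>
  proof -
    have "?l = (\<Oplus>\<^bsub>self_module K\<^esub>y\<in>?A. \<omega> a (r y \<odot>\<^bsub>M\<^esub> q (inv\<^bsub>G\<^esub> y \<otimes>\<^bsub>G\<^esub> (x \<otimes>\<^bsub>G\<^esub> \<nu>))))"
      by (rule mod_homs_finsum[OF M.module_axioms K.self_module_module \<omega>_hom(1)[OF single(2)] A(1)])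
        (use CR_closed[OF r] CM_closed[OF q] in auto)
    also have "\<dots> = ?r"
      unfolding finsum_self_module
    proof (rule K.finsum_cong')
      fix y assume y: "y \<in> ?A"
      hence yG: "y \<in> carrier G" using A(2) by auto
      have "inv\<^bsub>G\<^esub> y \<otimes>\<^bsub>G\<^esub> (x \<otimes>\<^bsub>G\<^esub> \<nu>) = x \<otimes>\<^bsub>G\<^esub> (inv\<^bsub>G\<^esub> y \<otimes>\<^bsub>G\<^esub> \<nu>)"
        using yG \<nu> single(1) by (simp add: G.m_lcomm)
      thus "\<omega> a (r y \<odot>\<^bsub>M\<^esub> q (inv\<^bsub>G\<^esub> y \<otimes>\<^bsub>G\<^esub> (x \<otimes>\<^bsub>G\<^esub> \<nu>))) =
          r y \<otimes>\<^bsub>K\<^esub> (if inv\<^bsub>G\<^esub> y \<otimes>\<^bsub>G\<^esub> \<nu> \<in> carrier G then \<omega> a (q (x \<otimes>\<^bsub>G\<^esub> (inv\<^bsub>G\<^esub> y \<otimes>\<^bsub>G\<^esub> \<nu>))) else \<zero>\<^bsub>K\<^esub>)"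
        using yG \<nu> single CR_closed[OF r] CM_closed[OF q] by (simp add: \<omega>_smult)
    qed (use single CR_closed[OF r] CM_closed[OF q] in auto)
    finally show ?thesis .
  qed
  thus ?case
    unfolding form_single[OF single smult_closed_aux[OF r q]] mult_eq[OF r form_closed[OF s q] A(1) order_refl A(2)]
    unfolding form_single[OF single q] smult_eq[OF r q A(1) order_refl A(2)]
    using single by (auto simp: fun_eq_iff)
next
  case (add p p')
  show ?case
    unfolding form_add_left[OF add(1,2) smult_closed_aux[OF r q]] form_add_left[OF add(1,2) q] add(3,4)
      mult_add_right[OF form_closed[OF add(1) q] form_closed[OF add(2) q] r] ..
qed

text \<open>Shifting the first argument by \<open>y\<close> shifts the coefficients of the form by
  the inverse of \<open>y\<close>. This semilinearity is why the form represents functionals on the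
  twisted module.\<close>

lemma form_smult_left:
  assumes r: "r \<in> CR" and p: "p \<in> CM" and q: "q \<in> CM"
  shows "form (r \<odot>\<^bsub>MG\<^esub> p) q = antipode K G r \<otimes>\<^bsub>R\<^esub> form p q"
  using r
proof (induction rule: K.fin_supp_induct)
  case zero
  show ?case
    using smult_zero_left[OF p] form_zero_left[OF q] antipode_zero mult_zero_left[OF form_closed[OF p q]] by simp
next
  case (single y c)
  note y = single
  note s = single_CR[OF single]
  note s' = single_CR[OF G.inv_closed[OF single(1)] single(2)]
  show ?case using p
  proof (induction rule: M.fin_supp_induct)
    case zero
    show ?case using smult_zero_right[OF s] form_zero_left[OF q] mult_zero_right[OF antipode_closed[OF s]] by simp
  next
    case (single x a)
    have e: "y \<otimes>\<^bsub>G\<^esub> x \<otimes>\<^bsub>G\<^esub> \<nu> = x \<otimes>\<^bsub>G\<^esub> (y \<otimes>\<^bsub>G\<^esub> \<nu>)" if "\<nu> \<in> carrier G" for \<nu>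
      using that y single by (simp add: G.m_ac)
    have yx: "y \<otimes>\<^bsub>G\<^esub> x \<in> carrier G" "c \<odot>\<^bsub>M\<^esub> a \<in> carrier M" using y single by auto
    have "form (single \<zero>\<^bsub>K\<^esub> y c \<odot>\<^bsub>MG\<^esub> single \<zero>\<^bsub>M\<^esub> x a) q =
        (\<lambda>\<nu>. if \<nu> \<in> carrier G then c \<otimes>\<^bsub>K\<^esub> \<omega> a (q (x \<otimes>\<^bsub>G\<^esub> (y \<otimes>\<^bsub>G\<^esub> \<nu>))) else \<zero>\<^bsub>K\<^esub>)"
      unfolding smult_single_single[OF y single] form_single[OF yx q]
      using y single CM_closed[OF q] by (auto simp: fun_eq_iff e \<omega>_smult)
    also have "\<dots> = single \<zero>\<^bsub>K\<^esub> (inv\<^bsub>G\<^esub> y) c \<otimes>\<^bsub>R\<^esub> form (single \<zero>\<^bsub>M\<^esub> x a) q"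
      unfolding form_single[OF single q] R_sel(4)
      using self.smult_single[OF G.inv_closed[OF y(1)] y(2), of "form (single \<zero>\<^bsub>M\<^esub> x a) q"]
        form_closed[OF single_CM[OF single] q] y form_single[OF single q] by (simp add: fun_eq_iff)
    finally show ?case using antipode_single[OF y(1)] by simp
  next
    case (add p p')
    show ?case
      unfolding smult_add_right[OF s add(1,2)] form_add_left[OF smult_closed_aux[OF s add(1)] smult_closed_aux[OF s add(2)] q]
        form_add_left[OF add(1,2) q] add(3,4)
        mult_add_right[OF form_closed[OF add(1) q] form_closed[OF add(2) q] antipode_closed[OF s]] ..
  qed
next
  case (add f g)
  show ?case
    unfolding smult_add_left[OF add(1,2) p] antipode_add
      form_add_left[OF smult_closed_aux[OF add(1) p] smult_closed_aux[OF add(2) p] q] add(3,4)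
      mult_add_left[OF antipode_closed[OF add(1)] antipode_closed[OF add(2)] form_closed[OF p q]] ..
qed

end

section \<open>Regularity of the sequence\<close>

lemma (in comm_group) finprod_pow_add:
  assumes "\<gamma> \<in> A \<rightarrow> carrier G"
  shows "(\<Otimes>\<^bsub>G\<^esub>j\<in>A. \<gamma> j [^]\<^bsub>G\<^esub> (c j :: int)) \<otimes>\<^bsub>G\<^esub> (\<Otimes>\<^bsub>G\<^esub>j\<in>A. \<gamma> j [^]\<^bsub>G\<^esub> c' j) =
    (\<Otimes>\<^bsub>G\<^esub>j\<in>A. \<gamma> j [^]\<^bsub>G\<^esub> (c j + c' j))"
proof -
  have "(\<Otimes>\<^bsub>G\<^esub>j\<in>A. \<gamma> j [^]\<^bsub>G\<^esub> (c j + c' j)) = (\<Otimes>\<^bsub>G\<^esub>j\<in>A. \<gamma> j [^]\<^bsub>G\<^esub> c j \<otimes>\<^bsub>G\<^esub> \<gamma> j [^]\<^bsub>G\<^esub> c' j)"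
    using assms by (intro finprod_cong') (auto simp: int_pow_mult Pi_iff)
  also have "\<dots> = (\<Otimes>\<^bsub>G\<^esub>j\<in>A. \<gamma> j [^]\<^bsub>G\<^esub> c j) \<otimes>\<^bsub>G\<^esub> (\<Otimes>\<^bsub>G\<^esub>j\<in>A. \<gamma> j [^]\<^bsub>G\<^esub> c' j)"
    using assms by (intro finprod_multf) (auto simp: Pi_iff)
  finally show ?thesis by simp
qed

section \<open>Independent families in an abelian group\<close>

locale independent_family = comm_group G for G :: "('l, 'd) monoid_scheme" +
  fixes D :: nat and \<gamma> :: "nat \<Rightarrow> 'l"
  assumes \<gamma>_closed: "\<gamma> \<in> {1..D} \<rightarrow> carrier G"
    and independent: "(\<Otimes>\<^bsub>G\<^esub>j\<in>{1..D}. \<gamma> j [^]\<^bsub>G\<^esub> (c j :: int)) = \<one>\<^bsub>G\<^esub> \<Longrightarrow> j \<in> {1..D} \<Longrightarrow> c j = 0"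
begin

definition gen_upto :: "nat \<Rightarrow> 'l set" where
  "gen_upto s = {\<Otimes>\<^bsub>G\<^esub>j\<in>{1..s}. \<gamma> j [^]\<^bsub>G\<^esub> c j | c :: nat \<Rightarrow> int. True}"

lemma \<gamma>_upto: "s \<le> D \<Longrightarrow> \<gamma> \<in> {1..s} \<rightarrow> carrier G"
  using \<gamma>_closed by (auto simp: Pi_iff)

lemma gen_upto_closed: "s \<le> D \<Longrightarrow> w \<in> gen_upto s \<Longrightarrow> w \<in> carrier G"
  using \<gamma>_upto[of s] by (auto simp: gen_upto_def Pi_iff intro!: finprod_closed)

lemma gen_upto_mult: "s \<le> D \<Longrightarrow> w \<in> gen_upto s \<Longrightarrow> w' \<in> gen_upto s \<Longrightarrow> w \<otimes>\<^bsub>G\<^esub> w' \<in> gen_upto s"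
  unfolding gen_upto_def using finprod_pow_add[OF \<gamma>_upto] by fast

lemma gen_upto_one: "\<one>\<^bsub>G\<^esub> \<in> gen_upto s"
  unfolding gen_upto_def by (rule CollectI, rule exI[of _ "\<lambda>_. 0"]) simp

lemma gen_upto_inv:
  assumes s: "s \<le> D" and w: "w \<in> gen_upto s" shows "inv\<^bsub>G\<^esub> w \<in> gen_upto s"
proof -
  obtain c where c: "w = (\<Otimes>\<^bsub>G\<^esub>j\<in>{1..s}. \<gamma> j [^]\<^bsub>G\<^esub> (c j :: int))" using w by (auto simp: gen_upto_def)
  let ?w = "\<Otimes>\<^bsub>G\<^esub>j\<in>{1..s}. \<gamma> j [^]\<^bsub>G\<^esub> (- c j)"
  have w': "?w \<in> gen_upto s" by (auto simp: gen_upto_def)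
  have "?w \<otimes>\<^bsub>G\<^esub> w = \<one>\<^bsub>G\<^esub>" unfolding c finprod_pow_add[OF \<gamma>_upto[OF s]] by simp
  hence "inv\<^bsub>G\<^esub> w = ?w" by (rule inv_equality[OF _ gen_upto_closed[OF s w] gen_upto_closed[OF s w']])
  thus ?thesis using w' by simp
qed

lemma gen_upto_\<gamma>: assumes s: "s \<le> D" and j: "j \<in> {1..s}" shows "\<gamma> j \<in> gen_upto s"
proof -
  have \<gamma>: "\<gamma> i \<in> carrier G" if "i \<in> {1..s}" for i using \<gamma>_upto[OF s] that by auto
  have "(\<Otimes>\<^bsub>G\<^esub>i\<in>{1..s}. \<gamma> i [^]\<^bsub>G\<^esub> (if j = i then 1 else 0 :: int)) =
      (\<Otimes>\<^bsub>G\<^esub>i\<in>{1..s}. if j = i then \<gamma> i else \<one>\<^bsub>G\<^esub>)"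
    using \<gamma> by (intro finprod_cong') (auto simp: int_pow_1)
  also have "\<dots> = \<gamma> j" by (rule finprod_singleton[OF j]) (use \<gamma> in auto)
  finally show ?thesis unfolding gen_upto_def
    by (intro CollectI exI[of _ "\<lambda>i. if j = i then 1 else 0"]) simp
qed

lemma pow_not_gen:
  assumes s: "s < D" and N: "\<gamma> (Suc s) [^]\<^bsub>G\<^esub> (N :: nat) \<in> gen_upto s"
  shows "N = 0"
proof -
  obtain c where c: "\<gamma> (Suc s) [^]\<^bsub>G\<^esub> N = (\<Otimes>\<^bsub>G\<^esub>j\<in>{1..s}. \<gamma> j [^]\<^bsub>G\<^esub> (c j :: int))"
    using N by (auto simp: gen_upto_def)
  \<comment> \<open>The relation moved to one side and extended by zero beyond \<open>Suc s\<close>,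
    ready to be tested against independence.\<close>
  define c' where "c' j = (if j = Suc s then int N else if j \<le> s then - c j else 0)" for j
  have \<gamma>: "\<gamma> i \<in> carrier G" if "i \<in> {1..D}" for i using \<gamma>_closed that by auto
  have \<gamma>s: "\<gamma> (Suc s) \<in> carrier G" using \<gamma> s by simp
  let ?w = "\<Otimes>\<^bsub>G\<^esub>j\<in>{1..s}. \<gamma> j [^]\<^bsub>G\<^esub> (- c j)"
  have sD: "s \<le> D" using s by simp
  have w: "?w \<in> carrier G" by (rule gen_upto_closed[OF sD]) (auto simp: gen_upto_def)
  have "(\<Otimes>\<^bsub>G\<^esub>j\<in>{1..D}. \<gamma> j [^]\<^bsub>G\<^esub> c' j) = (\<Otimes>\<^bsub>G\<^esub>j\<in>{1..Suc s}. \<gamma> j [^]\<^bsub>G\<^esub> c' j)"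
    by (rule finprod_mono_neutral_cong_right) (use s \<gamma> in \<open>auto simp: c'_def\<close>)
  also have "{1..Suc s} = insert (Suc s) {1..s}" by auto
  also have "(\<Otimes>\<^bsub>G\<^esub>j\<in>insert (Suc s) {1..s}. \<gamma> j [^]\<^bsub>G\<^esub> c' j) =
      \<gamma> (Suc s) [^]\<^bsub>G\<^esub> c' (Suc s) \<otimes>\<^bsub>G\<^esub> (\<Otimes>\<^bsub>G\<^esub>j\<in>{1..s}. \<gamma> j [^]\<^bsub>G\<^esub> c' j)"
    by (rule finprod_insert) (use s \<gamma> \<gamma>s in auto)
  also have "(\<Otimes>\<^bsub>G\<^esub>j\<in>{1..s}. \<gamma> j [^]\<^bsub>G\<^esub> c' j) = ?w"
    by (rule finprod_cong') (use s \<gamma> in \<open>auto simp: c'_def\<close>)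
  also have "\<gamma> (Suc s) [^]\<^bsub>G\<^esub> c' (Suc s) = (\<Otimes>\<^bsub>G\<^esub>j\<in>{1..s}. \<gamma> j [^]\<^bsub>G\<^esub> c j)"
    using c by (simp add: c'_def int_pow_int)
  also have "(\<Otimes>\<^bsub>G\<^esub>j\<in>{1..s}. \<gamma> j [^]\<^bsub>G\<^esub> c j) \<otimes>\<^bsub>G\<^esub> ?w = \<one>\<^bsub>G\<^esub>"
    unfolding finprod_pow_add[OF \<gamma>_upto[OF sD]] by simp
  finally have "c' (Suc s) = 0" using s by (intro independent) auto
  thus ?thesis by (simp add: c'_def)
qed

text \<open>Two exponents that both bring \<open>b\<close> into the coset of \<open>a\<close> differ
  by an exponent that puts a power of \<open>\<gamma> (Suc s)\<close> into the subgroup, so they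
  agree. Each pair of points excludes at most one \<open>N\<close>, and finitely many pairs leave
  some \<open>N\<close> over: the translate of \<open>S\<close> then avoids all cosets of
  \<open>gen_upto s\<close> that meet \<open>S\<close>.\<close>

lemma pow_separates:
  assumes s: "s < D" and S: "finite S" "S \<subseteq> carrier G"
  shows "\<exists>N::nat. \<forall>a\<in>S. \<forall>b\<in>S. \<forall>w\<in>gen_upto s. \<gamma> (Suc s) [^]\<^bsub>G\<^esub> N \<otimes>\<^bsub>G\<^esub> b \<noteq> a \<otimes>\<^bsub>G\<^esub> w"
proof -
  have \<gamma>: "\<gamma> (Suc s) \<in> carrier G" using \<gamma>_closed s by auto
  have sD: "s \<le> D" using s by simp
  define bad where "bad a b = {N::nat. \<exists>w\<in>gen_upto s. \<gamma> (Suc s) [^]\<^bsub>G\<^esub> N \<otimes>\<^bsub>G\<^esub> b = a \<otimes>\<^bsub>G\<^esub> w}" for a b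
  have bad1: "N \<le> N'" if ab: "a \<in> carrier G" "b \<in> carrier G" and N: "N \<in> bad a b" "N' \<in> bad a b" for a b N N'
  proof (rule ccontr)
    assume "\<not> N \<le> N'"
    then obtain k where k: "N = N' + k" "k \<noteq> 0" by (metis less_imp_add_positive not_le not_less0)
    obtain w w' where w: "w \<in> gen_upto s" "\<gamma> (Suc s) [^]\<^bsub>G\<^esub> N \<otimes>\<^bsub>G\<^esub> b = a \<otimes>\<^bsub>G\<^esub> w"
      "w' \<in> gen_upto s" "\<gamma> (Suc s) [^]\<^bsub>G\<^esub> N' \<otimes>\<^bsub>G\<^esub> b = a \<otimes>\<^bsub>G\<^esub> w'" using N by (auto simp: bad_def)
    have wc: "w \<in> carrier G" "w' \<in> carrier G" using gen_upto_closed[OF sD] w by auto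
    let ?y = "\<gamma> (Suc s)"
    have "a \<otimes>\<^bsub>G\<^esub> w = ?y [^]\<^bsub>G\<^esub> k \<otimes>\<^bsub>G\<^esub> (?y [^]\<^bsub>G\<^esub> N' \<otimes>\<^bsub>G\<^esub> b)"
      unfolding w(2)[symmetric] k(1) using \<gamma> ab by (simp add: nat_pow_mult[symmetric] m_ac)
    also have "\<dots> = a \<otimes>\<^bsub>G\<^esub> (?y [^]\<^bsub>G\<^esub> k \<otimes>\<^bsub>G\<^esub> w')"
      unfolding w(4) using \<gamma> ab wc by (simp add: m_lcomm)
    finally have "w = ?y [^]\<^bsub>G\<^esub> k \<otimes>\<^bsub>G\<^esub> w'" using \<gamma> ab wc by simp
    hence "?y [^]\<^bsub>G\<^esub> k = w \<otimes>\<^bsub>G\<^esub> inv\<^bsub>G\<^esub> w'" using \<gamma> wc by (simp add: m_assoc)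
    also have "\<dots> \<in> gen_upto s" by (rule gen_upto_mult[OF sD w(1) gen_upto_inv[OF sD w(3)]])
    finally have "?y [^]\<^bsub>G\<^esub> k \<in> gen_upto s" .
    from pow_not_gen[OF s this] k(2) show False by simp
  qed
  have fin: "finite (bad a b)" if "a \<in> S" "b \<in> S" for a b
  proof (cases "bad a b = {}")
    case False
    then obtain N where N: "N \<in> bad a b" by blast
    have ab: "a \<in> carrier G" "b \<in> carrier G" using S(2) that by auto
    have "bad a b \<subseteq> {N}"
    proof
      fix n assume n: "n \<in> bad a b"
      show "n \<in> {N}" using le_antisym[OF bad1[OF ab n N] bad1[OF ab N n]] by simp
    qed
    thus ?thesis by (rule finite_subset) simp
  qed simp
  have "finite (\<Union>a\<in>S. \<Union>b\<in>S. bad a b)" using S(1) fin by blast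
  from ex_new_if_finite[OF infinite_UNIV_nat this] obtain N where N: "N \<notin> (\<Union>a\<in>S. \<Union>b\<in>S. bad a b)" ..
  have "\<gamma> (Suc s) [^]\<^bsub>G\<^esub> N \<otimes>\<^bsub>G\<^esub> b \<noteq> a \<otimes>\<^bsub>G\<^esub> w" if "a \<in> S" "b \<in> S" "w \<in> gen_upto s" for a b w
    using N that unfolding bad_def by simp
  thus ?thesis by (intro exI[of _ N]) simp
qed

end

section \<open>Regularity of the elements 1 - x^\<gamma> on modules A[G]\<close>

locale group_algebra_basis = group_algebra_module K G M + independent_family G D \<gamma>
  for K :: "('k, 'c) ring_scheme" and G :: "('l, 'd) monoid_scheme" and M :: "('k, 'p) module" and D \<gamma>
begin

sublocale MG: Module.module R MG by (rule MG_module)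

abbreviation t where "t \<equiv> (\<lambda>j. \<one>\<^bsub>R\<^esub> \<ominus>\<^bsub>R\<^esub> group_elt K (\<gamma> j))"

abbreviation mon where "mon y \<equiv> single \<zero>\<^bsub>K\<^esub> y \<one>\<^bsub>K\<^esub>"

lemma group_elt_single: "group_elt K y = mon y"
  by (simp add: group_elt_def single_def)

lemma mon_closed: "y \<in> carrier G \<Longrightarrow> mon y \<in> carrier R"
  by (simp add: R_sel single_CR)

lemma t_closed: "t \<in> {1..D} \<rightarrow> carrier R"
  using \<gamma>_closed mon_closed by (auto simp: group_elt_single Pi_iff)

lemma t_pow_closed: "s \<le> D \<Longrightarrow> (\<lambda>j. t j [^]\<^bsub>R\<^esub> (k::nat)) \<in> {1..s} \<rightarrow> carrier R"
  using t_closed by (auto simp: Pi_iff)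

lemma t_smult:
  assumes "j \<in> {1..D}" "p \<in> carrier MG"
  shows "t j \<odot>\<^bsub>MG\<^esub> p = p \<ominus>\<^bsub>MG\<^esub> mon (\<gamma> j) \<odot>\<^bsub>MG\<^esub> p"
proof -
  have "mon (\<gamma> j) \<in> carrier R" using assms \<gamma>_closed mon_closed by (auto simp: Pi_iff)
  thus ?thesis unfolding group_elt_single a_minus_def using assms(2)
    by (simp add: MG.smult_l_distr MG.smult_l_minus)
qed

lemma mon_smult:
  "y \<in> carrier G \<Longrightarrow> p \<in> carrier MG \<Longrightarrow>
    mon y \<odot>\<^bsub>MG\<^esub> p = (\<lambda>x. if x \<in> carrier G then p (inv\<^bsub>G\<^esub> y \<otimes>\<^bsub>G\<^esub> x) else \<zero>\<^bsub>M\<^esub>)"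
  using smult_single[of y "\<one>\<^bsub>K\<^esub>" p] CM_closed[of p] by (simp add: MG_sel fun_eq_iff)

text \<open>Projection to the coefficients at \<open>V\<close>. It is not linear over the group
  ring, but for a union \<open>V\<close> of cosets of the subgroup generated by some of the
  \<open>\<gamma> j\<close> it commutes with the corresponding \<open>t j\<close>, and so preserves
  the submodules they span.\<close>

definition cut :: "'l set \<Rightarrow> ('l \<Rightarrow> 'p) \<Rightarrow> 'l \<Rightarrow> 'p" where
  "cut V p = (\<lambda>x. if x \<in> V then p x else \<zero>\<^bsub>M\<^esub>)"

lemma cut_closed: assumes "p \<in> carrier MG" shows "cut V p \<in> carrier MG"
proof -
  have p: "p \<in> CM" using assms by (simp add: MG_sel)
  show ?thesis
    unfolding MG_sel cut_def
    by (rule fin_suppI[where S = "{x. p x \<noteq> \<zero>\<^bsub>M\<^esub>}"])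
      (simp_all add: CM_closed[OF p] fin_supp_out[OF p] fin_supp_finite[OF p] split: if_splits)
qed

lemma cut_add: "p \<in> carrier MG \<Longrightarrow> q \<in> carrier MG \<Longrightarrow> cut V (p \<oplus>\<^bsub>MG\<^esub> q) = cut V p \<oplus>\<^bsub>MG\<^esub> cut V q"
  by (auto simp: MG_sel cut_def fun_eq_iff)

lemma MG_uminus: assumes p: "p \<in> carrier MG" shows "\<ominus>\<^bsub>MG\<^esub> p = (\<lambda>x. \<ominus>\<^bsub>M\<^esub> p x)"
proof (rule MG.minus_equality)
  have "(\<lambda>x. \<ominus>\<^bsub>M\<^esub> p x) \<in> CM"
    by (rule fin_suppI[where S = "{x. p x \<noteq> \<zero>\<^bsub>M\<^esub>}"])
      (use p CM_closed[of p] fin_supp_out[of p] fin_supp_finite[of p] in \<open>auto simp: MG_sel\<close>)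
  thus "(\<lambda>x. \<ominus>\<^bsub>M\<^esub> p x) \<in> carrier MG" by (simp add: MG_sel)
  show "(\<lambda>x. \<ominus>\<^bsub>M\<^esub> p x) \<oplus>\<^bsub>MG\<^esub> p = \<zero>\<^bsub>MG\<^esub>"
    using p CM_closed[of p] by (simp add: MG_sel M.l_neg)
qed (rule p)

lemma cut_uminus: "p \<in> carrier MG \<Longrightarrow> cut V (\<ominus>\<^bsub>MG\<^esub> p) = \<ominus>\<^bsub>MG\<^esub> cut V p"
  by (simp add: MG_uminus cut_closed) (auto simp: cut_def)

lemma cut_minus: "p \<in> carrier MG \<Longrightarrow> q \<in> carrier MG \<Longrightarrow> cut V (p \<ominus>\<^bsub>MG\<^esub> q) = cut V p \<ominus>\<^bsub>MG\<^esub> cut V q"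
  by (simp add: a_minus_def cut_add cut_uminus)

lemma cut_mon:
  assumes "y \<in> carrier G" "p \<in> carrier MG" "\<And>x. x \<in> carrier G \<Longrightarrow> inv\<^bsub>G\<^esub> y \<otimes>\<^bsub>G\<^esub> x \<in> V \<longleftrightarrow> x \<in> V"
  shows "cut V (mon y \<odot>\<^bsub>MG\<^esub> p) = mon y \<odot>\<^bsub>MG\<^esub> cut V p"
  using assms by (auto simp: mon_smult cut_closed) (auto simp: cut_def fun_eq_iff)

lemma cut_t_pow:
  assumes j: "j \<in> {1..D}" and V: "\<And>x. x \<in> carrier G \<Longrightarrow> inv\<^bsub>G\<^esub> (\<gamma> j) \<otimes>\<^bsub>G\<^esub> x \<in> V \<longleftrightarrow> x \<in> V"
  shows "p \<in> carrier MG \<Longrightarrow> cut V (t j [^]\<^bsub>R\<^esub> (k::nat) \<odot>\<^bsub>MG\<^esub> p) = t j [^]\<^bsub>R\<^esub> k \<odot>\<^bsub>MG\<^esub> cut V p"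
proof (induction k arbitrary: p)
  case 0 thus ?case by (simp add: cut_closed)
next
  case (Suc k)
  have tj: "t j \<in> carrier R" and \<gamma>j: "\<gamma> j \<in> carrier G" using t_closed \<gamma>_closed j by auto
  have m: "mon (\<gamma> j) \<odot>\<^bsub>MG\<^esub> p \<in> carrier MG" using mon_closed[OF \<gamma>j] Suc.prems by simp
  have tp: "t j \<odot>\<^bsub>MG\<^esub> p \<in> carrier MG" using tj Suc.prems by blast
  have pw: "t j [^]\<^bsub>R\<^esub> Suc k \<odot>\<^bsub>MG\<^esub> q = t j [^]\<^bsub>R\<^esub> k \<odot>\<^bsub>MG\<^esub> (t j \<odot>\<^bsub>MG\<^esub> q)" if "q \<in> carrier MG" for q
    using MG.smult_assoc1[OF R.nat_pow_closed[OF tj] tj that] by simp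
  have cm: "cut V (mon (\<gamma> j) \<odot>\<^bsub>MG\<^esub> p) = mon (\<gamma> j) \<odot>\<^bsub>MG\<^esub> cut V p"
    by (rule cut_mon[OF \<gamma>j Suc.prems V])
  have "cut V (t j \<odot>\<^bsub>MG\<^esub> p) = t j \<odot>\<^bsub>MG\<^esub> cut V p"
    unfolding t_smult[OF j Suc.prems] t_smult[OF j cut_closed[OF Suc.prems]] cut_minus[OF Suc.prems m] cm ..
  thus ?case unfolding pw[OF Suc.prems] pw[OF cut_closed[OF Suc.prems]] Suc.IH[OF tp] by simp
qed

text \<open>The submodule \<open>A[G]\<close> of \<open>M[G]\<close>. Working modulo it amounts to
  working in \<open>(M / A)[G]\<close> without a new coefficient module.\<close>

definition coeffs_in :: "'p set \<Rightarrow> ('l \<Rightarrow> 'p) set" where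
  "coeffs_in A = {p \<in> carrier MG. \<forall>x. p x \<in> A}"

lemma coeffs_in_submodule:
  assumes A: "submodule A K M"
  shows "submodule (coeffs_in A) R MG"
proof -
  note A' = M.sub_facts[OF A]
  show ?thesis
  proof (rule MG.submoduleI)
    show "coeffs_in A \<subseteq> carrier MG" by (auto simp: coeffs_in_def)
    show "\<zero>\<^bsub>MG\<^esub> \<in> coeffs_in A" using MG.zero_closed A'(2) by (auto simp: coeffs_in_def MG_sel(2))
    show "\<ominus>\<^bsub>MG\<^esub> p \<in> coeffs_in A" if "p \<in> coeffs_in A" for p
      using that MG.a_inv_closed[of p] A'(5) by (auto simp: coeffs_in_def MG_uminus)
    show "p \<oplus>\<^bsub>MG\<^esub> q \<in> coeffs_in A" if "p \<in> coeffs_in A" "q \<in> coeffs_in A" for p q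
      using that MG.a_closed[of p q] A'(3) by (auto simp: coeffs_in_def MG_sel(3))
    fix r p assume r: "r \<in> carrier R" and p: "p \<in> coeffs_in A"
    have "r \<odot>\<^bsub>MG\<^esub> p \<in> carrier MG" using r p by (auto simp: coeffs_in_def)
    moreover have "(r \<odot>\<^bsub>MG\<^esub> p) x \<in> A" for x
    proof -
      have rC: "r \<in> CR" using r by (simp add: R_sel)
      have "(\<Oplus>\<^bsub>M\<^esub>y\<in>{y \<in> carrier G. r y \<noteq> \<zero>\<^bsub>K\<^esub>}. r y \<odot>\<^bsub>M\<^esub> p (inv\<^bsub>G\<^esub> y \<otimes>\<^bsub>G\<^esub> x)) \<in> A"
        by (rule M.sub_finsum[OF A])
          (use fin_supp_finite[OF rC] A'(4) CR_closed[OF rC] p in \<open>auto simp: coeffs_in_def\<close>)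
      thus ?thesis using A'(2) by (simp add: group_module_def)
    qed
    ultimately show "r \<odot>\<^bsub>MG\<^esub> p \<in> coeffs_in A" by (auto simp: coeffs_in_def)
  qed
qed

lemma cut_span:
  assumes A: "submodule A K M" and s: "s \<le> D"
    and V: "\<And>x j. x \<in> carrier G \<Longrightarrow> j \<in> {1..s} \<Longrightarrow> inv\<^bsub>G\<^esub> (\<gamma> j) \<otimes>\<^bsub>G\<^esub> x \<in> V \<longleftrightarrow> x \<in> V"
  shows "p \<in> span_mod R MG (\<lambda>j. t j [^]\<^bsub>R\<^esub> (k::nat)) (coeffs_in A) s \<Longrightarrow>
    cut V p \<in> span_mod R MG (\<lambda>j. t j [^]\<^bsub>R\<^esub> k) (coeffs_in A) s"
  using s V
proof (induction s arbitrary: p)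
  case 0
  thus ?case using M.sub_facts(2)[OF A] cut_closed by (auto simp: coeffs_in_def) (auto simp: cut_def)
next
  case (Suc s)
  let ?v = "\<lambda>j. t j [^]\<^bsub>R\<^esub> k"
  obtain q m where p: "p = q \<oplus>\<^bsub>MG\<^esub> ?v (Suc s) \<odot>\<^bsub>MG\<^esub> m" "q \<in> span_mod R MG ?v (coeffs_in A) s" "m \<in> carrier MG"
    using Suc.prems(1) by auto
  have sD: "s \<le> D" "Suc s \<in> {1..D}" "Suc s \<in> {1..Suc s}" using Suc.prems(2) by auto
  have q: "q \<in> carrier MG"
    using MG.sub_facts(1)[OF MG.span_mod_submodule[OF coeffs_in_submodule[OF A] t_pow_closed[OF sD(1)]]] p(2) by blast
  have tm: "?v (Suc s) \<odot>\<^bsub>MG\<^esub> m \<in> carrier MG"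
    using p(3) t_pow_closed[OF Suc.prems(2), of k] sD(3) by blast
  have e: "cut V p = cut V q \<oplus>\<^bsub>MG\<^esub> ?v (Suc s) \<odot>\<^bsub>MG\<^esub> cut V m"
    unfolding p(1) cut_add[OF q tm] using cut_t_pow[OF sD(2) Suc.prems(3)[OF _ sD(3)] p(3)] by simp
  have "cut V q \<in> span_mod R MG ?v (coeffs_in A) s"
    by (rule Suc.IH[OF p(2) sD(1)]) (rule Suc.prems(3), auto)
  from MG.span_mod_SucI[OF this cut_closed[OF p(3)] e] show ?case .
qed

text \<open>Modulo the span, \<open>m\<close> agrees with its translate by
  \<open>\<gamma> (Suc s)\<close>, hence with all translates by powers. A suitable power moves the
  support of \<open>m\<close> off the cosets of \<open>gen_upto s\<close> that it meets. Cutting the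
  difference of \<open>m\<close> and this translate down to these cosets returns \<open>m\<close>,
  and the cut preserves the span.\<close>

lemma span_regular_step:
  assumes A: "submodule A K M" and s: "s < D" and m: "m \<in> carrier MG"
    and tm: "t (Suc s) \<odot>\<^bsub>MG\<^esub> m \<in> span_mod R MG (\<lambda>j. t j [^]\<^bsub>R\<^esub> (k::nat)) (coeffs_in A) s"
  shows "m \<in> span_mod R MG (\<lambda>j. t j [^]\<^bsub>R\<^esub> k) (coeffs_in A) s"
proof -
  let ?S = "span_mod R MG (\<lambda>j. t j [^]\<^bsub>R\<^esub> k) (coeffs_in A) s"
  let ?y = "\<gamma> (Suc s)"
  have sD: "s \<le> D" "Suc s \<in> {1..D}" using s by auto
  have y: "?y \<in> carrier G" using \<gamma>_closed sD by auto
  have S: "submodule ?S R MG" by (rule MG.span_mod_submodule[OF coeffs_in_submodule[OF A] t_pow_closed[OF sD(1)]])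
  note sf = MG.sub_facts[OF S]
  let ?supp = "{x. m x \<noteq> \<zero>\<^bsub>M\<^esub>}"
  have mC: "m \<in> CM" using m by (simp add: MG_sel)
  have supp: "finite ?supp" "?supp \<subseteq> carrier G" using fin_supp_finite[OF mC] fin_supp_sub[OF mC] by auto
  obtain N :: nat where N: "\<And>a b w. a \<in> ?supp \<Longrightarrow> b \<in> ?supp \<Longrightarrow> w \<in> gen_upto s \<Longrightarrow> ?y [^]\<^bsub>G\<^esub> N \<otimes>\<^bsub>G\<^esub> b \<noteq> a \<otimes>\<^bsub>G\<^esub> w"
    using pow_separates[OF s supp] by blast
  have yn: "?y [^]\<^bsub>G\<^esub> n \<in> carrier G" for n :: nat using y by simp
  have mm: "mon (?y [^]\<^bsub>G\<^esub> n) \<odot>\<^bsub>MG\<^esub> m \<in> carrier MG" for n :: nat using mon_closed[OF yn] m by blast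
  have 1: "m \<ominus>\<^bsub>MG\<^esub> mon ?y \<odot>\<^bsub>MG\<^esub> m \<in> ?S" using tm unfolding t_smult[OF sD(2) m] .
  \<comment> \<open>Multiplication by the monomial preserves \<open>?S\<close>, so the congruence of
    \<open>m\<close> with its first translate propagates to all of them.\<close>
  have diff: "m \<ominus>\<^bsub>MG\<^esub> mon (?y [^]\<^bsub>G\<^esub> n) \<odot>\<^bsub>MG\<^esub> m \<in> ?S" for n :: nat
  proof (induction n)
    case 0
    have "mon (?y [^]\<^bsub>G\<^esub> (0::nat)) \<odot>\<^bsub>MG\<^esub> m = m" using MG.smult_one[OF m] by (simp add: R_sel)
    thus ?case using sf(2) m by (simp add: a_minus_def MG.r_neg)
  next
    case (Suc n)
    have "mon ?y \<otimes>\<^bsub>R\<^esub> mon (?y [^]\<^bsub>G\<^esub> n) = mon (?y [^]\<^bsub>G\<^esub> Suc n)"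
      using mult_single_single[OF y K.one_closed yn[of n] K.one_closed] y by (simp add: m_comm)
    hence e: "mon (?y [^]\<^bsub>G\<^esub> Suc n) \<odot>\<^bsub>MG\<^esub> m = mon ?y \<odot>\<^bsub>MG\<^esub> (mon (?y [^]\<^bsub>G\<^esub> n) \<odot>\<^bsub>MG\<^esub> m)"
      using MG.smult_assoc1[OF mon_closed[OF y] mon_closed[OF yn[of n]] m] by simp
    have ym: "mon ?y \<odot>\<^bsub>MG\<^esub> m \<in> carrier MG" using mon_closed[OF y] m by blast
    have yym: "mon ?y \<odot>\<^bsub>MG\<^esub> (mon (?y [^]\<^bsub>G\<^esub> n) \<odot>\<^bsub>MG\<^esub> m) \<in> carrier MG" using mon_closed[OF y] mm by blast
    have "(m \<ominus>\<^bsub>MG\<^esub> mon ?y \<odot>\<^bsub>MG\<^esub> m) \<oplus>\<^bsub>MG\<^esub> mon ?y \<odot>\<^bsub>MG\<^esub> (m \<ominus>\<^bsub>MG\<^esub> mon (?y [^]\<^bsub>G\<^esub> n) \<odot>\<^bsub>MG\<^esub> m) =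
        m \<ominus>\<^bsub>MG\<^esub> mon (?y [^]\<^bsub>G\<^esub> Suc n) \<odot>\<^bsub>MG\<^esub> m"
      unfolding e MG.smult_minus_distrib[OF mon_closed[OF y] m mm] using m ym yym
      by (simp add: a_minus_def MG.a_assoc MG.r_neg1)
    thus ?case using sf(3)[OF 1 sf(4)[OF mon_closed[OF y] Suc]] by simp
  qed
  \<comment> \<open>The union of the cosets of \<open>gen_upto s\<close> that meet the support of
    \<open>m\<close>; it contains the support and is stable under the first \<open>s\<close>
    generators.\<close>
  define V where "V = {a \<otimes>\<^bsub>G\<^esub> w | a w. a \<in> ?supp \<and> w \<in> gen_upto s}"
  have V: "inv\<^bsub>G\<^esub> (\<gamma> j) \<otimes>\<^bsub>G\<^esub> x \<in> V \<longleftrightarrow> x \<in> V" if x: "x \<in> carrier G" and j: "j \<in> {1..s}" for x j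
  proof -
    have \<gamma>j: "\<gamma> j \<in> carrier G" using \<gamma>_upto[OF sD(1)] j by auto
    have step: "u \<otimes>\<^bsub>G\<^esub> z \<in> V" if u: "u \<in> gen_upto s" and z: "z \<in> V" for u z
    proof -
      obtain a w where aw: "z = a \<otimes>\<^bsub>G\<^esub> w" "a \<in> ?supp" "w \<in> gen_upto s" using z by (auto simp: V_def)
      have "u \<otimes>\<^bsub>G\<^esub> z = a \<otimes>\<^bsub>G\<^esub> (u \<otimes>\<^bsub>G\<^esub> w)"
        using aw supp(2) gen_upto_closed[OF sD(1)] u by (auto simp: m_lcomm subset_iff)
      thus ?thesis using aw gen_upto_mult[OF sD(1) u aw(3)] unfolding V_def by blast
    qed
    have "x = \<gamma> j \<otimes>\<^bsub>G\<^esub> (inv\<^bsub>G\<^esub> (\<gamma> j) \<otimes>\<^bsub>G\<^esub> x)" using x \<gamma>j by (simp add: m_assoc[symmetric])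
    thus ?thesis using step[OF gen_upto_inv[OF sD(1) gen_upto_\<gamma>[OF sD(1) j]], of x]
        step[OF gen_upto_\<gamma>[OF sD(1) j], of "inv\<^bsub>G\<^esub> (\<gamma> j) \<otimes>\<^bsub>G\<^esub> x"] by auto
  qed
  have "cut V (m \<ominus>\<^bsub>MG\<^esub> mon (?y [^]\<^bsub>G\<^esub> N) \<odot>\<^bsub>MG\<^esub> m) \<in> ?S"
    by (rule cut_span[OF A sD(1) V diff])
  moreover have "cut V m = m"
  proof (rule ext)
    fix x show "cut V m x = m x"
    proof (cases "x \<in> ?supp")
      case True
      hence "x = x \<otimes>\<^bsub>G\<^esub> \<one>\<^bsub>G\<^esub>" using supp(2) by (auto simp: subset_iff)
      hence "x \<in> V" unfolding V_def using gen_upto_one[of s] True by blast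
      thus ?thesis by (simp add: cut_def)
    qed (simp add: cut_def)
  qed
  moreover have "cut V (mon (?y [^]\<^bsub>G\<^esub> N) \<odot>\<^bsub>MG\<^esub> m) = \<zero>\<^bsub>MG\<^esub>"
  proof -
    have "m (inv\<^bsub>G\<^esub> (?y [^]\<^bsub>G\<^esub> N) \<otimes>\<^bsub>G\<^esub> x) = \<zero>\<^bsub>M\<^esub>" if x: "x \<in> carrier G" "x \<in> V" for x
    proof (rule ccontr)
      assume "\<not> ?thesis"
      hence b: "inv\<^bsub>G\<^esub> (?y [^]\<^bsub>G\<^esub> N) \<otimes>\<^bsub>G\<^esub> x \<in> ?supp" by simp
      obtain a w where aw: "x = a \<otimes>\<^bsub>G\<^esub> w" "a \<in> ?supp" "w \<in> gen_upto s" using x by (auto simp: V_def)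
      have "?y [^]\<^bsub>G\<^esub> N \<otimes>\<^bsub>G\<^esub> (inv\<^bsub>G\<^esub> (?y [^]\<^bsub>G\<^esub> N) \<otimes>\<^bsub>G\<^esub> x) = a \<otimes>\<^bsub>G\<^esub> w"
        using x yn[of N] aw(1) by (simp add: m_assoc[symmetric])
      thus False using N[OF aw(2) b aw(3)] by simp
    qed
    thus ?thesis unfolding mon_smult[OF yn m] by (auto simp: cut_def MG_sel(2) fun_eq_iff)
  qed
  ultimately show ?thesis using m cut_minus[OF m mm, of V N] by (simp add: a_minus_def)
qed

text \<open>The power of the new element is peeled off one factor at a time, while the exponent
  \<open>k\<close> inside the span stays fixed.\<close>

lemma span_regular:
  assumes A: "submodule A K M" and s: "s < D" and m: "m \<in> carrier MG"
    and tm: "t (Suc s) [^]\<^bsub>R\<^esub> (n::nat) \<odot>\<^bsub>MG\<^esub> m \<in> span_mod R MG (\<lambda>j. t j [^]\<^bsub>R\<^esub> (k::nat)) (coeffs_in A) s"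
  shows "m \<in> span_mod R MG (\<lambda>j. t j [^]\<^bsub>R\<^esub> k) (coeffs_in A) s"
  using m tm
proof (induction n arbitrary: m)
  case 0 thus ?case by simp
next
  case (Suc n)
  have ts: "t (Suc s) \<in> carrier R" using t_closed s by auto
  have tm: "t (Suc s) \<odot>\<^bsub>MG\<^esub> m \<in> carrier MG" using ts Suc.prems(1) by blast
  have "t (Suc s) [^]\<^bsub>R\<^esub> Suc n \<odot>\<^bsub>MG\<^esub> m = t (Suc s) [^]\<^bsub>R\<^esub> n \<odot>\<^bsub>MG\<^esub> (t (Suc s) \<odot>\<^bsub>MG\<^esub> m)"
    using MG.smult_assoc1[OF R.nat_pow_closed[OF ts] ts Suc.prems(1)] by simp
  hence "t (Suc s) \<odot>\<^bsub>MG\<^esub> m \<in> span_mod R MG (\<lambda>j. t j [^]\<^bsub>R\<^esub> k) (coeffs_in A) s"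
    using Suc.IH[OF tm] Suc.prems(2) by simp
  thus ?case by (rule span_regular_step[OF A s Suc.prems(1)])
qed

text \<open>Serves for two kinds of \<open>A\<close>: the zero submodule, which gives exactness for
  the group modules themselves, and the image of a self-dual module in a free one, where exactness
  is required for the quotient.\<close>

lemma kos_exact_coeffs:
  assumes A: "submodule A K M" and p: "p < D" and c: "c \<in> cochains D (carrier MG)"
    and cl: "\<And>I. I \<subseteq> {1..D} \<Longrightarrow> card I = Suc p \<Longrightarrow> kos R MG (\<lambda>j. t j [^]\<^bsub>R\<^esub> (k::nat)) c I \<in> coeffs_in A"
  shows "\<exists>b\<in>cochains D (carrier MG). \<forall>I. I \<subseteq> {1..D} \<longrightarrow> card I = p \<longrightarrow>
    c I \<ominus>\<^bsub>MG\<^esub> kos R MG (\<lambda>j. t j [^]\<^bsub>R\<^esub> k) b I \<in> coeffs_in A"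
  by (rule MG.kos_exact[OF coeffs_in_submodule[OF A] t_pow_closed[OF order_refl] _ p c cl])
    (rule span_regular[OF A])

lemma kos_exact_group_module:
  assumes p: "p < D" and c: "c \<in> cochains D (carrier MG)"
    and cl: "\<And>I. I \<subseteq> {1..D} \<Longrightarrow> card I = Suc p \<Longrightarrow> kos R MG (\<lambda>j. t j [^]\<^bsub>R\<^esub> (k::nat)) c I = \<zero>\<^bsub>MG\<^esub>"
  shows "\<exists>b\<in>cochains D (carrier MG). \<forall>I. I \<subseteq> {1..D} \<longrightarrow> card I = p \<longrightarrow>
    c I = kos R MG (\<lambda>j. t j [^]\<^bsub>R\<^esub> k) b I"
proof -
  have z: "coeffs_in {\<zero>\<^bsub>M\<^esub>} = {\<zero>\<^bsub>MG\<^esub>}"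
    using MG.zero_closed by (auto simp: coeffs_in_def MG_sel(2))
  have "\<exists>b\<in>cochains D (carrier MG). \<forall>I. I \<subseteq> {1..D} \<longrightarrow> card I = p \<longrightarrow>
      c I \<ominus>\<^bsub>MG\<^esub> kos R MG (\<lambda>j. t j [^]\<^bsub>R\<^esub> k) b I \<in> coeffs_in {\<zero>\<^bsub>M\<^esub>}"
    by (rule kos_exact_coeffs[OF M.zero_submodule p c]) (simp add: z cl)
  then obtain b where b: "b \<in> cochains D (carrier MG)" "\<And>I. I \<subseteq> {1..D} \<Longrightarrow> card I = p \<Longrightarrow>
      c I \<ominus>\<^bsub>MG\<^esub> kos R MG (\<lambda>j. t j [^]\<^bsub>R\<^esub> k) b I = \<zero>\<^bsub>MG\<^esub>" unfolding z by blast
  have "c I = kos R MG (\<lambda>j. t j [^]\<^bsub>R\<^esub> k) b I" if "I \<subseteq> {1..D}" "card I = p" for I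
    using b(2)[OF that] cochainsD[OF c that(1)] MG.kos_cochain_closed[OF b(1) t_pow_closed[OF order_refl] that(1)]
    by (metis MG.r_neg MG.add.inv_closed MG.add.r_cancel a_minus_def)
  thus ?thesis using b(1) by blast
qed

end

section \<open>Duals of free modules\<close>

text \<open>\<open>self_module\<close> of the group ring and \<open>group_module\<close> over
  \<open>self_module K\<close> are two records of one module; the Koszul differential reads only the
  fields they share.\<close>

lemma kos_transfer:
  assumes "carrier M = carrier N" "ring.add M = ring.add N" "ring.zero M = ring.zero N" "smult M = smult N"
  shows "kos R M v c I = kos R N v c I"
  using assms by (simp add: kos_def finsum_def finprod_def)

lemma (in cring) free_hom_ext:
  assumes N: "Module.module R N" and f: "f \<in> mod_homs R (free_module R B) N" and g: "g \<in> mod_homs R (free_module R B) N"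
    and eq: "\<And>b. b \<in> B \<Longrightarrow> f (single \<zero> b \<one>) = g (single \<zero> b \<one>)" and x: "x \<in> carrier (free_module R B)"
  shows "f x = g x"
proof -
  interpret F: module R "free_module R B" by (rule free_module_module)
  interpret N: module R N by fact
  have "x \<in> fin_supp B (carrier R) \<zero>" using x by simp
  thus ?thesis
  proof (induction rule: fin_supp_induct)
    case zero
    show ?case using mod_homs_zero[OF F.module_axioms N f] mod_homs_zero[OF F.module_axioms N g] by simp
  next
    case (single b c)
    have u: "single \<zero> b \<one> \<in> carrier (free_module R B)" using single by (simp add: single_fin_supp)
    have "single \<zero> b c = c \<odot>\<^bsub>free_module R B\<^esub> single \<zero> b \<one>"
      using single by (auto simp: single_def fun_eq_iff)
    thus ?case using mod_homs_smult[OF f single(2) u] mod_homs_smult[OF g single(2) u] eq[OF single(1)] by simp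
  next
    case (add x y)
    show ?case using mod_homs_add[OF f, of x y] mod_homs_add[OF g, of x y] add by simp
  qed
qed

lemma hom_eval:
  assumes "Module.module R F" "Module.module R N" "x \<in> carrier F"
  shows "(\<lambda>\<phi>. \<phi> x) \<in> mod_homs R (hom_module R F N) N"
  by (rule mod_homsI) (use assms(3) mod_homs_closed in auto)

text \<open>The dual of a free module is the product of copies of the ring over the basis, with
  evaluation at the basis vectors as projections. Koszul exactness for one fixed sequence passes to
  products: primitives are found at each basis vector separately and extended linearly.\<close>

lemma (in cring) kos_exact_free_dual:
  assumes v: "v \<in> {1..D} \<rightarrow> carrier R"
    and exact: "\<And>c. c \<in> cochains D (carrier R) \<Longrightarrow>
      (\<And>I. I \<subseteq> {1..D} \<Longrightarrow> card I = Suc p \<Longrightarrow> kos R (self_module R) v c I = \<zero>) \<Longrightarrow>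
      \<exists>b\<in>cochains D (carrier R). \<forall>I. I \<subseteq> {1..D} \<longrightarrow> card I = p \<longrightarrow> c I = kos R (self_module R) v b I"
    and c: "c \<in> cochains D (carrier (hom_module R (free_module R B) (self_module R)))"
    and cl: "\<And>I. I \<subseteq> {1..D} \<Longrightarrow> card I = Suc p \<Longrightarrow>
      kos R (hom_module R (free_module R B) (self_module R)) v c I = \<zero>\<^bsub>hom_module R (free_module R B) (self_module R)\<^esub>"
  shows "\<exists>e\<in>cochains D (carrier (hom_module R (free_module R B) (self_module R))).
    \<forall>I. I \<subseteq> {1..D} \<longrightarrow> card I = p \<longrightarrow> c I = kos R (hom_module R (free_module R B) (self_module R)) v e I"
proof -
  let ?F = "free_module R B" and ?R = "self_module R"
  let ?H = "hom_module R ?F ?R" and ?u = "\<lambda>b. single \<zero> b \<one>"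
  have F: "Module.module R ?F" by (rule free_module_module)
  have Rm: "Module.module R ?R" by (rule self_module_module)
  interpret RR: module R ?R by (rule Rm)
  interpret FF: module R ?F by (rule F)
  interpret H: module R ?H by (rule hom_module_module[OF F Rm])
  have u: "?u b \<in> carrier ?F" if "b \<in> B" for b using that by (simp add: single_fin_supp)
  have vI: "v \<in> I \<rightarrow> carrier R" "finite I" if "I \<subseteq> {1..D}" for I using that v finite_subset by auto
  have ev: "(kos R ?H v e I) x = kos R ?R v (\<lambda>J. e J x) I"
    if "x \<in> carrier ?F" "e \<in> cochains D (carrier ?H)" "I \<subseteq> {1..D}" for e I x
    by (rule H.kos_hom[OF Rm hom_eval[OF F Rm that(1)] vI(2)[OF that(3)] vI(1)[OF that(3)]])
      (rule cochains_Diff[OF that(2,3)])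
  have "\<exists>e. e \<in> cochains D (carrier R) \<and> (b \<in> B \<longrightarrow> (\<forall>I. I \<subseteq> {1..D} \<longrightarrow> card I = p \<longrightarrow> c I (?u b) = kos R ?R v e I))" for b
  proof (cases "b \<in> B")
    case True
    have cb: "(\<lambda>J. c J (?u b)) \<in> cochains D (carrier R)"
      using mod_homs_closed[of _ R ?F ?R, OF _ u[OF True]] cochainsD[OF c] by (auto simp: cochains_def)
    have "kos R ?R v (\<lambda>J. c J (?u b)) I = \<zero>" if "I \<subseteq> {1..D}" "card I = Suc p" for I
      using ev[OF u[OF True] c that(1)] cl[OF that] u[OF True] by simp
    from exact[OF cb this] show ?thesis by blast
  next
    case False
    thus ?thesis by (intro exI[of _ "\<lambda>_. \<zero>"]) (simp add: cochains_def)
  qed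
  then obtain e where e: "\<And>b. e b \<in> cochains D (carrier R)"
    "\<And>b I. b \<in> B \<Longrightarrow> I \<subseteq> {1..D} \<Longrightarrow> card I = p \<Longrightarrow> c I (?u b) = kos R ?R v (e b) I" by metis
  define e' where "e' J = (\<lambda>x\<in>carrier ?F. lin_ext R ?R (\<lambda>b. e b J) x)" for J
  have lin: "lin_ext R ?R (\<lambda>b. e b J) \<in> mod_homs R ?F ?R" if "J \<subseteq> {1..D}" for J
    by (rule RR.lin_ext_hom) (use cochainsD[OF e(1) that] in auto)
  have e': "e' \<in> cochains D (carrier ?H)"
  proof (rule cochainsI)
    fix J assume "J \<subseteq> {1..D}"
    note l = lin[OF this]
    have "e' J \<in> mod_homs R ?F ?R"
      using mod_homs_closed[OF l] mod_homs_add[OF l] mod_homs_smult[OF l] FF.a_closed FF.smult_closed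
      by (intro mod_homsI) (simp_all add: e'_def del: free_module_sel self_module_sel)
    thus "e' J \<in> carrier ?H" by (simp add: e'_def)
  qed
  have e'u: "e' J (?u b) = e b J" if "J \<subseteq> {1..D}" "b \<in> B" for J b
    using RR.lin_ext_unit[of "\<lambda>b. e b J" b] u[OF that(2)] cochainsD[OF e(1) that(1)] by (simp add: e'_def single_def)
  have "c I = kos R ?H v e' I" if I: "I \<subseteq> {1..D}" "card I = p" for I
  proof (rule extensionalityI)
    have k: "kos R ?H v e' I \<in> carrier ?H" by (rule H.kos_cochain_closed[OF e' v I(1)])
    have cI: "c I \<in> carrier ?H" by (rule cochainsD[OF c I(1)])
    show "c I \<in> extensional (carrier ?F)" "kos R ?H v e' I \<in> extensional (carrier ?F)" using k cI by simp_all
    fix x assume x: "x \<in> carrier ?F"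
    show "c I x = kos R ?H v e' I x"
    proof (rule free_hom_ext[OF Rm _ _ _ x])
      show "c I \<in> mod_homs R ?F ?R" "kos R ?H v e' I \<in> mod_homs R ?F ?R" using k cI by simp_all
      fix b assume b: "b \<in> B"
      have "kos R ?H v e' I (?u b) = kos R ?R v (\<lambda>J. e' J (?u b)) I" by (rule ev[OF u[OF b] e' I(1)])
      also have "\<dots> = kos R ?R v (e b) I"
        by (rule RR.kos_cong[OF vI(1)[OF I(1)]])
          (use e'u[OF _ b] I(1) cochains_Diff[OF e(1) I(1)] in \<open>auto simp: subset_iff\<close>)
      finally show "c I (?u b) = kos R ?H v e' I (?u b)" using e(2)[OF b I] by simp
    qed
  qed
  thus ?thesis using e' by blast
qed

section \<open>Perfectness of the form\<close>

lemma cis_mod: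
  assumes "0 < n"
  shows "cis (2 * pi * real_of_int x / real n) = cis (2 * pi * real_of_int (x mod int n) / real n)"
proof -
  have "real_of_int x = real n * real_of_int (x div int n) + real_of_int (x mod int n)"
    by (metis mult_div_mod_eq of_int_add of_int_mult of_int_of_nat_eq)
  hence "2 * pi * real_of_int x / real n =
      2 * pi * real_of_int (x div int n) + 2 * pi * real_of_int (x mod int n) / real n"
    using assms by (simp add: field_simps)
  thus ?thesis by (simp add: cis_mult[symmetric])
qed

lemma cis_eq_1_imp_dvd:
  assumes "0 < n" "cis (2 * pi * real_of_int x / real n) = 1"
  shows "x mod int n = 0"
proof -
  let ?k = "nat (x mod int n)"
  have k: "?k < n" "real ?k = real_of_int (x mod int n)" using assms(1) by (simp_all add: nat_less_iff)
  have "cis (2 * pi * real ?k / real n) = cis (2 * pi * real 0 / real n)"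
    using assms cis_mod[OF assms(1), of x] unfolding k(2) by simp
  \<comment> \<open>The powers of a primitive \<open>n\<close>-th root of unity with exponents below
    \<open>n\<close> are distinct.\<close>
  hence "?k = 0"
    by (rule inj_onD[OF bij_betw_imp_inj_on[OF bij_betw_roots_unity[OF assms(1)]]])
      (use k(1) assms(1) in simp_all)
  thus ?thesis using pos_mod_sign[of "int n" x] assms(1) by linarith
qed

text \<open>Send \<open>k\<close> to the \<open>k\<close>-th power of a primitive root of unity. The
  trivial kernel means that vanishing in \<open>ZFact\<close> is detected by complex numbers, where
  character sums are available.\<close>

lemma ZFact_character:
  assumes n: "0 < n"
  obtains \<chi> :: "int set \<Rightarrow> complex"
  where "\<And>x y. x \<in> carrier (ZFact (int n)) \<Longrightarrow> y \<in> carrier (ZFact (int n)) \<Longrightarrow>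
      \<chi> (x \<oplus>\<^bsub>ZFact (int n)\<^esub> y) = \<chi> x * \<chi> y"
    and "\<And>x. x \<in> carrier (ZFact (int n)) \<Longrightarrow> \<chi> x = 1 \<longleftrightarrow> x = \<zero>\<^bsub>ZFact (int n)\<^esub>"
proof -
  let ?K = "ZFact (int n)"
  let ?c = "\<lambda>k::int. cis (2 * pi * real_of_int k / real n)"
  interpret I: ideal "Idl\<^bsub>\<Z>\<^esub> {int n}" \<Z> by (rule int.genideal_ideal) simp
  have carrier: "carrier ?K = range (ZMod (int n))"
    unfolding ZFact_def FactRing_def A_RCOSETS_def' ZMod_def by auto
  have add: "ZMod (int n) (a + b) = ZMod (int n) a \<oplus>\<^bsub>?K\<^esub> ZMod (int n) b" for a b
    using ring_hom_add[OF I.rcos_ring_hom, of a b] unfolding ZMod_def ZFact_def by simp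
  have zero: "\<zero>\<^bsub>?K\<^esub> = ZMod (int n) 0"
    using I.a_rcos_const[of 0] by (simp add: ZFact_def FactRing_def ZMod_def)
  \<comment> \<open>Any representative of the coset may be chosen, since \<open>cis\<close> has the
    right period.\<close>
  define \<chi> where "\<chi> U = ?c (SOME k. ZMod (int n) k = U)" for U
  have \<chi>: "\<chi> (ZMod (int n) k) = ?c k" for k
  proof -
    have "ZMod (int n) (SOME k'. ZMod (int n) k' = ZMod (int n) k) = ZMod (int n) k" by (rule someI) simp
    hence "(SOME k'. ZMod (int n) k' = ZMod (int n) k) mod int n = k mod int n" by (rule ZMod_imp_zmod)
    thus ?thesis unfolding \<chi>_def using cis_mod[OF n] by metis
  qed
  show ?thesis
  proof (rule that)
    fix x y assume "x \<in> carrier ?K" "y \<in> carrier ?K"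
    then obtain a b where ab: "x = ZMod (int n) a" "y = ZMod (int n) b" by (auto simp: carrier)
    show "\<chi> (x \<oplus>\<^bsub>?K\<^esub> y) = \<chi> x * \<chi> y"
      unfolding ab add[symmetric] \<chi> by (simp add: cis_mult add_divide_distrib distrib_left)
  next
    fix x assume "x \<in> carrier ?K"
    then obtain a where a: "x = ZMod (int n) a" by (auto simp: carrier)
    show "\<chi> x = 1 \<longleftrightarrow> x = \<zero>\<^bsub>?K\<^esub>"
    proof
      assume "\<chi> x = 1"
      hence "a mod int n = 0 mod int n" using cis_eq_1_imp_dvd[OF n, of a] by (simp add: a \<chi>)
      thus "x = \<zero>\<^bsub>?K\<^esub>" unfolding a zero by (metis ZMod_mod)
    next
      assume "x = \<zero>\<^bsub>?K\<^esub>"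
      thus "\<chi> x = 1" by (simp add: zero \<chi>)
    qed
  qed
qed

text \<open>Translation by \<open>c\<close> permutes the group and multiplies the sum by
  \<open>\<psi> c\<close>, which differs from 1.\<close>

lemma (in abelian_group) character_sum_zero:
  fixes \<psi> :: "'a \<Rightarrow> complex"
  assumes "finite (carrier G)" "\<And>a b. a \<in> carrier G \<Longrightarrow> b \<in> carrier G \<Longrightarrow> \<psi> (a \<oplus> b) = \<psi> a * \<psi> b"
    and c: "c \<in> carrier G" "\<psi> c \<noteq> 1"
  shows "(\<Sum>a\<in>carrier G. \<psi> a) = 0"
proof -
  have "bij_betw (\<lambda>a. c \<oplus> a) (carrier G) (carrier G)"
    by (rule bij_betwI[of _ _ _ "\<lambda>a. \<ominus> c \<oplus> a"]) (use c in \<open>auto simp: r_neg1 r_neg2\<close>)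
  hence "(\<Sum>a\<in>carrier G. \<psi> a) = (\<Sum>a\<in>carrier G. \<psi> (c \<oplus> a))"
    by (rule sum.reindex_bij_betw[symmetric])
  also have "\<dots> = \<psi> c * (\<Sum>a\<in>carrier G. \<psi> a)"
    unfolding sum_distrib_left by (rule sum.cong) (use assms in auto)
  finally have "(1 - \<psi> c) * (\<Sum>a\<in>carrier G. \<psi> a) = 0" by (simp add: algebra_simps)
  thus ?thesis using c(2) by simp
qed

text \<open>If the functional \<open>\<chi>\<close> were not of the form \<open>\<omega>(_, b)\<close>, then for every \<open>b\<close> the character sum of
  \<open>\<chi> - \<omega>(_, b)\<close> would vanish.  Summing over \<open>b\<close> first shows that the total is the order of the group.\<close>

lemma nondegenerate_perfect:
  assumes n: "0 < n" and M: "Module.module (ZFact (int n)) M" and fin: "finite (carrier M)"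
    and bil: "bilinear_form (ZFact (int n)) M \<omega>"
    and nondeg: "\<And>a. a \<in> carrier M \<Longrightarrow> (\<And>b. b \<in> carrier M \<Longrightarrow> \<omega> a b = \<zero>\<^bsub>ZFact (int n)\<^esub>) \<Longrightarrow> a = \<zero>\<^bsub>M\<^esub>"
    and \<chi>: "\<chi> \<in> mod_homs (ZFact (int n)) M (self_module (ZFact (int n)))"
  shows "\<exists>b\<in>carrier M. \<forall>a\<in>carrier M. \<chi> a = \<omega> a b"
proof (rule ccontr)
  assume neg: "\<not> ?thesis"
  let ?K = "ZFact (int n)"
  interpret K: cring ?K by (rule ZFact_is_cring)
  interpret M: module ?K M by (rule M)
  obtain E :: "int set \<Rightarrow> complex" where E:
    "\<And>x y. x \<in> carrier ?K \<Longrightarrow> y \<in> carrier ?K \<Longrightarrow> E (x \<oplus>\<^bsub>?K\<^esub> y) = E x * E y"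
    "\<And>x. x \<in> carrier ?K \<Longrightarrow> E x = 1 \<longleftrightarrow> x = \<zero>\<^bsub>?K\<^esub>" using ZFact_character[OF n] by blast
  have wl: "\<omega> a \<in> mod_homs ?K M (self_module ?K)" and wr: "(\<lambda>b. \<omega> b a) \<in> mod_homs ?K M (self_module ?K)"
    if "a \<in> carrier M" for a
    using bil that by (auto simp: bilinear_form_def)
  have wc: "\<omega> a b \<in> carrier ?K" if "a \<in> carrier M" "b \<in> carrier M" for a b
    using mod_homs_closed[OF wl[OF that(1)] that(2)] by simp
  have \<chi>c: "\<chi> a \<in> carrier ?K" if "a \<in> carrier M" for a
    using mod_homs_closed[OF \<chi> that] by simp
  have wadd: "\<omega> a (b \<oplus>\<^bsub>M\<^esub> c) = \<omega> a b \<oplus>\<^bsub>?K\<^esub> \<omega> a c" "\<omega> (b \<oplus>\<^bsub>M\<^esub> c) a = \<omega> b a \<oplus>\<^bsub>?K\<^esub> \<omega> c a"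
    if "a \<in> carrier M" "b \<in> carrier M" "c \<in> carrier M" for a b c
    using mod_homs_add[OF wl[OF that(1)] that(2,3)] mod_homs_add[OF wr[OF that(1)] that(2,3)] by simp_all
  have \<chi>add: "\<chi> (b \<oplus>\<^bsub>M\<^esub> c) = \<chi> b \<oplus>\<^bsub>?K\<^esub> \<chi> c" if "b \<in> carrier M" "c \<in> carrier M" for b c
    using mod_homs_add[OF \<chi> that] by simp
  have \<chi>0: "\<chi> \<zero>\<^bsub>M\<^esub> = \<zero>\<^bsub>?K\<^esub>" using mod_homs_zero[OF M K.self_module_module \<chi>] by simp
  have w0: "\<omega> \<zero>\<^bsub>M\<^esub> b = \<zero>\<^bsub>?K\<^esub>" if "b \<in> carrier M" for b
    using mod_homs_zero[OF M K.self_module_module wr[OF that]] by simp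
  have inner: "(\<Sum>a\<in>carrier M. E (\<chi> a \<ominus>\<^bsub>?K\<^esub> \<omega> a b)) = 0" if b: "b \<in> carrier M" for b
  proof -
    obtain c where c: "c \<in> carrier M" "\<chi> c \<noteq> \<omega> c b" using neg b by blast
    have "\<chi> c \<ominus>\<^bsub>?K\<^esub> \<omega> c b \<noteq> \<zero>\<^bsub>?K\<^esub>"
      using c \<chi>c[OF c(1)] wc[OF c(1) b] by simp
    hence "E (\<chi> c \<ominus>\<^bsub>?K\<^esub> \<omega> c b) \<noteq> 1" using E(2) \<chi>c[OF c(1)] wc[OF c(1) b] by simp
    moreover have "E (\<chi> (a \<oplus>\<^bsub>M\<^esub> a') \<ominus>\<^bsub>?K\<^esub> \<omega> (a \<oplus>\<^bsub>M\<^esub> a') b) = E (\<chi> a \<ominus>\<^bsub>?K\<^esub> \<omega> a b) * E (\<chi> a' \<ominus>\<^bsub>?K\<^esub> \<omega> a' b)"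
      if a: "a \<in> carrier M" "a' \<in> carrier M" for a a'
    proof -
      have "\<chi> (a \<oplus>\<^bsub>M\<^esub> a') \<ominus>\<^bsub>?K\<^esub> \<omega> (a \<oplus>\<^bsub>M\<^esub> a') b = (\<chi> a \<ominus>\<^bsub>?K\<^esub> \<omega> a b) \<oplus>\<^bsub>?K\<^esub> (\<chi> a' \<ominus>\<^bsub>?K\<^esub> \<omega> a' b)"
        unfolding \<chi>add[OF a] wadd(2)[OF b a]
        using \<chi>c[OF a(1)] \<chi>c[OF a(2)] wc[OF a(1) b] wc[OF a(2) b]
        by (simp add: a_minus_def K.minus_add K.a_ac)
      thus ?thesis using E(1) \<chi>c[OF a(1)] \<chi>c[OF a(2)] wc[OF a(1) b] wc[OF a(2) b] by simp
    qed
    ultimately show ?thesis by (intro M.character_sum_zero[OF fin _ c(1)])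
  qed
  \<comment> \<open>For nonzero \<open>a\<close> the factor \<open>E (\<chi> a)\<close> comes out of
    the sum and a character in \<open>b\<close> remains, nontrivial by nondegeneracy; for zero
    \<open>a\<close> every term is 1.\<close>
  have outer: "(\<Sum>b\<in>carrier M. E (\<chi> a \<ominus>\<^bsub>?K\<^esub> \<omega> a b)) = (if a = \<zero>\<^bsub>M\<^esub> then of_nat (card (carrier M)) else 0)"
    if a: "a \<in> carrier M" for a
  proof (cases "a = \<zero>\<^bsub>M\<^esub>")
    case True
    have "(\<Sum>b\<in>carrier M. E (\<chi> a \<ominus>\<^bsub>?K\<^esub> \<omega> a b)) = (\<Sum>b\<in>carrier M. 1)"
      by (rule sum.cong) (use True E(2)[of "\<zero>\<^bsub>?K\<^esub>"] in \<open>simp_all add: \<chi>0 w0 a_minus_def\<close>)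
    thus ?thesis using True by simp
  next
    case False
    then obtain c where c: "c \<in> carrier M" "\<omega> a c \<noteq> \<zero>\<^bsub>?K\<^esub>" using nondeg[OF a] by blast
    have "\<ominus>\<^bsub>?K\<^esub> \<omega> a c \<noteq> \<zero>\<^bsub>?K\<^esub>" using c wc[OF a c(1)] K.minus_minus by fastforce
    hence "E (\<ominus>\<^bsub>?K\<^esub> \<omega> a c) \<noteq> 1" using E(2) wc[OF a c(1)] by simp
    moreover have "E (\<ominus>\<^bsub>?K\<^esub> \<omega> a (b \<oplus>\<^bsub>M\<^esub> b')) = E (\<ominus>\<^bsub>?K\<^esub> \<omega> a b) * E (\<ominus>\<^bsub>?K\<^esub> \<omega> a b')"
      if b: "b \<in> carrier M" "b' \<in> carrier M" for b b'
      unfolding wadd(1)[OF a b] using E(1) wc[OF a b(1)] wc[OF a b(2)] by (simp add: K.minus_add)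
    ultimately have "(\<Sum>b\<in>carrier M. E (\<ominus>\<^bsub>?K\<^esub> \<omega> a b)) = 0"
      by (intro M.character_sum_zero[OF fin _ c(1)])
    moreover have "(\<Sum>b\<in>carrier M. E (\<chi> a \<ominus>\<^bsub>?K\<^esub> \<omega> a b)) = (\<Sum>b\<in>carrier M. E (\<chi> a) * E (\<ominus>\<^bsub>?K\<^esub> \<omega> a b))"
      by (rule sum.cong) (use E(1) \<chi>c[OF a] wc[OF a] in \<open>auto simp: a_minus_def\<close>)
    ultimately show ?thesis using False by (simp add: sum_distrib_left[symmetric])
  qed
  have "0 = (\<Sum>b\<in>carrier M. \<Sum>a\<in>carrier M. E (\<chi> a \<ominus>\<^bsub>?K\<^esub> \<omega> a b))" using inner by simp
  also have "\<dots> = (\<Sum>a\<in>carrier M. \<Sum>b\<in>carrier M. E (\<chi> a \<ominus>\<^bsub>?K\<^esub> \<omega> a b))" by (rule sum.swap)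
  also have "\<dots> = (\<Sum>a\<in>carrier M. if a = \<zero>\<^bsub>M\<^esub> then of_nat (card (carrier M)) else 0)"
    using outer by simp
  also have "\<dots> = of_nat (card (carrier M))" using fin by simp
  finally have "card (carrier M) = 0" by simp
  thus False using fin M.zero_closed by auto
qed

lemma finite_fin_gen_module:
  assumes M: "Module.module K M" and K: "finite (carrier K)" and fg: "fin_gen_module K M"
  shows "finite (carrier M)"
proof -
  interpret M: module K M by fact
  obtain S where S: "finite S" "S \<subseteq> carrier M"
    "\<And>x. x \<in> carrier M \<Longrightarrow> \<exists>c\<in>S \<rightarrow> carrier K. x = (\<Oplus>\<^bsub>M\<^esub>s\<in>S. c s \<odot>\<^bsub>M\<^esub> s)"
    using fg by (auto simp: fin_gen_module_def)
  have "carrier M \<subseteq> (\<lambda>c. \<Oplus>\<^bsub>M\<^esub>s\<in>S. c s \<odot>\<^bsub>M\<^esub> s) ` (S \<rightarrow>\<^sub>E carrier K)"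
  proof
    fix x assume "x \<in> carrier M"
    then obtain c where c: "c \<in> S \<rightarrow> carrier K" "x = (\<Oplus>\<^bsub>M\<^esub>s\<in>S. c s \<odot>\<^bsub>M\<^esub> s)" using S(3) by blast
    have "x = (\<Oplus>\<^bsub>M\<^esub>s\<in>S. restrict c S s \<odot>\<^bsub>M\<^esub> s)"
      unfolding c(2) by (rule M.finsum_cong') (use c(1) S(2) in \<open>auto simp: Pi_iff subset_iff\<close>)
    moreover have "restrict c S \<in> S \<rightarrow>\<^sub>E carrier K" using c(1) by auto
    ultimately show "x \<in> (\<lambda>c. \<Oplus>\<^bsub>M\<^esub>s\<in>S. c s \<odot>\<^bsub>M\<^esub> s) ` (S \<rightarrow>\<^sub>E carrier K)" by blast
  qed
  moreover have "finite (S \<rightarrow>\<^sub>E carrier K)" using S(1) K by (intro finite_PiE) auto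
  ultimately show ?thesis using finite_subset by blast
qed

lemma finite_ZFact: assumes "0 < n" shows "finite (carrier (ZFact (int n)))"
proof -
  have "carrier (ZFact (int n)) \<subseteq> ZMod (int n) ` {0..<int n}"
  proof
    fix x assume "x \<in> carrier (ZFact (int n))"
    then obtain k where "x = ZMod (int n) k"
      unfolding ZFact_def FactRing_def A_RCOSETS_def' ZMod_def by auto
    hence "x = ZMod (int n) (k mod int n)" by (metis ZMod_mod)
    moreover have "k mod int n \<in> {0..<int n}" using assms by simp
    ultimately show "x \<in> ZMod (int n) ` {0..<int n}" by blast
  qed
  thus ?thesis using finite_subset by blast
qed

section \<open>Representation of semilinear functionals on M[G] by the form\<close>

context group_algebra_form begin

lemma single_as_smult:
  "x \<in> carrier G \<Longrightarrow> a \<in> carrier M \<Longrightarrow>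
    single \<zero>\<^bsub>M\<^esub> x a = single \<zero>\<^bsub>K\<^esub> x \<one>\<^bsub>K\<^esub> \<odot>\<^bsub>MG\<^esub> single \<zero>\<^bsub>M\<^esub> \<one>\<^bsub>G\<^esub> a"
  by (simp add: smult_single_single)

text \<open>A functional that is semilinear for the antipode is determined by its values on \<open>M\<close>, the
  coefficients of which are linear functionals on \<open>M\<close>.\<close>

lemma form_representable:
  assumes perfect: "\<And>\<chi>. \<chi> \<in> mod_homs K M (self_module K) \<Longrightarrow> \<exists>b\<in>carrier M. \<forall>a\<in>carrier M. \<chi> a = \<omega> a b"
    and fin: "finite (carrier M)"
    and g: "\<And>p. p \<in> CM \<Longrightarrow> g p \<in> CR"
    and g_add: "\<And>p q. p \<in> CM \<Longrightarrow> q \<in> CM \<Longrightarrow> g (\<lambda>x. p x \<oplus>\<^bsub>M\<^esub> q x) = (\<lambda>x. g p x \<oplus>\<^bsub>K\<^esub> g q x)"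
    and g_smult: "\<And>r p. r \<in> CR \<Longrightarrow> p \<in> CM \<Longrightarrow> g (r \<odot>\<^bsub>MG\<^esub> p) = antipode K G r \<otimes>\<^bsub>R\<^esub> g p"
  shows "\<exists>q\<in>CM. \<forall>p\<in>CM. g p = form p q"
proof -
  define s where "s a = single \<zero>\<^bsub>M\<^esub> \<one>\<^bsub>G\<^esub> a" for a
  have s: "s a \<in> CM" if "a \<in> carrier M" for a unfolding s_def by (rule single_CM[OF G.one_closed that])
  have \<chi>: "(\<lambda>a. g (s a) \<nu>) \<in> mod_homs K M (self_module K)" if \<nu>: "\<nu> \<in> carrier G" for \<nu>
  proof (rule mod_homsI)
    show "g (s a) \<nu> \<in> carrier (self_module K)" if "a \<in> carrier M" for a
      using CR_closed[OF g[OF s[OF that]]] by simp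
    show "g (s (a \<oplus>\<^bsub>M\<^esub> b)) \<nu> = g (s a) \<nu> \<oplus>\<^bsub>self_module K\<^esub> g (s b) \<nu>"
      if ab: "a \<in> carrier M" "b \<in> carrier M" for a b
    proof -
      have "s (a \<oplus>\<^bsub>M\<^esub> b) = (\<lambda>x. s a x \<oplus>\<^bsub>M\<^esub> s b x)" by (auto simp: s_def single_def fun_eq_iff)
      thus ?thesis using g_add[OF s[OF ab(1)] s[OF ab(2)]] by simp
    qed
    fix c a assume c: "c \<in> carrier K" and a: "a \<in> carrier M"
    have sc: "single \<zero>\<^bsub>K\<^esub> \<one>\<^bsub>G\<^esub> c \<in> CR" by (rule single_CR[OF G.one_closed c])
    have "s (c \<odot>\<^bsub>M\<^esub> a) = single \<zero>\<^bsub>K\<^esub> \<one>\<^bsub>G\<^esub> c \<odot>\<^bsub>MG\<^esub> s a"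
      unfolding s_def using smult_single_single[OF G.one_closed c G.one_closed a] by simp
    hence "g (s (c \<odot>\<^bsub>M\<^esub> a)) = single \<zero>\<^bsub>K\<^esub> \<one>\<^bsub>G\<^esub> c \<otimes>\<^bsub>R\<^esub> g (s a)"
      using g_smult[OF sc s[OF a]] by (simp add: antipode_single)
    thus "g (s (c \<odot>\<^bsub>M\<^esub> a)) \<nu> = c \<odot>\<^bsub>self_module K\<^esub> g (s a) \<nu>"
      using self.smult_single[OF G.one_closed c, of "g (s a)"] g[OF s[OF a]] \<nu> by (simp add: R_sel)
  qed
  \<comment> \<open>Where all the coefficients vanish, zero is prescribed instead of an arbitrary
    representing element, so that the support of \<open>b\<close> lies in the union of the supports
    of \<open>g (s a)\<close> over the finitely many \<open>a\<close>.\<close>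
  define b where "b \<nu> = (if \<exists>a\<in>carrier M. g (s a) \<nu> \<noteq> \<zero>\<^bsub>K\<^esub>
    then SOME b. b \<in> carrier M \<and> (\<forall>a\<in>carrier M. g (s a) \<nu> = \<omega> a b) else \<zero>\<^bsub>M\<^esub>)" for \<nu>
  have b: "b \<nu> \<in> carrier M \<and> (\<forall>a\<in>carrier M. g (s a) \<nu> = \<omega> a (b \<nu>))" if \<nu>: "\<nu> \<in> carrier G" for \<nu>
  proof (cases "\<exists>a\<in>carrier M. g (s a) \<nu> \<noteq> \<zero>\<^bsub>K\<^esub>")
    case True
    have "\<exists>b. b \<in> carrier M \<and> (\<forall>a\<in>carrier M. g (s a) \<nu> = \<omega> a b)" using perfect[OF \<chi>[OF \<nu>]] by blast
    from someI_ex[OF this] show ?thesis unfolding b_def if_P[OF True] .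
  next
    case False
    hence "b \<nu> = \<zero>\<^bsub>M\<^esub>" by (simp add: b_def)
    thus ?thesis using False by simp
  qed
  have q: "b \<in> CM"
  proof (rule fin_suppI)
    show "finite (\<Union>a\<in>carrier M. {\<nu>. g (s a) \<nu> \<noteq> \<zero>\<^bsub>K\<^esub>})"
      using fin fin_supp_finite[OF g[OF s]] by blast
    show "b \<nu> \<in> carrier M" if "\<nu> \<in> carrier G" for \<nu> using b[OF that] by simp
    show "b \<nu> = \<zero>\<^bsub>M\<^esub>" if "\<nu> \<notin> carrier G" for \<nu>
      using that fin_supp_out[OF g[OF s]] by (auto simp: b_def)
    show "\<nu> \<in> (\<Union>a\<in>carrier M. {\<nu>. g (s a) \<nu> \<noteq> \<zero>\<^bsub>K\<^esub>})" if "b \<nu> \<noteq> \<zero>\<^bsub>M\<^esub>" for \<nu>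
      using that by (auto simp: b_def split: if_splits)
  qed
  have eq: "g (s a) = form (s a) b" if a: "a \<in> carrier M" for a
    unfolding s_def form_single[OF G.one_closed a q]
    using b a fin_supp_out[OF g[OF s[OF a]]] by (auto simp: fun_eq_iff s_def)
  have "g p = form p b" if "p \<in> CM" for p
    using that
  proof (induction rule: M.fin_supp_induct)
    case zero
    have z: "(\<lambda>_. \<zero>\<^bsub>K\<^esub>) \<odot>\<^bsub>MG\<^esub> (\<lambda>_. \<zero>\<^bsub>M\<^esub>) = (\<lambda>_. \<zero>\<^bsub>M\<^esub>)" "(\<lambda>_. \<zero>\<^bsub>M\<^esub>) \<in> CM"
      using smult_zero_right[OF zero_CR] by (auto simp: fin_supp_def)
    have "g (\<lambda>_. \<zero>\<^bsub>M\<^esub>) = (\<lambda>_. \<zero>\<^bsub>K\<^esub>)"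
      using g_smult[OF zero_CR z(2)] mult_zero_left[OF g[OF z(2)]] by (simp add: z(1) antipode_zero)
    thus ?case using form_zero_left[OF q] by simp
  next
    case (single x a)
    have m: "single \<zero>\<^bsub>K\<^esub> x \<one>\<^bsub>K\<^esub> \<in> CR" by (rule single_CR[OF single(1) K.one_closed])
    show ?case
      using single_as_smult[OF single] g_smult[OF m s[OF single(2)]] form_smult_left[OF m s[OF single(2)] q]
        eq[OF single(2)] by (simp add: s_def)
  next
    case (add p p')
    show ?case unfolding g_add[OF add(1,2)] form_add_left[OF add(1,2) q] add(3,4) ..
  qed
  thus ?thesis using q by blast
qed

end

text \<open>Functoriality of \<open>M[G]\<close> in \<open>M\<close>. It makes the embedding of the
  coefficients in a free module, and evaluation at an element, linear over the group ring.\<close>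

lemma group_module_map:
  assumes "group_algebra_module K G M" "group_algebra_module K G M'" and f: "f \<in> mod_homs K M M'"
  shows "(\<lambda>p x. f (p x)) \<in> mod_homs (group_ring K G) (group_module K G M) (group_module K G M')"
proof -
  interpret M: group_algebra_module K G M by fact
  interpret M': group_algebra_module K G M' by fact
  have f0: "f \<zero>\<^bsub>M\<^esub> = \<zero>\<^bsub>M'\<^esub>" by (rule mod_homs_zero[OF M.M.module_axioms M'.M.module_axioms f])
  have cl: "(\<lambda>x. f (p x)) \<in> M'.CM" if p: "p \<in> M.CM" for p
    by (rule fin_suppI[where S = "{x. p x \<noteq> \<zero>\<^bsub>M\<^esub>}"])
      (use mod_homs_closed[OF f M.CM_closed[OF p]] f0 fin_supp_out[OF p] fin_supp_finite[OF p] in auto)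
  show ?thesis
  proof (rule mod_homsI)
    show "(\<lambda>x. f (p x)) \<in> carrier (group_module K G M')" if "p \<in> carrier (group_module K G M)" for p
      using cl[of p] that by (simp add: M.MG_sel M'.MG_sel)
    show "(\<lambda>x. f ((p \<oplus>\<^bsub>group_module K G M\<^esub> q) x)) =
        (\<lambda>x. f (p x)) \<oplus>\<^bsub>group_module K G M'\<^esub> (\<lambda>x. f (q x))"
      if "p \<in> carrier (group_module K G M)" "q \<in> carrier (group_module K G M)" for p q
      using that mod_homs_add[OF f M.CM_closed[of p] M.CM_closed[of q]] by (simp add: M.MG_sel M'.MG_sel)
    fix r p assume r: "r \<in> carrier (group_ring K G)" and p: "p \<in> carrier (group_module K G M)"
    have r': "r \<in> M.CR" and p': "p \<in> M.CM" using r p by (simp_all add: M.R_sel M.MG_sel)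
    let ?A = "{y. r y \<noteq> \<zero>\<^bsub>K\<^esub>}"
    have A: "finite ?A" "?A \<subseteq> carrier G" using fin_supp_finite[OF r'] fin_supp_sub[OF r'] by auto
    have "f (\<Oplus>\<^bsub>M\<^esub>y\<in>?A. r y \<odot>\<^bsub>M\<^esub> p (inv\<^bsub>G\<^esub> y \<otimes>\<^bsub>G\<^esub> x)) =
        (\<Oplus>\<^bsub>M'\<^esub>y\<in>?A. r y \<odot>\<^bsub>M'\<^esub> f (p (inv\<^bsub>G\<^esub> y \<otimes>\<^bsub>G\<^esub> x)))" for x
    proof -
      have "f (\<Oplus>\<^bsub>M\<^esub>y\<in>?A. r y \<odot>\<^bsub>M\<^esub> p (inv\<^bsub>G\<^esub> y \<otimes>\<^bsub>G\<^esub> x)) =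
          (\<Oplus>\<^bsub>M'\<^esub>y\<in>?A. f (r y \<odot>\<^bsub>M\<^esub> p (inv\<^bsub>G\<^esub> y \<otimes>\<^bsub>G\<^esub> x)))"
        by (rule mod_homs_finsum[OF M.M.module_axioms M'.M.module_axioms f A(1)])
          (use M.CR_closed[OF r'] M.CM_closed[OF p'] in auto)
      also have "\<dots> = (\<Oplus>\<^bsub>M'\<^esub>y\<in>?A. r y \<odot>\<^bsub>M'\<^esub> f (p (inv\<^bsub>G\<^esub> y \<otimes>\<^bsub>G\<^esub> x)))"
        by (rule M'.M.finsum_cong')
          (use M.CR_closed[OF r'] M.CM_closed[OF p'] mod_homs_closed[OF f] mod_homs_smult[OF f] in auto)
      finally show ?thesis .
    qed
    thus "(\<lambda>x. f ((r \<odot>\<^bsub>group_module K G M\<^esub> p) x)) = r \<odot>\<^bsub>group_module K G M'\<^esub> (\<lambda>x. f (p x))"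
      unfolding M.smult_eq[OF r' p' A(1) order_refl A(2)] M'.smult_eq[OF r' cl[OF p'] A(1) order_refl A(2)]
      by (auto simp: fun_eq_iff f0)
  qed
qed

section \<open>Lagrangian codes\<close>

text \<open>Self-duality of the coefficients enters as \<open>perfect\<close>, so that
  \<open>K\<close> can be any commutative ring; over \<open>ZFact\<close> the character sums supply
  it. \<open>finite_M\<close> keeps supports finite when an element of \<open>M[G]\<close> is
  assembled from its pairings with all of \<open>M\<close>.\<close>

locale lagrangian_module = group_algebra_form K G M \<omega> + group_algebra_basis K G M D \<gamma>
  for K :: "('k, 'c) ring_scheme" and G :: "('l, 'd) monoid_scheme" and M :: "('k, 'p) module"
    and \<omega> D \<gamma> +
  fixes L :: "('l \<Rightarrow> 'p) set"
  assumes finite_M: "finite (carrier M)"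
    and perfect: "\<chi> \<in> mod_homs K M (self_module K) \<Longrightarrow> \<exists>b\<in>carrier M. \<forall>a\<in>carrier M. \<chi> a = \<omega> a b"
    and nondeg: "a \<in> carrier M \<Longrightarrow> (\<And>b. b \<in> carrier M \<Longrightarrow> \<omega> b a = \<zero>\<^bsub>K\<^esub>) \<Longrightarrow> a = \<zero>\<^bsub>M\<^esub>"
    and L_sub: "submodule L R MG"
    and L_orth: "L = {p \<in> carrier MG. \<forall>l\<in>L. form l p = \<zero>\<^bsub>R\<^esub>}"
begin

abbreviation N where "N \<equiv> quot_module MG L"
abbreviation Nb where "Nb \<equiv> antipode_twist K G N"
abbreviation F where "F \<equiv> res_module R Nb"
abbreviation E where "E \<equiv> \<lambda>r. hom_module R (F r) (self_module R)"
abbreviation dE where "dE \<equiv> \<lambda>r \<phi>. \<lambda>x\<in>carrier (F (Suc r)). \<phi> (res_diff R Nb r x)"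
abbreviation cls where "cls p \<equiv> L +>\<^bsub>MG\<^esub> p"
abbreviation gen where "gen m \<equiv> single \<zero>\<^bsub>R\<^esub> (Gen m) \<one>\<^bsub>R\<^esub>"

section \<open>The dual of the canonical resolution and its Koszul exactness\<close>

lemma N_module: "Module.module R N" by (rule MG.quot_module_module[OF L_sub])

sublocale NB: Module.module R Nb by (rule twist_module[OF N_module])

lemma F_module: "Module.module R (F k)"
  unfolding res_module_def by (rule R.free_module_module)

lemma R_module: "Module.module R (self_module R)"
  by (rule R.self_module_module)

lemma res_diff_hom: "res_diff R Nb k \<in> mod_homs R (F (Suc k)) (F k)"
  using NB.res_exact_0(2) NB.res_exact_Suc(2) by (cases k) auto

lemma res_diff_res_diff: "x \<in> carrier (F (Suc (Suc k))) \<Longrightarrow> res_diff R Nb k (res_diff R Nb (Suc k) x) = \<zero>\<^bsub>F k\<^esub>"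
  using NB.res_exact_Suc(1)[of k] by blast

lemma E_module: "Module.module R (E r)"
  by (rule hom_module_module[OF F_module R_module])

lemma dE_hom: "dE r \<in> mod_homs R (E r) (E (Suc r))"
proof (rule mod_homsI)
  interpret Fr: Module.module R "F (Suc r)" by (rule F_module)
  note c = mod_homs_closed[OF res_diff_hom[of r]] mod_homs_add[OF res_diff_hom[of r]] mod_homs_smult[OF res_diff_hom[of r]]
  show "dE r \<phi> \<in> carrier (E (Suc r))" if "\<phi> \<in> carrier (E r)" for \<phi>
  proof -
    have \<phi>: "\<phi> \<in> mod_homs R (F r) (self_module R)" using that by simp
    have "dE r \<phi> \<in> mod_homs R (F (Suc r)) (self_module R)"
      by (rule mod_homsI)
        (use mod_homs_closed[OF \<phi>] mod_homs_add[OF \<phi>] mod_homs_smult[OF \<phi>] c in \<open>simp_all del: self_module_sel\<close>)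
    thus ?thesis by simp
  qed
qed (use mod_homs_closed[OF res_diff_hom[of r]] in \<open>auto intro!: restrict_ext\<close>)

lemma dE_dE:
  assumes "\<phi> \<in> carrier (E r)" shows "dE (Suc r) (dE r \<phi>) = \<zero>\<^bsub>E (Suc (Suc r))\<^esub>"
proof -
  have "\<phi> \<zero>\<^bsub>F r\<^esub> = \<zero>\<^bsub>self_module R\<^esub>" using mod_homs_zero[OF F_module R_module] assms by auto
  thus ?thesis using mod_homs_closed[OF res_diff_hom[of "Suc r"]] by (auto simp: res_diff_res_diff intro!: restrict_ext)
qed

lemma kos_exact_R:
  assumes p: "p < D" and c: "c \<in> cochains D (carrier R)"
    and cl: "\<And>I. I \<subseteq> {1..D} \<Longrightarrow> card I = Suc p \<Longrightarrow> kos R (self_module R) (\<lambda>j. t j [^]\<^bsub>R\<^esub> (k::nat)) c I = \<zero>\<^bsub>R\<^esub>"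
  shows "\<exists>b\<in>cochains D (carrier R). \<forall>I. I \<subseteq> {1..D} \<longrightarrow> card I = p \<longrightarrow>
    c I = kos R (self_module R) (\<lambda>j. t j [^]\<^bsub>R\<^esub> k) b I"
proof -
  interpret S: group_algebra_basis K G "self_module K" D \<gamma>
    by (intro group_algebra_basis.intro self_algebra independent_family_axioms)
  have e: "kos R (self_module R) v b I = kos R (group_module K G (self_module K)) v b I" for v b I
    by (rule kos_transfer) (auto simp: R_sel self.MG_sel fun_eq_iff)
  have "carrier (group_module K G (self_module K)) = carrier R" "\<zero>\<^bsub>group_module K G (self_module K)\<^esub> = \<zero>\<^bsub>R\<^esub>"
    by (simp_all add: R_sel self.MG_sel)
  with S.kos_exact_group_module[OF p, of c k] c cl show ?thesis by (simp add: e)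
qed

lemma kos_exact_E:
  assumes p: "p < D" and c: "c \<in> cochains D (carrier (E r))"
    and cl: "\<And>I. I \<subseteq> {1..D} \<Longrightarrow> card I = Suc p \<Longrightarrow> kos R (E r) (\<lambda>j. t j [^]\<^bsub>R\<^esub> (k::nat)) c I = \<zero>\<^bsub>E r\<^esub>"
  shows "\<exists>b\<in>cochains D (carrier (E r)). \<forall>I. I \<subseteq> {1..D} \<longrightarrow> card I = p \<longrightarrow>
    c I = kos R (E r) (\<lambda>j. t j [^]\<^bsub>R\<^esub> k) b I"
  using R.kos_exact_free_dual[OF t_pow_closed[OF order_refl] kos_exact_R[OF p] c[unfolded res_module_def]
    cl[unfolded res_module_def]] unfolding res_module_def by blast

section \<open>The code as the kernel in degree 0 of the dual complex\<close>

lemma L_closed: "l \<in> L \<Longrightarrow> l \<in> carrier MG"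
  using MG.sub_facts(1)[OF L_sub] by blast

lemma form_carrier: "p \<in> carrier MG \<Longrightarrow> q \<in> carrier MG \<Longrightarrow> form p q \<in> carrier R"
  using form_closed[of p q] by (simp add: MG_sel R_sel)

lemma form_add_carrier:
  "p \<in> carrier MG \<Longrightarrow> p' \<in> carrier MG \<Longrightarrow> q \<in> carrier MG \<Longrightarrow> form (p \<oplus>\<^bsub>MG\<^esub> p') q = form p q \<oplus>\<^bsub>R\<^esub> form p' q"
  "p \<in> carrier MG \<Longrightarrow> q \<in> carrier MG \<Longrightarrow> q' \<in> carrier MG \<Longrightarrow> form p (q \<oplus>\<^bsub>MG\<^esub> q') = form p q \<oplus>\<^bsub>R\<^esub> form p q'"
  using form_add_left[of p p' q] form_add_right[of p q q'] by (simp_all add: MG_sel R_sel)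

lemma form_smult_carrier:
  "r \<in> carrier R \<Longrightarrow> p \<in> carrier MG \<Longrightarrow> q \<in> carrier MG \<Longrightarrow> form p (r \<odot>\<^bsub>MG\<^esub> q) = r \<otimes>\<^bsub>R\<^esub> form p q"
  "r \<in> carrier R \<Longrightarrow> p \<in> carrier MG \<Longrightarrow> q \<in> carrier MG \<Longrightarrow>
    form (r \<odot>\<^bsub>MG\<^esub> p) q = antipode K G r \<otimes>\<^bsub>R\<^esub> form p q"
  using form_smult_right[of r p q] form_smult_left[of r p q] by (simp_all only: MG_sel(1) R_sel(1))

lemma form_isotropic: "l \<in> L \<Longrightarrow> l' \<in> L \<Longrightarrow> form l l' = \<zero>\<^bsub>R\<^esub>"
  using L_orth by blast

text \<open>As \<open>L\<close> is isotropic, pairing with an element of \<open>L\<close> cannot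
  distinguish representatives of a class. The arbitrary choice in \<open>lift\<close> is thus
  invisible to \<open>L\<close>.\<close>

lemma form_cls_eq:
  assumes l: "l \<in> L" and p: "p \<in> carrier MG" "p' \<in> carrier MG" and eq: "cls p = cls p'"
  shows "form p l = form p' l"
proof -
  have "p \<ominus>\<^bsub>MG\<^esub> p' \<in> L" using MG.rcos_eq_iff[OF L_sub p] eq by simp
  moreover have "p = (p \<ominus>\<^bsub>MG\<^esub> p') \<oplus>\<^bsub>MG\<^esub> p'"
    using p by (simp add: a_minus_def MG.a_assoc MG.l_neg)
  ultimately have "form p l = form (p \<ominus>\<^bsub>MG\<^esub> p') l \<oplus>\<^bsub>R\<^esub> form p' l"
    using form_add_carrier(1)[OF L_closed p(2) L_closed[OF l]] by metis
  thus ?thesis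
    using form_isotropic[OF _ l] \<open>p \<ominus>\<^bsub>MG\<^esub> p' \<in> L\<close> form_carrier[OF p(2) L_closed[OF l]] by simp
qed

definition lift :: "('l \<Rightarrow> 'p) set \<Rightarrow> 'l \<Rightarrow> 'p" where
  "lift m = (SOME p. p \<in> carrier MG \<and> cls p = m)"

lemma lift: assumes "m \<in> carrier N" shows "lift m \<in> carrier MG \<and> cls (lift m) = m"
proof -
  have "\<exists>p. p \<in> carrier MG \<and> cls p = m" using assms unfolding MG.quot_carrier by blast
  thus ?thesis unfolding lift_def by (rule someI_ex)
qed

lemma cls_carrier: "p \<in> carrier MG \<Longrightarrow> cls p \<in> carrier N"
  by (simp add: MG.quot_carrier)

lemma form_lift: "l \<in> L \<Longrightarrow> p \<in> carrier MG \<Longrightarrow> form (lift (cls p)) l = form p l"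
  by (rule form_cls_eq) (use lift[OF cls_carrier] in auto)

text \<open>A map out of \<open>F 0\<close> is given by its values on the basis, one vector for each
  class; pairing the chosen lifts with \<open>p\<close> supplies such values for every
  \<open>p\<close>. For \<open>p\<close> in \<open>L\<close> the result is the augmentation followed
  by a functional on the quotient. Elsewhere it depends on the lifts, but it is still linear in
  \<open>p\<close> because the form is linear in its second argument.\<close>

definition u :: "('l \<Rightarrow> 'p) \<Rightarrow> (('l \<Rightarrow> 'k, ('l \<Rightarrow> 'p) set) res_gen \<Rightarrow> 'l \<Rightarrow> 'k) \<Rightarrow> 'l \<Rightarrow> 'k" where
  "u p = (\<lambda>x\<in>carrier (F 0). lin_ext R (self_module R) (\<lambda>b. form (lift (gen_value b)) p) x)"

lemma gen_carrier: "m \<in> carrier N \<Longrightarrow> gen m \<in> carrier (F 0)"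
  by (simp add: res_module_def twist_sel single_fin_supp)

lemma E_gen_ext:
  assumes "\<phi> \<in> carrier (E 0)" "\<psi> \<in> carrier (E 0)" "\<And>m. m \<in> carrier N \<Longrightarrow> \<phi> (gen m) = \<psi> (gen m)"
  shows "\<phi> = \<psi>"
proof (rule extensionalityI)
  show "\<phi> \<in> extensional (carrier (F 0))" "\<psi> \<in> extensional (carrier (F 0))" using assms by simp_all
  fix x assume x: "x \<in> carrier (F 0)"
  show "\<phi> x = \<psi> x"
  proof (rule R.free_hom_ext[OF R_module _ _ _ x[unfolded res_module_def]])
    show "\<phi> \<in> mod_homs R (free_module R (res_basis R Nb 0)) (self_module R)"
      "\<psi> \<in> mod_homs R (free_module R (res_basis R Nb 0)) (self_module R)"
      using assms(1,2) by (simp_all add: res_module_def)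
    show "\<phi> (single \<zero>\<^bsub>R\<^esub> b \<one>\<^bsub>R\<^esub>) = \<psi> (single \<zero>\<^bsub>R\<^esub> b \<one>\<^bsub>R\<^esub>)" if "b \<in> res_basis R Nb 0" for b
      using that assms(3) by (auto simp: twist_sel)
  qed
qed

lemma u_closed: assumes p: "p \<in> carrier MG" shows "u p \<in> carrier (E 0)"
proof -
  interpret RR: Module.module R "self_module R" by (rule R_module)
  interpret F0: Module.module R "F 0" by (rule F_module)
  have l: "lin_ext R (self_module R) (\<lambda>b. form (lift (gen_value b)) p) \<in> mod_homs R (F 0) (self_module R)"
    unfolding res_module_def
    by (rule RR.lin_ext_hom) (use p lift form_carrier in \<open>auto simp: twist_sel\<close>)
  have "u p \<in> mod_homs R (F 0) (self_module R)"
    using mod_homs_closed[OF l] mod_homs_add[OF l] mod_homs_smult[OF l]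
    by (intro mod_homsI) (simp_all add: u_def del: self_module_sel)
  thus ?thesis by (simp add: u_def)
qed

lemma u_gen:
  assumes "p \<in> carrier MG" "m \<in> carrier N" shows "u p (gen m) = form (lift m) p"
proof -
  interpret RR: Module.module R "self_module R" by (rule R_module)
  show ?thesis
    using RR.lin_ext_unit[of "\<lambda>b. form (lift (gen_value b)) p" "Gen m"] gen_carrier[OF assms(2)]
      form_carrier[of "lift m" p] lift[OF assms(2)] assms(1) by (simp add: u_def single_def)
qed

lemma u_hom: "u \<in> mod_homs R MG (E 0)"
proof (rule mod_homsI)
  interpret E0: Module.module R "E 0" by (rule E_module)
  show "u p \<in> carrier (E 0)" if "p \<in> carrier MG" for p by (rule u_closed[OF that])
  show "u (p \<oplus>\<^bsub>MG\<^esub> q) = u p \<oplus>\<^bsub>E 0\<^esub> u q" if pq: "p \<in> carrier MG" "q \<in> carrier MG" for p q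
  proof (rule E_gen_ext[OF u_closed[OF MG.a_closed[OF pq]] E0.a_closed[OF u_closed[OF pq(1)] u_closed[OF pq(2)]]])
    fix m assume m: "m \<in> carrier N"
    show "u (p \<oplus>\<^bsub>MG\<^esub> q) (gen m) = (u p \<oplus>\<^bsub>E 0\<^esub> u q) (gen m)"
      using u_gen[OF _ m] pq gen_carrier[OF m] form_add_carrier(2) lift[OF m] by simp
  qed
  show "u (r \<odot>\<^bsub>MG\<^esub> p) = r \<odot>\<^bsub>E 0\<^esub> u p" if r: "r \<in> carrier R" and p: "p \<in> carrier MG" for r p
  proof (rule E_gen_ext[OF u_closed[OF MG.smult_closed[OF r p]] E0.smult_closed[OF r u_closed[OF p]]])
    fix m assume m: "m \<in> carrier N"
    show "u (r \<odot>\<^bsub>MG\<^esub> p) (gen m) = (r \<odot>\<^bsub>E 0\<^esub> u p) (gen m)"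
      using u_gen[OF _ m] r p gen_carrier[OF m] form_smult_carrier(1) lift[OF m] by simp
  qed
qed

lemma form_nondeg:
  assumes p: "p \<in> carrier MG" and z: "\<And>a. a \<in> carrier M \<Longrightarrow> form (single \<zero>\<^bsub>M\<^esub> \<one>\<^bsub>G\<^esub> a) p = \<zero>\<^bsub>R\<^esub>"
  shows "p = \<zero>\<^bsub>MG\<^esub>"
proof -
  have p': "p \<in> CM" using p by (simp add: MG_sel)
  have "p x = \<zero>\<^bsub>M\<^esub>" for x
  proof (cases "x \<in> carrier G")
    case True
    show ?thesis
    proof (rule nondeg[OF CM_closed[OF p']])
      fix b assume b: "b \<in> carrier M"
      show "\<omega> b (p x) = \<zero>\<^bsub>K\<^esub>"
        using fun_cong[OF z[OF b], of x] True by (simp add: form_single[OF G.one_closed b p'] R_sel)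
    qed
  next
    case False thus ?thesis by (rule fin_supp_out[OF p'])
  qed
  thus ?thesis by (simp add: MG_sel fun_eq_iff)
qed

lemma single_carrier: "a \<in> carrier M \<Longrightarrow> single \<zero>\<^bsub>M\<^esub> \<one>\<^bsub>G\<^esub> a \<in> carrier MG"
  using single_CM[OF G.one_closed] by (simp add: MG_sel)

lemma u_gen_L: "l \<in> L \<Longrightarrow> p \<in> carrier MG \<Longrightarrow> u l (gen (cls p)) = form p l"
  using u_gen[OF L_closed cls_carrier] form_lift by simp

lemma u_inj:
  assumes l: "l \<in> L" and z: "u l = \<zero>\<^bsub>E 0\<^esub>" shows "l = \<zero>\<^bsub>MG\<^esub>"
proof (rule form_nondeg[OF L_closed[OF l]])
  fix a assume "a \<in> carrier M"
  note s = single_carrier[OF this]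
  show "form (single \<zero>\<^bsub>M\<^esub> \<one>\<^bsub>G\<^esub> a) l = \<zero>\<^bsub>R\<^esub>"
    using u_gen_L[OF l s] gen_carrier[OF cls_carrier[OF s]] by (simp add: z)
qed

lemma res_aug_gen: "m \<in> carrier N \<Longrightarrow> res_aug R Nb (gen m) = m"
  using NB.lin_ext_unit[of gen_value "Gen m"] by (simp add: res_aug_def single_def twist_sel)

lemma antipode_carrier: "r \<in> carrier R \<Longrightarrow> antipode K G r \<in> carrier R"
  using antipode_closed[of r] by (simp only: R_sel(1))

text \<open>By exactness of the resolution at \<open>F 0\<close>, the kernel consists of the
  functionals on the twisted quotient. Pulled back to \<open>MG\<close> they are semilinear for the
  antipode, hence of the form \<open>form _ q\<close>; they vanish on \<open>L\<close>, so
  \<open>q\<close> is orthogonal to \<open>L\<close> and lies in it. Conversely, isotropy lets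
  elements of \<open>L\<close> define such functionals.\<close>

lemma u_image: "u ` L = {\<phi> \<in> carrier (E 0). dE 0 \<phi> = \<zero>\<^bsub>E 1\<^esub>}"
proof
  interpret F0: Module.module R "F 0" by (rule F_module)
  show "u ` L \<subseteq> {\<phi> \<in> carrier (E 0). dE 0 \<phi> = \<zero>\<^bsub>E 1\<^esub>}"
  proof (rule image_subsetI)
    fix l assume l: "l \<in> L"
    \<comment> \<open>The functional on the quotient defined by \<open>l\<close>. It is linear for
      the twisted action because the antipode of the action and that of the form cancel.\<close>
    define \<Phi> where "\<Phi> m = form (lift m) l" for m
    have \<Phi>: "\<Phi> (cls p) = form p l" if "p \<in> carrier MG" for p unfolding \<Phi>_def by (rule form_lift[OF l that])
    have "\<Phi> \<in> mod_homs R Nb (self_module R)"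
    proof (rule mod_homsI)
      fix m assume "m \<in> carrier Nb"
      then obtain p where p: "p \<in> carrier MG" "m = cls p" by (auto simp: twist_sel MG.quot_carrier)
      show "\<Phi> m \<in> carrier (self_module R)" using form_carrier[OF p(1) L_closed[OF l]] by (simp add: p(2) \<Phi>[OF p(1)])
      { fix r assume r: "r \<in> carrier R"
        have ar: "antipode K G r \<in> carrier R" by (rule antipode_carrier[OF r])
        have "antipode K G (antipode K G r) = r" using antipode_antipode[of r] r by (simp add: R_sel)
        thus "\<Phi> (r \<odot>\<^bsub>Nb\<^esub> m) = r \<odot>\<^bsub>self_module R\<^esub> \<Phi> m"
          using \<Phi>[OF p(1)] \<Phi>[OF MG.smult_closed[OF ar p(1)]] form_smult_carrier(2)[OF ar p(1) L_closed[OF l]]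
          by (simp add: p(2) twist_sel MG.quot_smult[OF L_sub ar p(1)]) }
      fix m' assume "m' \<in> carrier Nb"
      then obtain p' where p': "p' \<in> carrier MG" "m' = cls p'" by (auto simp: twist_sel MG.quot_carrier)
      show "\<Phi> (m \<oplus>\<^bsub>Nb\<^esub> m') = \<Phi> m \<oplus>\<^bsub>self_module R\<^esub> \<Phi> m'"
        using \<Phi>[OF p(1)] \<Phi>[OF p'(1)] \<Phi>[OF MG.a_closed[OF p(1) p'(1)]] form_add_carrier(1)[OF p(1) p'(1) L_closed[OF l]]
        by (simp add: p(2) p'(2) twist_sel MG.quot_add[OF L_sub p(1) p'(1)])
    qed
    note \<Phi>_hom = this
    have comp: "(\<lambda>x. \<Phi> (res_aug R Nb x)) \<in> mod_homs R (F 0) (self_module R)"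
      by (rule mod_homs_comp[OF NB.res_aug_hom \<Phi>_hom])
    have "(\<lambda>x\<in>carrier (F 0). \<Phi> (res_aug R Nb x)) \<in> mod_homs R (F 0) (self_module R)"
      using mod_homs_closed[OF comp] mod_homs_add[OF comp] mod_homs_smult[OF comp]
      by (intro mod_homsI) (simp_all del: self_module_sel)
    hence c: "(\<lambda>x\<in>carrier (F 0). \<Phi> (res_aug R Nb x)) \<in> carrier (E 0)" by simp
    have ul: "u l = (\<lambda>x\<in>carrier (F 0). \<Phi> (res_aug R Nb x))"
      by (rule E_gen_ext[OF u_closed[OF L_closed[OF l]] c])
        (simp add: u_gen[OF L_closed[OF l]] gen_carrier res_aug_gen \<Phi>_def)
    have "u l (res_diff R Nb 0 x) = \<zero>\<^bsub>R\<^esub>" if x: "x \<in> carrier (F (Suc 0))" for x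
    proof -
      have "res_diff R Nb 0 x \<in> {f \<in> carrier (F 0). res_aug R Nb f = \<zero>\<^bsub>Nb\<^esub>}"
        using NB.res_exact_0(1) x by blast
      thus ?thesis using mod_homs_zero[OF NB.module_axioms R_module \<Phi>_hom] by (simp add: ul)
    qed
    thus "u l \<in> {\<phi> \<in> carrier (E 0). dE 0 \<phi> = \<zero>\<^bsub>E 1\<^esub>}"
      using u_closed[OF L_closed[OF l]] by (auto simp: One_nat_def intro!: restrict_ext)
  qed
  show "{\<phi> \<in> carrier (E 0). dE 0 \<phi> = \<zero>\<^bsub>E 1\<^esub>} \<subseteq> u ` L"
  proof
    fix \<phi> assume "\<phi> \<in> {\<phi> \<in> carrier (E 0). dE 0 \<phi> = \<zero>\<^bsub>E 1\<^esub>}"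
    hence \<phi>: "\<phi> \<in> carrier (E 0)" "\<phi> \<in> mod_homs R (F 0) (self_module R)"
      and d\<phi>: "dE 0 \<phi> = \<zero>\<^bsub>E (Suc 0)\<^esub>" by (auto simp: One_nat_def)
    have ker: "\<phi> y = \<zero>\<^bsub>R\<^esub>" if y: "y \<in> carrier (F 0)" "res_aug R Nb y = \<zero>\<^bsub>Nb\<^esub>" for y
    proof -
      have "y \<in> res_diff R Nb 0 ` carrier (F (Suc 0))" unfolding NB.res_exact_0(1) using y by blast
      then obtain x where x: "x \<in> carrier (F (Suc 0))" "y = res_diff R Nb 0 x" by blast
      show ?thesis using fun_cong[OF d\<phi>, of x] x by simp
    qed
    note aug = mod_homs_add[OF NB.res_aug_hom] mod_homs_smult[OF NB.res_aug_hom]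
      mod_homs_minus[OF F_module NB.module_axioms NB.res_aug_hom]
    \<comment> \<open>\<open>\<phi>\<close> depends only on the image under the augmentation.
      Identities between classes can therefore be used under \<open>\<phi>\<close>, although
      \<open>gen\<close> itself is not additive.\<close>
    have kerd: "\<phi> x = \<phi> y" if xy: "x \<in> carrier (F 0)" "y \<in> carrier (F 0)" "res_aug R Nb x = res_aug R Nb y" for x y
    proof -
      have "res_aug R Nb (x \<ominus>\<^bsub>F 0\<^esub> y) = \<zero>\<^bsub>Nb\<^esub>"
        using aug(3)[OF xy(1,2)] xy mod_homs_closed[OF NB.res_aug_hom xy(2)] by (simp add: a_minus_def NB.r_neg)
      from ker[OF F0.minus_closed[OF xy(1,2)] this] have "\<phi> x \<ominus>\<^bsub>self_module R\<^esub> \<phi> y = \<zero>\<^bsub>self_module R\<^esub>"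
        using mod_homs_minus[OF F_module R_module \<phi>(2) xy(1,2)] by simp
      moreover interpret RR: Module.module R "self_module R" by (rule R_module)
      have "\<phi> x \<in> carrier (self_module R)" "\<phi> y \<in> carrier (self_module R)"
        using mod_homs_closed[OF \<phi>(2)] xy by auto
      ultimately show ?thesis
        by (metis RR.r_neg RR.add.inv_closed RR.add.r_cancel a_minus_def)
    qed
    define g where "g p = \<phi> (gen (cls p))" for p
    have gc: "gen (cls p) \<in> carrier (F 0)" if "p \<in> carrier MG" for p by (rule gen_carrier[OF cls_carrier[OF that]])
    have g_add: "g (p \<oplus>\<^bsub>MG\<^esub> q) = g p \<oplus>\<^bsub>R\<^esub> g q" if pq: "p \<in> carrier MG" "q \<in> carrier MG" for p q
    proof -
      have "\<phi> (gen (cls (p \<oplus>\<^bsub>MG\<^esub> q))) = \<phi> (gen (cls p) \<oplus>\<^bsub>F 0\<^esub> gen (cls q))"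
      proof (rule kerd[OF gc[OF MG.a_closed[OF pq]] F0.a_closed[OF gc[OF pq(1)] gc[OF pq(2)]]])
        show "res_aug R Nb (gen (cls (p \<oplus>\<^bsub>MG\<^esub> q))) = res_aug R Nb (gen (cls p) \<oplus>\<^bsub>F 0\<^esub> gen (cls q))"
          unfolding aug(1)[OF gc[OF pq(1)] gc[OF pq(2)]]
          by (simp add: res_aug_gen cls_carrier pq twist_sel MG.quot_add[OF L_sub pq])
      qed
      thus ?thesis using mod_homs_add[OF \<phi>(2) gc[OF pq(1)] gc[OF pq(2)]] by (simp add: g_def)
    qed
    have g_smult: "g (r \<odot>\<^bsub>MG\<^esub> p) = antipode K G r \<otimes>\<^bsub>R\<^esub> g p" if r: "r \<in> carrier R" and p: "p \<in> carrier MG" for r p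
    proof -
      have ar: "antipode K G r \<in> carrier R" by (rule antipode_carrier[OF r])
      have aar: "antipode K G (antipode K G r) = r" using antipode_antipode[of r] r by (simp add: R_sel)
      have "\<phi> (gen (cls (r \<odot>\<^bsub>MG\<^esub> p))) = \<phi> (antipode K G r \<odot>\<^bsub>F 0\<^esub> gen (cls p))"
      proof (rule kerd[OF gc[OF MG.smult_closed[OF r p]] F0.smult_closed[OF ar gc[OF p]]])
        show "res_aug R Nb (gen (cls (r \<odot>\<^bsub>MG\<^esub> p))) = res_aug R Nb (antipode K G r \<odot>\<^bsub>F 0\<^esub> gen (cls p))"
          unfolding aug(2)[OF ar gc[OF p]]
          using r p by (simp add: res_aug_gen cls_carrier twist_sel aar MG.quot_smult[OF L_sub r p])
      qed
      thus ?thesis using mod_homs_smult[OF \<phi>(2) ar gc[OF p]] by (simp add: g_def)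
    qed
    have g_closed: "g p \<in> carrier R" if "p \<in> carrier MG" for p
      using mod_homs_closed[OF \<phi>(2) gc[OF that]] by (simp add: g_def)
    have "\<exists>q\<in>CM. \<forall>p\<in>CM. g p = form p q"
    proof (rule form_representable[OF perfect finite_M])
      show "g p \<in> CR" if "p \<in> CM" for p using g_closed[of p] that by (simp add: MG_sel R_sel)
      show "g (\<lambda>x. p x \<oplus>\<^bsub>M\<^esub> q x) = (\<lambda>x. g p x \<oplus>\<^bsub>K\<^esub> g q x)" if "p \<in> CM" "q \<in> CM" for p q
        using g_add[of p q] that by (simp add: MG_sel R_sel)
      show "g (r \<odot>\<^bsub>MG\<^esub> p) = antipode K G r \<otimes>\<^bsub>R\<^esub> g p" if "r \<in> CR" "p \<in> CM" for r p
        using g_smult[of r p] that by (simp only: MG_sel(1) R_sel(1))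
    qed
    then obtain q where q: "q \<in> carrier MG" "\<And>p. p \<in> carrier MG \<Longrightarrow> g p = form p q" by (auto simp: MG_sel)
    have "form l q = \<zero>\<^bsub>R\<^esub>" if l: "l \<in> L" for l
    proof -
      have "cls l = \<zero>\<^bsub>Nb\<^esub>" using MG.rcos_zero_iff[OF L_sub L_closed[OF l]] l by (simp add: twist_sel MG.quot_zero)
      hence "g l = \<zero>\<^bsub>R\<^esub>" unfolding g_def
        by (rule ker[OF gc[OF L_closed[OF l]] trans[OF res_aug_gen[OF cls_carrier[OF L_closed[OF l]]]]])
      thus ?thesis using q(2)[OF L_closed[OF l]] by simp
    qed
    hence qL: "q \<in> L" using q(1) by (subst L_orth) blast
    have "u q = \<phi>"
    proof (rule E_gen_ext[OF u_closed[OF q(1)] \<phi>(1)])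
      fix m assume m: "m \<in> carrier N"
      show "u q (gen m) = \<phi> (gen m)"
        using u_gen[OF q(1) m] q(2)[of "lift m"] lift[OF m] by (simp add: g_def)
    qed
    thus "\<phi> \<in> u ` L" using qL by blast
  qed
qed

text \<open>The dual of \<open>P\<close> is embedded in the dual of a free module by evaluation at all \<open>a\<close> in \<open>P\<^sub>0\<close>; the
  quotient of that embedding is again a module of the form \<open>A[\<Lambda>]\<close>, for which the sequence is regular.\<close>

lemma kos_exact_L:
  assumes p: "p < D" and l: "l \<in> cochains D (carrier MG)" and e: "e \<in> cochains D (carrier (E 0))"
    and le: "\<And>I. I \<subseteq> {1..D} \<Longrightarrow> card I = Suc p \<Longrightarrow>
      l I \<in> L \<and> u (l I) = kos R (E 0) (\<lambda>j. t j [^]\<^bsub>R\<^esub> (k::nat)) e I"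
  shows "\<exists>c\<in>cochains D (carrier MG). \<forall>I. I \<subseteq> {1..D} \<longrightarrow> card I = Suc p \<longrightarrow>
    l I = kos R MG (\<lambda>j. t j [^]\<^bsub>R\<^esub> k) c I"
proof -
  \<comment> \<open>The free module on the finite set \<open>carrier M\<close>; its coordinate at
    \<open>a\<close> will record pairing with \<open>a\<close>.\<close>
  define G0 where "G0 = free_module K (carrier M)"
  let ?H = "group_module K G G0" and ?S = "group_module K G (self_module K)"
  let ?v = "\<lambda>j. t j [^]\<^bsub>R\<^esub> k"
  have G0_module: "Module.module K G0" unfolding G0_def by (rule K.free_module_module)
  interpret S: group_algebra_basis K G G0 D \<gamma>
    by (intro group_algebra_basis.intro group_algebra_module.intro group_algebra_axioms G0_module
        independent_family_axioms)
  interpret E0: Module.module R "E 0" by (rule E_module)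
  interpret RR: Module.module R "self_module R" by (rule R_module)
  note vc = t_pow_closed[OF order_refl, of k]
  have vI: "?v \<in> I \<rightarrow> carrier R" "finite I" if "I \<subseteq> {1..D}" for I
    using that vc finite_subset by auto
  define sg where "sg a = single \<zero>\<^bsub>M\<^esub> \<one>\<^bsub>G\<^esub> a" for a
  have sg: "sg a \<in> carrier MG" if "a \<in> carrier M" for a unfolding sg_def by (rule single_carrier[OF that])
  have gsg: "gen (cls (sg a)) \<in> carrier (F 0)" if "a \<in> carrier M" for a
    by (rule gen_carrier[OF cls_carrier[OF sg[OF that]]])
  define \<iota> where "\<iota> b = (\<lambda>a. if a \<in> carrier M then \<omega> a b else \<zero>\<^bsub>K\<^esub>)" for b
  have \<iota>_closed: "\<iota> b \<in> fin_supp (carrier M) (carrier K) \<zero>\<^bsub>K\<^esub>" if "b \<in> carrier M" for b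
    by (rule fin_suppI[OF _ _ finite_M]) (use that in \<open>auto simp: \<iota>_def\<close>)
  have \<iota>: "\<iota> \<in> mod_homs K M G0"
    by (rule mod_homsI) (auto simp: G0_def \<iota>_closed, auto simp: \<iota>_def \<omega>_add \<omega>_smult fun_eq_iff)
  have \<iota>_inj: "b = b'" if b: "b \<in> carrier M" "b' \<in> carrier M" and eq: "\<iota> b = \<iota> b'" for b b'
  proof -
    have z: "\<iota> (b \<ominus>\<^bsub>M\<^esub> b') = \<zero>\<^bsub>G0\<^esub>"
      using mod_homs_minus[OF M.module_axioms G0_module \<iota> b] mod_homs_closed[OF \<iota> b(2)]
      by (simp add: eq a_minus_def S.M.r_neg)
    have "\<omega> a (b \<ominus>\<^bsub>M\<^esub> b') = \<zero>\<^bsub>K\<^esub>" if "a \<in> carrier M" for a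
      using that fun_cong[OF z, of a] by (simp add: \<iota>_def G0_def)
    hence "b \<ominus>\<^bsub>M\<^esub> b' = \<zero>\<^bsub>M\<^esub>" using b by (intro nondeg) auto
    thus ?thesis using b by (metis M.r_neg M.add.inv_closed M.add.r_cancel a_minus_def)
  qed
  define \<iota>s where "\<iota>s q = (\<lambda>x. \<iota> (q x))" for q :: "'l \<Rightarrow> 'p"
  have \<iota>s: "\<iota>s \<in> mod_homs R MG ?H"
    unfolding \<iota>s_def by (rule group_module_map[OF group_algebra_module_axioms S.group_algebra_module_axioms \<iota>])
  have \<iota>s_inj: "q = q'" if q: "q \<in> carrier MG" "q' \<in> carrier MG" and eq: "\<iota>s q = \<iota>s q'" for q q'
  proof (rule ext)
    fix x show "q x = q' x"
      using \<iota>_inj[of "q x" "q' x"] CM_closed[of q] CM_closed[of q'] q fun_cong[OF eq, of x] by (simp add: \<iota>s_def MG_sel)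
  qed
  \<comment> \<open>The values of \<open>e\<close> at the finitely many basis vectors that belong to
    the classes of constants \<open>a\<close>, collected into an element of
    \<open>G0[G]\<close>.\<close>
  define e' where "e' J = (\<lambda>\<nu> a. if a \<in> carrier M then e J (gen (cls (sg a))) \<nu> else \<zero>\<^bsub>K\<^esub>)" for J
  have eR: "e J (gen (cls (sg a))) \<in> CR" if "J \<subseteq> {1..D}" "a \<in> carrier M" for J a
  proof -
    have "e J \<in> mod_homs R (F 0) (self_module R)" using cochainsD[OF e that(1)] by simp
    from mod_homs_closed[OF this gsg[OF that(2)]] show ?thesis by (simp add: R_sel)
  qed
  have e': "e' \<in> cochains D (carrier ?H)"
  proof (rule cochainsI)
    fix J assume J: "J \<subseteq> {1..D}"
    have "e' J \<in> S.CM"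
    proof (rule fin_suppI)
      show "finite (\<Union>a\<in>carrier M. {\<nu>. e J (gen (cls (sg a))) \<nu> \<noteq> \<zero>\<^bsub>K\<^esub>})"
        using finite_M fin_supp_finite[OF eR[OF J]] by blast
      show "e' J \<nu> \<in> carrier G0" for \<nu>
        unfolding G0_def free_module_sel
        by (rule fin_suppI[OF _ _ finite_M]) (use CR_closed[OF eR[OF J]] in \<open>auto simp: e'_def\<close>)
      show "e' J \<nu> = \<zero>\<^bsub>G0\<^esub>" if "\<nu> \<notin> carrier G" for \<nu>
        using fin_supp_out[OF eR[OF J] that] by (auto simp: e'_def G0_def fun_eq_iff)
      show "\<nu> \<in> (\<Union>a\<in>carrier M. {\<nu>. e J (gen (cls (sg a))) \<nu> \<noteq> \<zero>\<^bsub>K\<^esub>})" if "e' J \<nu> \<noteq> \<zero>\<^bsub>G0\<^esub>" for \<nu>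
        using that by (auto simp: e'_def G0_def fun_eq_iff split: if_splits)
    qed
    thus "e' J \<in> carrier ?H" by (simp add: S.MG_sel)
  qed
  \<comment> \<open>At the basis vector of the class of \<open>a\<close>, the functional
    \<open>u (l I)\<close> is the pairing with \<open>a\<close>, whose coefficient at
    \<open>\<nu>\<close> is \<open>\<omega> a (l I \<nu>)\<close>. The boundary of \<open>e'\<close>
    is therefore the image of \<open>l I\<close> under the embedding
    \<open>\<iota>s\<close>.\<close>
  have kos_e': "kos R ?H ?v e' I = \<iota>s (l I)" if I: "I \<subseteq> {1..D}" "card I = Suc p" for I
  proof (intro ext)
    fix \<nu> a
    have lI: "l I \<in> carrier MG" by (rule cochainsD[OF l I(1)])
    show "kos R ?H ?v e' I \<nu> a = \<iota>s (l I) \<nu> a"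
    proof (cases "a \<in> carrier M")
      case False
      have "kos R ?H ?v e' I \<in> S.CM" using S.MG.kos_cochain_closed[OF e' vc I(1)] by (simp add: S.MG_sel)
      hence "kos R ?H ?v e' I \<nu> \<in> fin_supp (carrier M) (carrier K) \<zero>\<^bsub>K\<^esub>"
        using S.CM_closed by (simp add: G0_def)
      thus ?thesis using fin_supp_out[OF _ False] False by (fastforce simp: \<iota>s_def \<iota>_def)
    next
      case True
      have "(\<lambda>g. g a) \<in> mod_homs K G0 (self_module K)"
        by (rule mod_homsI) (use True in \<open>auto simp: G0_def fin_supp_def\<close>)
      from group_module_map[OF S.group_algebra_module_axioms self_algebra this]
      have ev: "(\<lambda>m x. m x a) \<in> mod_homs R ?H ?S" .
      have ea: "(\<lambda>x. e' J x a) = e J (gen (cls (sg a)))" for J using True by (simp add: e'_def)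
      have "(\<lambda>x. kos R ?H ?v e' I x a) = kos R ?S ?v (\<lambda>J x. e' J x a) I"
        by (rule S.MG.kos_hom[OF self.MG_module ev vI(2)[OF I(1)] vI(1)[OF I(1)]])
          (rule cochains_Diff[OF e' I(1)])
      also have "\<dots> = kos R (self_module R) ?v (\<lambda>J. e J (gen (cls (sg a)))) I"
        unfolding ea by (rule kos_transfer) (auto simp: R_sel self.MG_sel fun_eq_iff)
      also have "\<dots> = kos R (E 0) ?v e I (gen (cls (sg a)))"
        by (rule E0.kos_hom[OF R_module hom_eval[OF F_module R_module gsg[OF True]] vI(2)[OF I(1)]
              vI(1)[OF I(1)], symmetric]) (rule cochains_Diff[OF e I(1)])
      also have "\<dots> = form (sg a) (l I)"
        using le[OF I] u_gen_L[OF _ sg[OF True], of "l I"] by simp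
      also have "\<dots> = (\<lambda>\<nu>. \<iota>s (l I) \<nu> a)"
      proof -
        have lC: "l I \<in> CM" using lI by (simp add: MG_sel)
        show ?thesis
          unfolding sg_def form_single[OF G.one_closed True lC]
          using True fin_supp_out[OF lC] by (auto simp: fun_eq_iff \<iota>s_def \<iota>_def)
      qed
      finally show ?thesis by (rule fun_cong)
    qed
  qed
  let ?A = "\<iota> ` carrier M"
  have A: "submodule ?A K G0" by (rule S.M.image_submodule[OF M.module_axioms \<iota>])
  \<comment> \<open>Modulo the image of \<open>MG\<close>, \<open>e'\<close> is a Koszul cocycle in
    degree \<open>p < D\<close>, hence a boundary there; the error is the image of some
    \<open>c\<close>. Taking the boundary once more kills \<open>b\<close> and shows, by injectivity
    of the embedding, that \<open>l I\<close> is the boundary of \<open>c\<close>.\<close>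
  have "\<exists>b\<in>cochains D (carrier ?H). \<forall>I. I \<subseteq> {1..D} \<longrightarrow> card I = p \<longrightarrow>
      e' I \<ominus>\<^bsub>?H\<^esub> kos R ?H ?v b I \<in> S.coeffs_in ?A"
  proof (rule S.kos_exact_coeffs[OF A p e'])
    fix I assume I: "I \<subseteq> {1..D}" "card I = Suc p"
    have "l I \<in> carrier MG" by (rule cochainsD[OF l I(1)])
    thus "kos R ?H ?v e' I \<in> S.coeffs_in ?A"
      unfolding kos_e'[OF I] S.coeffs_in_def using mod_homs_closed[OF \<iota>s] CM_closed[of "l I"]
      by (auto simp: \<iota>s_def MG_sel)
  qed
  then obtain b where b: "b \<in> cochains D (carrier ?H)" "\<And>I. I \<subseteq> {1..D} \<Longrightarrow> card I = p \<Longrightarrow>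
      e' I \<ominus>\<^bsub>?H\<^esub> kos R ?H ?v b I \<in> S.coeffs_in ?A" by blast
  have onto: "\<exists>q\<in>carrier MG. \<iota>s q = m" if m: "m \<in> S.coeffs_in ?A" for m
  proof -
    have mx: "\<exists>b\<in>carrier M. \<iota> b = m x" for x using m unfolding S.coeffs_in_def by (smt (verit) imageE mem_Collect_eq)
    define q where "q x = (SOME b. b \<in> carrier M \<and> \<iota> b = m x)" for x
    have q: "q x \<in> carrier M \<and> \<iota> (q x) = m x" for x
      unfolding q_def by (rule someI_ex) (use mx in blast)
    have mC: "m \<in> S.CM" using m by (simp add: S.coeffs_in_def S.MG_sel)
    have \<iota>0: "\<iota> \<zero>\<^bsub>M\<^esub> = \<zero>\<^bsub>G0\<^esub>" by (rule mod_homs_zero[OF M.module_axioms G0_module \<iota>])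
    have q0: "q x = \<zero>\<^bsub>M\<^esub>" if "m x = \<zero>\<^bsub>G0\<^esub>" for x
      by (rule \<iota>_inj) (use q[of x] that \<iota>0 in auto)
    have "q \<in> CM"
      by (rule fin_suppI[OF _ _ fin_supp_finite[OF mC]]) (use q q0 fin_supp_out[OF mC] in auto)
    thus ?thesis using q by (intro bexI[of _ q]) (auto simp: \<iota>s_def MG_sel)
  qed
  have "\<exists>c. c \<in> carrier MG \<and> (I \<subseteq> {1..D} \<longrightarrow> card I = p \<longrightarrow> \<iota>s c = e' I \<ominus>\<^bsub>?H\<^esub> kos R ?H ?v b I)" for I
  proof (cases "I \<subseteq> {1..D} \<and> card I = p")
    case True thus ?thesis using onto[OF b(2)] by blast
  qed (use MG.zero_closed in blast)
  then obtain c where c: "\<And>I. c I \<in> carrier MG"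
    "\<And>I. I \<subseteq> {1..D} \<Longrightarrow> card I = p \<Longrightarrow> \<iota>s (c I) = e' I \<ominus>\<^bsub>?H\<^esub> kos R ?H ?v b I" by metis
  have cc: "c \<in> cochains D (carrier MG)" using c(1) by (simp add: cochains_def)
  have kb: "kos R ?H ?v b \<in> cochains D (carrier ?H)"
    by (rule cochainsI) (rule S.MG.kos_cochain_closed[OF b(1) vc])
  have "l I = kos R MG ?v c I" if I: "I \<subseteq> {1..D}" "card I = Suc p" for I
  proof (rule \<iota>s_inj[OF cochainsD[OF l I(1)] MG.kos_cochain_closed[OF cc vc I(1)]])
    have "\<iota>s (kos R MG ?v c I) = kos R ?H ?v (\<lambda>J. \<iota>s (c J)) I"
      by (rule MG.kos_hom[OF S.MG_module \<iota>s vI(2)[OF I(1)] vI(1)[OF I(1)] c(1)])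
    also have "\<dots> = kos R ?H ?v (\<lambda>J. e' J \<ominus>\<^bsub>?H\<^esub> kos R ?H ?v b J) I"
    proof (rule S.MG.kos_cong[OF vI(1)[OF I(1)]])
      fix i assume i: "i \<in> I"
      show "\<iota>s (c (I - {i})) \<in> carrier ?H" by (rule mod_homs_closed[OF \<iota>s c(1)])
      show "\<iota>s (c (I - {i})) = e' (I - {i}) \<ominus>\<^bsub>?H\<^esub> kos R ?H ?v b (I - {i})"
        by (rule c(2)) (use i I vI(2)[OF I(1)] in \<open>auto simp: card_Diff_singleton\<close>)
    qed
    also have "\<dots> = kos R ?H ?v e' I \<ominus>\<^bsub>?H\<^esub> kos R ?H ?v (kos R ?H ?v b) I"
      by (rule S.MG.kos_minus[OF vI(2)[OF I(1)] vI(1)[OF I(1)]])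
        (rule cochains_Diff[OF e' I(1)] cochains_Diff[OF kb I(1)])+
    also have "kos R ?H ?v (kos R ?H ?v b) I = \<zero>\<^bsub>?H\<^esub>"
      by (rule S.MG.kos_kos[OF vI(2)[OF I(1)] vI(1)[OF I(1)]]) (use I(1) cochainsD[OF b(1)] in blast)
    also have "kos R ?H ?v e' I \<ominus>\<^bsub>?H\<^esub> \<zero>\<^bsub>?H\<^esub> = \<iota>s (l I)"
      unfolding kos_e'[OF I] using mod_homs_closed[OF \<iota>s cochainsD[OF l I(1)]] by (simp add: a_minus_def)
    finally show "\<iota>s (l I) = \<iota>s (kos R MG ?v c I)" by simp
  qed
  thus ?thesis using cc by blast
qed

section \<open>From codes to Koszul resolutions\<close>

lemma koszul_resolution:
  assumes annih: "\<And>i z r. i \<in> {1..D} \<Longrightarrow> z \<in> carrier (E (Suc r)) \<Longrightarrow> dE (Suc r) z = \<zero>\<^bsub>E (Suc (Suc r))\<^esub> \<Longrightarrow>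
    \<exists>w\<in>carrier (E r). dE r w = t i \<odot>\<^bsub>E (Suc r)\<^esub> z"
  shows "koszul_resolution R E dE D t MG L u"
proof (intro koszul_resolution.intro koszul_complex.intro R.cring_axioms MG.module_axioms
    koszul_complex_axioms.intro koszul_resolution_axioms.intro)
  show "u ` L = {x \<in> carrier (E 0). dE 0 x = \<zero>\<^bsub>E 1\<^esub>}" by (rule u_image)
qed (fact E_module dE_hom dE_dE t_closed kos_exact_E annih L_sub u_hom u_inj kos_exact_group_module kos_exact_L)+

end

text \<open>A class is killed when the multiple of its cocycle is a boundary. The multiplier wanted
  is the negative of the one in the hypothesis, so the primitive changes its sign.\<close>

lemma (in lagrangian_module) annihilated_boundary:
  assumes ann: "\<And>q. q \<in> carrier (cohomology E dE (Suc r)) \<Longrightarrow>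
      (group_elt K y \<ominus>\<^bsub>R\<^esub> \<one>\<^bsub>R\<^esub>) \<odot>\<^bsub>cohomology E dE (Suc r)\<^esub> q = \<zero>\<^bsub>cohomology E dE (Suc r)\<^esub>"
    and y: "y \<in> carrier G" and z: "z \<in> carrier (E (Suc r))" and dz: "dE (Suc r) z = \<zero>\<^bsub>E (Suc (Suc r))\<^esub>"
  shows "\<exists>w\<in>carrier (E r). dE r w = (\<one>\<^bsub>R\<^esub> \<ominus>\<^bsub>R\<^esub> group_elt K y) \<odot>\<^bsub>E (Suc r)\<^esub> z"
proof -
  let ?X = "(E (Suc r))\<lparr>carrier := cocycles E dE (Suc r)\<rparr>" and ?B = "coboundaries E dE (Suc r)"
  let ?s = "group_elt K y \<ominus>\<^bsub>R\<^esub> \<one>\<^bsub>R\<^esub>"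
  interpret E1: Module.module R "E (Suc r)" by (rule E_module)
  interpret E0: Module.module R "E r" by (rule E_module)
  interpret X: Module.module R ?X
    by (rule cohomology_quotient(1)[where R = R and C = E and d = dE, OF E_module dE_hom dE_dE]; assumption)
  have B: "submodule ?B R ?X"
    by (rule cohomology_quotient(2)[where R = R and C = E and d = dE, OF E_module dE_hom dE_dE]; assumption)
  have g: "group_elt K y \<in> carrier R" using mon_closed[OF y] by (simp add: group_elt_single)
  have s: "?s \<in> carrier R" using g by simp
  have zX: "z \<in> carrier ?X" using z dz by (simp add: cocycles_def)
  have "?s \<odot>\<^bsub>quot_module ?X ?B\<^esub> (?B +>\<^bsub>?X\<^esub> z) = \<zero>\<^bsub>quot_module ?X ?B\<^esub>"
    using ann[of "?B +>\<^bsub>?X\<^esub> z"] zX unfolding cohomology_def X.quot_carrier by blast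
  hence "?B +>\<^bsub>?X\<^esub> (?s \<odot>\<^bsub>?X\<^esub> z) = ?B" using X.quot_smult[OF B s zX] by (simp add: X.quot_zero)
  hence "?s \<odot>\<^bsub>?X\<^esub> z \<in> ?B" using X.rcos_zero_iff[OF B X.smult_closed[OF s zX]] by simp
  hence "?s \<odot>\<^bsub>E (Suc r)\<^esub> z \<in> dE r ` carrier (E r)" by (simp add: coboundaries_def)
  then obtain w where w: "w \<in> carrier (E r)" "?s \<odot>\<^bsub>E (Suc r)\<^esub> z = dE r w" by blast
  have "\<one>\<^bsub>R\<^esub> \<ominus>\<^bsub>R\<^esub> group_elt K y = \<ominus>\<^bsub>R\<^esub> ?s" using g by (simp add: a_minus_def R.minus_add R.a_comm)
  hence "(\<one>\<^bsub>R\<^esub> \<ominus>\<^bsub>R\<^esub> group_elt K y) \<odot>\<^bsub>E (Suc r)\<^esub> z = \<ominus>\<^bsub>E (Suc r)\<^esub> (?s \<odot>\<^bsub>E (Suc r)\<^esub> z)"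
    using E1.smult_l_minus[OF s z] by simp
  also have "\<dots> = dE r (\<ominus>\<^bsub>E r\<^esub> w)"
    unfolding w(2) by (rule mod_homs_uminus[OF E_module E_module dE_hom w(1), symmetric])
  finally show ?thesis using E0.a_inv_closed[OF w(1)] by metis
qed

lemma free_with_basis_independent:
  assumes G: "comm_group G" and sub: "subgroup \<Gamma> G" and basis: "free_with_basis G \<Gamma> D \<gamma>"
  shows "independent_family G D \<gamma>"
proof -
  interpret comm_group G by (rule G)
  have \<gamma>: "\<gamma> \<in> {1..D} \<rightarrow> carrier G"
    using basis subgroup.subset[OF sub] by (auto simp: free_with_basis_def)
  show ?thesis
  proof unfold_locales
    show "\<gamma> \<in> {1..D} \<rightarrow> carrier G" by (rule \<gamma>)
    fix c :: "nat \<Rightarrow> int" and j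
    assume c: "(\<Otimes>\<^bsub>G\<^esub>j\<in>{1..D}. \<gamma> j [^]\<^bsub>G\<^esub> c j) = \<one>\<^bsub>G\<^esub>" and j: "j \<in> {1..D}"
    let ?f = "\<lambda>c :: nat \<Rightarrow> int. \<Otimes>\<^bsub>G\<^esub>j\<in>{1..D}. \<gamma> j [^]\<^bsub>G\<^esub> c j"
    have inj: "inj_on ?f ({1..D} \<rightarrow>\<^sub>E UNIV)"
      using basis by (auto simp: free_with_basis_def bij_betw_def)
    \<comment> \<open>Uniqueness of coordinates is stated for extensional functions, so
      \<open>c\<close> and the zero family are restricted to \<open>{1..D}\<close> before they are
      compared.\<close>
    have "?f (restrict c {1..D}) = ?f c" by (rule finprod_cong') (use \<gamma> in \<open>auto simp: Pi_iff\<close>)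
    moreover have "?f (\<lambda>j\<in>{1..D}. 0) = ?f (\<lambda>_. 0)" by (rule finprod_cong') auto
    moreover have "?f (\<lambda>_. 0) = \<one>\<^bsub>G\<^esub>" by simp
    ultimately have "?f (restrict c {1..D}) = ?f (\<lambda>j\<in>{1..D}. 0)" using c by (simp only:)
    hence "restrict c {1..D} = (\<lambda>j\<in>{1..D}. 0)" by (rule inj_onD[OF inj]) auto
    from fun_cong[OF this, of j] show "c j = 0" using j by simp
  qed
qed

lemma lagrangian_code_module:
  assumes code: "lagrangian_code n \<Lambda> L P\<^sub>0 \<omega>\<^sub>0" and ind: "independent_family \<Lambda> D \<gamma>"
  shows "lagrangian_module (ZFact (int n)) \<Lambda> P\<^sub>0 \<omega>\<^sub>0 D \<gamma> L"
proof -
  interpret code: lagrangian_code n \<Lambda> L P\<^sub>0 \<omega>\<^sub>0 by (rule code)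
  let ?K = "ZFact (int n)"
  note lc = code.n_pos code.comm_group code.module code.fin_gen_module code.bilinear code.alternating
    code.nondegenerate code.submodule code.lagrangian
  interpret K: cring ?K by (rule ZFact_is_cring)
  interpret G: comm_group \<Lambda> by (rule lc(2))
  interpret GA: group_algebra ?K \<Lambda> by unfold_locales
  interpret M: Module.module ?K P\<^sub>0 by (rule lc(3))
  interpret GM: group_algebra_module ?K \<Lambda> P\<^sub>0
    by (intro group_algebra_module.intro GA.group_algebra_axioms M.module_axioms)
  interpret GF: group_algebra_form ?K \<Lambda> P\<^sub>0 \<omega>\<^sub>0
    by (intro group_algebra_form.intro group_algebra_form_axioms.intro GM.group_algebra_module_axioms lc(5))
  interpret GB: group_algebra_basis ?K \<Lambda> P\<^sub>0 D \<gamma>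
    by (intro group_algebra_basis.intro GM.group_algebra_module_axioms ind)
  have fin: "finite (carrier P\<^sub>0)" by (rule finite_fin_gen_module[OF lc(3) finite_ZFact[OF lc(1)] lc(4)])
  have nondeg: "a = \<zero>\<^bsub>P\<^sub>0\<^esub>" if "a \<in> carrier P\<^sub>0" "\<And>b. b \<in> carrier P\<^sub>0 \<Longrightarrow> \<omega>\<^sub>0 b a = \<zero>\<^bsub>?K\<^esub>" for a
    using lc(7) that by (auto simp: nondegenerate_form_def)
  \<comment> \<open>Nondegeneracy is given in the second argument, while the character sums use it
    in the first; alternation makes the form skew-symmetric and exchanges the two.\<close>
  have skew: "\<omega>\<^sub>0 a b = \<ominus>\<^bsub>?K\<^esub> \<omega>\<^sub>0 b a" if ab: "a \<in> carrier P\<^sub>0" "b \<in> carrier P\<^sub>0" for a b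
  proof -
    have alt: "\<omega>\<^sub>0 c c = \<zero>\<^bsub>?K\<^esub>" if "c \<in> carrier P\<^sub>0" for c
      using lc(6) that by (auto simp: alternating_form_def)
    have "\<zero>\<^bsub>?K\<^esub> = \<omega>\<^sub>0 (a \<oplus>\<^bsub>P\<^sub>0\<^esub> b) (a \<oplus>\<^bsub>P\<^sub>0\<^esub> b)"
      using alt[of "a \<oplus>\<^bsub>P\<^sub>0\<^esub> b"] ab by simp
    also have "\<dots> = (\<omega>\<^sub>0 a a \<oplus>\<^bsub>?K\<^esub> \<omega>\<^sub>0 b a) \<oplus>\<^bsub>?K\<^esub> (\<omega>\<^sub>0 a b \<oplus>\<^bsub>?K\<^esub> \<omega>\<^sub>0 b b)"
      using ab by (simp add: GF.\<omega>_add K.a_ac)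
    also have "\<dots> = \<omega>\<^sub>0 a b \<oplus>\<^bsub>?K\<^esub> \<omega>\<^sub>0 b a"
      using alt[OF ab(1)] alt[OF ab(2)] GF.\<omega>_closed[OF ab] GF.\<omega>_closed[OF ab(2) ab(1)] by (simp add: K.a_comm)
    finally have "\<zero>\<^bsub>?K\<^esub> = \<omega>\<^sub>0 a b \<oplus>\<^bsub>?K\<^esub> \<omega>\<^sub>0 b a" .
    thus ?thesis using ab by (metis GF.\<omega>_closed K.minus_equality)
  qed
  have perfect: "\<exists>b\<in>carrier P\<^sub>0. \<forall>a\<in>carrier P\<^sub>0. \<chi> a = \<omega>\<^sub>0 a b" if "\<chi> \<in> mod_homs ?K P\<^sub>0 (self_module ?K)" for \<chi>
  proof (rule nondegenerate_perfect[OF lc(1) lc(3) fin lc(5) _ that])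
    fix a assume a: "a \<in> carrier P\<^sub>0" and z: "\<And>b. b \<in> carrier P\<^sub>0 \<Longrightarrow> \<omega>\<^sub>0 a b = \<zero>\<^bsub>?K\<^esub>"
    show "a = \<zero>\<^bsub>P\<^sub>0\<^esub>"
    proof (rule nondeg[OF a])
      fix b assume b: "b \<in> carrier P\<^sub>0"
      show "\<omega>\<^sub>0 b a = \<zero>\<^bsub>?K\<^esub>" unfolding skew[OF b a] z[OF b] by simp
    qed
  qed
  show ?thesis
  proof (intro lagrangian_module.intro lagrangian_module_axioms.intro GF.group_algebra_form_axioms
      GB.group_algebra_basis_axioms)
    show "L = {p \<in> carrier (group_module ?K \<Lambda> P\<^sub>0). \<forall>l\<in>L. group_form ?K \<Lambda> P\<^sub>0 \<omega>\<^sub>0 l p = \<zero>\<^bsub>group_ring ?K \<Lambda>\<^esub>}"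
      using lc(9) unfolding code_orthogonal_def by simp
  qed (fact fin perfect nondeg lc(8))+
qed

theorem proposition44:
  fixes n :: nat
    and \<Lambda> :: "'l monoid"
    and L :: "('l \<Rightarrow> 'p) set"
    and P\<^sub>0 :: "(int set, 'p) module"
    and \<omega>\<^sub>0 :: "'p \<Rightarrow> 'p \<Rightarrow> int set"
    and \<Gamma> :: "'l set"
    and \<gamma> :: "nat \<Rightarrow> 'l"
    and i D :: nat
    and K :: "int set ring"
    and R :: "('l \<Rightarrow> int set) ring"
    and P :: "('l \<Rightarrow> int set, 'l \<Rightarrow> 'p) module"
    and t :: "nat \<Rightarrow> 'l \<Rightarrow> int set"
  defines "K \<equiv> ZFact (int n)"
    and "R \<equiv> lattice_ring n \<Lambda>"
    and "P \<equiv> qudit_module n \<Lambda> P\<^sub>0"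
    and "Q \<equiv> charge_module n \<Lambda> L P\<^sub>0"
    and "D \<equiv> free_rank \<Lambda>"
    and "t \<equiv> (\<lambda>j. \<one>\<^bsub>R\<^esub> \<ominus>\<^bsub>R\<^esub> group_elt K (\<gamma> j))"
  assumes lagrangian: "lagrangian_code n \<Lambda> L P\<^sub>0 \<omega>\<^sub>0"
    and dim: "\<And>k. carrier (Q k) = {\<zero>\<^bsub>Q k\<^esub>} \<or> module_dim R (Q k) = 0"
    and subgroup: "subgroup \<Gamma> \<Lambda>"
    and finite_index: "finite (rcosets\<^bsub>\<Lambda>\<^esub> \<Gamma>)"
    and basis: "free_with_basis \<Lambda> \<Gamma> D \<gamma>"
    and annihilates: "\<And>g k q. g \<in> \<Gamma> \<Longrightarrow> q \<in> carrier (Q k) \<Longrightarrow>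
      (group_elt K g \<ominus>\<^bsub>R\<^esub> \<one>\<^bsub>R\<^esub>) \<odot>\<^bsub>Q k\<^esub> q = \<zero>\<^bsub>Q k\<^esub>"
    and range: "i + 2 \<le> D"
  shows "mod_isomorphic R (Q i) (cech_cohomology R D t (quot_module P L) (i + 1))"
proof -
  interpret code: lagrangian_code n \<Lambda> L P\<^sub>0 \<omega>\<^sub>0 by (rule lagrangian)
  interpret S: lagrangian_module "ZFact (int n)" \<Lambda> P\<^sub>0 \<omega>\<^sub>0 D \<gamma> L
    by (rule lagrangian_code_module[OF lagrangian free_with_basis_independent[OF code.comm_group subgroup basis]])
  \<comment> \<open>\<open>Q k\<close> sits in degree \<open>Suc k\<close> of \<open>E\<close>, so
    annihilation of all the \<open>Q k\<close> covers exactly the positive degrees, as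
    \<open>annih\<close> demands.\<close>
  have Q: "Q k = cohomology S.E S.dE (Suc k)" for k
    by (simp add: Q_def charge_module_def Ext_def One_nat_def)
  have "koszul_resolution R S.E S.dE D t P L S.u"
    unfolding R_def P_def t_def K_def
  proof (rule S.koszul_resolution)
    fix j z r
    assume j: "j \<in> {1..D}" and z: "z \<in> carrier (S.E (Suc r))" "S.dE (Suc r) z = \<zero>\<^bsub>S.E (Suc (Suc r))\<^esub>"
    have \<gamma>: "\<gamma> j \<in> \<Gamma>" using basis j by (auto simp: free_with_basis_def)
    show "\<exists>w\<in>carrier (S.E r). S.dE r w = S.t j \<odot>\<^bsub>S.E (Suc r)\<^esub> z"
    proof (rule S.annihilated_boundary[OF _ _ z])
      show "\<gamma> j \<in> carrier \<Lambda>" using \<gamma> subgroup.subset[OF subgroup] by blast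
      show "(group_elt (ZFact (int n)) (\<gamma> j) \<ominus>\<^bsub>lattice_ring n \<Lambda>\<^esub> \<one>\<^bsub>lattice_ring n \<Lambda>\<^esub>)
          \<odot>\<^bsub>cohomology S.E S.dE (Suc r)\<^esub> q = \<zero>\<^bsub>cohomology S.E S.dE (Suc r)\<^esub>"
        if "q \<in> carrier (cohomology S.E S.dE (Suc r))" for q
        using annihilates[OF \<gamma>, of q r] that by (simp add: Q K_def R_def)
    qed
  qed
  then interpret T: koszul_resolution R S.E S.dE D t P L S.u .
  \<comment> \<open>The condition \<open>Suc i < D\<close> of the comparison theorem is the bound
    \<open>i + 2 \<le> D\<close>.\<close>
  show ?thesis using T.cech_iso[of i] range by (simp add: Q One_nat_def)
qed

end
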